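(* Let $\mathbf{B}=(B_n)_{n\ge1}$ be a bounded sequence of integers which is not periodic and such that $\min_{n\in\mathbb{N}}|B_n|\ge3$ and $\mathrm{rep}(\mathbf{B})<\infty$. Let $\zeta$ be the complex number whose Hurwitz continued fraction expansion is \[ \zeta=[0;-2,1+iB_1,-2,1+iB_2,-2,1+iB_3,-2,1+iB_4,\dots]. \] Then $\zeta$ is transcendental.
   Context: Hurwitz continued fractions: for $z\in\mathbb{C}$, $[z]:=\lfloor \mathrm{Re}(z)+\tfrac12\rfloor+i\lfloor \mathrm{Im}(z)+\tfrac12\rfloor$; $\mathfrak{F}:=\{z: -\tfrac12\le \mathrm{Re}(z)<\tfrac12,\ -\tfrac12\le \mathrm{Im}(z)<\tfrac12\}$; $T(0)=0$, $T(z)=z^{-1}-[z^{-1}]$; $a_1(z)=[z^{-1}]$, $a_n(z)=a_1(T^{n-1}(z))$. The notation $z=[0;a_1,a_2,\dots]$ means that $z\in\mathfrak{F}$ and $(a_n)$ is its sequence of Hurwitz partial quotients (in which case $z=\lim_n p_n/q_n$ with the usual convergents). Repetition exponent: for an infinite word $\mathbf{x}=(x_n)$ over a finite alphabet and $n\in\mathbb{N}$, $r(n,\mathbf{x})$ is the least $m\in\mathbb{N}$ such that there is $i\in\{1,\dots,m-n\}$ with $(x_i,\dots,x_{i+n-1})=(x_{m-n+1},\dots,x_m)$, and $\mathrm{rep}(\mathbf{x}):=\liminf_{n\to\infty} r(n,\mathbf{x})/n$.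
   Formalization: "Not periodic" is taken to mean not ultimately periodic (a pre-period is allowed); for purely periodic only, the claim fails, e.g. B = 5,3,3,3,... gives an algebraic ζ. *)

theory Defs
  imports Complex_Main "HOL-Computational_Algebra.Polynomial" "HOL-Library.Extended_Real"
begin

text \<open>All sequences and infinite words are indexed by the positive integers; the value at
  index \<open>0\<close> of a function on \<open>nat\<close> representing one is irrelevant throughout.\<close>

definition nearest_gauss :: "complex \<Rightarrow> complex" where
  "nearest_gauss z = Complex (of_int \<lfloor>Re z + 1/2\<rfloor>) (of_int \<lfloor>Im z + 1/2\<rfloor>)"

definition hurwitz_domain :: "complex set" where
  "hurwitz_domain = {z. -1/2 \<le> Re z \<and> Re z < 1/2 \<and> -1/2 \<le> Im z \<and> Im z < 1/2}"

definition hurwitz_T :: "complex \<Rightarrow> complex" where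
  "hurwitz_T z = (if z = 0 then 0 else inverse z - nearest_gauss (inverse z))"

text \<open>The \<open>n\<close>-th partial quotient, for \<open>n \<ge> 1\<close>; it is only meaningful when the
  \<open>(n - 1)\<close>-st iterate of \<open>hurwitz_T\<close> at \<open>z\<close> is nonzero.\<close>

definition hurwitz_pq :: "nat \<Rightarrow> complex \<Rightarrow> complex" where
  "hurwitz_pq n z = nearest_gauss (inverse ((hurwitz_T ^^ (n - 1)) z))"

text \<open>\<open>z = [0; a 1, a 2, \<dots>]\<close> as an infinite expansion: the orbit of \<open>z\<close> never reaches \<open>0\<close>,
  so all partial quotients are defined.\<close>

definition has_hurwitz_expansion :: "complex \<Rightarrow> (nat \<Rightarrow> complex) \<Rightarrow> bool" where
  "has_hurwitz_expansion z a \<longleftrightarrow> z \<in> hurwitz_domain \<and>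
     (\<forall>n\<ge>1. (hurwitz_T ^^ (n - 1)) z \<noteq> 0 \<and> hurwitz_pq n z = a n)"

text \<open>Here \<open>m - n\<close> is truncated, but for \<open>m \<le> n\<close> the range of \<open>i\<close> is empty. For a word over a
  finite alphabet such an \<open>m\<close> always exists, by the pigeonhole principle.\<close>

definition rep_fun :: "nat \<Rightarrow> (nat \<Rightarrow> 'a) \<Rightarrow> nat" where
  "rep_fun n x = (LEAST m. \<exists>i\<in>{1..m - n}. \<forall>k<n. x (i + k) = x (m - n + 1 + k))"

definition rep_exponent :: "(nat \<Rightarrow> 'a) \<Rightarrow> ereal" where
  "rep_exponent x = liminf (\<lambda>n. ereal (real (rep_fun n x) / real n))"

text \<open>As usual for continued fractions, a pre-period is allowed.\<close>

definition periodic_seq :: "(nat \<Rightarrow> 'a) \<Rightarrow> bool" where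
  "periodic_seq x \<longleftrightarrow> (\<exists>p\<ge>1. \<exists>N\<ge>1. \<forall>n\<ge>N. x (n + p) = x n)"

text \<open>The sequence \<open>-2, 1 + i B 1, -2, 1 + i B 2, \<dots>\<close>.\<close>

definition interleaved_pq :: "(nat \<Rightarrow> int) \<Rightarrow> nat \<Rightarrow> complex" where
  "interleaved_pq B n = (if odd n then -2 else 1 + \<i> * of_int (B (n div 2)))"

end

theory Submission
  imports "HOL-Library.Poly_Mapping" "Jordan_Normal_Form.Determinant" Defs
begin

text \<open>The digits \<open>-2, 1 + i B\<close> force the even iterates of the Hurwitz map onto the line \<open>Re = -1/2\<close>. Hence
  \<open>\<alpha> = 2 Im \<zeta>\<close> is a real number with the continued fraction \<open>[0; 2 B 1, 2 B 2, ...]\<close>, whose partial quotients are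
  bounded and not ultimately periodic, and if \<open>\<zeta>\<close> is algebraic then so is \<open>\<alpha>\<close>.

  Let the partial quotients after the places \<open>r < r'\<close> agree for a long time, let \<open>M r\<close> be the matrix of two
  consecutive convergents, and let \<open>S\<close> run through the symmetric integer matrices. The points
  \<open>M r * S * transpose (M r')\<close> lie in a rational hyperplane of dimension 3, and the four products of the linear forms
  \<open>q\<close> and \<open>q \<alpha> - p\<close> in the rows and in the columns are small on them if \<open>S\<close> is adapted to the complete quotient
  \<open>Y r\<close>. Three independent matrices \<open>S\<close> of this kind exist unless \<open>Y r\<close> is very close to a quadratic number; in
  that case the points \<open>M r * S * transpose (M r)\<close> with \<open>S\<close> orthogonal to the quadratic form provide a similar
  plane in three-dimensional space. Since \<open>\<alpha>\<close> is badly approximable and not quadratic, the heights of these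
  hyperplanes grow.

  That an algebraic \<open>\<alpha>\<close> does not admit infinitely many such hyperplanes is a case of the subspace theorem, proved by
  the method of Thue, Siegel, Roth and Schmidt: Siegel's lemma yields a multihomogeneous polynomial of high index
  along the linear forms. It vanishes to high order on many integer points of the hyperplanes and so has high
  index along them, and its restriction to two coordinates in each block contradicts Roth's lemma.\<close>

text \<open>The sizes explain the construction. If the entries of \<open>S\<close> are at most R and
  those of \<open>S\<close> applied to (- Y, 1) are at most \<rho>, the denominators cancel in the
  product of the four forms and about R \<rho>^3 remains, which must be below 1. Three independent
  \<open>S\<close> exist once R \<rho>^2 is large, unless the dual lattice has a short vector: an
  integral quadratic form almost vanishing at Y. R = exp (x (3 k - 1)) and \<rho> = exp (- x k) meet
  both demands. If every scale k fails, each yields such a form, and these cannot change too often: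
  three different ones would be dependent, and the integer vector orthogonal to all of them would
  approximate Y too well. So one form, of size F, serves a long range of scales and its value at Y
  is below F^(-5). On the plane of the \<open>S\<close> orthogonal to it the product of the three
  forms is about F^3 / Z, where Z is the size of the denominator of a convergent of Y, and a value
  below F^(-5) permits Z > F^3. In both cases the points span a whole hyperplane, so that Roth's
  lemma can be applied to the ratio of two coordinates of its normal vector.\<close>

abbreviation ri :: "int => real" where
  "ri \<equiv> of_int"

section \<open>Multivariate polynomials as finitely supported maps, and substitution\<close>

type_synonym 'v mp = "('v \<Rightarrow>\<^sub>0 nat) \<Rightarrow>\<^sub>0 real"

abbreviation coef :: "('a \<Rightarrow>\<^sub>0 'b::zero) => 'a => 'b" where "coef \<equiv> Poly_Mapping.lookup"
abbreviation supp :: "('a \<Rightarrow>\<^sub>0 'b::zero) => 'a set" where "supp \<equiv> Poly_Mapping.keys"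
abbreviation mono1 :: "'a => 'b::zero => ('a \<Rightarrow>\<^sub>0 'b)" where "mono1 \<equiv> Poly_Mapping.single"

text \<open>The monomial with exponent vector \<open>k\<close> evaluated at \<open>\<phi>\<close>,
  polymorphic in the target: polynomial values give substitution, real values give the weights of
  norms and scaling factors.\<close>

definition mpow :: "('v => 'r::comm_semiring_1) => ('v \<Rightarrow>\<^sub>0 nat) => 'r" where
  "mpow \<phi> k = (\<Prod>v\<in>supp k. \<phi> v ^ coef k v)"

definition Const :: "real => 'v mp" where "Const c = mono1 0 c"

definition Var :: "'v => 'v mp" where "Var v = mono1 (mono1 v 1) 1"

definition subst :: "('v => 'w mp) => 'v mp => 'w mp" where
  "subst \<phi> f = (\<Sum>k\<in>supp f. Const (coef f k) * mpow \<phi> k)"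

lemma coef_mono1: "coef (mono1 k c) l = (if k = l then c else 0)"
  by (simp add: lookup_single when_def)

lemma mpow_superset:
  assumes "finite A" "supp k \<subseteq> A"
  shows "mpow \<phi> k = (\<Prod>v\<in>A. \<phi> v ^ coef k v)"
  unfolding mpow_def
  by (rule prod.mono_neutral_left[OF assms]) (auto simp: in_keys_iff)

lemma mpow_0 [simp]: "mpow \<phi> 0 = 1"
  by (simp add: mpow_def)

lemma mpow_add: "mpow \<phi> (k + l) = mpow \<phi> k * mpow \<phi> l"
proof -
  let ?A = "supp k \<union> supp l"
  have "supp (k + l) \<subseteq> ?A" by (rule keys_add)
  then show ?thesis
    by (subst (1 2 3) mpow_superset[where A = ?A])
       (auto simp: lookup_add power_add prod.distrib)
qed

lemma mpow_mono1: "mpow \<phi> (mono1 v n) = \<phi> v ^ n"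
  by (cases "n = 0") (simp_all add: mpow_def)

lemma mpow_mult: "mpow (\<lambda>v. \<phi> v * \<psi> v) k = mpow \<phi> k * mpow \<psi> k"
  by (simp add: mpow_def power_mult_distrib prod.distrib)

lemma mpow_nonneg: "(\<And>v. \<tau> v \<ge> (0::real)) ==> mpow \<tau> k \<ge> 0"
  by (simp add: mpow_def prod_nonneg)

lemma mpow_cong: "(\<And>v. v \<in> supp k ==> \<phi> v = \<psi> v) ==> mpow \<phi> k = mpow \<psi> k"
  by (simp add: mpow_def)

lemma mpow_one [simp]: "mpow (\<lambda>_. 1) k = 1"
  by (simp add: mpow_def)

lemma mp_expand: "f = (\<Sum>k\<in>supp f. mono1 k (coef f k))"
  by (rule poly_mapping_eqI)
     (simp add: lookup_sum coef_mono1 in_keys_iff if_distrib sum.delta' cong: if_cong)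

lemma mp_induct [case_names mono add]:
  assumes "\<And>k c. P (mono1 k c)" and "\<And>f g. P f ==> P g ==> P (f + g)"
  shows "P (f :: 'a \<Rightarrow>\<^sub>0 'b::comm_monoid_add)"
proof -
  have "P (\<Sum>k\<in>A. mono1 k (coef f k))" if "finite A" for A
    using that
  proof (induction A)
    case empty
    then show ?case using assms(1)[of undefined 0] by simp
  qed (simp add: assms)
  from this[of "supp f"] show ?thesis
    by (simp flip: mp_expand)
qed

lemma Const_0 [simp]: "Const 0 = 0" and Const_1 [simp]: "Const 1 = 1"
  by (simp_all add: Const_def)

lemma Const_add: "Const (a + b) = Const a + Const b"
  by (simp add: Const_def single_add)

lemma Const_mult: "Const (a * b) = Const a * Const b"
  by (simp add: Const_def mult_single)

lemma Const_sum: "Const (sum g A) = (\<Sum>i\<in>A. Const (g i))"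
  by (induction A rule: infinite_finite_induct) (simp_all add: Const_add)

lemma Const_prod: "Const (prod g A) = (\<Prod>i\<in>A. Const (g i))"
  by (induction A rule: infinite_finite_induct) (simp_all add: Const_mult)

lemma Const_power: "Const (a ^ n) = Const a ^ n"
  by (induction n) (simp_all add: Const_mult)

lemma mpow_Const: "mpow (\<lambda>v. Const (g v)) k = Const (mpow g k)"
  by (simp add: mpow_def Const_prod Const_power)

lemma Const_mono1: "Const c * mono1 k d = mono1 k (c * d)"
  by (simp add: Const_def mult_single)

lemma coef_Const_mult: "coef (Const c * f) k = c * coef f k"
proof (induction f rule: mp_induct)
  case (mono l d)
  then show ?case by (simp add: Const_mono1 coef_mono1)
next
  case (add f g)
  then show ?case by (simp add: lookup_add algebra_simps)
qed

lemma mpow_Var: "mpow Var k = mono1 k 1"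
proof (induction k rule: mp_induct)
  case (mono v n)
  have "mono1 (mono1 v (Suc 0)) (1::real) ^ n = mono1 (mono1 v n) 1"
  proof (induction n)
    case (Suc n)
    have "mono1 v (Suc 0) + mono1 v n = mono1 v (Suc n)"
      by (simp flip: single_add)
    then show ?case using Suc by (simp add: mult_single)
  qed simp
  then show ?case by (simp add: mpow_mono1 Var_def)
next
  case (add f g)
  then show ?case by (simp add: mpow_add mult_single)
qed

lemma subst_superset:
  assumes "finite A" "supp f \<subseteq> A"
  shows "subst \<phi> f = (\<Sum>k\<in>A. Const (coef f k) * mpow \<phi> k)"
  unfolding subst_def
  by (rule sum.mono_neutral_left[OF assms]) (auto simp: in_keys_iff)

lemma subst_0 [simp]: "subst \<phi> 0 = 0"
  by (simp add: subst_def)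

lemma subst_add: "subst \<phi> (f + g) = subst \<phi> f + subst \<phi> g"
proof -
  let ?A = "supp f \<union> supp g"
  have "supp (f + g) \<subseteq> ?A" by (rule keys_add)
  then show ?thesis
    by (subst (1 2 3) subst_superset[where A = ?A])
       (auto simp: lookup_add Const_add algebra_simps sum.distrib)
qed

lemma subst_mono1: "subst \<phi> (mono1 k c) = Const c * mpow \<phi> k"
  by (cases "c = 0") (simp_all add: subst_def)

lemma subst_Const [simp]: "subst \<phi> (Const c) = Const c"
  unfolding Const_def[of c] by (simp add: subst_mono1, simp add: Const_def)

lemma subst_1 [simp]: "subst \<phi> 1 = 1"
  using subst_Const[of \<phi> 1] by simp

lemma subst_Var [simp]: "subst \<phi> (Var v) = \<phi> v"
  by (simp add: Var_def subst_mono1 mpow_mono1)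

lemma subst_sum: "subst \<phi> (sum g A) = (\<Sum>i\<in>A. subst \<phi> (g i))"
  by (induction A rule: infinite_finite_induct) (simp_all add: subst_add)

lemma subst_mult: "subst \<phi> (f * g) = subst \<phi> f * subst \<phi> g"
proof (induction f rule: mp_induct)
  case (mono k c)
  show ?case
  proof (induction g rule: mp_induct)
    case (mono l d)
    then show ?case
      by (simp add: mult_single subst_mono1 mpow_add Const_mult algebra_simps)
  next
    case (add f g)
    then show ?case by (simp add: algebra_simps subst_add)
  qed
next
  case (add f g)
  then show ?case by (simp add: algebra_simps subst_add)
qed

lemma subst_power: "subst \<phi> (f ^ n) = subst \<phi> f ^ n"
  by (induction n) (simp_all add: subst_mult)

lemma subst_prod: "subst \<phi> (prod g A) = (\<Prod>i\<in>A. subst \<phi> (g i))"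
  by (induction A rule: infinite_finite_induct) (simp_all add: subst_mult)

lemma subst_mpow: "subst \<phi> (mpow \<psi> k) = mpow (\<lambda>v. subst \<phi> (\<psi> v)) k"
  by (simp add: mpow_def subst_prod subst_power)

lemma subst_subst: "subst \<phi> (subst \<psi> f) = subst (\<lambda>v. subst \<phi> (\<psi> v)) f"
  by (simp add: subst_def[of \<psi>] subst_def[of "\<lambda>v. subst \<phi> (\<psi> v)"]
      subst_sum subst_mult subst_mpow)

lemma subst_cong:
  assumes "\<And>k v. k \<in> supp f ==> v \<in> supp k ==> \<phi> v = \<psi> v"
  shows "subst \<phi> f = subst \<psi> f"
  unfolding subst_def using assms by (intro sum.cong refl arg_cong2[where f = "(*)"] mpow_cong) auto

lemma subst_Var_id [simp]: "subst Var f = f"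
  by (induction f rule: mp_induct) (simp_all add: subst_add subst_mono1 mpow_Var Const_mono1)

lemma subst_scale:
  assumes "\<And>k. k \<in> supp f ==> mpow g k = c"
  shows "subst (\<lambda>v. Const (g v) * \<phi> v) f = Const c * subst \<phi> f"
proof -
  have "mpow (\<lambda>v. Const (g v) * \<phi> v) k = Const c * mpow \<phi> k" if "k \<in> supp f" for k
    using assms[OF that] by (simp add: mpow_mult mpow_Const)
  then show ?thesis
    by (simp add: subst_def sum_distrib_left algebra_simps)
qed

section \<open>Weighted norms and integrality\<close>

text \<open>A submultiplicative l1 norm. Weight 1 is the sum of the absolute coefficients, weight 2
  dominates every Hasse derivative at once, and small weights on chosen variables later allow a
  single coefficient to be compared with the norm.\<close>

definition wnorm :: "('v => real) => 'v mp => real" where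
  "wnorm \<tau> f = (\<Sum>k\<in>supp f. \<bar>coef f k\<bar> * mpow \<tau> k)"

abbreviation l1norm :: "'v mp => real" where "l1norm \<equiv> wnorm (\<lambda>_. 1)"

lemma wnorm_superset:
  assumes "finite A" "supp f \<subseteq> A"
  shows "wnorm \<tau> f = (\<Sum>k\<in>A. \<bar>coef f k\<bar> * mpow \<tau> k)"
  unfolding wnorm_def
  by (rule sum.mono_neutral_left[OF assms]) (auto simp: in_keys_iff)

lemma wnorm_0 [simp]: "wnorm \<tau> 0 = 0"
  by (simp add: wnorm_def)

lemma wnorm_mono1: "wnorm \<tau> (mono1 k c) = \<bar>c\<bar> * mpow \<tau> k"
  by (cases "c = 0") (simp_all add: wnorm_def)

lemma wnorm_Const: "wnorm \<tau> (Const c) = \<bar>c\<bar>"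
  by (simp add: Const_def wnorm_mono1)

lemma wnorm_1 [simp]: "wnorm \<tau> 1 = 1"
  using wnorm_Const[of \<tau> 1] by simp

context
  fixes \<tau> :: "'v => real"
  assumes \<tau>: "\<And>v. \<tau> v \<ge> 0"
begin

lemma wnorm_nonneg: "wnorm \<tau> f \<ge> 0"
  by (simp add: wnorm_def sum_nonneg mpow_nonneg[OF \<tau>])

lemma wnorm_add: "wnorm \<tau> (f + g) \<le> wnorm \<tau> f + wnorm \<tau> g"
proof -
  let ?A = "supp f \<union> supp g"
  have *: "supp (f + g) \<subseteq> ?A" by (rule keys_add)
  have "(\<Sum>k\<in>?A. \<bar>coef (f + g) k\<bar> * mpow \<tau> k)
      \<le> (\<Sum>k\<in>?A. \<bar>coef f k\<bar> * mpow \<tau> k + \<bar>coef g k\<bar> * mpow \<tau> k)"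
    by (intro sum_mono)
       (auto simp: lookup_add mpow_nonneg[OF \<tau>] abs_triangle_ineq mult_right_mono
             simp flip: distrib_right)
  with * show ?thesis
    by (subst (1 2 3) wnorm_superset[where A = ?A]) (auto simp: sum.distrib)
qed

lemma wnorm_sum: "wnorm \<tau> (sum g A) \<le> (\<Sum>i\<in>A. wnorm \<tau> (g i))"
proof (induction A rule: infinite_finite_induct)
  case (insert x F)
  then show ?case using wnorm_add[of "g x" "sum g F"] by simp
qed simp_all

lemma wnorm_mult: "wnorm \<tau> (f * g) \<le> wnorm \<tau> f * wnorm \<tau> g"
proof -
  have "f * g = (\<Sum>k\<in>supp f. mono1 k (coef f k)) * (\<Sum>l\<in>supp g. mono1 l (coef g l))"
    by (simp flip: mp_expand)
  also have "... = (\<Sum>k\<in>supp f. \<Sum>l\<in>supp g. mono1 (k + l) (coef f k * coef g l))"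
    by (simp add: sum_product mult_single)
  also have "wnorm \<tau> ... \<le> (\<Sum>k\<in>supp f. \<Sum>l\<in>supp g. wnorm \<tau> (mono1 (k + l) (coef f k * coef g l)))"
    by (intro order_trans[OF wnorm_sum] sum_mono) simp_all
  also have "... = wnorm \<tau> f * wnorm \<tau> g"
    by (simp add: wnorm_mono1 mpow_add abs_mult) (simp add: wnorm_def sum_product algebra_simps)
  finally show ?thesis .
qed

lemma wnorm_power: "wnorm \<tau> (f ^ n) \<le> wnorm \<tau> f ^ n"
proof (induction n)
  case (Suc n)
  have "wnorm \<tau> (f * f ^ n) \<le> wnorm \<tau> f * wnorm \<tau> (f ^ n)" by (rule wnorm_mult)
  also have "... \<le> wnorm \<tau> f * wnorm \<tau> f ^ n"
    by (rule mult_left_mono[OF Suc wnorm_nonneg])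
  finally show ?case by simp
qed simp

lemma wnorm_prod: "wnorm \<tau> (prod g A) \<le> (\<Prod>i\<in>A. wnorm \<tau> (g i))"
proof (induction A rule: infinite_finite_induct)
  case (insert x F)
  have "wnorm \<tau> (g x * prod g F) \<le> wnorm \<tau> (g x) * wnorm \<tau> (prod g F)" by (rule wnorm_mult)
  also have "... \<le> wnorm \<tau> (g x) * (\<Prod>i\<in>F. wnorm \<tau> (g i))"
    by (rule mult_left_mono[OF insert.IH wnorm_nonneg])
  finally show ?case using insert by simp
qed simp_all

lemma wnorm_mpow: "wnorm \<tau> (mpow \<phi> k) \<le> mpow (\<lambda>v. wnorm \<tau> (\<phi> v)) k"
  unfolding mpow_def
  by (rule order_trans[OF wnorm_prod prod_mono]) (auto simp: wnorm_nonneg wnorm_power)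

lemma wnorm_subst:
  "wnorm \<tau> (subst \<phi> f) \<le> (\<Sum>k\<in>supp f. \<bar>coef f k\<bar> * mpow (\<lambda>v. wnorm \<tau> (\<phi> v)) k)"
proof -
  have "wnorm \<tau> (subst \<phi> f) \<le> (\<Sum>k\<in>supp f. wnorm \<tau> (Const (coef f k) * mpow \<phi> k))"
    unfolding subst_def by (rule wnorm_sum)
  also have "... \<le> (\<Sum>k\<in>supp f. \<bar>coef f k\<bar> * mpow (\<lambda>v. wnorm \<tau> (\<phi> v)) k)"
  proof (intro sum_mono)
    fix k
    have "wnorm \<tau> (Const (coef f k) * mpow \<phi> k) \<le> wnorm \<tau> (Const (coef f k)) * wnorm \<tau> (mpow \<phi> k)"
      by (rule wnorm_mult)
    also have "... \<le> \<bar>coef f k\<bar> * mpow (\<lambda>v. wnorm \<tau> (\<phi> v)) k"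
      by (simp add: wnorm_Const mult_left_mono wnorm_mpow)
    finally show "wnorm \<tau> (Const (coef f k) * mpow \<phi> k) \<le> \<bar>coef f k\<bar> * mpow (\<lambda>v. wnorm \<tau> (\<phi> v)) k" .
  qed
  finally show ?thesis .
qed

lemma coef_le_wnorm: "\<bar>coef f k\<bar> * mpow \<tau> k \<le> wnorm \<tau> f"
proof (cases "k \<in> supp f")
  case True
  then show ?thesis unfolding wnorm_def
    by (intro member_le_sum[where f = "\<lambda>k. \<bar>coef f k\<bar> * mpow \<tau> k"]) (auto simp: mpow_nonneg[OF \<tau>])
next
  case False
  then show ?thesis by (simp add: in_keys_iff wnorm_nonneg)
qed

end

lemma mpow_le_mono:
  assumes "\<And>v. v \<in> supp k ==> 0 \<le> \<sigma> v \<and> \<sigma> v \<le> (\<tau> v :: real)"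
  shows "mpow \<sigma> k \<le> mpow \<tau> k"
  unfolding mpow_def by (rule prod_mono) (auto intro!: power_mono simp: assms)

definition intc :: "'v mp => bool" where "intc f \<longleftrightarrow> (\<forall>k. coef f k \<in> \<int>)"

lemma intc_mono1: "c \<in> \<int> ==> intc (mono1 k c)"
  by (simp add: intc_def coef_mono1)

lemma intc_Const: "c \<in> \<int> ==> intc (Const c)"
  by (simp add: Const_def intc_mono1)

lemma intc_Var: "intc (Var v)"
  by (simp add: Var_def intc_mono1)

lemma intc_0 [simp]: "intc 0" and intc_1 [simp]: "intc 1"
  using intc_Const[of 0] intc_Const[of 1] by auto

lemma intc_add: "intc f ==> intc g ==> intc (f + g)"
  by (simp add: intc_def lookup_add)

lemma intc_sum: "(\<And>i. i \<in> A ==> intc (g i)) ==> intc (sum g A)"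
  by (induction A rule: infinite_finite_induct) (simp_all add: intc_add)

lemma intc_mult:
  assumes "intc f" "intc g"
  shows "intc (f * g)"
proof -
  have "f * g = (\<Sum>k\<in>supp f. mono1 k (coef f k)) * (\<Sum>l\<in>supp g. mono1 l (coef g l))"
    by (simp flip: mp_expand)
  also have "... = (\<Sum>k\<in>supp f. \<Sum>l\<in>supp g. mono1 (k + l) (coef f k * coef g l))"
    by (simp add: sum_product mult_single)
  also have "intc ..."
    using assms by (intro intc_sum intc_mono1) (simp add: intc_def)
  finally show ?thesis .
qed

lemma intc_power: "intc f ==> intc (f ^ n)"
  by (induction n) (simp_all add: intc_mult)

lemma intc_prod: "(\<And>i. i \<in> A ==> intc (g i)) ==> intc (prod g A)"
  by (induction A rule: infinite_finite_induct) (simp_all add: intc_mult)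

lemma intc_subst: "intc f ==> (\<And>v. intc (\<phi> v)) ==> intc (subst \<phi> f)"
  unfolding subst_def mpow_def
  by (intro intc_sum intc_mult intc_Const intc_prod intc_power) (auto simp: intc_def)

section \<open>Hasse derivatives\<close>

definition in_vars :: "'v set => 'v mp => bool" where
  "in_vars S f \<longleftrightarrow> (\<forall>k\<in>supp f. supp k \<subseteq> S)"

lemma in_vars_add: "in_vars S f ==> in_vars S g ==> in_vars S (f + g)"
  unfolding in_vars_def using keys_add[of f g] by blast

lemma in_vars_0 [simp]: "in_vars S 0"
  by (simp add: in_vars_def)

lemma in_vars_sum: "(\<And>i. i \<in> A ==> in_vars S (g i)) ==> in_vars S (sum g A)"
  by (induction A rule: infinite_finite_induct) (simp_all add: in_vars_add)

lemma in_vars_mult: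
  assumes "in_vars S f" "in_vars S g"
  shows "in_vars S (f * g)"
  unfolding in_vars_def
proof
  fix k assume "k \<in> supp (f * g)"
  then obtain a b where "k = a + b" "a \<in> supp f" "b \<in> supp g"
    using keys_mult[of f g] by blast
  then show "supp k \<subseteq> S"
    using assms keys_add[of a b] unfolding in_vars_def by blast
qed

lemma in_vars_mono1: "supp k \<subseteq> S ==> in_vars S (mono1 k c)"
  by (simp add: in_vars_def)

lemma in_vars_Const [simp]: "in_vars S (Const c)"
  by (simp add: Const_def in_vars_mono1)

lemma in_vars_1 [simp]: "in_vars S 1"
  using in_vars_Const[of S 1] by simp

lemma in_vars_Var: "v \<in> S ==> in_vars S (Var v)"
  by (simp add: Var_def in_vars_mono1)

lemma in_vars_power: "in_vars S f ==> in_vars S (f ^ n)"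
  by (induction n) (simp_all add: in_vars_mult)

lemma in_vars_prod: "(\<And>i. i \<in> A ==> in_vars S (g i)) ==> in_vars S (prod g A)"
  by (induction A rule: infinite_finite_induct) (simp_all add: in_vars_mult)

lemma in_vars_mpow: "(\<And>v. v \<in> supp k ==> in_vars S (\<phi> v)) ==> in_vars S (mpow \<phi> k)"
  unfolding mpow_def by (intro in_vars_prod in_vars_power)

lemma in_vars_subst:
  assumes "\<And>k v. k \<in> supp f ==> v \<in> supp k ==> in_vars S (\<phi> v)"
  shows "in_vars S (subst \<phi> f)"
  unfolding subst_def using assms by (intro in_vars_sum in_vars_mult in_vars_mpow in_vars_Const) auto

definition mbin :: "('v \<Rightarrow>\<^sub>0 nat) => ('v \<Rightarrow>\<^sub>0 nat) => real" where
  "mbin k a = (\<Prod>v\<in>supp a. of_nat (coef k v choose coef a v))"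

lemma mbin_superset:
  "finite A ==> supp a \<subseteq> A ==> mbin k a = (\<Prod>v\<in>A. of_nat (coef k v choose coef a v))"
  unfolding mbin_def
  by (rule prod.mono_neutral_left) (auto simp: in_keys_iff)

lemma mbin_eq_0:
  assumes "coef k v < coef a v"
  shows "mbin k a = 0"
proof -
  have "v \<in> supp a" using assms by (simp add: in_keys_iff)
  with assms show ?thesis unfolding mbin_def by (intro prod_zero) (auto intro!: bexI[of _ v])
qed

lemma mbin_nonneg: "mbin k a \<ge> 0"
  by (simp add: mbin_def prod_nonneg)

lemma mbin_Ints: "mbin k a \<in> \<int>"
  unfolding mbin_def by (intro Ints_prod) auto

lemma mbin_le: "mbin k a \<le> mpow (\<lambda>_. 2) k"
proof -
  let ?A = "supp k \<union> supp a"
  have "mbin k a = (\<Prod>v\<in>?A. of_nat (coef k v choose coef a v))"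
    by (rule mbin_superset) auto
  also have "... \<le> (\<Prod>v\<in>?A. 2 ^ coef k v)"
    by (intro prod_mono) (auto intro!: of_nat_le_numeral_power_cancel_iff[THEN iffD2] binomial_le_pow2)
  also have "... = mpow (\<lambda>_. 2) k"
    by (rule mpow_superset[symmetric]) auto
  finally show ?thesis .
qed

lemma mbin_0 [simp]: "mbin k 0 = 1"
  by (simp add: mbin_def)

text \<open>The divided partial derivative of order \<open>a\<close>: dividing by factorials keeps
  the coefficients integral and their growth at most exponential in the degree. The truncated
  subtraction \<open>k - a\<close> is harmless because \<open>mbin k a\<close> vanishes unless
  \<open>a\<close> is below \<open>k\<close> in every variable.\<close>

definition hasse :: "('v \<Rightarrow>\<^sub>0 nat) => 'v mp => 'v mp" where
  "hasse a f = (\<Sum>k\<in>supp f. mono1 (k - a) (mbin k a * coef f k))"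

lemma hasse_superset:
  assumes "finite A" "supp f \<subseteq> A"
  shows "hasse a f = (\<Sum>k\<in>A. mono1 (k - a) (mbin k a * coef f k))"
  unfolding hasse_def
  by (rule sum.mono_neutral_left[OF assms]) (auto simp: in_keys_iff)

lemma hasse_0 [simp]: "hasse a 0 = 0"
  by (simp add: hasse_def)

lemma hasse_add: "hasse a (f + g) = hasse a f + hasse a g"
proof -
  let ?A = "supp f \<union> supp g"
  have "supp (f + g) \<subseteq> ?A" by (rule keys_add)
  then show ?thesis
    by (subst (1 2 3) hasse_superset[where A = ?A])
       (auto simp: lookup_add single_add algebra_simps sum.distrib)
qed

lemma hasse_sum: "hasse a (sum g A) = (\<Sum>i\<in>A. hasse a (g i))"
  by (induction A rule: infinite_finite_induct) (simp_all add: hasse_add)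

lemma hasse_mono1: "hasse a (mono1 k c) = mono1 (k - a) (mbin k a * c)"
  by (cases "c = 0") (simp_all add: hasse_def)

lemma hasse_Const_mult: "hasse a (Const c * f) = Const c * hasse a f"
  by (induction f rule: mp_induct)
     (simp_all add: hasse_add Const_mono1 hasse_mono1 algebra_simps)

lemma key_diff_add:
  fixes k a :: "'v \<Rightarrow>\<^sub>0 nat"
  assumes "\<And>v. coef a v \<le> coef k v"
  shows "k - a + a = k"
  by (rule poly_mapping_eqI) (use assms in \<open>simp add: lookup_add lookup_minus\<close>)

lemma coef_hasse: "coef (hasse a f) k = mbin (k + a) a * coef f (k + a)"
proof (induction f rule: mp_induct)
  case (mono l c)
  show ?case
  proof (cases "\<exists>v. coef l v < coef a v")
    case True
    then have "l \<noteq> k + a" by (auto simp: lookup_add)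
    with True show ?thesis by (auto simp: hasse_mono1 coef_mono1 mbin_eq_0)
  next
    case False
    then have "l - a + a = l" by (intro key_diff_add) (auto simp: not_less)
    then have "l - a = k \<longleftrightarrow> l = k + a" by auto
    then show ?thesis by (auto simp: hasse_mono1 coef_mono1)
  qed
next
  case (add f g)
  then show ?case by (simp add: hasse_add lookup_add algebra_simps)
qed

lemma supp_hasse: "k \<in> supp (hasse a f) ==> k + a \<in> supp f"
  by (auto simp: in_keys_iff coef_hasse)

lemma in_vars_hasse:
  assumes "in_vars S f"
  shows "in_vars S (hasse a f)"
  unfolding in_vars_def
proof
  fix k assume "k \<in> supp (hasse a f)"
  then have "supp (k + a) \<subseteq> S" using assms supp_hasse[of k a f] by (auto simp: in_vars_def)
  moreover have "supp k \<subseteq> supp (k + a)" by (auto simp: in_keys_iff lookup_add)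
  ultimately show "supp k \<subseteq> S" by blast
qed

lemma intc_hasse: "intc f ==> intc (hasse a f)"
  by (simp add: intc_def coef_hasse mbin_Ints)

lemma l1norm_hasse: "l1norm (hasse a f) \<le> wnorm (\<lambda>_. 2) f"
proof -
  have "l1norm (hasse a f) \<le> (\<Sum>k\<in>supp f. l1norm (mono1 (k - a) (mbin k a * coef f k)))"
    unfolding hasse_def by (rule wnorm_sum) simp
  also have "... \<le> (\<Sum>k\<in>supp f. \<bar>coef f k\<bar> * mpow (\<lambda>_. 2) k)"
    by (intro sum_mono)
       (simp add: wnorm_mono1 abs_mult mbin_nonneg mbin_le mult_left_mono mult.commute[of "mbin _ _"])
  finally show ?thesis by (simp add: wnorm_def)
qed

text \<open>In disjoint sets of variables the binomials factor and the Leibniz rule has a single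
  term. This later turns a Wronskian of a sum of products into a product of two
  determinants.\<close>

lemma hasse_separated:
  assumes "in_vars S f" "in_vars S' g" "supp a \<subseteq> S" "supp b \<subseteq> S'" "S \<inter> S' = {}"
  shows "hasse (a + b) (f * g) = hasse a f * hasse b g"
proof -
  have *: "mono1 (k + l - (a + b)) (mbin (k + l) (a + b) * (coef f k * coef g l)) =
      mono1 (k - a) (mbin k a * coef f k) * mono1 (l - b) (mbin l b * coef g l)"
    if "k \<in> supp f" "l \<in> supp g" for k l
  proof -
    have kS: "supp k \<subseteq> S" "supp l \<subseteq> S'" using assms that by (auto simp: in_vars_def)
    have z: "coef l v = 0 \<and> coef b v = 0" if "v \<in> S" for v
      using kS assms that by (meson disjoint_iff in_keys_iff subset_iff)
    have z': "coef k v = 0 \<and> coef a v = 0" if "v \<in> S'" for v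
      using kS assms that by (meson disjoint_iff in_keys_iff subset_iff)
    have sab: "supp (a + b) = supp a \<union> supp b" by (auto simp: in_keys_iff lookup_add)
    have "mbin (k + l) (a + b) = (\<Prod>v\<in>supp a \<union> supp b. of_nat (coef (k + l) v choose coef (a + b) v))"
      by (simp add: mbin_def sab)
    also have "... = (\<Prod>v\<in>supp a. of_nat (coef (k + l) v choose coef (a + b) v)) *
        (\<Prod>v\<in>supp b. of_nat (coef (k + l) v choose coef (a + b) v))"
      by (rule prod.union_disjoint) (use assms in auto)
    also have "... = mbin k a * mbin l b"
      unfolding mbin_def using z z' assms(3,4)
      by (intro arg_cong2[where f = "(*)"] prod.cong) (auto simp: lookup_add subset_iff)
    finally have m: "mbin (k + l) (a + b) = mbin k a * mbin l b" .
    \<comment> \<open>Truncated subtraction is additive here only when \<open>a\<close> is below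
      \<open>k\<close> and \<open>b\<close> below \<open>l\<close>; otherwise both sides have
      coefficient 0.\<close>
    have e: "k + l - (a + b) = (k - a) + (l - b)" if "mbin k a \<noteq> 0" "mbin l b \<noteq> 0"
    proof (rule poly_mapping_eqI)
      fix v
      have "coef a v \<le> coef k v" "coef b v \<le> coef l v"
        using that mbin_eq_0 not_less by metis+
      then show "coef (k + l - (a + b)) v = coef (k - a + (l - b)) v"
        by (simp add: lookup_add lookup_minus)
    qed
    show ?thesis
      by (cases "mbin k a = 0 \<or> mbin l b = 0") (auto simp: m e mult_single algebra_simps)
  qed
  have "f * g = (\<Sum>k\<in>supp f. mono1 k (coef f k)) * (\<Sum>l\<in>supp g. mono1 l (coef g l))"
    by (simp flip: mp_expand)
  also have "... = (\<Sum>k\<in>supp f. \<Sum>l\<in>supp g. mono1 (k + l) (coef f k * coef g l))"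
    by (simp add: sum_product mult_single)
  finally have "hasse (a + b) (f * g) = (\<Sum>k\<in>supp f. \<Sum>l\<in>supp g.
      mono1 (k + l - (a + b)) (mbin (k + l) (a + b) * (coef f k * coef g l)))"
    by (simp add: hasse_sum hasse_mono1)
  also have "... = (\<Sum>k\<in>supp f. \<Sum>l\<in>supp g.
      mono1 (k - a) (mbin k a * coef f k) * mono1 (l - b) (mbin l b * coef g l))"
    by (intro sum.cong refl *)
  also have "... = hasse a f * hasse b g"
    by (simp add: hasse_def sum_product)
  finally show ?thesis .
qed

lemma key_split: "a = (a - mono1 v (coef a v)) + mono1 v (coef a v)" for a :: "'v \<Rightarrow>\<^sub>0 nat"
  by (rule poly_mapping_eqI) (simp add: lookup_add lookup_minus coef_mono1)

lemma coef_Var_power: "Var v ^ n = mono1 (mono1 v n) 1"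
  using mpow_Var[of "mono1 v n"] by (simp add: mpow_mono1)

lemma hasse_linear_power:
  "hasse (mono1 v n) ((Var v + Const b) ^ N) = Const (real (N choose n)) * (Var v + Const b) ^ (N - n)"
proof (rule poly_mapping_eqI)
  fix k
  have ex: "(Var v + Const b) ^ M = (\<Sum>i\<le>M. mono1 (mono1 v i) (real (M choose i) * b ^ (M - i)))" for M
  proof -
    have "(of_nat c :: 'a mp) = Const (real c)" for c
      by (simp add: Const_def flip: single_of_nat)
    then show ?thesis
      by (simp add: binomial_ring coef_Var_power Const_mono1 flip: Const_power Const_mult)
         (simp add: mult.commute[of "mono1 _ _"] Const_mono1 mult_ac flip: mult.assoc)
  qed
  have c: "coef ((Var v + Const b) ^ M) k =
      (if \<exists>i\<le>M. k = mono1 v i then real (M choose coef k v) * b ^ (M - coef k v) else 0)" for M k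
  proof (cases "\<exists>i\<le>M. k = mono1 v i")
    case True
    then obtain i where i: "i \<le> M" "k = mono1 v i" by blast
    have "mono1 v j = mono1 v i \<longleftrightarrow> j = i" for j
      by (metis lookup_single_eq)
    moreover have "\<exists>j\<le>M. mono1 v i = mono1 v j" using i by blast
    ultimately show ?thesis using i by (simp add: ex lookup_sum coef_mono1 if_distrib cong: if_cong)
  next
    case False
    then show ?thesis by (auto simp: ex lookup_sum coef_mono1 intro!: sum.neutral)
  qed
  show "coef (hasse (mono1 v n) ((Var v + Const b) ^ N)) k =
      coef (Const (real (N choose n)) * (Var v + Const b) ^ (N - n)) k"
  proof (cases "\<exists>i. k = mono1 v i")
    case True
    then obtain i where i: "k = mono1 v i" by blast
    have e: "mono1 v i + mono1 v n = mono1 v (i + n)" by (simp add: single_add)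
    have inj: "mono1 v j = mono1 v l \<longleftrightarrow> j = l" for j l :: nat
      by (metis lookup_single_eq)
    have m: "mbin (mono1 v (i + n)) (mono1 v n) = real ((i + n) choose n)"
      by (cases "n = 0") (simp_all add: mbin_def)
    show ?thesis
    proof (cases "i + n \<le> N")
      case True
      have "real ((i + n) choose n) * real (N choose (i + n)) = real (N choose n) * real ((N - n) choose i)"
        using choose_mult[of n "i + n" N] True by (simp flip: of_nat_mult add: mult.commute)
      with True show ?thesis
        by (auto simp: coef_hasse coef_Const_mult c i e m inj) (auto simp: algebra_simps)
    next
      case False
      then show ?thesis
        by (cases "n \<le> N") (auto simp: coef_hasse coef_Const_mult c i e inj binomial_eq_0)
    qed
  next
    case False
    have "\<not> (\<exists>i. k + mono1 v n = mono1 v i)"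
    proof
      assume "\<exists>i. k + mono1 v n = mono1 v i"
      then obtain i where i: "k + mono1 v n = mono1 v i" by blast
      have "k = mono1 v (i - n)"
      proof (rule poly_mapping_eqI)
        fix w
        from i have "coef k w + coef (mono1 v n) w = coef (mono1 v i) w" by (metis lookup_add)
        then show "coef k w = coef (mono1 v (i - n)) w" by (auto simp: coef_mono1 split: if_splits)
      qed
      with False show False by blast
    qed
    with False show ?thesis by (auto simp: coef_hasse coef_Const_mult c)
  qed
qed

text \<open>Taylor expansion: the coefficient of \<open>shift \<beta> f\<close> at \<open>k\<close>
  is the Hasse derivative of order \<open>k\<close> at \<open>\<beta>\<close>. Order of vanishing
  and index at \<open>\<beta>\<close> are therefore read off from the support of
  \<open>shift \<beta> f\<close>.\<close>

definition shift :: "('v => real) => 'v mp => 'v mp" where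
  "shift \<beta> = subst (\<lambda>v. Var v + Const (\<beta> v))"

text \<open>The induction adds one new variable with its whole exponent, so that
  \<open>hasse_separated\<close> splits off a power of one linear polynomial, which
  \<open>hasse_linear_power\<close> handles.\<close>

lemma hasse_shift_mpow:
  fixes \<beta> :: "'v => real"
  defines "\<phi> \<equiv> (\<lambda>v. Var v + Const (\<beta> v))"
  shows "hasse a (mpow \<phi> k) = Const (mbin k a) * mpow \<phi> (k - a)"
proof (induction k arbitrary: a rule: update_induct)
  case const
  show ?case
  proof (cases "a = 0")
    case True
    then show ?thesis using hasse_mono1[of 0 0 1] by simp
  next
    case False
    then obtain v where "coef a v \<noteq> 0" by (metis poly_mapping_eqI lookup_zero)
    then have "mbin 0 a = 0" by (intro mbin_eq_0[of 0 v]) auto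
    then show ?thesis by (simp add: hasse_def)
  qed
next
  case (update k v n)
  have upd: "Poly_Mapping.update v n k = k + mono1 v n"
    by (rule poly_mapping_eqI) (use update(1) in \<open>auto simp: lookup_update lookup_add coef_mono1 in_keys_iff\<close>)
  define p where "p = coef a v"
  define a' where "a' = a - mono1 v p"
  have a: "a = a' + mono1 v p" unfolding a'_def p_def by (rule key_split)
  have va: "coef a' v = 0" by (simp add: a'_def p_def lookup_minus)
  have vk: "coef k v = 0" using update(1) by (simp add: in_keys_iff)
  have "hasse a (mpow \<phi> (k + mono1 v n)) = hasse (a' + mono1 v p) (mpow \<phi> k * \<phi> v ^ n)"
    by (simp add: mpow_add mpow_mono1 a)
  also have "... = hasse a' (mpow \<phi> k) * hasse (mono1 v p) (\<phi> v ^ n)"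
  proof (rule hasse_separated[where S = "- {v}" and S' = "{v}"])
    show "in_vars (- {v}) (mpow \<phi> k)"
      unfolding \<phi>_def using update(1)
      by (intro in_vars_mpow in_vars_add in_vars_Var in_vars_Const) auto
    show "in_vars {v} (\<phi> v ^ n)"
      unfolding \<phi>_def by (intro in_vars_power in_vars_add in_vars_Var in_vars_Const) auto
    show "supp a' \<subseteq> - {v}" using va by (auto simp: in_keys_iff)
  qed auto
  also have "... = Const (mbin k a' * real (n choose p)) * mpow \<phi> ((k - a') + mono1 v (n - p))"
    using update(3)[of a']
    by (simp add: \<phi>_def hasse_linear_power mpow_add mpow_mono1 Const_mult algebra_simps)
  also have "mbin k a' * real (n choose p) = mbin (k + mono1 v n) a"
  proof -
    have "mbin (k + mono1 v n) a = (\<Prod>w\<in>insert v (supp a'). of_nat (coef (k + mono1 v n) w choose coef a w))"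
      by (rule mbin_superset) (auto simp: a in_keys_iff lookup_add coef_mono1 split: if_splits)
    also have "... = real (n choose p) * (\<Prod>w\<in>supp a'. of_nat (coef (k + mono1 v n) w choose coef a w))"
      using va vk by (subst prod.insert) (auto simp: in_keys_iff a lookup_add)
    also have "(\<Prod>w\<in>supp a'. real (coef (k + mono1 v n) w choose coef a w)) = mbin k a'"
      unfolding mbin_def using va
      by (intro prod.cong) (auto simp: in_keys_iff a lookup_add coef_mono1)
    finally show ?thesis by simp
  qed
  also have "(k - a') + mono1 v (n - p) = k + mono1 v n - a"
    by (rule poly_mapping_eqI) (use va vk in \<open>auto simp: a lookup_add lookup_minus coef_mono1\<close>)
  finally show ?case by (simp add: upd)
qed

lemma shift_hasse: "shift \<beta> (hasse a f) = hasse a (shift \<beta> f)"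
  unfolding shift_def
  by (induction f rule: mp_induct)
     (simp_all add: subst_add hasse_add subst_mono1 hasse_mono1 hasse_Const_mult hasse_shift_mpow
        Const_mult mult.assoc)

section \<open>Generalised Wronskians\<close>

abbreviation dt :: "nat => (nat => nat => 'a) => 'a::comm_ring_1" where
  "dt K E \<equiv> det (mat K K (\<lambda>(i, j). E i j))"

lemma dt_eq: "dt K E = (\<Sum>p | p permutes {0..<K}. signof p * (\<Prod>i<K. E i (p i)))"
proof -
  have "dt K E = (\<Sum>p | p permutes {0..<K}. signof p * (\<Prod>i = 0..<K. mat K K (\<lambda>(i, j). E i j) $$ (i, p i)))"
    by (rule det_def') simp
  also have "... = (\<Sum>p | p permutes {0..<K}. signof p * (\<Prod>i<K. E i (p i)))"
  proof (intro sum.cong refl arg_cong2[where f = "(*)"])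
    fix p assume "p \<in> {p. p permutes {0..<K}}"
    then have "p i < K" if "i < K" for i using that permutes_in_image[of p "{0..<K}" i] by auto
    then show "(\<Prod>i = 0..<K. mat K K (\<lambda>(i, j). E i j) $$ (i, p i)) = (\<Prod>i<K. E i (p i))"
      by (intro prod.cong) auto
  qed
  finally show ?thesis .
qed

lemma dt_cong: "(\<And>i j. i < K ==> j < K ==> E i j = F i j) ==> dt K E = dt K F"
  by (intro arg_cong[where f = det] cong_mat) auto

lemma dt_mult: "dt K (\<lambda>i j. \<Sum>l<K. E i l * F l j) = dt K E * dt K F"
proof -
  have "mat K K (\<lambda>(i, j). \<Sum>l<K. E i l * F l j) = mat K K (\<lambda>(i, j). E i j) * mat K K (\<lambda>(i, j). F i j)"
    by (rule eq_matI) (auto simp: scalar_prod_def atLeast0LessThan)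
  then show ?thesis by (simp add: det_mult[where n = K])
qed

lemma dt_row_linear:
  assumes "i0 < K"
  shows "dt K (\<lambda>i j. if i = i0 then u j + c * v j else E i j) =
    dt K (\<lambda>i j. if i = i0 then u j else E i j) + c * dt K (\<lambda>i j. if i = i0 then v j else E i j)"
proof -
  have *: "(\<Prod>i<K. if i = i0 then w (p i) else E i (p i)) = w (p i0) * (\<Prod>i\<in>{..<K} - {i0}. E i (p i))" for w p
    using assms by (subst prod.remove[where x = i0]) (auto intro!: arg_cong2[where f = "(*)"] prod.cong)
  show ?thesis
    using *[of u] *[of v] *[of "\<lambda>j. u j + c * v j"]
    by (simp add: dt_eq sum_distrib_left algebra_simps sum.distrib)
qed

lemma dt_rows_mult: "dt K (\<lambda>i j. c i * E i j) = (\<Prod>i<K. c i) * dt K E"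
  by (simp add: dt_eq prod.distrib sum_distrib_left algebra_simps)

text \<open>Operators diagonal on monomials. The Euler-type operators x^a D_a are of this kind, and
  such an operator acts on a leading term by the value of \<open>g\<close> at its exponent, which
  makes determinants of them computable.\<close>

definition thet :: "(('v \<Rightarrow>\<^sub>0 nat) => real) => 'v mp => 'v mp" where
  "thet g f = (\<Sum>k\<in>supp f. mono1 k (g k * coef f k))"

lemma coef_thet: "coef (thet g f) k = g k * coef f k"
  by (auto simp: thet_def lookup_sum coef_mono1 in_keys_iff if_distrib cong: if_cong)

lemma thet_add: "thet (\<lambda>k. g k + c * h k) f = thet g f + Const c * thet h f"
  by (rule poly_mapping_eqI) (simp add: coef_thet lookup_add coef_Const_mult algebra_simps)

lemma thet_zero: "thet (\<lambda>k. 0) f = 0"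
  by (rule poly_mapping_eqI) (simp add: coef_thet)

lemma mono1_hasse: "mono1 a 1 * hasse a f = thet (\<lambda>k. mbin k a) f"
proof (induction f rule: mp_induct)
  case (mono k c)
  have "thet (\<lambda>k. mbin k a) (mono1 k c) = mono1 k (mbin k a * c)"
    by (rule poly_mapping_eqI) (auto simp: coef_thet coef_mono1)
  moreover have "a + (k - a) = k" if "mbin k a \<noteq> 0"
  proof -
    have "coef a v \<le> coef k v" for v using that mbin_eq_0 not_less by metis
    then show ?thesis using key_diff_add[of a k] by (simp add: add.commute)
  qed
  ultimately show ?case by (cases "mbin k a = 0") (auto simp: hasse_mono1 mult_single)
next
  case (add f g)
  have "thet h (f + g) = thet h f + thet h g" for h
    by (rule poly_mapping_eqI) (simp add: coef_thet lookup_add algebra_simps)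
  with add show ?case by (simp add: hasse_add algebra_simps)
qed

definition tdeg :: "('v \<Rightarrow>\<^sub>0 nat) => nat" where "tdeg a = (\<Sum>v\<in>supp a. coef a v)"

lemma tdeg_superset: "finite A ==> supp a \<subseteq> A ==> tdeg a = (\<Sum>v\<in>A. coef a v)"
  unfolding tdeg_def by (rule sum.mono_neutral_left) (auto simp: in_keys_iff)

lemma tdeg_add_mono1: "tdeg (a + mono1 v n) = tdeg a + n"
proof -
  have "tdeg (a + mono1 v n) = (\<Sum>w\<in>insert v (supp a). coef (a + mono1 v n) w)"
    by (rule tdeg_superset) (auto simp: in_keys_iff lookup_add coef_mono1 split: if_splits)
  also have "... = (\<Sum>w\<in>insert v (supp a). coef a w) + (\<Sum>w\<in>insert v (supp a). coef (mono1 v n) w)"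
    by (simp add: lookup_add sum.distrib)
  also have "(\<Sum>w\<in>insert v (supp a). coef a w) = tdeg a"
    by (rule tdeg_superset[symmetric]) auto
  also have "(\<Sum>w\<in>insert v (supp a). coef (mono1 v n) w) = n"
    by (simp add: coef_mono1)
  finally show ?thesis .
qed

text \<open>Combinations of the functions \<open>mbin _ a\<close> with \<open>a\<close> of total degree at most \<open>p\<close>; they contain
  all polynomial functions of degree at most \<open>p\<close> in the exponents of the variables in \<open>S\<close>.\<close>

inductive bspan :: "'v set => nat => (('v \<Rightarrow>\<^sub>0 nat) => real) => bool" for S p where
  zero: "bspan S p (\<lambda>_. 0)"
| add: "bspan S p g ==> supp a \<subseteq> S ==> tdeg a \<le> p ==> bspan S p (\<lambda>k. g k + c * mbin k a)"

text \<open>The identity n C(n,p) = p C(n,p) + (p+1) C(n,p+1) in the variable \<open>v\<close>. It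
  shows that multiplication by an exponent keeps the span of the functions \<open>mbin _ a\<close>
  and raises the degree by one.\<close>

lemma mbin_mult_exponent:
  "real (coef k v) * mbin k a = real (coef a v) * mbin k a + real (coef a v + 1) * mbin k (a + mono1 v 1)"
proof -
  let ?n = "coef k v" and ?p = "coef a v"
  let ?R = "\<Prod>w\<in>supp a - {v}. real (coef k w choose coef a w)"
  have 1: "mbin k a = real (?n choose ?p) * ?R"
  proof -
    have "mbin k a = (\<Prod>w\<in>insert v (supp a - {v}). real (coef k w choose coef a w))"
      by (rule mbin_superset) auto
    then show ?thesis by (simp del: insert_Diff_single)
  qed
  have 2: "mbin k (a + mono1 v 1) = real (?n choose (?p + 1)) * ?R"
  proof -
    have "mbin k (a + mono1 v 1) = (\<Prod>w\<in>insert v (supp a - {v}). real (coef k w choose coef (a + mono1 v 1) w))"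
      by (rule mbin_superset) (auto simp: in_keys_iff lookup_add coef_mono1 split: if_splits)
    also have "... = real (?n choose (?p + 1)) * (\<Prod>w\<in>supp a - {v}. real (coef k w choose coef (a + mono1 v 1) w))"
      by (simp add: lookup_add del: insert_Diff_single)
    also have "(\<Prod>w\<in>supp a - {v}. real (coef k w choose coef (a + mono1 v 1) w)) = ?R"
      by (intro prod.cong) (auto simp: lookup_add coef_mono1)
    finally show ?thesis .
  qed
  have "real ?n * real (?n choose ?p) = real ?p * real (?n choose ?p) + real (?p + 1) * real (?n choose (?p + 1))"
  proof (cases "?p \<le> ?n")
    case True
    have "(?p + 1) * (?n choose (?p + 1)) = (?n - ?p) * (?n choose ?p)"
      using binomial_absorb_comp[of ?n ?p] binomial_absorption[of ?p ?n] by (cases ?n) (auto simp: algebra_simps)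
    then have "real (?p + 1) * real (?n choose (?p + 1)) = (real ?n - real ?p) * real (?n choose ?p)"
      using True by (metis of_nat_diff of_nat_mult)
    then show ?thesis by (simp add: algebra_simps)
  qed (auto simp: binomial_eq_0)
  then have "real ?n * real (?n choose ?p) * ?R =
      (real ?p * real (?n choose ?p) + real (?p + 1) * real (?n choose (?p + 1))) * ?R" by simp
  then show ?thesis unfolding 1 2 by (simp add: algebra_simps)
qed

lemma bspan_const: "bspan S p (\<lambda>_. c)"
proof -
  have "bspan S p (\<lambda>k. 0 + c * mbin k 0)"
    by (rule bspan.intros) (auto intro: bspan.intros simp: tdeg_def)
  then show ?thesis by simp
qed

lemma bspan_affine:
  assumes "bspan S p g" "v \<in> S"
  shows "bspan S (Suc p) (\<lambda>k. c * (real (coef k v) - r) * g k)"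
  using assms(1)
proof (induction rule: bspan.induct)
  case zero
  then show ?case by (simp add: bspan.zero)
next
  case (add g a d)
  have "bspan S (Suc p) (\<lambda>k. (c * (real (coef k v) - r) * g k + (c * d * (real (coef a v) - r)) * mbin k a)
      + (c * d * real (coef a v + 1)) * mbin k (a + mono1 v 1))"
    using add assms(2) keys_add[of a "mono1 v 1"]
    by (intro bspan.add) (auto simp: tdeg_add_mono1)
  moreover have "(c * (real (coef k v) - r) * g k + (c * d * (real (coef a v) - r)) * mbin k a)
      + (c * d * real (coef a v + 1)) * mbin k (a + mono1 v 1) = c * (real (coef k v) - r) * (g k + d * mbin k a)" for k
  proof -
    have "c * d * (real (coef k v) * mbin k a) =
        c * d * (real (coef a v) * mbin k a + real (coef a v + 1) * mbin k (a + mono1 v 1))"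
      by (simp only: mbin_mult_exponent)
    then show ?thesis by (simp only: ring_distribs mult_ac)
  qed
  ultimately show ?case by simp
qed

text \<open>Lagrange interpolation with one affine factor for each node to be killed, in any
  variable in which that node differs from \<open>\<kappa> i\<close>. One factor per node explains
  the degree \<open>card J\<close>.\<close>

lemma lagrange_bspan:
  assumes "finite J" "i \<notin> J" "\<And>j. j \<in> J ==> supp (\<kappa> j) \<subseteq> S" "supp (\<kappa> i) \<subseteq> S"
    "\<And>j. j \<in> J ==> \<kappa> j \<noteq> \<kappa> i"
  shows "\<exists>g. bspan S (card J) g \<and> g (\<kappa> i) = 1 \<and> (\<forall>j\<in>J. g (\<kappa> j) = 0)"
  using assms
proof (induction J)
  case empty
  then show ?case using bspan_const[of S 0 1] by auto
next
  case (insert j J)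
  then obtain g where g: "bspan S (card J) g" "g (\<kappa> i) = 1" "\<forall>j\<in>J. g (\<kappa> j) = 0" by auto
  have "\<kappa> j \<noteq> \<kappa> i" using insert by auto
  then obtain v where v: "coef (\<kappa> j) v \<noteq> coef (\<kappa> i) v" by (metis poly_mapping_eqI)
  have "v \<in> S"
  proof (cases "v \<in> supp (\<kappa> j)")
    case False
    then have "v \<in> supp (\<kappa> i)" using v by (metis in_keys_iff)
    then show ?thesis using insert.prems by auto
  qed (use insert.prems in auto)
  have "bspan S (Suc (card J)) (\<lambda>k. (1 / (real (coef (\<kappa> i) v) - real (coef (\<kappa> j) v))) *
      (real (coef k v) - real (coef (\<kappa> j) v)) * g k)"
    by (rule bspan_affine[OF g(1) \<open>v \<in> S\<close>])
  then show ?case using v g(2,3) insert.hyps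
    by (intro exI[of _ "\<lambda>k. (1 / (real (coef (\<kappa> i) v) - real (coef (\<kappa> j) v))) *
      (real (coef k v) - real (coef (\<kappa> j) v)) * g k"]) auto
qed

text \<open>With natural numbers as variables the exponents carry a linear order compatible with
  addition, so the sum of two upper bounds of the supports arises from one pair only.\<close>

lemma coef_lead_mult:
  fixes f g :: "nat mp"
  assumes "\<And>k. k \<in> supp f ==> k \<le> \<kappa>" "\<And>k. k \<in> supp g ==> k \<le> \<mu>"
  shows "coef (f * g) (\<kappa> + \<mu>) = coef f \<kappa> * coef g \<mu>"
proof -
  have *: "k + l = \<kappa> + \<mu> \<longleftrightarrow> k = \<kappa> \<and> l = \<mu>" if "k \<in> supp f" "l \<in> supp g" for k l
    using assms that by (metis add_le_less_mono add_less_le_mono order_le_less less_irrefl)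
  have "f * g = (\<Sum>k\<in>supp f. mono1 k (coef f k)) * (\<Sum>l\<in>supp g. mono1 l (coef g l))"
    by (simp flip: mp_expand)
  also have "... = (\<Sum>k\<in>supp f. \<Sum>l\<in>supp g. mono1 (k + l) (coef f k * coef g l))"
    by (simp add: sum_product mult_single)
  finally have "coef (f * g) (\<kappa> + \<mu>) = (\<Sum>k\<in>supp f. \<Sum>l\<in>supp g. if k = \<kappa> \<and> l = \<mu> then coef f k * coef g l else 0)"
    by (simp add: lookup_sum coef_mono1 * cong: sum.cong)
  also have "... = (\<Sum>k\<in>supp f. if k = \<kappa> then coef f k * coef g \<mu> else 0)"
    by (intro sum.cong refl) (auto simp: in_keys_iff)
  also have "... = coef f \<kappa> * coef g \<mu>"
    by (auto simp: in_keys_iff)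
  finally show ?thesis .
qed

lemma coef_lead_prod:
  fixes G :: "'i => nat mp"
  assumes "finite I" "\<And>i k. i \<in> I ==> k \<in> supp (G i) ==> k \<le> \<kappa> i"
  shows "coef (\<Prod>i\<in>I. G i) (\<Sum>i\<in>I. \<kappa> i) = (\<Prod>i\<in>I. coef (G i) (\<kappa> i)) \<and>
    (\<forall>k\<in>supp (\<Prod>i\<in>I. G i). k \<le> (\<Sum>i\<in>I. \<kappa> i))"
  using assms
proof (induction I)
  case (insert x I)
  then have IH: "coef (\<Prod>i\<in>I. G i) (\<Sum>i\<in>I. \<kappa> i) = (\<Prod>i\<in>I. coef (G i) (\<kappa> i))"
    "\<forall>k\<in>supp (\<Prod>i\<in>I. G i). k \<le> (\<Sum>i\<in>I. \<kappa> i)" by auto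
  have "coef (G x * (\<Prod>i\<in>I. G i)) (\<kappa> x + (\<Sum>i\<in>I. \<kappa> i)) = coef (G x) (\<kappa> x) * coef (\<Prod>i\<in>I. G i) (\<Sum>i\<in>I. \<kappa> i)"
    using insert.prems IH(2) by (intro coef_lead_mult) auto
  moreover have "k \<le> \<kappa> x + (\<Sum>i\<in>I. \<kappa> i)" if k: "k \<in> supp (G x * (\<Prod>i\<in>I. G i))" for k
  proof -
    obtain a b where ab: "k = a + b" "a \<in> supp (G x)" "b \<in> supp (\<Prod>i\<in>I. G i)"
      using k keys_mult[of "G x" "\<Prod>i\<in>I. G i"] by blast
    then show ?thesis using insert.prems IH(2) by (auto intro: add_mono)
  qed
  ultimately show ?case using insert.hyps IH by simp
qed simp

abbreviation lmon :: "nat mp => (nat \<Rightarrow>\<^sub>0 nat)" where "lmon f \<equiv> Max (supp f)"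

lemma lmon_in: "f \<noteq> 0 ==> lmon f \<in> supp f"
  by (rule Max_in) auto

definition lin_indep :: "nat => (nat => 'v mp) => bool" where
  "lin_indep K F \<longleftrightarrow> (\<forall>x. (\<Sum>j<K. Const (x j) * F j) = 0 \<longrightarrow> (\<forall>j<K. x j = 0))"

text \<open>Gaussian elimination with respect to leading monomials. The new vector has coefficient 1
  at \<open>p\<close> and the smallest possible leading monomial; an old vector with the same
  leading monomial could be subtracted to make it smaller.\<close>

lemma echelon:
  fixes F :: "nat => nat mp"
  assumes ind: "lin_indep K F"
  shows "p \<le> K ==> \<exists>G c. (\<forall>j<p. G j \<noteq> 0 \<and> G j = (\<Sum>l<K. Const (c j l) * F l) \<and> (\<forall>l\<ge>p. c j l = 0)) \<and>
    inj_on (\<lambda>j. lmon (G j)) {..<p}"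
proof (induction p)
  case (Suc p)
  then have "p \<le> K" by simp
  from Suc.IH[OF this] obtain G c where
    GG: "\<forall>j<p. G j \<noteq> 0 \<and> G j = (\<Sum>l<K. Const (c j l) * F l) \<and> (\<forall>l\<ge>p. c j l = 0)"
    and Ginj: "inj_on (\<lambda>j. lmon (G j)) {..<p}" by (elim exE conjE)
  have G: "\<And>j. j < p ==> G j \<noteq> 0" "\<And>j. j < p ==> G j = (\<Sum>l<K. Const (c j l) * F l)"
    "\<And>j l. j < p ==> l \<ge> p ==> c j l = 0"
    using GG by blast+
  define Ks where "Ks = (\<Union>l<K. supp (F l))"
  have finK: "finite Ks" by (simp add: Ks_def)
  define comb where "comb x = (\<Sum>l<K. Const (x l) * F l)" for x :: "nat => real"
  define ok where "ok x \<longleftrightarrow> x p = 1 \<and> (\<forall>l>p. x l = 0)" for x :: "nat => real"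
  \<comment> \<open>The number of occurring exponents up to the leading one: a natural number to
    minimise in place of an exponent.\<close>
  define ms where "ms x = card {k\<in>Ks. k \<le> lmon (comb x)}" for x
  have ok_ne: "comb x \<noteq> 0" if "ok x" for x
    using ind that Suc.prems unfolding lin_indep_def comb_def ok_def by force
  have sub: "supp (comb x) \<subseteq> Ks" for x
  proof
    fix k assume "k \<in> supp (comb x)"
    then have "(\<Sum>l<K. x l * coef (F l) k) \<noteq> 0"
      by (simp add: comb_def in_keys_iff lookup_sum coef_Const_mult)
    then obtain l where "l < K" "coef (F l) k \<noteq> 0"
      by (metis (mono_tags, lifting) lessThan_iff mult_zero_right sum.not_neutral_contains_not_neutral)
    then show "k \<in> Ks" by (auto simp: Ks_def in_keys_iff)
  qed
  have ex: "ok (\<lambda>l. if l = p then 1 else 0)" by (simp add: ok_def)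
  obtain x where x: "ok x" "\<And>y. ok y ==> ms x \<le> ms y"
    using arg_min_nat_lemma[of ok, OF ex, of ms] by blast
  have new: "lmon (comb x) \<noteq> lmon (G j)" if j: "j < p" for j
  proof
    assume eq: "lmon (comb x) = lmon (G j)"
    let ?m = "lmon (comb x)"
    have gm: "coef (G j) ?m \<noteq> 0" using lmon_in[OF G(1)[OF j]] eq by (simp add: in_keys_iff)
    define r where "r = coef (comb x) ?m / coef (G j) ?m"
    define y where "y l = x l - r * c j l" for l
    have oky: "ok y" using x(1) j G(3)[OF j] by (auto simp: ok_def y_def)
    have cy: "comb y = comb x + Const (- r) * G j"
      by (rule poly_mapping_eqI)
         (simp add: comb_def y_def G(2)[OF j] lookup_add lookup_sum coef_Const_mult,
          simp add: algebra_simps sum_subtractf sum_distrib_left)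
    have le: "k \<le> ?m" if "k \<in> supp (comb y)" for k
    proof -
      have "k \<in> supp (comb x) \<or> k \<in> supp (G j)"
        using that by (auto simp: cy in_keys_iff lookup_add coef_Const_mult)
      then show ?thesis
      proof
        assume "k \<in> supp (comb x)"
        then show ?thesis by (intro Max_ge) auto
      next
        assume "k \<in> supp (G j)"
        then show ?thesis unfolding eq by (intro Max_ge) auto
      qed
    qed
    have "coef (comb y) ?m = 0" using gm by (simp add: cy lookup_add coef_Const_mult r_def)
    then have "?m \<notin> supp (comb y)" by (simp add: in_keys_iff)
    then have lt: "lmon (comb y) < ?m"
      using le[OF lmon_in[OF ok_ne[OF oky]]] lmon_in[OF ok_ne[OF oky]] by (metis order_le_less)
    have "{k\<in>Ks. k \<le> lmon (comb y)} \<subset> {k\<in>Ks. k \<le> ?m}"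
    proof
      show "{k\<in>Ks. k \<le> lmon (comb y)} \<subseteq> {k\<in>Ks. k \<le> ?m}" using lt by auto
      have "?m \<in> Ks" using sub lmon_in[OF ok_ne[OF x(1)]] by blast
      then have "?m \<in> {k\<in>Ks. k \<le> ?m}" by simp
      moreover have "?m \<notin> {k\<in>Ks. k \<le> lmon (comb y)}" using lt by (simp add: not_le)
      ultimately show "{k\<in>Ks. k \<le> lmon (comb y)} \<noteq> {k\<in>Ks. k \<le> ?m}" by blast
    qed
    then have "ms y < ms x" unfolding ms_def by (intro psubset_card_mono) (use finK in auto)
    with x(2)[OF oky] show False by simp
  qed
  define G' where "G' = G(p := comb x)"
  define c' where "c' = c(p := x)"
  have "\<forall>j<Suc p. G' j \<noteq> 0 \<and> G' j = (\<Sum>l<K. Const (c' j l) * F l) \<and> (\<forall>l\<ge>Suc p. c' j l = 0)"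
    using G(1,2,3) x(1) ok_ne[OF x(1)] by (auto simp: G'_def c'_def less_Suc_eq comb_def ok_def)
  moreover have "inj_on (\<lambda>j. lmon (G' j)) {..<Suc p}"
  proof (rule inj_onI)
    fix i j assume ij: "i \<in> {..<Suc p}" "j \<in> {..<Suc p}" "lmon (G' i) = lmon (G' j)"
    consider "i = p" "j = p" | "i = p" "j < p" | "i < p" "j = p" | "i < p" "j < p" using ij by force
    then show "i = j"
    proof cases
      case 4
      then show ?thesis using ij(3) Ginj by (auto simp: G'_def inj_on_def)
    qed (use ij(3) new[of j] new[of i] in \<open>auto simp: G'_def\<close>)
  qed
  ultimately show ?case by blast
qed auto

text \<open>A determinant is linear in each row and every \<open>g i\<close> is a combination of
  functions \<open>mbin _ a\<close>, so it stays nonzero for at least one of the summands. The rows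
  are exchanged one after another.\<close>

lemma wronskian_rows:
  assumes "\<And>i. i < K ==> bspan S q (g i)" "dt K (\<lambda>i j. thet (g i) (G j)) \<noteq> 0"
  shows "p \<le> K ==> \<exists>a. (\<forall>i<p. supp (a i) \<subseteq> S \<and> tdeg (a i) \<le> q) \<and>
    dt K (\<lambda>i j. thet (if i < p then (\<lambda>k. mbin k (a i)) else g i) (G j)) \<noteq> 0"
proof (induction p)
  case 0
  then show ?case using assms(2) by auto
next
  case (Suc p)
  then obtain a where a: "\<And>i. i < p ==> supp (a i) \<subseteq> S \<and> tdeg (a i) \<le> q"
    "dt K (\<lambda>i j. thet (if i < p then (\<lambda>k. mbin k (a i)) else g i) (G j)) \<noteq> 0" by auto
  define E where "E i j = thet (if i < p then (\<lambda>k. mbin k (a i)) else g i) (G j)" for i j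
  have step: "\<exists>b. supp b \<subseteq> S \<and> tdeg b \<le> q \<and>
      dt K (\<lambda>i j. if i = p then thet (\<lambda>k. mbin k b) (G j) else E i j) \<noteq> 0"
    if "bspan S q h" "dt K (\<lambda>i j. if i = p then thet h (G j) else E i j) \<noteq> 0" for h
    using that
  proof (induction rule: bspan.induct)
    case zero
    have "dt K (\<lambda>i j. if i = p then 0 else E i j) = 0"
    proof -
      have "(\<Prod>i<K. if i = p then 0 else E i (x i)) = 0" for x
        by (rule prod_zero) (use Suc.prems in \<open>auto intro!: bexI[of _ p]\<close>)
      then show ?thesis by (simp add: dt_eq)
    qed
    with zero show ?case by (simp add: thet_zero cong: if_cong)
  next
    case (add h b c)
    have "dt K (\<lambda>i j. if i = p then thet h (G j) + Const c * thet (\<lambda>k. mbin k b) (G j) else E i j) \<noteq> 0"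
      using add.prems by (simp only: thet_add not_False_eq_True)
    then have "dt K (\<lambda>i j. if i = p then thet h (G j) else E i j) \<noteq> 0 \<or>
        dt K (\<lambda>i j. if i = p then thet (\<lambda>k. mbin k b) (G j) else E i j) \<noteq> 0"
      using Suc.prems by (subst (asm) dt_row_linear) auto
    then show ?case using add by blast
  qed
  have "bspan S q (g p)" using assms(1) Suc.prems by simp
  moreover have "dt K (\<lambda>i j. if i = p then thet (g p) (G j) else E i j) \<noteq> 0"
  proof -
    have "(\<lambda>i j. if i = p then thet (g p) (G j) else E i j) = E"
      by (auto simp: E_def fun_eq_iff)
    then show ?thesis using a(2) by (simp add: E_def[abs_def])
  qed
  ultimately obtain b where b: "supp b \<subseteq> S" "tdeg b \<le> q"
    "dt K (\<lambda>i j. if i = p then thet (\<lambda>k. mbin k b) (G j) else E i j) \<noteq> 0" using step by blast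
  have "(\<lambda>i j. if i = p then thet (\<lambda>k. mbin k b) (G j) else E i j) =
      (\<lambda>i j. thet (if i < Suc p then (\<lambda>k. mbin k ((a(p := b)) i)) else g i) (G j))"
    by (auto simp: E_def fun_eq_iff)
  with b a(1) show ?case by (intro exI[of _ "a(p := b)"]) (auto simp: less_Suc_eq)
qed

text \<open>After elimination the leading exponents are distinct, and interpolation provides
  diagonal operators of order at most K - 1 dual to them. Their determinant has the product of the
  leading coefficients as its coefficient at the sum of the leading exponents. The return to Hasse
  derivatives uses \<open>wronskian_rows\<close>, a monomial factor in each row and the matrix of
  the elimination.\<close>

theorem generalised_wronskian:
  fixes F :: "nat => nat mp"
  assumes ind: "lin_indep K F" and vars: "\<And>j. j < K ==> in_vars S (F j)"
  shows "\<exists>a. (\<forall>i<K. supp (a i) \<subseteq> S \<and> tdeg (a i) \<le> K - 1) \<and> dt K (\<lambda>i j. hasse (a i) (F j)) \<noteq> 0"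
proof -
  obtain G c where G: "\<And>j. j < K ==> G j \<noteq> 0" "\<And>j. j < K ==> G j = (\<Sum>l<K. Const (c j l) * F l)"
    "inj_on (\<lambda>j. lmon (G j)) {..<K}"
    using echelon[OF ind order_refl] by (elim exE conjE) blast
  define \<kappa> where "\<kappa> j = lmon (G j)" for j
  have \<kappa>G: "\<kappa> j \<in> supp (G j)" "\<And>k. k \<in> supp (G j) ==> k \<le> \<kappa> j" if "j < K" for j
    using lmon_in[OF G(1)[OF that]] by (auto simp: \<kappa>_def)
  have "in_vars S (G j)" if "j < K" for j
    unfolding G(2)[OF that] by (intro in_vars_sum in_vars_mult in_vars_Const vars) auto
  then have \<kappa>S: "supp (\<kappa> j) \<subseteq> S" if "j < K" for j
    using \<kappa>G(1)[OF that] that by (auto simp: in_vars_def)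
  have "\<exists>g. bspan S (K - 1) g \<and> g (\<kappa> i) = 1 \<and> (\<forall>j\<in>{..<K} - {i}. g (\<kappa> j) = 0)" if "i < K" for i
  proof -
    have "\<exists>g. bspan S (card ({..<K} - {i})) g \<and> g (\<kappa> i) = 1 \<and> (\<forall>j\<in>{..<K} - {i}. g (\<kappa> j) = 0)"
      using G(3) that \<kappa>S by (intro lagrange_bspan) (auto simp: \<kappa>_def inj_on_def)
    then show ?thesis using that by simp
  qed
  then have "\<forall>i. \<exists>g. i < K \<longrightarrow> bspan S (K - 1) g \<and> g (\<kappa> i) = 1 \<and> (\<forall>j\<in>{..<K} - {i}. g (\<kappa> j) = 0)"
    by blast
  from choice[OF this] obtain g where
    gg: "\<forall>i. i < K \<longrightarrow> bspan S (K - 1) (g i) \<and> g i (\<kappa> i) = 1 \<and> (\<forall>j\<in>{..<K} - {i}. g i (\<kappa> j) = 0)" ..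
  have g: "\<And>i. i < K ==> bspan S (K - 1) (g i)" "\<And>i. i < K ==> g i (\<kappa> i) = 1"
    "\<And>i j. i < K ==> j < K ==> j \<noteq> i ==> g i (\<kappa> j) = 0"
    using gg by blast+
  have "coef (dt K (\<lambda>i j. thet (g i) (G j))) (\<Sum>j<K. \<kappa> j) = (\<Prod>j<K. coef (G j) (\<kappa> j))"
  proof -
    \<comment> \<open>Only the identity permutation contributes, since \<open>g i\<close> vanishes
      at all leading exponents except the i-th.\<close>
    have tm: "coef (\<Prod>i<K. thet (g i) (G (p i))) (\<Sum>j<K. \<kappa> j) = (if p = id then (\<Prod>j<K. coef (G j) (\<kappa> j)) else 0)"
      if p: "p permutes {0..<K}" for p
    proof -
      have pK: "p i < K" if "i < K" for i using p that permutes_in_image[of p "{0..<K}" i] by auto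
      have "(\<Sum>j<K. \<kappa> j) = (\<Sum>i<K. \<kappa> (p i))"
        using sum.permute[OF p, of \<kappa>] by (simp add: o_def atLeast0LessThan)
      then have "coef (\<Prod>i<K. thet (g i) (G (p i))) (\<Sum>j<K. \<kappa> j) = (\<Prod>i<K. coef (thet (g i) (G (p i))) (\<kappa> (p i)))"
        using coef_lead_prod[of "{..<K}" "\<lambda>i. thet (g i) (G (p i))" "\<lambda>i. \<kappa> (p i)"] \<kappa>G(2)[OF pK]
        by (auto simp: in_keys_iff coef_thet)
      also have "... = (\<Prod>i<K. g i (\<kappa> (p i)) * coef (G (p i)) (\<kappa> (p i)))" by (simp add: coef_thet)
      also have "... = (if p = id then (\<Prod>j<K. coef (G j) (\<kappa> j)) else 0)"
      proof (cases "p = id")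
        case False
        then obtain i where i: "p i \<noteq> i" by (auto simp: fun_eq_iff)
        then have "i < K" using p by (metis atLeastLessThan_iff le0 permutes_not_in)
        then have "g i (\<kappa> (p i)) = 0" using g(3) pK i by auto
        then show ?thesis using False \<open>i < K\<close> by (auto intro!: prod_zero bexI[of _ i])
      qed (use g in auto)
      finally show ?thesis .
    qed
    have "coef (dt K (\<lambda>i j. thet (g i) (G j))) (\<Sum>j<K. \<kappa> j) =
        (\<Sum>p | p permutes {0..<K}. signof p * coef (\<Prod>i<K. thet (g i) (G (p i))) (\<Sum>j<K. \<kappa> j))"
    proof -
      have "coef (signof p * f) k = signof p * coef f k" for p and f :: "nat mp" and k
        by (cases "sign p = 1") (auto simp: sign_def)
      then show ?thesis by (simp add: dt_eq lookup_sum)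
    qed
    also have "... = (\<Sum>p | p permutes {0..<K}. if p = id then (\<Prod>j<K. coef (G j) (\<kappa> j)) else 0)"
      by (intro sum.cong refl) (auto simp: tm)
    also have "... = (\<Prod>j<K. coef (G j) (\<kappa> j))"
      by (simp add: finite_permutations permutes_id)
    finally show ?thesis .
  qed
  moreover have "(\<Prod>j<K. coef (G j) (\<kappa> j)) \<noteq> 0" using \<kappa>G(1) by (auto simp: in_keys_iff)
  ultimately have "dt K (\<lambda>i j. thet (g i) (G j)) \<noteq> 0" by (metis lookup_zero)
  from wronskian_rows[OF g(1) this order_refl] obtain a where
    a: "\<And>i. i < K ==> supp (a i) \<subseteq> S \<and> tdeg (a i) \<le> K - 1"
    "dt K (\<lambda>i j. thet (if i < K then (\<lambda>k. mbin k (a i)) else g i) (G j)) \<noteq> 0" by auto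
  have "dt K (\<lambda>i j. thet (if i < K then (\<lambda>k. mbin k (a i)) else g i) (G j)) =
      dt K (\<lambda>i j. mono1 (a i) 1 * hasse (a i) (G j))"
    by (rule dt_cong) (simp add: mono1_hasse)
  also have "... = (\<Prod>i<K. mono1 (a i) 1) * dt K (\<lambda>i j. hasse (a i) (G j))"
    by (rule dt_rows_mult)
  also have "dt K (\<lambda>i j. hasse (a i) (G j)) = dt K (\<lambda>i j. \<Sum>l<K. hasse (a i) (F l) * Const (c j l))"
    by (rule dt_cong) (simp add: G(2) hasse_sum hasse_Const_mult, simp add: mult.commute)
  also have "... = dt K (\<lambda>i j. hasse (a i) (F j)) * dt K (\<lambda>l j. Const (c j l))"
    by (rule dt_mult)
  finally have "dt K (\<lambda>i j. hasse (a i) (F j)) \<noteq> 0" using a(2) by auto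
  with a(1) show ?thesis by blast
qed

section \<open>Roth's lemma\<close>

lemma of_int_eq_Const: "(of_int z :: 'v mp) = Const (of_int z)"
  by (simp add: Const_def)

lemma subst_dt: "subst \<phi> (dt K E) = dt K (\<lambda>i j. subst \<phi> (E i j))"
  by (simp add: dt_eq subst_sum subst_mult subst_prod of_int_eq_Const)

lemma dt_transpose: "dt K (\<lambda>i j. E j i) = dt K E"
proof -
  have "transpose_mat (mat K K (\<lambda>(i, j). E i j)) = mat K K (\<lambda>(i, j). E j i)"
    by (rule eq_matI) auto
  then show ?thesis using det_transpose[of "mat K K (\<lambda>(i, j). E i j)" K] by simp
qed

lemma intc_dt:
  assumes "\<And>i j. i < K ==> j < K ==> intc (E i j)"
  shows "intc (dt K E)"
  unfolding dt_eq of_int_eq_Const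
proof (intro intc_sum intc_mult intc_Const intc_prod assms)
  fix p i assume "p \<in> {p. p permutes {0..<K}}" "i \<in> {..<K}"
  then show "p i < K" using permutes_in_image[of p "{0..<K}" i] by auto
qed auto

lemma in_vars_dt:
  assumes "\<And>i j. i < K ==> j < K ==> in_vars S (E i j)"
  shows "in_vars S (dt K E)"
  unfolding dt_eq of_int_eq_Const
proof (intro in_vars_sum in_vars_mult in_vars_Const in_vars_prod assms)
  fix p i assume "p \<in> {p. p permutes {0..<K}}" "i \<in> {..<K}"
  then show "p i < K" using permutes_in_image[of p "{0..<K}" i] by auto
qed auto

lemma l1norm_dt:
  fixes E :: "nat => nat => 'v mp"
  assumes "\<And>i j. i < K ==> j < K ==> l1norm (E i j) \<le> B"
  shows "l1norm (dt K E) \<le> fact K * B ^ K"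
proof -
  have "l1norm (of_int (sign p) * (\<Prod>i<K. E i (p i))) \<le> B ^ K" if p: "p permutes {0..<K}" for p
  proof -
    have pK: "p i < K" if "i < K" for i using p that permutes_in_image[of p "{0..<K}" i] by auto
    have "l1norm (of_int (sign p) * (\<Prod>i<K. E i (p i))) \<le> l1norm (of_int (sign p) :: 'v mp) * l1norm (\<Prod>i<K. E i (p i))"
      by (rule wnorm_mult) simp
    also have "... = l1norm (\<Prod>i<K. E i (p i))"
      by (simp add: of_int_eq_Const wnorm_Const sign_def)
    also have "... \<le> (\<Prod>i<K. l1norm (E i (p i)))" by (rule wnorm_prod) simp
    also have "... \<le> (\<Prod>i<K. B)" by (intro prod_mono) (auto intro!: wnorm_nonneg assms pK)
    finally show ?thesis by simp
  qed
  then have "(\<Sum>p | p permutes {0..<K}. l1norm (of_int (sign p) * (\<Prod>i<K. E i (p i)))) \<le> of_nat (card {p. p permutes {0..<K}}) * B ^ K"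
    by (intro sum_bounded_above) auto
  also have "card {p. p permutes {0..<K}} = fact K"
    using card_permutations[of "{0..<K}" K] by simp
  finally show ?thesis
    unfolding dt_eq using wnorm_sum[of "\<lambda>_. 1" "\<lambda>p. of_int (sign p) * (\<Prod>i<K. E i (p i))" "{p. p permutes {0..<K}}"]
    by (simp add: fact_nonzero)
qed

text \<open>For additive \<open>h\<close> these conditions multiply like degrees. An exponent as
  \<open>h\<close> gives a degree bound, the negative of an index gives a lower bound for the
  index.\<close>

definition supp_le :: "(('v \<Rightarrow>\<^sub>0 nat) => real) => real => 'v mp => bool" where
  "supp_le h c f \<longleftrightarrow> (\<forall>k\<in>supp f. h k \<le> c)"

lemma supp_le_sum: "(\<And>i. i \<in> A ==> supp_le h c (g i)) ==> supp_le h c (sum g A)"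
proof (induction A rule: infinite_finite_induct)
  case (insert x F)
  then show ?case using keys_add[of "g x" "sum g F"] by (fastforce simp: supp_le_def)
qed (auto simp: supp_le_def)

lemma supp_le_mult:
  assumes "\<And>k l. h (k + l) = h k + h l" "supp_le h c f" "supp_le h d g"
  shows "supp_le h (c + d) (f * g)"
  unfolding supp_le_def
proof
  fix k assume "k \<in> supp (f * g)"
  then obtain a b where "k = a + b" "a \<in> supp f" "b \<in> supp g" using keys_mult[of f g] by blast
  then show "h k \<le> c + d" using assms by (auto simp: supp_le_def intro: add_mono)
qed

lemma supp_le_prod:
  assumes h: "\<And>k l. h (k + l) = h k + h l" and "\<And>i. i \<in> A ==> supp_le h (c i) (g i)"
  shows "supp_le h (\<Sum>i\<in>A. c i) (\<Prod>i\<in>A. g i)"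
proof -
  have h0: "h 0 = 0" using h[of 0 0] by simp
  show ?thesis using assms(2)
  proof (induction A rule: infinite_finite_induct)
    case (insert x F)
    then show ?case using supp_le_mult[OF h, of "c x" "g x" "sum c F" "prod g F"] by simp
  qed (auto simp: supp_le_def h0)
qed

text \<open>Each permutation takes one entry from every column, so bounds that depend only on the
  column add up.\<close>

lemma supp_le_dt:
  assumes h: "\<And>k l. h (k + l) = h k + h l" and "\<And>i j. i < K ==> j < K ==> supp_le h (c j) (E i j)"
  shows "supp_le h (\<Sum>j<K. c j) (dt K E)"
  unfolding dt_eq
proof (intro supp_le_sum)
  fix p assume p: "p \<in> {p. p permutes {0..<K}}"
  then have pK: "p i < K" if "i < K" for i using that permutes_in_image[of p "{0..<K}" i] by auto
  have h0: "h 0 = 0" using h[of 0 0] by simp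
  have "supp_le h (\<Sum>i<K. c (p i)) (\<Prod>i<K. E i (p i))"
    by (rule supp_le_prod[OF h]) (auto intro: assms pK)
  moreover have "(\<Sum>i<K. c (p i)) = (\<Sum>j<K. c j)"
    using p sum.permute[of p "{0..<K}" c] by (simp add: o_def atLeast0LessThan)
  moreover have "supp_le h 0 (of_int (sign p))"
    unfolding supp_le_def of_int_eq_Const Const_def
    by (auto simp del: single_of_int simp: h0 split: if_splits)
  ultimately show "supp_le h (\<Sum>j<K. c j) (of_int (sign p) * (\<Prod>i<K. E i (p i)))"
    using supp_le_mult[OF h, of 0 "of_int (sign p)" "\<Sum>j<K. c j" "\<Prod>i<K. E i (p i)"] by simp
qed

lemma coef_separated:
  assumes "in_vars S f" "in_vars S' g" "S \<inter> S' = {}" "supp k \<subseteq> S" "supp l \<subseteq> S'"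
  shows "coef (f * g) (k + l) = coef f k * coef g l"
proof -
  have *: "k' + l' = k + l \<longleftrightarrow> k' = k \<and> l' = l" if "k' \<in> supp f" "l' \<in> supp g" for k' l'
  proof
    assume e: "k' + l' = k + l"
    have s: "supp k' \<subseteq> S" "supp l' \<subseteq> S'" using that assms by (auto simp: in_vars_def)
    have e': "coef k' v + coef l' v = coef k v + coef l v" for v
      using e by (metis lookup_add)
    have "coef k' v = coef k v \<and> coef l' v = coef l v" for v
    proof (cases "v \<in> S")
      case True
      then have "coef l' v = 0" "coef l v = 0" using s assms(3,5) by (auto simp: in_keys_iff)
      then show ?thesis using e'[of v] by simp
    next
      case False
      then have "coef k' v = 0" "coef k v = 0" using s assms(4) by (auto simp: in_keys_iff)
      then show ?thesis using e'[of v] by simp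
    qed
    then show "k' = k \<and> l' = l" by (auto intro: poly_mapping_eqI)
  qed auto
  have "f * g = (\<Sum>k\<in>supp f. mono1 k (coef f k)) * (\<Sum>l\<in>supp g. mono1 l (coef g l))"
    by (simp flip: mp_expand)
  also have "... = (\<Sum>k\<in>supp f. \<Sum>l\<in>supp g. mono1 (k + l) (coef f k * coef g l))"
    by (simp add: sum_product mult_single)
  finally have "coef (f * g) (k + l) = (\<Sum>k'\<in>supp f. \<Sum>l'\<in>supp g. if k' = k \<and> l' = l then coef f k' * coef g l' else 0)"
    by (simp add: lookup_sum coef_mono1 * cong: sum.cong)
  also have "... = (\<Sum>k'\<in>supp f. if k' = k then coef f k' * coef g l else 0)"
    by (intro sum.cong refl) (auto simp: in_keys_iff)
  also have "... = coef f k * coef g l"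
    by (auto simp: in_keys_iff)
  finally show ?thesis .
qed

lemma shift_inverse: "shift (\<lambda>v. - \<beta> v) (shift \<beta> f) = f"
proof -
  have "Var v + Const (- \<beta> v) + Const (\<beta> v) = Var v" for v
    by (simp add: add.assoc flip: Const_add)
  then show ?thesis by (simp only: shift_def subst_subst subst_add subst_Var subst_Const subst_Var_id)
qed

lemma shift_nonzero: "f \<noteq> 0 ==> shift \<beta> f \<noteq> 0"
  using shift_inverse[of \<beta> f] by (auto simp: shift_def)

lemma in_vars_shift:
  assumes "in_vars S f"
  shows "in_vars S (shift \<beta> f)"
  unfolding shift_def
  by (intro in_vars_subst in_vars_add in_vars_Var in_vars_Const) (use assms in \<open>auto simp: in_vars_def\<close>)

subsection \<open>One variable\<close>

lemma linear_factor_pseudo_division: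
  "\<exists>n r c. smult (b ^ n) q = [:-a, b:] * r + [:c:]" for q :: "int poly"
proof (induction q)
  case 0
  show ?case by (intro exI[of _ 0]) auto
next
  case (pCons x p)
  then obtain n r c where e: "smult (b ^ n) p = [:-a, b:] * r + [:c:]" by blast
  have "smult (b ^ Suc n) (pCons x p) = [:b ^ Suc n * x:] + [:0, b:] * smult (b ^ n) p"
    by (simp add: mult.commute)
  also have "... = [:-a, b:] * ([:0, b:] * r + [:c:]) + [:a * c + b ^ Suc n * x:]"
    unfolding e by (simp add: algebra_simps)
  finally show ?case by blast
qed

abbreviation rpoly :: "int poly => real poly" where "rpoly \<equiv> map_poly ri"

lemma rpoly_mult: "rpoly (p * q) = rpoly p * rpoly q"
  by (rule poly_eqI) (simp add: coeff_map_poly coeff_mult)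

lemma rpoly_add: "rpoly (p + q) = rpoly p + rpoly q"
  by (rule poly_eqI) (simp add: coeff_map_poly)

lemma rpoly_smult: "rpoly (smult c q) = smult (ri c) (rpoly q)"
  by (rule poly_eqI) (simp add: coeff_map_poly)

text \<open>Gauss's lemma: \<open>[:-a, b:]\<close> is primitive, so a comparison of contents
  removes the power of \<open>b\<close> that pseudo division introduces.\<close>

lemma linear_factor_dvd:
  fixes q :: "int poly"
  assumes "coprime a b" "b > 0" "poly (rpoly q) (ri a / ri b) = 0"
  shows "[:-a, b:] dvd q"
proof -
  obtain n r c where e: "smult (b ^ n) q = [:-a, b:] * r + [:c:]"
    using linear_factor_pseudo_division by blast
  have "poly (rpoly (smult (b ^ n) q)) (ri a / ri b) = 0"
    using assms(3) by (simp add: rpoly_smult)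
  then have "c = 0" unfolding e rpoly_mult rpoly_add using assms(2)
    by (simp add: map_poly_pCons)
  then have e: "smult (b ^ n) q = [:-a, b:] * r" using e by simp
  have "content [:-a, b:] = 1" using assms(1,2) by (simp add: content_def coprime_iff_gcd_eq_1)
  then have "content (smult (b ^ n) q) = content r" unfolding e content_mult by simp
  then have "content r = b ^ n * content q" using assms(2) by simp
  define r' where "r' = smult (content q) (primitive_part r)"
  have "r = smult (content r) (primitive_part r)" by simp
  also have "... = smult (b ^ n) r'" unfolding \<open>content r = b ^ n * content q\<close> r'_def by simp
  finally have "r = smult (b ^ n) r'" .
  then have "smult (b ^ n) q = smult (b ^ n) ([:-a, b:] * r')" using e by (simp only: mult_smult_right)
  then have "q = [:-a, b:] * r'" by (rule smult_cancel[rotated]) (use assms(2) in simp)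
  then show ?thesis by (metis dvd_triv_left)
qed

text \<open>Every factor \<open>[:-a, b:]\<close> that splits off over the integers contributes a
  factor \<open>b\<close> to the leading coefficient.\<close>

lemma multiplicity_lead_coeff:
  fixes q :: "int poly"
  assumes "coprime a b" "b > 0" "[:- (ri a / ri b), 1:] ^ v dvd rpoly q"
  shows "b ^ v dvd lead_coeff q"
  using assms(3)
proof (induction v arbitrary: q)
  case (Suc v)
  let ?\<beta> = "ri a / ri b"
  have "[:- ?\<beta>, 1:] dvd rpoly q"
    using Suc.prems by (metis dvd_mult_left power_Suc)
  then have "poly (rpoly q) ?\<beta> = 0" by (simp add: poly_eq_0_iff_dvd)
  then obtain q' where q': "q = [:-a, b:] * q'" using linear_factor_dvd[OF assms(1,2)] by blast
  have "rpoly q = [:- ri a, ri b:] * (rpoly q')"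
    unfolding q' rpoly_mult by (simp add: map_poly_pCons)
  also have "[:- ri a, ri b:] = smult (ri b) [:- ?\<beta>, 1:]"
    using assms(2) by simp
  finally have eqq: "rpoly q = [:- ?\<beta>, 1:] * smult (ri b) (rpoly q')"
    by (simp only: mult_smult_left mult_smult_right)
  have "[:- ?\<beta>, 1:] * [:- ?\<beta>, 1:] ^ v dvd [:- ?\<beta>, 1:] * smult (ri b) (rpoly q')"
    using Suc.prems unfolding eqq power_Suc .
  then have "[:- ?\<beta>, 1:] ^ v dvd smult (ri b) (rpoly q')"
    by (subst (asm) dvd_mult_cancel_left) auto
  then have "[:- ?\<beta>, 1:] ^ v dvd (rpoly q')"
    using assms(2) by (simp add: dvd_smult_iff)
  from Suc.IH[OF this] have "b ^ v dvd lead_coeff q'" .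
  moreover have "lead_coeff q = b * lead_coeff q'"
    unfolding q' using assms(2) by (simp only: lead_coeff_mult) simp
  ultimately show ?case by simp
qed simp

text \<open>The passage to univariate polynomials: a ring homomorphism that puts 1 for all variables
  other than \<open>m\<close>.\<close>

definition upoly :: "'v => 'v mp => real poly" where
  "upoly m f = (\<Sum>k\<in>supp f. monom (coef f k) (coef k m))"

lemma upoly_add: "upoly m (f + g) = upoly m f + upoly m g"
proof -
  have *: "upoly m f = (\<Sum>k\<in>A. monom (coef f k) (coef k m))" if "finite A" "supp f \<subseteq> A" for A f
    unfolding upoly_def using that by (intro sum.mono_neutral_left) (auto simp: in_keys_iff)
  have "supp (f + g) \<subseteq> supp f \<union> supp g" by (rule keys_add)
  then show ?thesis
    by (subst (1 2 3) *[where A = "supp f \<union> supp g"]) (auto simp: lookup_add sum.distrib simp flip: add_monom)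
qed

lemma upoly_mono1: "upoly m (mono1 k c) = monom c (coef k m)"
  by (cases "c = 0") (simp_all add: upoly_def)

lemma upoly_mult: "upoly m (f * g) = upoly m f * upoly m g"
proof (induction f rule: mp_induct)
  case (mono k c)
  show ?case
  proof (induction g rule: mp_induct)
    case (mono l d)
    then show ?case by (simp add: mult_single upoly_mono1 mult_monom lookup_add)
  next
    case (add f g)
    then show ?case by (simp add: algebra_simps upoly_add)
  qed
next
  case (add f g)
  then show ?case by (simp add: algebra_simps upoly_add)
qed

lemma upoly_Const: "upoly m (Const c) = [:c:]"
  by (simp add: Const_def upoly_mono1 monom_0)

lemma upoly_power: "upoly m (f ^ n) = upoly m f ^ n"
  by (induction n) (simp_all add: upoly_mult upoly_Const flip: Const_1)

lemma upoly_sum: "upoly m (sum g A) = (\<Sum>i\<in>A. upoly m (g i))"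
  by (induction A rule: infinite_finite_induct) (simp_all add: upoly_add, simp_all add: upoly_def)

lemma supp_singleton: "supp k \<subseteq> {m} ==> k = mono1 m (coef k m)"
  by (rule poly_mapping_eqI) (auto simp: coef_mono1 in_keys_iff subset_iff)

lemma pcompose_power: "pcompose (p ^ n) q = pcompose p q ^ n" for p :: "'a::comm_semiring_1 poly"
proof (induction n)
  case 0
  then show ?case using pcompose_const[of 1 q] by (simp add: one_pCons)
qed (simp add: pcompose_mult)

lemma upoly_shift:
  assumes "in_vars {m} f"
  shows "upoly m (shift \<beta> f) = pcompose (upoly m f) [:\<beta> m, 1:]"
proof -
  have "upoly m (mpow (\<lambda>v. Var v + Const (\<beta> v)) k) = [:\<beta> m, 1:] ^ coef k m" if "k \<in> supp f" for k
  proof -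
    have "k = mono1 m (coef k m)" using assms that by (intro supp_singleton) (auto simp: in_vars_def)
    then have "mpow (\<lambda>v. Var v + Const (\<beta> v)) k = (Var m + Const (\<beta> m)) ^ coef k m"
      by (metis mpow_mono1)
    then show ?thesis
      by (simp add: upoly_power upoly_add upoly_Const) (simp add: Var_def upoly_mono1 monom_Suc monom_0 one_pCons)
  qed
  then have "upoly m (shift \<beta> f) = (\<Sum>k\<in>supp f. [:coef f k:] * [:\<beta> m, 1:] ^ coef k m)"
    by (simp add: shift_def subst_def upoly_sum upoly_mult upoly_Const)
  also have "... = (\<Sum>k\<in>supp f. pcompose (monom (coef f k) (coef k m)) [:\<beta> m, 1:])"
    by (intro sum.cong refl) (simp add: monom_altdef pcompose_smult pcompose_power pcompose_pCons)
  also have "... = pcompose (upoly m f) [:\<beta> m, 1:]"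
    by (simp add: upoly_def pcompose_sum)
  finally show ?thesis .
qed

text \<open>Roth's lemma in one variable: a zero of order \<open>v\<close> at a / b makes b^v a
  divisor of the leading coefficient, which cannot exceed the norm.\<close>

lemma multiplicity_bound:
  fixes f :: "'v mp"
  assumes f: "in_vars {m} f" "intc f" "f \<noteq> 0" and ab: "coprime a b" "b > 0" "\<beta> m = ri a / ri b"
    and v: "\<And>k. k \<in> supp (shift \<beta> f) ==> v \<le> coef k m"
  shows "ri b ^ v \<le> l1norm f"
proof -
  have cf: "coeff (upoly m f) i = coef f (mono1 m i)" for i
  proof -
    have "coef k m = i \<longleftrightarrow> k = mono1 m i" if "k \<in> supp f" for k
      using f(1) that supp_singleton[of k m] by (auto simp: in_vars_def)
    then have "coeff (upoly m f) i = (\<Sum>k\<in>supp f. if k = mono1 m i then coef f k else 0)"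
      by (auto simp: upoly_def coeff_sum intro!: sum.cong)
    then show ?thesis by (auto simp: in_keys_iff)
  qed
  define q where "q = map_poly (\<lambda>x. \<lfloor>x\<rfloor>) (upoly m f)"
  have q: "rpoly q = upoly m f"
    using f(2) by (intro poly_eqI) (auto simp: q_def coeff_map_poly cf intc_def elim: Ints_cases)
  obtain k where k: "k \<in> supp f" using f(3) by (metis all_not_in_conv keys_eq_empty)
  then have "k = mono1 m (coef k m)" using f(1) by (intro supp_singleton) (auto simp: in_vars_def)
  then have "coeff (upoly m f) (coef k m) \<noteq> 0" using k cf by (simp add: in_keys_iff)
  then have "q \<noteq> 0" using q by auto
  have "[:0, 1:] ^ v dvd upoly m (shift \<beta> f)"
  proof -
    have "monom 1 v dvd monom (coef (shift \<beta> f) k) (coef k m)" if "k \<in> supp (shift \<beta> f)" for k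
    proof -
      have "monom (coef (shift \<beta> f) k) (coef k m) = monom 1 v * monom (coef (shift \<beta> f) k) (coef k m - v)"
        using v[OF that] by (simp add: mult_monom)
      then show ?thesis by (metis dvd_triv_left)
    qed
    then have "monom 1 v dvd upoly m (shift \<beta> f)" unfolding upoly_def by (intro dvd_sum)
    then show ?thesis by (simp add: monom_altdef)
  qed
  then obtain r where r: "pcompose (upoly m f) [:\<beta> m, 1:] = [:0, 1:] ^ v * r"
    unfolding upoly_shift[OF f(1)] by blast
  have "upoly m f = pcompose (pcompose (upoly m f) [:\<beta> m, 1:]) [:- \<beta> m, 1:]"
    by (simp add: pcompose_pCons flip: pcompose_assoc)
  also have "... = [:- \<beta> m, 1:] ^ v * pcompose r [:- \<beta> m, 1:]"
    unfolding r by (simp add: pcompose_mult pcompose_power pcompose_pCons)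
  finally have "[:- \<beta> m, 1:] ^ v dvd rpoly q" using q by (metis dvd_triv_left)
  then have "b ^ v dvd lead_coeff q" unfolding ab(3) by (rule multiplicity_lead_coeff[OF ab(1,2)])
  then have "b ^ v \<le> \<bar>lead_coeff q\<bar>" using \<open>q \<noteq> 0\<close> by (intro zdvd_imp_le) (auto simp: dvd_abs_iff)
  then have "ri b ^ v \<le> \<bar>ri (lead_coeff q)\<bar>" by (metis of_int_abs of_int_le_iff of_int_power)
  also have "ri (lead_coeff q) = coef f (mono1 m (degree q))"
    using q cf by (metis coeff_map_poly of_int_0)
  also have "\<bar>coef f (mono1 m (degree q))\<bar> \<le> l1norm f"
    using coef_le_wnorm[of "\<lambda>_. 1" f "mono1 m (degree q)"] by simp
  finally show ?thesis .
qed


subsection \<open>Splitting off the last variable\<close>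

definition slice :: "'v => nat => 'v mp => 'v mp" where
  "slice m l f = (\<Sum>k\<in>{k\<in>supp f. coef k m = l}. mono1 (k - mono1 m l) (coef f k))"

lemma key_minus_mono1: "coef k m = l ==> k - mono1 m l + mono1 m l = k" for k :: "'v \<Rightarrow>\<^sub>0 nat"
  using key_split[of k m] by simp

lemma slice_sum:
  assumes "\<And>k. k \<in> supp f ==> coef k m \<le> N"
  shows "f = (\<Sum>l\<le>N. slice m l f * Var m ^ l)"
proof -
  have "slice m l f * Var m ^ l = (\<Sum>k\<in>{k\<in>supp f. coef k m = l}. mono1 k (coef f k))" for l
    unfolding slice_def sum_distrib_right
    by (rule sum.cong) (auto simp: coef_Var_power mult_single key_minus_mono1)
  then have "(\<Sum>l\<le>N. slice m l f * Var m ^ l) = (\<Sum>l\<le>N. \<Sum>k\<in>{k\<in>supp f. coef k m = l}. mono1 k (coef f k))"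
    by simp
  also have "... = (\<Sum>k\<in>supp f. mono1 k (coef f k))"
    by (rule sum.group) (use assms in auto)
  finally show ?thesis using mp_expand[of f] by simp
qed

lemma coef_slice: "coef (slice m l f) k = (if coef k m = 0 then coef f (k + mono1 m l) else 0)"
proof -
  have "coef (slice m l f) k = (\<Sum>k'\<in>{k\<in>supp f. coef k m = l}. if k' - mono1 m l = k then coef f k' else 0)"
    by (simp add: slice_def lookup_sum coef_mono1)
  also have "... = (\<Sum>k'\<in>{k\<in>supp f. coef k m = l}. if k' = k + mono1 m l \<and> coef k m = 0 then coef f k' else 0)"
  proof (intro sum.cong refl)
    fix k' assume k': "k' \<in> {k\<in>supp f. coef k m = l}"
    have "k' - mono1 m l = k \<longleftrightarrow> k' = k + mono1 m l \<and> coef k m = 0"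
    proof
      assume "k' - mono1 m l = k"
      then show "k' = k + mono1 m l \<and> coef k m = 0"
        using k' key_minus_mono1[of k' m l] by (auto simp: lookup_minus)
    qed auto
    then show "(if k' - mono1 m l = k then coef f k' else 0) = (if k' = k + mono1 m l \<and> coef k m = 0 then coef f k' else 0)"
      by simp
  qed
  also have "... = (if coef k m = 0 then coef f (k + mono1 m l) else 0)"
    by (cases "coef k m = 0") (auto simp: in_keys_iff lookup_add)
  finally show ?thesis .
qed

lemma supp_slice: "k \<in> supp (slice m l f) ==> k + mono1 m l \<in> supp f"
  by (auto simp: in_keys_iff coef_slice split: if_splits)

lemma in_vars_slice:
  assumes "in_vars (insert m S) f" "m \<notin> S"
  shows "in_vars S (slice m l f)"
  unfolding in_vars_def
proof
  fix k assume k: "k \<in> supp (slice m l f)"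
  then have "supp (k + mono1 m l) \<subseteq> insert m S" using assms supp_slice[OF k] by (auto simp: in_vars_def)
  moreover have "supp k \<subseteq> supp (k + mono1 m l)" by (auto simp: in_keys_iff lookup_add)
  moreover have "m \<notin> supp k" using k by (auto simp: in_keys_iff coef_slice split: if_splits)
  ultimately show "supp k \<subseteq> S" by blast
qed

lemma intc_slice: "intc f ==> intc (slice m l f)"
  by (auto simp: intc_def coef_slice)

lemma wnorm_slice:
  assumes "\<And>v. \<tau> v \<ge> 1"
  shows "wnorm \<tau> (slice m l f) \<le> wnorm \<tau> f"
proof -
  have t0: "\<tau> v \<ge> 0" for v using assms[of v] by linarith
  have "wnorm \<tau> (slice m l f) \<le> (\<Sum>k\<in>{k\<in>supp f. coef k m = l}. wnorm \<tau> (mono1 (k - mono1 m l) (coef f k)))"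
    unfolding slice_def by (rule wnorm_sum) (rule t0)
  also have "... \<le> (\<Sum>k\<in>{k\<in>supp f. coef k m = l}. \<bar>coef f k\<bar> * mpow \<tau> k)"
  proof (intro sum_mono)
    fix k assume k: "k \<in> {k\<in>supp f. coef k m = l}"
    have "mpow \<tau> (k - mono1 m l) * 1 \<le> mpow \<tau> (k - mono1 m l) * \<tau> m ^ l"
      by (intro mult_left_mono mpow_nonneg t0) (auto intro: one_le_power assms)
    also have "... = mpow \<tau> k"
      using k key_minus_mono1[of k m l] by (metis (mono_tags, lifting) mem_Collect_eq mpow_add mpow_mono1)
    finally show "wnorm \<tau> (mono1 (k - mono1 m l) (coef f k)) \<le> \<bar>coef f k\<bar> * mpow \<tau> k"
      by (simp add: wnorm_mono1 mult_left_mono)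
  qed
  also have "... \<le> wnorm \<tau> f"
    unfolding wnorm_def by (intro sum_mono2) (auto intro!: mult_nonneg_nonneg mpow_nonneg t0)
  finally show ?thesis .
qed

text \<open>A spanning subfamily of least size is independent, and relative to it its own members
  have unit vectors as coefficients. The last fact yields independence of the second factors when a
  polynomial is written as a sum of as few products as possible.\<close>

lemma rank_factorisation:
  fixes P :: "nat => 'v mp"
  assumes "\<exists>l\<le>N. P l \<noteq> 0"
  obtains K ls \<gamma> where "1 \<le> K" "K \<le> N + 1" "\<And>i. i < K ==> ls i \<le> N"
    "\<And>l. l \<le> N ==> P l = (\<Sum>i<K. Const (\<gamma> l i) * P (ls i))"
    "lin_indep K (\<lambda>i. P (ls i))" "\<And>i j. i < K ==> j < K ==> \<gamma> (ls i) j = (if i = j then 1 else 0)"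
proof -
  define ok where "ok A \<longleftrightarrow> A \<subseteq> {..N} \<and> (\<exists>\<gamma>. \<forall>l\<le>N. P l = (\<Sum>i\<in>A. Const (\<gamma> l i) * P i))" for A
  have "ok {..N}"
    unfolding ok_def
  proof (intro conjI exI[of _ "\<lambda>l i. if l = i then 1 else 0"] allI impI)
    fix l assume l: "l \<le> N"
    have "(\<Sum>i\<le>N. Const (if l = i then 1 else 0) * P i) = (\<Sum>i\<le>N. if l = i then P i else 0)"
      by (intro sum.cong) auto
    then show "P l = (\<Sum>i\<le>N. Const (if l = i then 1 else 0) * P i)" using l by simp
  qed simp
  then obtain A where A: "ok A" "\<And>A'. ok A' ==> card A \<le> card A'"
    using arg_min_nat_lemma[of ok "{..N}" card] by blast
  from A(1) obtain \<gamma> where sub: "A \<subseteq> {..N}" and \<gamma>: "\<And>l. l \<le> N ==> P l = (\<Sum>i\<in>A. Const (\<gamma> l i) * P i)"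
    by (auto simp: ok_def)
  have finA: "finite A" using sub finite_subset by blast
  have ind: "x i0 = 0" if "(\<Sum>i\<in>A. Const (x i) * P i) = 0" "i0 \<in> A" for x i0
  proof (rule ccontr)
    assume x0: "x i0 \<noteq> 0"
    have "Const (x i0) * P i0 + (\<Sum>i\<in>A - {i0}. Const (x i) * P i) = 0"
      using that finA by (simp add: sum.remove)
    then have "Const (x i0) * P i0 = - (\<Sum>i\<in>A - {i0}. Const (x i) * P i)"
      by (simp add: eq_neg_iff_add_eq_0)
    then have "Const (1 / x i0) * (Const (x i0) * P i0) = Const (1 / x i0) * (- (\<Sum>i\<in>A - {i0}. Const (x i) * P i))"
      by (simp only:)
    then have P0: "P i0 = (\<Sum>i\<in>A - {i0}. Const (- (x i / x i0)) * P i)"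
    proof -
      have "Const (1 / x i0) * (Const (x i0) * P i0) = P i0"
        using x0 by (simp flip: mult.assoc Const_mult)
      moreover have "Const (1 / x i0) * (- (\<Sum>i\<in>A - {i0}. Const (x i) * P i)) = (\<Sum>i\<in>A - {i0}. Const (- (x i / x i0)) * P i)"
        by (rule poly_mapping_eqI) (simp add: coef_Const_mult lookup_sum sum_distrib_left flip: sum_negf)
      ultimately show ?thesis
        using \<open>Const (1 / x i0) * (Const (x i0) * P i0) = Const (1 / x i0) * (- (\<Sum>i\<in>A - {i0}. Const (x i) * P i))\<close> by simp
    qed
    have "P l = (\<Sum>i\<in>A - {i0}. Const (\<gamma> l i + \<gamma> l i0 * - (x i / x i0)) * P i)" if l: "l \<le> N" for l
    proof -
      have "P l = Const (\<gamma> l i0) * P i0 + (\<Sum>i\<in>A - {i0}. Const (\<gamma> l i) * P i)"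
        using \<gamma>[OF l] \<open>i0 \<in> A\<close> finA by (simp add: sum.remove)
      also have "... = Const (\<gamma> l i0) * (\<Sum>i\<in>A - {i0}. Const (- (x i / x i0)) * P i) + (\<Sum>i\<in>A - {i0}. Const (\<gamma> l i) * P i)"
        by (simp only: flip: P0)
      also have "... = (\<Sum>i\<in>A - {i0}. Const (\<gamma> l i + \<gamma> l i0 * - (x i / x i0)) * P i)"
        by (rule poly_mapping_eqI)
           (simp add: lookup_add lookup_sum coef_Const_mult,
            simp add: sum_distrib_left algebra_simps sum_subtractf sum.distrib sum_negf)
      finally show ?thesis .
    qed
    then have "ok (A - {i0})"
      unfolding ok_def using sub by (intro conjI exI[of _ "\<lambda>l i. \<gamma> l i + \<gamma> l i0 * - (x i / x i0)"]) auto
    from A(2)[OF this] card_Diff1_less[OF finA \<open>i0 \<in> A\<close>] show False by linarith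
  qed
  define K where "K = card A"
  obtain ls where ls: "bij_betw ls {..<K} A"
    using ex_bij_betw_nat_finite[OF finA] by (auto simp: K_def atLeast0LessThan)
  have re: "(\<Sum>i\<in>A. h i) = (\<Sum>i<K. h (ls i))" for h :: "nat => 'v mp"
    using sum.reindex_bij_betw[OF ls, of h] by simp
  have lsA: "ls i \<in> A" if "i < K" for i using ls that by (auto simp: bij_betw_def)
  have ind': "lin_indep K (\<lambda>i. P (ls i))"
    unfolding lin_indep_def
  proof (intro allI impI)
    fix x j assume x: "(\<Sum>j<K. Const (x j) * P (ls j)) = 0" and j: "j < K"
    define y where "y i = x (the_inv_into {..<K} ls i)" for i
    have yx: "y (ls i) = x i" if "i < K" for i
      using ls that by (auto simp: y_def bij_betw_def the_inv_into_f_f)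
    have "(\<Sum>i\<in>A. Const (y i) * P i) = 0"
    proof -
      have "(\<Sum>i<K. Const (y (ls i)) * P (ls i)) = (\<Sum>j<K. Const (x j) * P (ls j))"
        by (rule sum.cong) (simp_all add: yx)
      then show ?thesis unfolding re by (simp add: x)
    qed
    from ind[OF this lsA[OF j]] show "x j = 0" using yx[OF j] by simp
  qed
  show ?thesis
  proof (rule that[of K ls "\<lambda>l i. \<gamma> l (ls i)"])
    show "1 \<le> K"
    proof (rule ccontr)
      assume "\<not> 1 \<le> K"
      then have "card A = 0" by (simp add: K_def)
      then have "A = {}" using finA by simp
      then show False using \<gamma> assms by auto
    qed
    show "K \<le> N + 1" using card_mono[OF _ sub] by (simp add: K_def)
    show "ls i \<le> N" if "i < K" for i using lsA[OF that] sub by auto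
    show "P l = (\<Sum>i<K. Const (\<gamma> l (ls i)) * P (ls i))" if "l \<le> N" for l
      using \<gamma>[OF that] re by simp
    show "\<gamma> (ls i) (ls j) = (if i = j then 1 else 0)" if ij: "i < K" "j < K" for i j
    proof -
      have "P (ls i) = (\<Sum>j<K. Const (\<gamma> (ls i) (ls j)) * P (ls j))"
        using \<gamma>[of "ls i"] lsA[OF ij(1)] sub re by auto
      moreover have "(\<Sum>j<K. Const (if i = j then 1 else 0) * P (ls j)) = P (ls i)"
      proof -
        have "(\<Sum>j<K. Const (if i = j then 1 else 0) * P (ls j)) = (\<Sum>j<K. if i = j then P (ls j) else 0)"
          by (intro sum.cong) auto
        then show ?thesis using ij by simp
      qed
      moreover have "(\<Sum>j<K. Const (\<gamma> (ls i) (ls j) - (if i = j then 1 else 0)) * P (ls j)) =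
          (\<Sum>j<K. Const (\<gamma> (ls i) (ls j)) * P (ls j)) - (\<Sum>j<K. Const (if i = j then 1 else 0) * P (ls j))"
        by (rule poly_mapping_eqI)
           (simp add: lookup_minus lookup_sum coef_Const_mult sum_subtractf left_diff_distrib)
      ultimately have "(\<Sum>j<K. Const (\<gamma> (ls i) (ls j) - (if i = j then 1 else 0)) * P (ls j)) = 0"
        by simp
      from ind'[unfolded lin_indep_def, rule_format, OF this ij(2)] show ?thesis by simp
    qed
  qed (rule ind')
qed

text \<open>If K - 1 is at most \<phi> d / 2, every term is at least \<phi> / 2; otherwise about the
  first \<phi> d / 2 terms are, and K is at most d + 1. In Roth's induction b runs through the
  orders of derivation in the last variable and the term is the index that remains.\<close>

lemma sum_truncated_linear:
  fixes \<phi> d :: real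
  assumes "0 < \<phi>" "\<phi> \<le> 1" "d \<ge> 1" "K \<ge> 1" "real K \<le> d + 1"
  shows "(\<Sum>b<K. max 0 (\<phi> - real b / d)) \<ge> real K * \<phi>\<^sup>2 / 8"
proof (cases "real K - 1 \<le> \<phi> * d / 2")
  case True
  have "\<phi>\<^sup>2 \<le> \<phi>" using assms by (simp add: power2_eq_square mult_left_le)
  have "real K * \<phi>\<^sup>2 / 8 = (\<Sum>b<K. \<phi>\<^sup>2 / 8)" by simp
  also have "... \<le> (\<Sum>b<K. max 0 (\<phi> - real b / d))"
  proof (intro sum_mono)
    fix b assume "b \<in> {..<K}"
    then have "real b \<le> \<phi> * d / 2" using True by auto
    then have "real b / d \<le> \<phi> / 2" using assms by (simp add: field_simps)
    then show "\<phi>\<^sup>2 / 8 \<le> max 0 (\<phi> - real b / d)" using \<open>\<phi>\<^sup>2 \<le> \<phi>\<close> assms by linarith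
  qed
  finally show ?thesis .
next
  case False
  define n where "n = nat \<lfloor>\<phi> * d / 2\<rfloor> + 1"
  have p: "\<phi> * d / 2 > 0" using assms by simp
  have n: "real n \<ge> \<phi> * d / 2" "real n - 1 \<le> \<phi> * d / 2" unfolding n_def using p by linarith+
  have "n \<le> K" using n False by linarith
  have "K \<ge> 2" using False p by linarith
  have "real n * (\<phi> / 2) = (\<Sum>b<n. \<phi> / 2)" by simp
  also have "... \<le> (\<Sum>b<n. max 0 (\<phi> - real b / d))"
  proof (intro sum_mono)
    fix b assume "b \<in> {..<n}"
    then have "real b \<le> \<phi> * d / 2" using n by auto
    then have "real b / d \<le> \<phi> / 2" using assms by (simp add: field_simps)
    then show "\<phi> / 2 \<le> max 0 (\<phi> - real b / d)" by linarith
  qed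
  also have "... \<le> (\<Sum>b<K. max 0 (\<phi> - real b / d))"
    by (intro sum_mono2) (use \<open>n \<le> K\<close> in auto)
  finally have 1: "real n * (\<phi> / 2) \<le> (\<Sum>b<K. max 0 (\<phi> - real b / d))" .
  have "real K * \<phi>\<^sup>2 / 8 \<le> (real K - 1) * \<phi>\<^sup>2 / 4"
  proof -
    have "real K \<le> 2 * (real K - 1)" using \<open>K \<ge> 2\<close> by simp
    then have "real K * \<phi>\<^sup>2 \<le> 2 * (real K - 1) * \<phi>\<^sup>2" by (intro mult_right_mono) auto
    then show ?thesis by (simp add: field_simps)
  qed
  also have "... \<le> d * \<phi>\<^sup>2 / 4" using assms by (intro divide_right_mono mult_right_mono) auto
  also have "... = (\<phi> * d / 2) * (\<phi> / 2)" by (simp add: power2_eq_square)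
  also have "... \<le> real n * (\<phi> / 2)" using n assms by (intro mult_right_mono) auto
  finally show ?thesis using 1 by linarith
qed

section \<open>The induction in Roth's lemma\<close>

definition widx :: "(nat => real) => nat => (nat \<Rightarrow>\<^sub>0 nat) => real" where
  "widx d m k = (\<Sum>j<m. real (coef k j) / d j)"

lemma widx_add: "widx d m (k + l) = widx d m k + widx d m l"
  by (simp add: widx_def lookup_add add_divide_distrib sum.distrib)

text \<open>\<open>E\<close> is the common scale: all d_j ln b_j are at least E, whereas the degrees
  and the logarithm of the norm are at most \<omega> E. The degrees decrease rapidly, so that
  derivatives in earlier variables of order up to the last degree cost almost no index.\<close>

definition roth_data ::
  "real => nat => (nat => real) => (nat => int) => (nat => int) => real => nat mp => bool" where
  "roth_data \<omega> m d a b E f \<longleftrightarrow>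
    (\<forall>j<m. d j \<ge> 1 \<and> b j > 0 \<and> coprime (a j) (b j) \<and> E \<le> d j * ln (ri (b j)) \<and> d j \<le> \<omega> * E) \<and>
    (\<forall>j. Suc j < m \<longrightarrow> d (Suc j) \<le> \<omega> * d j) \<and> E > 0 \<and> f \<noteq> 0 \<and> intc f \<and> in_vars {..<m} f \<and>
    (\<forall>k\<in>supp f. \<forall>j<m. real (coef k j) \<le> d j) \<and> ln (l1norm f) \<le> \<omega> * E"

lemma l1norm_pos:
  assumes "f \<noteq> 0"
  shows "l1norm f > 0"
proof -
  obtain k where k: "k \<in> supp f" using assms by (metis all_not_in_conv keys_eq_empty)
  have "0 < \<bar>coef f k\<bar>" using k by (simp add: in_keys_iff)
  also have "... \<le> l1norm f" using coef_le_wnorm[of "\<lambda>_. 1" f k] by simp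
  finally show ?thesis .
qed

lemma fact_le_exp: "fact K \<le> exp (real K * real K)"
proof -
  have "fact K \<le> real K ^ K" using fact_le_power[of K, where 'a = real] by simp
  also have "... \<le> exp (real K) ^ K"
    using exp_ge_add_one_self[of "real K"] by (intro power_mono) linarith+
  also have "... = exp (real K * real K)" by (simp add: exp_of_nat_mult)
  finally show ?thesis .
qed

text \<open>With f written as a sum of K products of a polynomial in the first m variables and one
  in the last, a generalised Wronskian of f factors as W = U V. If f had index at least \<theta>,
  all entries of W would have large index and W an index of about K \<theta>^2 / 8; the induction
  hypothesis for U and the one-variable bound for V keep it below that.\<close>

lemma roth_step:
  assumes IH: "\<And>d a b E f. roth_data \<omega>' m d a b E f ==>
      \<exists>k\<in>supp (shift (\<lambda>j. ri (a j) / ri (b j)) f). widx d m k < \<theta>\<^sup>2 / 64"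
    and \<theta>: "0 < \<theta>" "\<theta> \<le> 1" and \<omega>: "0 < \<omega>" "5 * \<omega> \<le> \<omega>'" "1000 * \<omega> \<le> \<theta>\<^sup>2"
    and data: "roth_data \<omega> (Suc m) d a b E f"
  shows "\<exists>k\<in>supp (shift (\<lambda>j. ri (a j) / ri (b j)) f). widx d (Suc m) k < \<theta>"
proof (rule ccontr)
  define \<beta> where "\<beta> j = ri (a j) / ri (b j)" for j
  assume "\<not> (\<exists>k\<in>supp (shift (\<lambda>j. ri (a j) / ri (b j)) f). widx d (Suc m) k < \<theta>)"
  then have low: "\<theta> \<le> widx d (Suc m) k" if "k \<in> supp (shift \<beta> f)" for k
    using that by (force simp: \<beta>_def[abs_def] not_less)
  have \<theta>2: "\<theta>\<^sup>2 \<le> \<theta>" using \<theta> by (simp add: power2_eq_square mult_left_le)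
  have \<omega>1: "\<omega> \<le> 1/1000" using \<omega> \<theta> \<theta>2 by linarith
  have d1: "d j \<ge> 1" "b j > 0" "coprime (a j) (b j)" "E \<le> d j * ln (ri (b j))" "d j \<le> \<omega> * E"
    if "j \<le> m" for j using data that by (auto simp: roth_data_def)
  have dS: "d (Suc j) \<le> \<omega> * d j" if "j < m" for j using data that by (auto simp: roth_data_def)
  have E: "E > 0" and f: "f \<noteq> 0" "intc f" "in_vars {..<Suc m} f" and lnf: "ln (l1norm f) \<le> \<omega> * E"
    and degf: "\<And>k j. k \<in> supp f ==> j \<le> m ==> real (coef k j) \<le> d j"
    using data by (auto simp: roth_data_def)
  have dmono: "j < i ==> i \<le> m ==> d i \<le> \<omega> * d j" for i j
  proof (induction i)
    case (Suc i)
    show ?case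
    proof (cases "j = i")
      case True
      then show ?thesis using dS Suc.prems by simp
    next
      case False
      then have IHi: "d i \<le> \<omega> * d j" using Suc by simp
      have "\<omega> * d j \<le> 1 * d j" using \<omega>1 d1(1)[of j] Suc.prems by (intro mult_right_mono) auto
      with IHi have "d i \<le> d j" by simp
      have "d (Suc i) \<le> \<omega> * d i" using dS Suc.prems by simp
      also have "... \<le> \<omega> * d j" using \<open>d i \<le> d j\<close> \<omega>(1) by (intro mult_left_mono) auto
      finally show ?thesis .
    qed
  qed simp
  have sumd: "M \<le> m ==> (\<Sum>j<Suc M. d j) \<le> 2 * d 0 - d M" for M
  proof (induction M)
    case (Suc M)
    have "\<omega> * d M \<le> 1/2 * d M" using \<omega>1 d1(1)[of M] Suc.prems by (intro mult_right_mono) auto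
    then show ?case using Suc dS[of M] by simp
  qed simp
  have sumd': "(\<Sum>j<Suc m. d j) \<le> 2 * \<omega> * E"
    using sumd[of m] d1(1)[of m] d1(5)[of 0] by simp
  \<comment> \<open>A common bound for all Hasse derivatives of f: \<omega> E comes from the norm of
    f and 2 \<omega> E from the powers of 2, because the total degree is at most 2 \<omega>
    E.\<close>
  define B where "B = exp (3 * \<omega> * E)"
  have l1f: "l1norm f \<le> exp (\<omega> * E)" using lnf l1norm_pos[OF f(1)] by (metis exp_le_cancel_iff exp_ln)
  have "mpow (\<lambda>_. 2) k \<le> exp (2 * \<omega> * E)" if k: "k \<in> supp f" for k
  proof -
    have "mpow (\<lambda>_. 2 :: real) k = (\<Prod>j<Suc m. 2 ^ coef k j)"
      using f(3) k by (intro mpow_superset) (auto simp: in_vars_def)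
    also have "... \<le> (\<Prod>j<Suc m. exp (real (coef k j)))"
    proof (intro prod_mono conjI)
      fix j
      have "(2::real) ^ coef k j \<le> exp 1 ^ coef k j" using exp_ge_add_one_self[of 1] by (intro power_mono) auto
      then show "(2::real) ^ coef k j \<le> exp (real (coef k j))" by (simp flip: exp_of_nat_mult)
    qed simp
    also have "... = exp (\<Sum>j<Suc m. real (coef k j))" by (rule exp_sum[symmetric]) simp
    also have "... \<le> exp (\<Sum>j<Suc m. d j)" using degf[OF k] by (simp only: exp_le_cancel_iff) (intro sum_mono, auto)
    also have "... \<le> exp (2 * \<omega> * E)" using sumd' by simp
    finally show ?thesis .
  qed
  then have "wnorm (\<lambda>_. 2) f \<le> (\<Sum>k\<in>supp f. \<bar>coef f k\<bar> * exp (2 * \<omega> * E))"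
    unfolding wnorm_def by (intro sum_mono mult_left_mono) auto
  also have "... = l1norm f * exp (2 * \<omega> * E)" by (simp add: wnorm_def sum_distrib_right)
  also have "... \<le> exp (\<omega> * E) * exp (2 * \<omega> * E)" using l1f by (intro mult_right_mono) auto
  also have "... = B" by (simp add: B_def flip: exp_add)
  finally have nf: "wnorm (\<lambda>_. 2) f \<le> B" .
  define N where "N = nat \<lfloor>d m\<rfloor>"
  have N: "real N \<le> d m" using d1(1)[of m] by (simp add: N_def)
  have "coef k m \<le> N" if "k \<in> supp f" for k using degf[OF that, of m] by (simp add: N_def le_nat_floor)
  then have fsum: "f = (\<Sum>l\<le>N. slice m l f * Var m ^ l)" by (rule slice_sum)
  define P where "P l = slice m l f" for l
  have "\<exists>l\<le>N. P l \<noteq> 0"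
  proof (rule ccontr)
    assume "\<not> (\<exists>l\<le>N. P l \<noteq> 0)"
    then have "(\<Sum>l\<le>N. slice m l f * Var m ^ l) = 0" by (auto simp: P_def)
    with fsum f(1) show False by simp
  qed
  then obtain K ls \<gamma> where K: "1 \<le> K" "K \<le> N + 1" and ls: "\<And>i. i < K ==> ls i \<le> N"
    and \<gamma>: "\<And>l. l \<le> N ==> P l = (\<Sum>i<K. Const (\<gamma> l i) * P (ls i))"
    and indP: "lin_indep K (\<lambda>i. P (ls i))"
    and \<gamma>id: "\<And>i j. i < K ==> j < K ==> \<gamma> (ls i) j = (if i = j then 1 else 0)"
    by (rule rank_factorisation) blast
  define g where "g i = (\<Sum>l\<le>N. Const (\<gamma> l i) * Var m ^ l)" for i
  have fg: "f = (\<Sum>i<K. P (ls i) * g i)"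
  proof -
    have "f = (\<Sum>l\<le>N. P l * Var m ^ l)" using fsum by (simp add: P_def)
    also have "... = (\<Sum>l\<le>N. \<Sum>i<K. P (ls i) * (Const (\<gamma> l i) * Var m ^ l))"
    proof (intro sum.cong refl)
      fix l assume "l \<in> {..N}"
      then have "P l = (\<Sum>i<K. Const (\<gamma> l i) * P (ls i))" using \<gamma> by simp
      then have "P l * Var m ^ l = (\<Sum>i<K. Const (\<gamma> l i) * P (ls i)) * Var m ^ l" by (rule arg_cong)
      also have "... = (\<Sum>i<K. P (ls i) * (Const (\<gamma> l i) * Var m ^ l))"
        unfolding sum_distrib_right by (rule sum.cong) (simp_all only: mult_ac)
      finally show "P l * Var m ^ l = (\<Sum>i<K. P (ls i) * (Const (\<gamma> l i) * Var m ^ l))" .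
    qed
    also have "... = (\<Sum>i<K. P (ls i) * g i)"
      unfolding g_def sum_distrib_left by (rule sum.swap)
    finally show ?thesis .
  qed
  have gvars: "in_vars {m} (g i)" for i
    unfolding g_def by (intro in_vars_sum in_vars_mult in_vars_Const in_vars_power in_vars_Var) auto
  have Pvars: "in_vars {..<m} (P l)" for l
    unfolding P_def using f(3) by (intro in_vars_slice) (auto simp: lessThan_Suc)
  have cg: "coef (g j) (mono1 m l) = \<gamma> l j" if "l \<le> N" for l j
  proof -
    have "(mono1 m i :: nat \<Rightarrow>\<^sub>0 nat) = mono1 m l \<longleftrightarrow> i = l" for i by (metis lookup_single_eq)
    then show ?thesis using that
      by (simp add: g_def lookup_sum coef_Const_mult coef_Var_power coef_mono1 if_distrib cong: if_cong)
  qed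
  have indg: "lin_indep K g"
    unfolding lin_indep_def
  proof (intro allI impI)
    fix x i assume x: "(\<Sum>j<K. Const (x j) * g j) = 0" and i: "i < K"
    have "0 = coef (\<Sum>j<K. Const (x j) * g j) (mono1 m (ls i))" by (simp add: x)
    also have "... = (\<Sum>j<K. x j * (if i = j then 1 else 0))"
      using i ls by (simp add: lookup_sum coef_Const_mult cg \<gamma>id)
    also have "... = x i" using i by (simp add: if_distrib cong: if_cong)
    finally show "x i = 0" by simp
  qed
  obtain A where A: "\<And>i. i < K ==> supp (A i) \<subseteq> {..<m} \<and> tdeg (A i) \<le> K - 1"
    and U0: "dt K (\<lambda>i j. hasse (A i) (P (ls j))) \<noteq> 0"
    using generalised_wronskian[OF indP, of "{..<m}"] Pvars by blast
  obtain Bk where Bk: "\<And>i. i < K ==> supp (Bk i) \<subseteq> {m} \<and> tdeg (Bk i) \<le> K - 1"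
    and V0: "dt K (\<lambda>i j. hasse (Bk i) (g j)) \<noteq> 0"
    using generalised_wronskian[OF indg, of "{m}"] gvars by blast
  define U where "U = dt K (\<lambda>i j. hasse (A i) (P (ls j)))"
  define V where "V = dt K (\<lambda>l j. hasse (Bk j) (g l))"
  define W where "W = dt K (\<lambda>i j. hasse (A i + Bk j) f)"
  have UV: "U \<noteq> 0" "V \<noteq> 0" using U0 V0 dt_transpose[of K "\<lambda>i j. hasse (Bk i) (g j)"] by (auto simp: U_def V_def)
  have W: "W = U * V"
  proof -
    have "W = dt K (\<lambda>i j. \<Sum>l<K. hasse (A i) (P (ls l)) * hasse (Bk j) (g l))"
      unfolding W_def
    proof (rule dt_cong)
      fix i j assume ij: "i < K" "j < K"
      have "hasse (A i + Bk j) f = (\<Sum>l<K. hasse (A i + Bk j) (P (ls l) * g l))"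
        by (subst fg) (simp add: hasse_sum)
      also have "... = (\<Sum>l<K. hasse (A i) (P (ls l)) * hasse (Bk j) (g l))"
        using A[OF ij(1)] Bk[OF ij(2)]
        by (intro sum.cong refl hasse_separated[where S = "{..<m}" and S' = "{m}"] Pvars gvars) auto
      finally show "hasse (A i + Bk j) f = (\<Sum>l<K. hasse (A i) (P (ls l)) * hasse (Bk j) (g l))" .
    qed
    also have "... = U * V" unfolding U_def V_def by (rule dt_mult)
    finally show ?thesis .
  qed
  define bb where "bb i = coef (Bk i) m" for i
  have Bkbb: "Bk i = mono1 m (bb i)" if "i < K" for i
    using supp_singleton[of "Bk i" m] Bk[OF that] by (simp add: bb_def)
  have bbK: "bb i < K" if "i < K" for i
  proof -
    have "tdeg (mono1 m (bb i)) = bb i" using tdeg_add_mono1[of 0 m "bb i"] by (simp add: tdeg_def)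
    moreover have "tdeg (Bk i) \<le> K - 1" using Bk[OF that] by blast
    ultimately have "bb i \<le> K - 1" using Bkbb[OF that] by simp
    then show ?thesis using that by linarith
  qed
  have bbinj: "inj_on bb {..<K}"
  proof (rule inj_onI, rule ccontr)
    fix i j assume ij: "i \<in> {..<K}" "j \<in> {..<K}" "bb i = bb j" "i \<noteq> j"
    then have "Bk i = Bk j" using Bkbb by auto
    then have "row (mat K K (\<lambda>(i, j). hasse (Bk i) (g j))) i = row (mat K K (\<lambda>(i, j). hasse (Bk i) (g j))) j"
      using ij by (intro eq_vecI) auto
    then have "dt K (\<lambda>i j. hasse (Bk i) (g j)) = 0"
      using ij by (intro det_identical_rows[of _ K i j]) auto
    then show False using V0 by simp
  qed
  \<comment> \<open>Equal orders would give equal rows of a nonzero determinant. The orders in the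
    last variable are thus distinct and below K, hence exactly 0, ..., K - 1.\<close>
  have bbim: "bb ` {..<K} = {..<K}"
    using bbinj bbK by (intro endo_inj_surj) auto
  have nentry: "l1norm (hasse x f) \<le> B" for x
    using l1norm_hasse[of x f] nf by linarith
  have nentryP: "l1norm (hasse x (P l)) \<le> B" for x l
    using l1norm_hasse[of x "P l"] nf wnorm_slice[of "\<lambda>_. 2" m l f] by (simp add: P_def)
  have KE: "real K * real K \<le> real K * (2 * \<omega> * E)"
  proof -
    have "real K \<le> d m + 1" using K N by linarith
    also have "... \<le> 2 * (\<omega> * E)" using d1(1)[of m] d1(5)[of m] by simp
    finally show ?thesis by (intro mult_left_mono) auto
  qed
  have bnd: "fact K * B ^ K \<le> exp (5 * \<omega> * E * real K)"
  proof -
    have "fact K * B ^ K \<le> exp (real K * real K) * exp (3 * \<omega> * E * real K)"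
      using fact_le_exp[of K] by (intro mult_mono) (auto simp: B_def mult.commute simp flip: exp_of_nat_mult)
    also have "... = exp (real K * real K + 3 * \<omega> * E * real K)" by (simp add: exp_add)
    also have "... \<le> exp (5 * \<omega> * E * real K)" using KE by (simp add: algebra_simps)
    finally show ?thesis .
  qed
  have nW: "l1norm W \<le> exp (5 * \<omega> * E * real K)"
    unfolding W_def using l1norm_dt[of K "\<lambda>i j. hasse (A i + Bk j) f" B] nentry bnd by fastforce
  have nU: "l1norm U \<le> exp (5 * \<omega> * E * real K)"
    unfolding U_def using l1norm_dt[of K "\<lambda>i j. hasse (A i) (P (ls j))" B] nentryP bnd by fastforce
  have Uvars: "in_vars {..<m} U" unfolding U_def by (intro in_vars_dt in_vars_hasse Pvars)
  have Vvars: "in_vars {m} V" unfolding V_def by (intro in_vars_dt in_vars_hasse gvars)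
  \<comment> \<open>A determinant of size K multiplies the degrees and the logarithm of the norm by
    K, so the data for U are those of f with d and E multiplied by K. The bound 5 \<omega> E K for
    the norm is the reason for 5 \<omega> \<le> \<omega>'.\<close>
  have "roth_data \<omega>' m (\<lambda>j. real K * d j) a b (real K * E) U"
    unfolding roth_data_def
  proof (intro conjI allI impI ballI)
    fix j assume j: "j < m"
    show "1 \<le> real K * d j" using K(1) d1(1)[of j] j by (simp add: mult_ge1_I)
    show "b j > 0" "coprime (a j) (b j)" using d1(2,3)[of j] j by auto
    show "real K * E \<le> real K * d j * ln (ri (b j))" using d1(4)[of j] j by (simp add: mult_left_mono mult.assoc)
    have "d j \<le> \<omega> * E" using d1(5)[of j] j by simp
    also have "... \<le> \<omega>' * E" using \<omega> E by (intro mult_right_mono) auto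
    finally have "real K * d j \<le> real K * (\<omega>' * E)" by (intro mult_left_mono) auto
    then show "real K * d j \<le> \<omega>' * (real K * E)" by (simp add: mult_ac)
  next
    fix j assume j: "Suc j < m"
    have "d (Suc j) \<le> \<omega> * d j" using dS j by simp
    also have "... \<le> \<omega>' * d j" using \<omega> d1(1)[of j] j by (intro mult_right_mono) auto
    finally have "real K * d (Suc j) \<le> real K * (\<omega>' * d j)" by (intro mult_left_mono) auto
    then show "real K * d (Suc j) \<le> \<omega>' * (real K * d j)" by (simp add: mult_ac)
  next
    show "0 < real K * E" using K E by simp
    show "U \<noteq> 0" by (rule UV)
    show "intc U" unfolding U_def P_def by (intro intc_dt intc_hasse intc_slice f)
    show "in_vars {..<m} U" by (rule Uvars)
    have "5 * \<omega> * E * real K \<le> \<omega>' * (real K * E)"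
      using mult_right_mono[OF \<omega>(2), of "E * real K"] E by (simp add: mult_ac)
    with nU have "l1norm U \<le> exp (\<omega>' * (real K * E))" by (meson exp_le_cancel_iff order_trans)
    then show "ln (l1norm U) \<le> \<omega>' * (real K * E)" using l1norm_pos[OF UV(1)] by (metis ln_exp ln_le_cancel_iff exp_gt_zero)
  next
    fix k j assume k: "k \<in> supp U" and j: "j < m"
    have "supp_le (\<lambda>k. real (coef k j)) (\<Sum>j'<K. d j) U"
      unfolding U_def
    proof (rule supp_le_dt)
      fix i l
      show "supp_le (\<lambda>k. real (coef k j)) (d j) (hasse (A i) (P (ls l)))"
        unfolding supp_le_def
      proof
        fix k assume "k \<in> supp (hasse (A i) (P (ls l)))"
        then have "k + A i + mono1 m (ls l) \<in> supp f" unfolding P_def by (intro supp_slice supp_hasse)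
        from degf[OF this, of j] j show "real (coef k j) \<le> d j" by (simp add: lookup_add)
      qed
    qed (simp add: lookup_add)
    then show "real (coef k j) \<le> real K * d j" using k by (simp add: supp_le_def)
  qed
  from IH[OF this] obtain I where I: "I \<in> supp (shift \<beta> U)" "widx (\<lambda>j. real K * d j) m I < \<theta>\<^sup>2 / 64"
    by (auto simp: \<beta>_def[abs_def])
  have wI: "widx d m I < real K * (\<theta>\<^sup>2 / 64)"
  proof -
    have "widx (\<lambda>j. real K * d j) m I = widx d m I / real K"
      by (simp add: widx_def sum_divide_distrib mult.commute)
    then have "widx d m I / real K < \<theta>\<^sup>2 / 64" using I(2) by simp
    then show ?thesis using K(1) by (simp only: pos_divide_less_eq) (simp add: mult.commute)
  qed
  obtain I0 where I0: "I0 \<in> supp U" using UV(1) by (metis all_not_in_conv keys_eq_empty)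
  then have I0s: "supp I0 \<subseteq> {..<m}" using Uvars by (auto simp: in_vars_def)
  \<comment> \<open>The relations between the slices are real, so V need not be integral. A nonzero
    coefficient of U times V is a part of W, hence integral and of norm at most that of W.\<close>
  define V' where "V' = Const (coef U I0) * V"
  have u0: "coef U I0 \<noteq> 0" using I0 by (simp add: in_keys_iff)
  have cV': "coef V' k = coef W (I0 + k)" if "supp k \<subseteq> {m}" for k
    unfolding V'_def W coef_Const_mult
    by (rule coef_separated[symmetric, OF Uvars Vvars]) (use I0s that in auto)
  have V'vars: "in_vars {m} V'" unfolding V'_def by (intro in_vars_mult Vvars in_vars_Const)
  have intW: "intc W" unfolding W_def by (intro intc_dt intc_hasse f)
  have intV': "intc V'"
    unfolding intc_def
  proof
    fix k
    show "coef V' k \<in> \<int>"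
    proof (cases "k \<in> supp V'")
      case True
      then have "supp k \<subseteq> {m}" using V'vars by (auto simp: in_vars_def)
      then show ?thesis using cV' intW by (simp add: intc_def)
    qed (simp add: in_keys_iff)
  qed
  have V'0: "V' \<noteq> 0"
  proof
    assume "V' = 0"
    then have "coef U I0 * coef V k = 0" for k by (metis V'_def coef_Const_mult lookup_zero)
    then have "V = 0" using u0 by (auto intro: poly_mapping_eqI)
    then show False using UV by simp
  qed
  have nV': "l1norm V' \<le> l1norm W"
  proof -
    have "l1norm V' = (\<Sum>k\<in>supp V'. \<bar>coef W (I0 + k)\<bar>)"
      unfolding wnorm_def using V'vars by (intro sum.cong) (auto simp: cV' in_vars_def)
    also have "... = (\<Sum>k\<in>(\<lambda>k. I0 + k) ` supp V'. \<bar>coef W k\<bar>)"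
      by (subst sum.reindex) (auto simp: inj_on_def)
    also have "... \<le> (\<Sum>k\<in>supp W. \<bar>coef W k\<bar>)"
    proof (intro sum_mono2)
      show "(\<lambda>k. I0 + k) ` supp V' \<subseteq> supp W"
        using cV' V'vars by (auto simp: in_keys_iff in_vars_def)
    qed auto
    finally show ?thesis by (simp add: wnorm_def)
  qed
  have sV'0: "shift \<beta> V' \<noteq> 0" by (rule shift_nonzero[OF V'0])
  define v where "v = Min ((\<lambda>k. coef k m) ` supp (shift \<beta> V'))"
  have "v \<in> (\<lambda>k. coef k m) ` supp (shift \<beta> V')" unfolding v_def using sV'0 by (intro Min_in) auto
  then obtain kv where kv: "kv \<in> supp (shift \<beta> V')" "v = coef kv m" by blast
  have kvm: "kv = mono1 m v"
    using kv in_vars_shift[OF V'vars, of \<beta>] supp_singleton[of kv m] by (auto simp: in_vars_def)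
  have vle: "v \<le> coef k m" if "k \<in> supp (shift \<beta> V')" for k
    unfolding v_def using that by (intro Min_le) auto
  have "ri (b m) ^ v \<le> l1norm V'"
    by (rule multiplicity_bound[OF V'vars intV' V'0 d1(3)[of m] d1(2)[of m] _ vle]) (auto simp: \<beta>_def)
  also have "... \<le> exp (5 * \<omega> * E * real K)" using nV' nW by linarith
  finally have "ln (ri (b m) ^ v) \<le> 5 * \<omega> * E * real K"
    using d1(2)[of m] by (metis exp_gt_zero ln_exp ln_le_cancel_iff of_int_0_less_iff order_refl zero_less_power)
  then have "real v * ln (ri (b m)) \<le> 5 * \<omega> * real K * E"
    using d1(2)[of m] by (simp add: ln_realpow mult_ac)
  also have "... \<le> 5 * \<omega> * real K * (d m * ln (ri (b m)))"
    using d1(4)[of m] \<omega>(1) by (intro mult_left_mono) auto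
  finally have "real v * ln (ri (b m)) \<le> (5 * \<omega> * real K * d m) * ln (ri (b m))" by (simp add: mult_ac)
  moreover have "ln (ri (b m)) > 0"
  proof -
    have "0 < d m * ln (ri (b m))" using d1(4)[of m] E by linarith
    then show ?thesis using d1(1)[of m] by (auto simp: zero_less_mult_iff)
  qed
  ultimately have v: "real v \<le> 5 * \<omega> * real K * d m" by simp
  have sW: "shift \<beta> W = shift \<beta> U * shift \<beta> V" unfolding W shift_def by (rule subst_mult)
  have sV': "shift \<beta> V' = Const (coef U I0) * shift \<beta> V" unfolding V'_def shift_def by (simp add: subst_mult)
  have "coef (shift \<beta> W) (I + mono1 m v) = coef (shift \<beta> U) I * coef (shift \<beta> V) (mono1 m v)"
    unfolding sW
    by (rule coef_separated[OF in_vars_shift[OF Uvars] in_vars_shift[OF Vvars]])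
       (use I(1) in_vars_shift[OF Uvars, of \<beta>] in \<open>auto simp: in_vars_def\<close>)
  moreover have "coef (shift \<beta> V) (mono1 m v) \<noteq> 0"
    using kv(1) kvm sV' by (auto simp: in_keys_iff coef_Const_mult)
  ultimately have inW: "I + mono1 m v \<in> supp (shift \<beta> W)" using I(1) by (simp add: in_keys_iff)
  \<comment> \<open>Minus the index left in column j: \<theta> is reduced by \<omega> for the
    derivatives in the first variables and by \<open>bb j / d m\<close> for those in the last, but
    never below 0.\<close>
  define cc where "cc j = - max 0 ((\<theta> - \<omega>) - real (bb j) / d m)" for j
  have "supp_le (\<lambda>k. - widx d (Suc m) k) (\<Sum>j<K. cc j) (dt K (\<lambda>i j. shift \<beta> (hasse (A i + Bk j) f)))"
  proof (rule supp_le_dt)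
    fix i j assume ij: "i < K" "j < K"
    show "supp_le (\<lambda>k. - widx d (Suc m) k) (cc j) (shift \<beta> (hasse (A i + Bk j) f))"
      unfolding supp_le_def
    proof
      fix k assume "k \<in> supp (shift \<beta> (hasse (A i + Bk j) f))"
      then have "k + (A i + Bk j) \<in> supp (shift \<beta> f)" unfolding shift_hasse by (rule supp_hasse)
      from low[OF this] have 1: "\<theta> \<le> widx d (Suc m) k + widx d (Suc m) (A i) + widx d (Suc m) (Bk j)"
        by (simp add: widx_add)
      have 2: "widx d (Suc m) (Bk j) = real (bb j) / d m"
        using Bkbb[OF ij(2)] by (simp add: widx_def coef_mono1)
      have "coef (A i) m = 0" using A[OF ij(1)] by (auto simp: in_keys_iff)
      then have "widx d (Suc m) (A i) = (\<Sum>l<m. real (coef (A i) l) / d l)" by (simp add: widx_def)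
      also have "... \<le> (\<Sum>l<m. real (coef (A i) l) * (\<omega> / d m))"
      proof (intro sum_mono)
        fix l assume l: "l \<in> {..<m}"
        have "1 / d l \<le> \<omega> / d m" using dmono[of l m] l d1(1)[of l] d1(1)[of m] by (simp add: field_simps)
        then have "real (coef (A i) l) * (1 / d l) \<le> real (coef (A i) l) * (\<omega> / d m)" by (intro mult_left_mono) auto
        then show "real (coef (A i) l) / d l \<le> real (coef (A i) l) * (\<omega> / d m)" by simp
      qed
      also have "... = real (\<Sum>l<m. coef (A i) l) * (\<omega> / d m)" by (simp only: sum_distrib_right of_nat_sum)
      also have "(\<Sum>l<m. coef (A i) l) = tdeg (A i)" using A[OF ij(1)] by (intro tdeg_superset[symmetric]) auto
      also have "real (tdeg (A i)) * (\<omega> / d m) \<le> d m * (\<omega> / d m)"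
      proof (intro mult_right_mono)
        have "tdeg (A i) \<le> N" using A[OF ij(1)] K by linarith
        then show "real (tdeg (A i)) \<le> d m" using N by linarith
      qed (use \<omega> d1(1)[of m] in auto)
      also have "... = \<omega>" using d1(1)[of m] by simp
      finally have 3: "widx d (Suc m) (A i) \<le> \<omega>" .
      have "widx d (Suc m) k \<ge> 0"
        unfolding widx_def using d1(1) by (intro sum_nonneg divide_nonneg_nonneg) (auto simp: less_Suc_eq_le intro: order_trans[of 0 1])
      with 1 2 3 show "- widx d (Suc m) k \<le> cc j" by (simp add: cc_def)
    qed
  qed (simp add: widx_add)
  moreover have "shift \<beta> W = dt K (\<lambda>i j. shift \<beta> (hasse (A i + Bk j) f))"
    unfolding W_def shift_def by (rule subst_dt)
  ultimately have "- widx d (Suc m) (I + mono1 m v) \<le> (\<Sum>j<K. cc j)"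
    using inW by (simp add: supp_le_def)
  moreover have "(\<Sum>j<K. cc j) = - (\<Sum>b<K. max 0 ((\<theta> - \<omega>) - real b / d m))"
  proof -
    have "(\<Sum>j<K. max 0 ((\<theta> - \<omega>) - real (bb j) / d m)) = (\<Sum>b\<in>bb ` {..<K}. max 0 ((\<theta> - \<omega>) - real b / d m))"
      by (subst sum.reindex[OF bbinj]) simp
    then show ?thesis by (simp add: cc_def sum_negf bbim)
  qed
  moreover have "(\<Sum>b<K. max 0 ((\<theta> - \<omega>) - real b / d m)) \<ge> real K * (\<theta> - \<omega>)\<^sup>2 / 8"
    using \<omega> \<theta> \<theta>2 d1(1)[of m] K N by (intro sum_truncated_linear) auto
  moreover have "widx d (Suc m) (I + mono1 m v) < real K * (\<theta>\<^sup>2 / 64) + 5 * \<omega> * real K"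
  proof -
    have "supp I \<subseteq> {..<m}" using I(1) in_vars_shift[OF Uvars, of \<beta>] by (auto simp: in_vars_def)
    then have "m \<notin> supp I" by auto
    then have "coef I m = 0" by (simp add: in_keys_iff)
    then have "widx d (Suc m) (I + mono1 m v) = widx d m I + real v / d m"
      by (auto simp: widx_def lookup_add coef_mono1 intro!: sum.cong)
    also have "real v / d m \<le> 5 * \<omega> * real K" using v d1(1)[of m] by (simp add: field_simps)
    finally show ?thesis using wI by linarith
  qed
  \<comment> \<open>After division by K, the left side is at least \<theta>^2 / 32 and the right
    side at most \<theta>^2 / 64 + \<theta>^2 / 200, because 1000 \<omega> is at most
    \<theta>^2.\<close>
  ultimately have "real K * (\<theta> - \<omega>)\<^sup>2 / 8 < real K * (\<theta>\<^sup>2 / 64) + 5 * \<omega> * real K" by linarith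
  then have "real K * ((\<theta> - \<omega>)\<^sup>2 / 8) < real K * (\<theta>\<^sup>2 / 64 + 5 * \<omega>)" by (simp add: algebra_simps)
  then have "(\<theta> - \<omega>)\<^sup>2 / 8 < \<theta>\<^sup>2 / 64 + 5 * \<omega>" using K(1) by simp
  moreover have "(\<theta> - \<omega>)\<^sup>2 \<ge> (\<theta> / 2)\<^sup>2" using \<omega> \<theta> \<theta>2 by (intro power_mono) auto
  ultimately show False using \<omega> \<theta> by (simp add: power2_eq_square) 
qed

theorem roth_lemma:
  "\<theta> > 0 ==> \<exists>\<omega>>0. \<omega> \<le> 1/2 \<and> (\<forall>d a b E f. roth_data \<omega> m d a b E f \<longrightarrow>
    (\<exists>k\<in>supp (shift (\<lambda>j. ri (a j) / ri (b j)) f). widx d m k < \<theta>))"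
proof (induction m arbitrary: \<theta>)
  case 0
  have "\<exists>k\<in>supp (shift \<beta> f). widx d 0 k < \<theta>" if ne: "f \<noteq> 0" for \<beta> d and f :: "nat mp"
  proof -
    obtain k where "k \<in> supp (shift \<beta> f)" using shift_nonzero[OF ne] by (metis all_not_in_conv keys_eq_empty)
    then show ?thesis using 0 by (intro bexI[of _ k]) (auto simp: widx_def)
  qed
  then show ?case by (intro exI[of _ "1/2"]) (auto simp: roth_data_def)
next
  case (Suc m)
  define \<theta>0 where "\<theta>0 = min \<theta> 1"
  have \<theta>0: "0 < \<theta>0" "\<theta>0 \<le> 1" "\<theta>0 \<le> \<theta>" using Suc.prems by (auto simp: \<theta>0_def)
  have "\<theta>0\<^sup>2 / 64 > 0" using \<theta>0 by simp
  from Suc.IH[OF this] obtain \<omega>' where \<omega>': "\<omega>' > 0" and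
    IH: "\<And>d a b E f. roth_data \<omega>' m d a b E f ==>
      \<exists>k\<in>supp (shift (\<lambda>j. ri (a j) / ri (b j)) f). widx d m k < \<theta>0\<^sup>2 / 64" by blast
  define \<omega> where "\<omega> = min (\<omega>' / 5) (\<theta>0\<^sup>2 / 1000)"
  have \<omega>: "0 < \<omega>" "5 * \<omega> \<le> \<omega>'" "1000 * \<omega> \<le> \<theta>0\<^sup>2" using \<omega>' \<theta>0 by (auto simp: \<omega>_def)
  have "\<theta>0\<^sup>2 \<le> 1" using \<theta>0 by (simp add: power_le_one)
  with \<omega> have "\<omega> \<le> 1/2" by linarith
  moreover have "\<exists>k\<in>supp (shift (\<lambda>j. ri (a j) / ri (b j)) f). widx d (Suc m) k < \<theta>"
    if "roth_data \<omega> (Suc m) d a b E f" for d a b E f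
  proof -
    have "\<exists>k\<in>supp (shift (\<lambda>j. ri (a j) / ri (b j)) f). widx d (Suc m) k < \<theta>0"
      by (rule roth_step[where \<omega>' = \<omega>', OF IH]) (use \<theta>0 \<omega> that in auto)
    then show ?thesis using \<theta>0(3) by (meson less_le_trans)
  qed
  ultimately show ?case using \<omega>(1) by blast
qed

section \<open>Siegel's lemma\<close>

lemma siegel:
  fixes c :: "'y => 'x => int" and T :: int
  assumes fin: "finite X" "finite Y" and ne: "X \<noteq> {}" and card: "2 * card Y \<le> card X"
    and T: "T \<ge> 1" and c: "\<And>x y. x \<in> X ==> y \<in> Y ==> \<bar>c y x\<bar> \<le> T"
  obtains p :: "'x => int" where "\<exists>x\<in>X. p x \<noteq> 0" "\<And>x. \<bar>p x\<bar> \<le> 2 * int (card X) * T"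
    "\<And>x. x \<notin> X ==> p x = 0" "\<And>y. y \<in> Y ==> (\<Sum>x\<in>X. c y x * p x) = 0"
proof -
  define N where "N = int (card X)"
  have N: "N \<ge> 1" using fin ne by (simp add: N_def Suc_leI card_gt_0_iff)
  \<comment> \<open>This choice makes the number 2 N T B + 1 of possible values of one equation
    equal to B^2 + 1, which is below the square of the B + 1 choices for one unknown. Twice as many
    unknowns as equations then suffice for the pigeonhole principle.\<close>
  define B where "B = 2 * N * T"
  have B: "B \<ge> 1" using N T by (simp add: B_def) (smt (verit) mult_le_cancel_left1)
  define Dm where "Dm = X \<rightarrow>\<^sub>E {0..B}"
  define Cd where "Cd = Y \<rightarrow>\<^sub>E {- (N * T * B)..N * T * B}"
  define ev where "ev p = (\<lambda>y\<in>Y. \<Sum>x\<in>X. c y x * p x)" for p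
  have map: "ev ` Dm \<subseteq> Cd"
  proof
    fix q assume "q \<in> ev ` Dm"
    then obtain p where p: "p \<in> Dm" "q = ev p" by blast
    have "\<bar>\<Sum>x\<in>X. c y x * p x\<bar> \<le> N * T * B" if y: "y \<in> Y" for y
    proof -
      have "\<bar>\<Sum>x\<in>X. c y x * p x\<bar> \<le> (\<Sum>x\<in>X. \<bar>c y x * p x\<bar>)" by (rule sum_abs)
      also have "... \<le> (\<Sum>x\<in>X. T * B)"
      proof (intro sum_mono)
        fix x assume x: "x \<in> X"
        have "0 \<le> p x" "p x \<le> B" using p(1) x by (auto simp: Dm_def PiE_iff)
        then show "\<bar>c y x * p x\<bar> \<le> T * B" unfolding abs_mult using c[OF x y] T by (intro mult_mono) auto
      qed
      also have "... = N * T * B" by (simp add: N_def)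
      finally show ?thesis .
    qed
    then have "(\<Sum>x\<in>X. c y x * p x) \<in> {- (N * T * B)..N * T * B}" if "y \<in> Y" for y
      using that unfolding atLeastAtMost_iff by (metis abs_le_iff minus_le_iff)
    then show "q \<in> Cd" unfolding p(2) ev_def Cd_def by auto
  qed
  have finC: "finite Cd" unfolding Cd_def by (intro finite_PiE fin) auto
  have "card Cd < card Dm"
  proof -
    have cC: "card Cd = nat (2 * (N * T * B) + 1) ^ card Y"
      unfolding Cd_def using fin by (subst card_PiE) (auto simp: algebra_simps)
    have cD: "card Dm = nat (B + 1) ^ card X"
      unfolding Dm_def using fin by (subst card_PiE) auto
    have lt: "nat (2 * (N * T * B) + 1) < nat (B + 1) ^ 2"
    proof -
      have "2 * (N * T * B) + 1 = B * B + 1" by (simp add: B_def)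
      also have "... < (B + 1) ^ 2" using B by (simp add: power2_eq_square algebra_simps)
      finally have "nat (2 * (N * T * B) + 1) < nat ((B + 1) ^ 2)" using N T B by (subst nat_less_eq_zless) (auto intro!: add_nonneg_nonneg mult_nonneg_nonneg)
      then show ?thesis using B by (simp add: nat_power_eq)
    qed
    have B1: "nat (B + 1) \<ge> 2" using B by simp
    show ?thesis
    proof (cases "card Y = 0")
      case True
      have "card X \<ge> 1" using N by (simp add: N_def)
      then have "nat (B + 1) ^ 1 \<le> nat (B + 1) ^ card X" using B1 by (intro power_increasing) auto
      then show ?thesis unfolding cC cD True using B1 by simp
    next
      case False
      have "card Cd < (nat (B + 1) ^ 2) ^ card Y"
        unfolding cC using lt False by (intro power_strict_mono) auto
      also have "... = nat (B + 1) ^ (2 * card Y)" by (simp add: power_mult)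
      also have "... \<le> card Dm" unfolding cD using card B1 by (intro power_increasing) auto
      finally show ?thesis .
    qed
  qed
  then have "\<not> inj_on ev Dm" using card_inj_on_le[OF _ map finC] by (meson not_le)
  then obtain p1 p2 where p12: "p1 \<in> Dm" "p2 \<in> Dm" "ev p1 = ev p2" "p1 \<noteq> p2" by (auto simp: inj_on_def)
  define p where "p x = (if x \<in> X then p1 x - p2 x else 0)" for x
  show ?thesis
  proof (rule that[of p])
    obtain x where "p1 x \<noteq> p2 x" using p12(4) by auto
    moreover have "x \<in> X" using p12(1,2) \<open>p1 x \<noteq> p2 x\<close> unfolding Dm_def by (metis PiE_arb)
    ultimately show "\<exists>x\<in>X. p x \<noteq> 0" by (auto simp: p_def)
    show "\<bar>p x\<bar> \<le> 2 * int (card X) * T" for x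
    proof (cases "x \<in> X")
      case True
      then have "p1 x \<in> {0..B}" "p2 x \<in> {0..B}" using p12 by (auto simp: Dm_def PiE_iff)
      then show ?thesis using True by (auto simp: p_def B_def N_def)
    qed (use T in \<open>simp add: p_def\<close>)
    show "p x = 0" if "x \<notin> X" for x using that by (simp add: p_def)
    show "(\<Sum>x\<in>X. c y x * p x) = 0" if y: "y \<in> Y" for y
    proof -
      have "ev p1 y = ev p2 y" using p12(3) by simp
      then show ?thesis using y by (simp add: ev_def p_def algebra_simps sum_subtractf)
    qed
  qed
qed

section \<open>Multihomogeneous exponents\<close>

type_synonym bkey = "(nat \<times> nat) \<Rightarrow>\<^sub>0 nat"

text \<open>The exponents of multidegree \<open>d\<close> in \<open>m\<close> blocks of
  \<open>n\<close> homogeneous coordinates; the variable (j, i) is coordinate i of block j.\<close>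

definition EM :: "nat => nat => (nat => nat) => bkey set" where
  "EM n m d = {e. supp e \<subseteq> {..<m} \<times> {..<n} \<and> (\<forall>j<m. (\<Sum>i<n. coef e (j, i)) = d j)}"

lemma EM_le: "e \<in> EM n m d ==> j < m ==> i < n ==> coef e (j, i) \<le> d j"
  unfolding EM_def using member_le_sum[of i "{..<n}" "\<lambda>i. coef e (j, i)"] by auto

lemma EM_finite_card: "finite (EM n m d) \<and> card (EM n m d) \<le> 2 ^ (n * (\<Sum>j<m. d j))"
proof -
  let ?A = "{..<m} \<times> {..<n}"
  define r where "r e = restrict (coef e) ?A" for e :: bkey
  have inj: "inj_on r (EM n m d)"
  proof (rule inj_onI, rule poly_mapping_eqI)
    fix e e' v assume e: "e \<in> EM n m d" "e' \<in> EM n m d" "r e = r e'"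
    show "coef e v = coef e' v"
    proof (cases "v \<in> ?A")
      case True
      then show ?thesis using e(3) by (metis r_def restrict_apply')
    next
      case False
      then have "v \<notin> supp e" "v \<notin> supp e'" using e by (auto simp: EM_def)
      then show ?thesis by (simp add: in_keys_iff)
    qed
  qed
  have sub: "r ` EM n m d \<subseteq> (\<Pi>\<^sub>E v\<in>?A. {..d (fst v)})"
    by (auto simp: r_def PiE_iff EM_le split: if_splits)
  have fin: "finite (\<Pi>\<^sub>E v\<in>?A. {..d (fst v)})" by (intro finite_PiE) auto
  have "card (EM n m d) \<le> card (\<Pi>\<^sub>E v\<in>?A. {..d (fst v)})" by (rule card_inj_on_le[OF inj sub fin])
  also have "... = (\<Prod>v\<in>?A. d (fst v) + 1)" by (subst card_PiE) auto
  also have "... \<le> (\<Prod>v\<in>?A. 2 ^ d (fst v))"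
  proof (intro prod_mono conjI)
    fix v :: "nat \<times> nat"
    show "d (fst v) + 1 \<le> 2 ^ d (fst v)" using less_exp[of "d (fst v)"] by (simp only: Suc_eq_plus1[symmetric] Suc_le_eq)
  qed auto
  also have "... = 2 ^ (\<Sum>v\<in>?A. d (fst v))" by (simp add: power_sum)
  also have "(\<Sum>v\<in>?A. d (fst v)) = n * (\<Sum>j<m. d j)"
    by (simp add: sum.cartesian_product[symmetric, of "\<lambda>j i. d j", simplified case_prod_beta'] sum_distrib_left case_prod_beta')
  finally show ?thesis using finite_imageD[OF finite_subset[OF sub fin] inj] by simp
qed

lemmas EM_finite = EM_finite_card[THEN conjunct1]

lemma EM_nonempty:
  assumes "n \<ge> 1"
  shows "EM n m d \<noteq> {}"
proof -
  define e :: bkey where "e = (\<Sum>j<m. mono1 (j, 0) (d j))"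
  have c: "coef e (j, i) = (if j < m \<and> i = 0 then d j else 0)" for j i
    by (cases "j < m"; cases "i = 0") (auto simp: e_def lookup_sum coef_mono1 intro!: sum.neutral)
  have "e \<in> EM n m d"
    unfolding EM_def using assms by (auto simp: in_keys_iff c split: if_splits)
  then show ?thesis by blast
qed

text \<open>The exchange of two coordinates of one block. Sums over \<open>EM n m d\<close> are
  invariant under it, which gives averages without counting exponents.\<close>

definition bswap :: "nat => nat => nat => bkey => bkey" where
  "bswap j i i' e = Poly_Mapping.map_key (Transposition.transpose (j, i) (j, i')) e"

lemma coef_bswap: "coef (bswap j i i' e) v = coef e (Transposition.transpose (j, i) (j, i') v)"
  unfolding bswap_def by (simp add: map_key.rep_eq)

lemma bswap_bswap: "bswap j i i' (bswap j i i' e) = e"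
  by (rule poly_mapping_eqI) (simp add: coef_bswap)

lemma bswap_EM:
  assumes "e \<in> EM n m d" "i < n" "i' < n" "j < m"
  shows "bswap j i i' e \<in> EM n m d"
proof -
  let ?\<pi> = "Transposition.transpose (j, i) (j, i')"
  have "supp (bswap j i i' e) \<subseteq> {..<m} \<times> {..<n}"
  proof
    fix v assume "v \<in> supp (bswap j i i' e)"
    then have "?\<pi> v \<in> supp e" by (simp add: in_keys_iff coef_bswap)
    then have "?\<pi> v \<in> {..<m} \<times> {..<n}" using assms(1) by (auto simp: EM_def)
    then show "v \<in> {..<m} \<times> {..<n}" using assms by (auto simp: Transposition.transpose_def split: if_splits)
  qed
  moreover have "(\<Sum>k<n. coef (bswap j i i' e) (j', k)) = d j'" if "j' < m" for j'
  proof (cases "j' = j")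
    case True
    have eq: "?\<pi> (j, k) = (j, Transposition.transpose i i' k)" for k
      by (auto simp: Transposition.transpose_def)
    have "(\<Sum>k<n. coef e (j, Transposition.transpose i i' k)) = (\<Sum>k<n. coef e (j, k))"
      using assms(2,3) by (intro sum.reindex_bij_witness[of _ "Transposition.transpose i i'" "Transposition.transpose i i'"])
        (auto simp: Transposition.transpose_def)
    then show ?thesis using True assms(1) that by (simp add: coef_bswap eq EM_def)
  next
    case False
    then have "?\<pi> (j', k) = (j', k)" for k by (auto simp: Transposition.transpose_def)
    then show ?thesis using assms(1) that by (simp add: coef_bswap EM_def)
  qed
  ultimately show ?thesis by (simp add: EM_def)
qed

lemma sum_EM_bswap:
  assumes "i < n" "i' < n" "j < m"
  shows "(\<Sum>e\<in>EM n m d. F e) = (\<Sum>e\<in>EM n m d. F (bswap j i i' e))"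
  by (rule sum.reindex_bij_witness[of _ "bswap j i i'" "bswap j i i'"])
     (auto simp: bswap_bswap bswap_EM assms)

text \<open>By symmetry every coordinate of block j has mean exponent d_j / n, also when weighted
  with a function invariant under exchanges in this block. A function of another block as weight
  shows that different blocks are uncorrelated.\<close>

lemma sum_EM_block_mean:
  fixes g :: "bkey => real"
  assumes j: "j < m" and n: "n \<ge> 1" and inv: "\<And>i i' e. i < n ==> i' < n ==> g (bswap j i i' e) = g e"
  shows "(\<Sum>e\<in>EM n m d. (\<Sum>i<n. s i * (real (coef e (j, i)) - real (d j) / real n)) * g e) = 0"
proof -
  define X where "X i = (\<Sum>e\<in>EM n m d. real (coef e (j, i)) * g e)" for i
  define G where "G = (\<Sum>e\<in>EM n m d. g e)"
  have eq: "X i = X 0" if i: "i < n" for i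
  proof -
    have "X i = (\<Sum>e\<in>EM n m d. real (coef (bswap j i 0 e) (j, i)) * g (bswap j i 0 e))"
      unfolding X_def using sum_EM_bswap[of i n 0 j m "\<lambda>e. real (coef e (j, i)) * g e" d] i n j by simp
    also have "... = X 0"
      unfolding X_def using inv i n by (intro sum.cong refl) (simp add: coef_bswap)
    finally show ?thesis .
  qed
  have "(\<Sum>i<n. X i) = (\<Sum>e\<in>EM n m d. (\<Sum>i<n. real (coef e (j, i))) * g e)"
    unfolding X_def by (subst sum.swap) (simp add: sum_distrib_right)
  also have "(\<Sum>e\<in>EM n m d. (\<Sum>i<n. real (coef e (j, i))) * g e) = real (d j) * G"
    unfolding G_def sum_distrib_left
  proof (intro sum.cong refl)
    fix e assume "e \<in> EM n m d"
    then have "\<forall>j<m. (\<Sum>i<n. coef e (j, i)) = d j" by (simp add: EM_def)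
    with j have "(\<Sum>i<n. coef e (j, i)) = d j" by blast
    from arg_cong[OF this, of real] have "real (\<Sum>i<n. coef e (j, i)) = real (d j)" .
    then show "(\<Sum>i<n. real (coef e (j, i))) * g e = real (d j) * g e" by simp
  qed
  finally have XG: "(\<Sum>i<n. X i) = real (d j) * G" .
  have "(\<Sum>i<n. X i) = (\<Sum>i<n. X 0)" by (intro sum.cong refl eq) simp
  then have "real n * X 0 = real (d j) * G" using XG by simp
  then have X: "X i = real (d j) / real n * G" if "i < n" for i using eq[OF that] n by (simp add: field_simps)
  have "(\<Sum>e\<in>EM n m d. (\<Sum>i<n. s i * (real (coef e (j, i)) - real (d j) / real n)) * g e)
      = (\<Sum>i<n. s i * (X i - real (d j) / real n * G))"
  proof -
    have "(\<Sum>e\<in>EM n m d. (\<Sum>i<n. s i * (real (coef e (j, i)) - real (d j) / real n)) * g e)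
        = (\<Sum>i<n. \<Sum>e\<in>EM n m d. s i * (real (coef e (j, i)) * g e - real (d j) / real n * g e))"
      by (subst sum.swap) (simp only: sum_distrib_right, intro sum.cong refl, simp add: algebra_simps)
    also have "... = (\<Sum>i<n. s i * (X i - real (d j) / real n * G))"
      unfolding X_def G_def by (simp only: sum_distrib_left sum_subtractf right_diff_distrib)
    finally show ?thesis .
  qed
  also have "... = 0" using X by simp
  finally show ?thesis .
qed

text \<open>Chebyshev's inequality: the centred contributions of the blocks are uncorrelated and
  bounded by 2 H, so the variance is at most 4 H^2 m. For \<open>lam\<close> proportional to m the
  exceptional proportion is of order 1 / m, which is enough for Siegel's lemma.\<close>

lemma EM_chebyshev:
  fixes s :: "nat => nat => real" and H lam :: real
  assumes n: "n \<ge> 1" and H: "\<And>j i. j < m ==> i < n ==> \<bar>s j i\<bar> * real (d j) \<le> H" and lam: "lam > 0"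
  defines "S \<equiv> (\<lambda>e :: bkey. \<Sum>j<m. \<Sum>i<n. s j i * real (coef e (j, i)))"
  defines "M \<equiv> (\<Sum>j<m. \<Sum>i<n. s j i * (real (d j) / real n))"
  shows "real (card {e \<in> EM n m d. S e \<ge> M + lam}) * lam\<^sup>2 \<le> 4 * H\<^sup>2 * real m * real (card (EM n m d))"
proof -
  define \<xi> where "\<xi> j e = (\<Sum>i<n. s j i * (real (coef e (j, i)) - real (d j) / real n))" for j and e :: bkey
  have fin: "finite (EM n m d)" by (rule EM_finite)
  have SM: "S e - M = (\<Sum>j<m. \<xi> j e)" for e
    by (simp add: S_def M_def \<xi>_def right_diff_distrib sum_subtractf)
  have bnd: "\<bar>\<xi> j e\<bar> \<le> 2 * H" if j: "j < m" and e: "e \<in> EM n m d" for j e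
  proof -
    have "0 \<le> \<bar>s j 0\<bar> * real (d j)" by simp
    then have H0: "H \<ge> 0" using H[OF j, of 0] n by linarith
    have 1: "\<bar>\<Sum>i<n. s j i * (x i / real (d j))\<bar> \<le> H / real (d j) * 1" if x: "\<And>i. i < n ==> x i \<ge> 0" "(\<Sum>i<n. x i) = real (d j)" and dj: "d j > 0" for x
    proof -
      have "\<bar>\<Sum>i<n. s j i * (x i / real (d j))\<bar> \<le> (\<Sum>i<n. \<bar>s j i * (x i / real (d j))\<bar>)" by (rule sum_abs)
      also have "... \<le> (\<Sum>i<n. H / real (d j) * (x i / real (d j)))"
      proof (intro sum_mono)
        fix i assume i: "i \<in> {..<n}"
        have "\<bar>s j i\<bar> \<le> H / real (d j)" using H[OF j, of i] i dj by (simp add: field_simps)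
        then show "\<bar>s j i * (x i / real (d j))\<bar> \<le> H / real (d j) * (x i / real (d j))"
          unfolding abs_mult using x(1)[of i] i by (intro mult_mono) auto
      qed
      also have "... = H / real (d j) * ((\<Sum>i<n. x i) / real (d j))" by (simp add: sum_distrib_left sum_divide_distrib)
      also have "... = H / real (d j) * 1" using x(2) dj by simp
      finally show ?thesis .
    qed
    show ?thesis
    proof (cases "d j = 0")
      case True
      then have "coef e (j, i) = 0" if "i < n" for i using EM_le[OF e j that] by simp
      then have "\<xi> j e = 0" using True by (simp add: \<xi>_def)
      then show ?thesis using H0 by simp
    next
      case False
      then have dj: "d j > 0" by simp
      have "\<bar>\<Sum>i<n. s j i * (real (coef e (j, i)) / real (d j))\<bar> \<le> H / real (d j) * 1"
        using e j dj by (intro 1) (auto simp: EM_def simp flip: of_nat_sum)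
      moreover have "\<bar>\<Sum>i<n. s j i * (real (d j) / real n / real (d j))\<bar> \<le> H / real (d j) * 1"
        using n dj by (intro 1) auto
      moreover have "\<xi> j e = real (d j) * ((\<Sum>i<n. s j i * (real (coef e (j, i)) / real (d j))) - (\<Sum>i<n. s j i * (real (d j) / real n / real (d j))))"
        using dj unfolding \<xi>_def by (simp add: right_diff_distrib sum_distrib_left sum_subtractf) (simp add: field_simps)
      ultimately have "\<bar>\<xi> j e\<bar> \<le> real (d j) * (H / real (d j) + H / real (d j))"
        by (simp only: abs_mult abs_of_nat) (intro mult_left_mono, linarith, simp)
      then show ?thesis using dj by simp
    qed
  qed
  have cross: "(\<Sum>e\<in>EM n m d. \<xi> j e * \<xi> j' e) = 0" if "j < m" "j' < m" "j \<noteq> j'" for j j'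
    unfolding \<xi>_def[of j]
  proof (rule sum_EM_block_mean[OF that(1) n])
    fix i i' e
    show "\<xi> j' (bswap j i i' e) = \<xi> j' e"
      using that(3) by (simp add: \<xi>_def coef_bswap Transposition.transpose_def)
  qed
  have "(\<Sum>e\<in>EM n m d. (S e - M)\<^sup>2) = (\<Sum>j<m. \<Sum>j'<m. \<Sum>e\<in>EM n m d. \<xi> j e * \<xi> j' e)"
    unfolding SM power2_eq_square sum_product by (subst sum.swap, rule sum.cong, simp, subst sum.swap, simp)
  also have "... = (\<Sum>j<m. \<Sum>j'<m. if j = j' then \<Sum>e\<in>EM n m d. \<xi> j e * \<xi> j e else 0)"
    using cross by (intro sum.cong refl) auto
  also have "... = (\<Sum>j<m. \<Sum>e\<in>EM n m d. \<xi> j e * \<xi> j e)" by (simp cong: if_cong)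
  also have "... \<le> (\<Sum>j<m. \<Sum>e\<in>EM n m d. (2 * H)\<^sup>2)"
  proof (intro sum_mono)
    fix j e assume je: "j \<in> {..<m}" "e \<in> EM n m d"
    have "\<xi> j e * \<xi> j e = \<bar>\<xi> j e\<bar>\<^sup>2" by (simp add: power2_eq_square)
    also have "... \<le> (2 * H)\<^sup>2" using bnd[of j e] je by (intro power_mono) auto
    finally show "\<xi> j e * \<xi> j e \<le> (2 * H)\<^sup>2" .
  qed
  also have "... = 4 * H\<^sup>2 * real m * real (card (EM n m d))" by (simp add: power_mult_distrib)
  finally have up: "(\<Sum>e\<in>EM n m d. (S e - M)\<^sup>2) \<le> 4 * H\<^sup>2 * real m * real (card (EM n m d))" .
  let ?B = "{e \<in> EM n m d. S e \<ge> M + lam}"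
  have "real (card ?B) * lam\<^sup>2 = (\<Sum>e\<in>?B. lam\<^sup>2)" by simp
  also have "... \<le> (\<Sum>e\<in>?B. (S e - M)\<^sup>2)" using lam by (intro sum_mono power_mono) auto
  also have "... \<le> (\<Sum>e\<in>EM n m d. (S e - M)\<^sup>2)" using fin by (intro sum_mono2) auto
  finally show ?thesis using up by linarith
qed

section \<open>Bounded elements of the ring generated by an algebraic integer\<close>

text \<open>Elements of Z[\<alpha>] that have some coordinate vector of l1 norm at most
  \<open>H\<close>. The powers of \<alpha> may be dependent, so a size belongs to a representation
  and not to the number.\<close>

definition zset :: "real => nat => real => real set" where
  "zset \<alpha> D H = {z. \<exists>c :: nat => int. z = (\<Sum>i<D. ri (c i) * \<alpha> ^ i) \<and> (\<Sum>i<D. \<bar>ri (c i)\<bar>) \<le> H}"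

lemma zset_0: "H \<ge> 0 ==> 0 \<in> zset \<alpha> D H"
  by (auto simp: zset_def intro!: exI[of _ "\<lambda>_. 0"])

lemma zset_1: "D \<ge> 1 ==> 1 \<in> zset \<alpha> D 1"
proof -
  assume D: "D \<ge> 1"
  have "(\<Sum>i<D. ri (if i = 0 then 1 else 0) * \<alpha> ^ i) = (\<Sum>i<D. if i = 0 then 1 else 0)"
    by (intro sum.cong) auto
  also have "... = 1" using D by simp
  moreover have "(\<Sum>i<D. \<bar>ri (if i = 0 then 1 else 0)\<bar>) = 1"
    using D by (simp add: if_distrib cong: if_cong)
  ultimately show ?thesis unfolding zset_def by (auto intro!: exI[of _ "\<lambda>i. if i = 0 then 1 else 0"])
qed

lemma zset_mono: "z \<in> zset \<alpha> D H ==> H \<le> H' ==> z \<in> zset \<alpha> D H'"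
  by (auto simp: zset_def intro: order_trans)

lemma zset_add:
  assumes "x \<in> zset \<alpha> D H" "y \<in> zset \<alpha> D H'"
  shows "x + y \<in> zset \<alpha> D (H + H')"
proof -
  obtain c c' where c: "x = (\<Sum>i<D. ri (c i) * \<alpha> ^ i)" "(\<Sum>i<D. \<bar>ri (c i)\<bar>) \<le> H"
    "y = (\<Sum>i<D. ri (c' i) * \<alpha> ^ i)" "(\<Sum>i<D. \<bar>ri (c' i)\<bar>) \<le> H'"
    using assms by (auto simp: zset_def)
  have "(\<Sum>i<D. \<bar>ri (c i + c' i)\<bar>) \<le> (\<Sum>i<D. \<bar>ri (c i)\<bar> + \<bar>ri (c' i)\<bar>)"
    by (intro sum_mono) simp
  then show ?thesis unfolding zset_def using c
    by (intro CollectI exI[of _ "\<lambda>i. c i + c' i"]) (auto simp: sum.distrib algebra_simps)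
qed

lemma zset_sum:
  "(\<And>i. i \<in> A ==> f i \<in> zset \<alpha> D (H i)) ==> finite A ==> (\<Sum>i\<in>A. f i) \<in> zset \<alpha> D (\<Sum>i\<in>A. H i)"
proof (induction A rule: infinite_finite_induct)
  case (insert x F)
  then show ?case by (simp add: zset_add)
qed (auto simp: zset_0)

lemma zset_int_mult:
  assumes "x \<in> zset \<alpha> D H"
  shows "ri N * x \<in> zset \<alpha> D (\<bar>ri N\<bar> * H)"
proof -
  obtain c where c: "x = (\<Sum>i<D. ri (c i) * \<alpha> ^ i)" "(\<Sum>i<D. \<bar>ri (c i)\<bar>) \<le> H"
    using assms by (auto simp: zset_def)
  have "(\<Sum>i<D. \<bar>ri (N * c i)\<bar>) = \<bar>ri N\<bar> * (\<Sum>i<D. \<bar>ri (c i)\<bar>)"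
    by (simp add: abs_mult sum_distrib_left)
  also have "... \<le> \<bar>ri N\<bar> * H" using c(2) by (intro mult_left_mono) auto
  finally have "(\<Sum>i<D. \<bar>ri (N * c i)\<bar>) \<le> \<bar>ri N\<bar> * H" .
  moreover have "ri N * x = (\<Sum>i<D. ri (N * c i) * \<alpha> ^ i)"
    unfolding c(1) by (simp add: sum_distrib_left mult_ac)
  ultimately show ?thesis unfolding zset_def by (intro CollectI exI[of _ "\<lambda>i. N * c i"] conjI)
qed

lemma zset_abs:
  assumes "z \<in> zset \<alpha> D H"
  shows "\<bar>z\<bar> \<le> H * (1 + \<bar>\<alpha>\<bar>) ^ D"
proof -
  obtain c where c: "z = (\<Sum>i<D. ri (c i) * \<alpha> ^ i)" "(\<Sum>i<D. \<bar>ri (c i)\<bar>) \<le> H"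
    using assms by (auto simp: zset_def)
  have "\<bar>z\<bar> \<le> (\<Sum>i<D. \<bar>ri (c i) * \<alpha> ^ i\<bar>)" unfolding c(1) by (rule sum_abs)
  also have "... \<le> (\<Sum>i<D. \<bar>ri (c i)\<bar> * (1 + \<bar>\<alpha>\<bar>) ^ D)"
  proof (intro sum_mono)
    fix i assume i: "i \<in> {..<D}"
    have "\<bar>\<alpha>\<bar> ^ i \<le> (1 + \<bar>\<alpha>\<bar>) ^ i" by (intro power_mono) auto
    also have "... \<le> (1 + \<bar>\<alpha>\<bar>) ^ D" using i by (intro power_increasing) auto
    finally show "\<bar>ri (c i) * \<alpha> ^ i\<bar> \<le> \<bar>ri (c i)\<bar> * (1 + \<bar>\<alpha>\<bar>) ^ D"
      by (simp add: abs_mult power_abs mult_left_mono)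
  qed
  also have "... = (\<Sum>i<D. \<bar>ri (c i)\<bar>) * (1 + \<bar>\<alpha>\<bar>) ^ D" by (simp add: sum_distrib_right)
  also have "... \<le> H * (1 + \<bar>\<alpha>\<bar>) ^ D" using c(2) by (intro mult_right_mono) auto
  finally show ?thesis .
qed

text \<open>An operator bound for multiplication by \<open>c\<close>. It is submultiplicative in
  \<open>c\<close> and takes the place of a bound for all conjugates.\<close>

definition zmul :: "real => nat => real => real => bool" where
  "zmul \<alpha> D C c \<longleftrightarrow> (\<forall>z H. H \<ge> 0 \<longrightarrow> z \<in> zset \<alpha> D H \<longrightarrow> c * z \<in> zset \<alpha> D (C * H))"

text \<open>Multiplication shifts the coordinates by one place, and the monic equation folds the
  overflowing top coordinate back into the lower ones.\<close>

lemma zmul_gen: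
  assumes D: "D \<ge> 1" and g: "\<alpha> ^ D = (\<Sum>i<D. ri (g i) * \<alpha> ^ i)"
  shows "zmul \<alpha> D (1 + (\<Sum>i<D. \<bar>ri (g i)\<bar>)) \<alpha>"
  unfolding zmul_def
proof (intro allI impI)
  fix z H assume "H \<ge> (0::real)" "z \<in> zset \<alpha> D H"
  then obtain c where c: "z = (\<Sum>i<D. ri (c i) * \<alpha> ^ i)" "(\<Sum>i<D. \<bar>ri (c i)\<bar>) \<le> H"
    by (auto simp: zset_def)
  obtain D' where D': "D = Suc D'" using D by (cases D) auto
  define c' where "c' i = (if i = 0 then 0 else c (i - 1)) + c D' * g i" for i
  have sh: "(\<Sum>i<D. x i * (if i = 0 then 0 else y (i - 1))) = (\<Sum>i<D'. x (Suc i) * y i)" for x y :: "nat => real"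
    unfolding D' by (subst sum.lessThan_Suc_shift) simp
  have "\<alpha> * z = (\<Sum>i<D'. \<alpha> ^ Suc i * ri (c i)) + ri (c D') * \<alpha> ^ D"
    unfolding c(1) D' by (simp add: sum_distrib_left algebra_simps)
  also have "... = (\<Sum>i<D. ri (c' i) * \<alpha> ^ i)"
  proof -
    have "ri (c' i) * \<alpha> ^ i = \<alpha> ^ i * (if i = 0 then 0 else ri (c (i - 1))) +
        ri (c D') * (ri (g i) * \<alpha> ^ i)" for i
      by (simp add: c'_def algebra_simps)
    then have "(\<Sum>i<D. ri (c' i) * \<alpha> ^ i) = (\<Sum>i<D. \<alpha> ^ i * (if i = 0 then 0 else ri (c (i - 1)))) +
        ri (c D') * (\<Sum>i<D. ri (g i) * \<alpha> ^ i)"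
      by (simp only: sum.distrib sum_distrib_left)
    then show ?thesis
      unfolding g using sh[of "\<lambda>i. \<alpha> ^ i" "\<lambda>i. ri (c i)"] by simp
  qed
  finally have 1: "\<alpha> * z = (\<Sum>i<D. ri (c' i) * \<alpha> ^ i)" .
  have "(\<Sum>i<D. \<bar>ri (c' i)\<bar>) \<le> (\<Sum>i<D. (if i = 0 then 0 else \<bar>ri (c (i - 1))\<bar>) + \<bar>ri (c D')\<bar> * \<bar>ri (g i)\<bar>)"
  proof (intro sum_mono)
    fix i
    have "\<bar>ri (c' i)\<bar> \<le> \<bar>ri (if i = 0 then 0 else c (i - 1))\<bar> + \<bar>ri (c D' * g i)\<bar>"
      unfolding c'_def by (metis abs_triangle_ineq of_int_add)
    then show "\<bar>ri (c' i)\<bar> \<le> (if i = 0 then 0 else \<bar>ri (c (i - 1))\<bar>) + \<bar>ri (c D')\<bar> * \<bar>ri (g i)\<bar>"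
      by (auto simp: abs_mult)
  qed
  also have "... = (\<Sum>i<D'. \<bar>ri (c i)\<bar>) + \<bar>ri (c D')\<bar> * (\<Sum>i<D. \<bar>ri (g i)\<bar>)"
    using sh[of "\<lambda>_. 1" "\<lambda>i. \<bar>ri (c i)\<bar>"] by (simp add: sum.distrib sum_distrib_left)
  also have "... \<le> H + H * (\<Sum>i<D. \<bar>ri (g i)\<bar>)"
  proof (intro add_mono mult_right_mono)
    have "(\<Sum>i<D. \<bar>ri (c i)\<bar>) = (\<Sum>i<D'. \<bar>ri (c i)\<bar>) + \<bar>ri (c D')\<bar>" by (simp add: D')
    moreover have "(\<Sum>i<D'. \<bar>ri (c i)\<bar>) \<ge> 0" by (intro sum_nonneg) auto
    ultimately show "(\<Sum>i<D'. \<bar>ri (c i)\<bar>) \<le> H" "\<bar>ri (c D')\<bar> \<le> H" using c(2) by linarith+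
  qed (intro sum_nonneg, auto)
  finally have 2: "(\<Sum>i<D. \<bar>ri (c' i)\<bar>) \<le> (1 + (\<Sum>i<D. \<bar>ri (g i)\<bar>)) * H" by (simp add: algebra_simps)
  show "\<alpha> * z \<in> zset \<alpha> D ((1 + (\<Sum>i<D. \<bar>ri (g i)\<bar>)) * H)"
    unfolding zset_def using 1 2 by blast
qed

lemma zmul_int: "zmul \<alpha> D \<bar>ri N\<bar> (ri N)"
  by (simp add: zmul_def zset_int_mult)

lemma zmul_mult:
  assumes "zmul \<alpha> D C c" "zmul \<alpha> D C' c'" "C' \<ge> 0"
  shows "zmul \<alpha> D (C * C') (c * c')"
  using assms unfolding zmul_def by (simp add: mult.assoc)

lemma zmul_mono:
  assumes "zmul \<alpha> D C c" "C \<le> C'"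
  shows "zmul \<alpha> D C' c"
  using assms unfolding zmul_def by (meson mult_right_mono zset_mono)

section \<open>The auxiliary polynomial\<close>

lemma coef_mult_Var: "coef (f * Var v) k = (if coef k v > 0 then coef f (k - mono1 v 1) else 0)"
proof (induction f rule: mp_induct)
  case (mono l c)
  have "l + mono1 v 1 = k \<longleftrightarrow> coef k v > 0 \<and> l = k - mono1 v 1"
  proof
    assume "l + mono1 v 1 = k"
    then show "coef k v > 0 \<and> l = k - mono1 v 1" by (auto simp: lookup_add)
  next
    assume "coef k v > 0 \<and> l = k - mono1 v 1"
    then show "l + mono1 v 1 = k"
      by (intro poly_mapping_eqI) (auto simp: lookup_add lookup_minus coef_mono1)
  qed
  then show ?case by (auto simp: Var_def mult_single coef_mono1)
next
  case (add f g)
  then show ?case by (simp add: distrib_right lookup_add)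
qed

text \<open>A linear substitution acting separately on each block: row i of the j-th matrix gives
  the image of the variable (j, i).\<close>

definition blin :: "nat => (nat => nat => nat => real) => nat \<times> nat => (nat \<times> nat) mp" where
  "blin n B v = (\<Sum>k<n. Const (B (fst v) (snd v) k) * Var (fst v, k))"

lemma subst_blin: "subst (blin n B) (blin n A v) = blin n (\<lambda>j i k. \<Sum>l<n. A j i l * B j l k) v"
proof -
  have "subst (blin n B) (blin n A v) = (\<Sum>l<n. \<Sum>k<n. Const (A (fst v) (snd v) l * B (fst v) l k) * Var (fst v, k))"
    by (simp add: blin_def subst_sum subst_mult sum_distrib_left Const_mult mult.assoc)
  also have "... = (\<Sum>k<n. \<Sum>l<n. Const (A (fst v) (snd v) l * B (fst v) l k) * Var (fst v, k))" by (rule sum.swap)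
  also have "... = blin n (\<lambda>j i k. \<Sum>l<n. A j i l * B j l k) v"
    by (simp add: blin_def Const_sum sum_distrib_right)
  finally show ?thesis .
qed

lemma blin_cong:
  "(\<And>k. k < n ==> A (fst v) (snd v) k = B (fst v) (snd v) k) ==> blin n A v = blin n B v"
  by (simp add: blin_def)

lemma blin_scaled_delta:
  assumes "snd v < n"
  shows "blin n (\<lambda>j i k. c * B j i k) v = Const c * blin n B v"
  by (simp add: blin_def sum_distrib_left Const_mult mult.assoc)

lemma intc_blin: "(\<And>k. k < n ==> B (fst v) (snd v) k \<in> \<int>) ==> intc (blin n B v)"
  unfolding blin_def by (intro intc_sum intc_mult intc_Const intc_Var) auto

lemma tdeg_eq_0: "tdeg e = 0 ==> e = 0"
  by (rule poly_mapping_eqI) (auto simp: tdeg_def in_keys_iff)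

text \<open>The linear forms are multiplied in one at a time. Each new coefficient is a sum of n
  terms, a matrix entry times an earlier coefficient, so every factor enlarges the size by n
  Ca.\<close>

lemma mpow_blin_zset:
  assumes D: "D \<ge> 1" and Ca: "Ca \<ge> 0" and zm: "\<And>i k. i < n ==> k < n ==> zmul \<alpha> D Ca (A i k)"
  shows "supp e \<subseteq> UNIV \<times> {..<n} ==> coef (mpow (blin n (\<lambda>_. A)) e) e' \<in> zset \<alpha> D ((real n * Ca) ^ tdeg e)"
proof (induction "tdeg e" arbitrary: e e')
  case 0
  then have "e = 0" using tdeg_eq_0 by metis
  then show ?case using zset_1[OF D, of \<alpha>] zset_0[of 1 \<alpha> D] by (simp add: lookup_one when_def tdeg_def)
next
  case (Suc t)
  then have "e \<noteq> 0" by (auto simp: tdeg_def)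
  then obtain v where v: "v \<in> supp e" by (metis all_not_in_conv keys_eq_empty)
  define e0 where "e0 = e - mono1 v 1"
  have e: "e = e0 + mono1 v 1"
    using v by (intro poly_mapping_eqI) (auto simp: e0_def lookup_add lookup_minus coef_mono1 in_keys_iff)
  have t: "tdeg e0 = t" using Suc(2) tdeg_add_mono1[of e0 v 1] e by simp
  have "supp e0 \<subseteq> supp e" by (auto simp: e0_def in_keys_iff lookup_minus)
  then have sub: "supp e0 \<subseteq> UNIV \<times> {..<n}" "snd v < n"
    using Suc.prems v by auto
  let ?F = "mpow (blin n (\<lambda>_. A)) e0"
  have "mpow (blin n (\<lambda>_. A)) e = ?F * blin n (\<lambda>_. A) v" by (simp add: e mpow_add mpow_mono1)
  also have "... = (\<Sum>k<n. Const (A (snd v) k) * (?F * Var (fst v, k)))"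
    by (simp add: blin_def sum_distrib_left mult_ac)
  finally have "coef (mpow (blin n (\<lambda>_. A)) e) e' =
      (\<Sum>k<n. A (snd v) k * (if coef e' (fst v, k) > 0 then coef ?F (e' - mono1 (fst v, k) 1) else 0))"
    by (simp add: lookup_sum coef_Const_mult coef_mult_Var)
  also have "... \<in> zset \<alpha> D (\<Sum>k<n. Ca * (real n * Ca) ^ t)"
  proof (rule zset_sum)
    fix k assume k: "k \<in> {..<n}"
    have pos: "(real n * Ca) ^ t \<ge> 0" using Ca by simp
    have "(if coef e' (fst v, k) > 0 then coef ?F (e' - mono1 (fst v, k) 1) else 0) \<in> zset \<alpha> D ((real n * Ca) ^ t)"
      using Suc(1)[of e0] t sub(1) pos zset_0 by auto
    then show "A (snd v) k * (if coef e' (fst v, k) > 0 then coef ?F (e' - mono1 (fst v, k) 1) else 0) \<in> zset \<alpha> D (Ca * (real n * Ca) ^ t)"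
      using zm[OF sub(2), of k] k pos unfolding zmul_def by blast
  qed simp
  also have "(\<Sum>k<n. Ca * (real n * Ca) ^ t) = (real n * Ca) ^ tdeg e" using Suc(2) by (simp flip: Suc(2))
  finally show ?case .
qed

lemma supp_le_power:
  assumes h: "\<And>k l. h (k + l) = h k + h l" and "supp_le h c f"
  shows "supp_le h (real n * c) (f ^ n)"
  using supp_le_prod[OF h, of "{..<n}" "\<lambda>_. c" "\<lambda>_. f"] assms by simp

lemma supp_le_mpow:
  assumes h: "\<And>k l. h (k + l) = h k + h l" and "\<And>v. v \<in> supp e ==> supp_le h (c v) (\<phi> v)"
  shows "supp_le h (\<Sum>v\<in>supp e. real (coef e v) * c v) (mpow \<phi> e)"
  unfolding mpow_def by (intro supp_le_prod[OF h] supp_le_power[OF h] assms)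

lemma supp_le_Const_mult:
  assumes h: "\<And>k l. h (k + l) = h k + h l" and "supp_le h c f"
  shows "supp_le h c (Const a * f)"
proof -
  have h0: "h 0 = 0" using h[of 0 0] by simp
  have "supp_le h 0 (Const a)" by (auto simp: supp_le_def Const_def h0 split: if_splits)
  then show ?thesis using supp_le_mult[OF h, of 0 "Const a" c f] assms(2) by simp
qed

lemma supp_le_subst:
  assumes h: "\<And>k l. h (k + l) = h k + h l" and "\<And>k. k \<in> supp f ==> supp_le h c (mpow \<phi> k)"
  shows "supp_le h c (subst \<phi> f)"
  unfolding subst_def by (intro supp_le_sum supp_le_Const_mult[OF h] assms)

lemma supp_le_blin:
  assumes h: "\<And>k l. h (k + l) = h k + h l" and "\<And>k. k < n ==> B (fst v) (snd v) k \<noteq> 0 ==> h (mono1 (fst v, k) 1) \<le> c"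
  shows "supp_le h c (blin n B v)"
  unfolding blin_def
proof (intro supp_le_sum)
  fix k assume k: "k \<in> {..<n}"
  show "supp_le h c (Const (B (fst v) (snd v) k) * Var (fst v, k))"
    using assms(2)[of k] k by (auto simp: supp_le_def Var_def Const_mono1 split: if_splits)
qed

lemma sum_supp_EM:
  assumes "e \<in> EM n m d"
  shows "(\<Sum>v\<in>supp e. real (coef e v) * c v) = (\<Sum>j<m. \<Sum>i<n. real (coef e (j, i)) * c (j, i))"
proof -
  have "(\<Sum>v\<in>supp e. real (coef e v) * c v) = (\<Sum>v\<in>{..<m} \<times> {..<n}. real (coef e v) * c v)"
    using assms by (intro sum.mono_neutral_left) (auto simp: EM_def in_keys_iff)
  then show ?thesis by (simp add: sum.cartesian_product)
qed

lemma EM_sum: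
  assumes "e \<in> EM n m d" "j < m"
  shows "(\<Sum>i<n. real (coef e (j, i))) = real (d j)"
proof -
  from assms have "(\<Sum>i<n. coef e (j, i)) = d j" by (simp add: EM_def)
  from arg_cong[OF this, of real] show ?thesis by simp
qed

text \<open>The degree in each block is preserved. Equality comes from upper bounds for this degree
  and for its negative, the cases s = 1 and s = -1.\<close>

lemma supp_mpow_blin_EM:
  assumes e: "e \<in> EM n m d"
  shows "supp (mpow (blin n B) e) \<subseteq> EM n m d"
proof
  fix k assume k: "k \<in> supp (mpow (blin n B) e)"
  have "in_vars ({..<m} \<times> {..<n}) (mpow (blin n B) e)"
    unfolding blin_def using e by (intro in_vars_mpow in_vars_sum in_vars_mult in_vars_Const in_vars_Var) (auto simp: EM_def)
  then have 1: "supp k \<subseteq> {..<m} \<times> {..<n}" using k by (auto simp: in_vars_def)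
  have "(\<Sum>i<n. coef k (j, i)) = d j" if j: "j < m" for j
  proof -
    define h where "h s k = s * real (\<Sum>i<n. coef k (j, i))" for s :: real and k :: bkey
    have hadd: "h s (k + l) = h s k + h s l" for s k l by (simp add: h_def lookup_add sum.distrib algebra_simps)
    have hm: "h s (mono1 (j', i) (Suc 0)) = (if j' = j then s else 0)" if "i < n" for s j' i
      using that by (auto simp: h_def coef_mono1 simp del: of_nat_sum)
    have "supp_le (h s) (\<Sum>v\<in>supp e. real (coef e v) * (if fst v = j then s else 0)) (mpow (blin n B) e)" for s
      by (intro supp_le_mpow hadd supp_le_blin) (auto simp: hm)
    moreover have "(\<Sum>v\<in>supp e. real (coef e v) * (if fst v = j then s else 0)) = s * real (d j)" for s
    proof -
      have "(\<Sum>v\<in>supp e. real (coef e v) * (if fst v = j then s else 0)) = (\<Sum>j'<m. if j' = j then (\<Sum>i<n. real (coef e (j', i)) * s) else 0)"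
        unfolding sum_supp_EM[OF e] by (intro sum.cong refl) auto
      also have "... = s * real (d j)" using j EM_sum[OF e j] by (simp flip: sum_distrib_right)
      finally show ?thesis .
    qed
    ultimately have "h s k \<le> s * real (d j)" for s using k by (auto simp: supp_le_def)
    from this[of 1] this[of "-1"] have "real (\<Sum>i<n. coef k (j, i)) = real (d j)" unfolding h_def by linarith
    then show ?thesis by (simp only: of_nat_eq_iff)
  qed
  with 1 show "k \<in> EM n m d" by (simp add: EM_def)
qed

lemma tdeg_EM: "e \<in> EM n m d ==> tdeg e = (\<Sum>j<m. d j)"
proof -
  assume e: "e \<in> EM n m d"
  have "tdeg e = (\<Sum>v\<in>{..<m} \<times> {..<n}. coef e v)" using e by (intro tdeg_superset) (auto simp: EM_def)
  also have "... = (\<Sum>j<m. \<Sum>i<n. coef e (j, i))" by (simp add: sum.cartesian_product)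
  also have "... = (\<Sum>j<m. d j)" using e by (intro sum.cong) (auto simp: EM_def)
  finally show ?thesis .
qed

lemma mpow_const_tdeg: "mpow (\<lambda>_. c) e = c ^ tdeg e"
  by (simp add: mpow_def tdeg_def power_sum)

text \<open>P has integral coefficients in the original coordinates, and the substitution rewrites
  it in terms of the linear forms. A coefficient of the result lies in Z[\<alpha>], and its
  vanishing is ensured by D integral equations, one for each power of \<alpha>. Hence 2 D times the
  number of bad exponents has to be at most the number of unknowns.\<close>

lemma auxiliary_polynomial:
  assumes D: "D \<ge> 1" and n: "n \<ge> 1" and Ca: "Ca \<ge> 1"
    and zm: "\<And>i k. i < n ==> k < n ==> zmul \<alpha> D Ca (A i k)"
    and bad: "bad \<subseteq> EM n m d" "2 * (D * card bad) \<le> card (EM n m d)"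
  defines "s \<equiv> (\<Sum>j<m. d j)"
  obtains P where "P \<noteq> 0" "intc P" "supp P \<subseteq> EM n m d"
    "\<And>k. \<bar>coef P k\<bar> \<le> 2 * real (card (EM n m d)) * (2 * (real n * Ca) ^ s)"
    "\<And>e'. e' \<in> bad ==> coef (subst (blin n (\<lambda>_. A)) P) e' = 0"
proof -
  let ?M = "EM n m d"
  let ?\<phi> = "blin n (\<lambda>_. A)"
  have fin: "finite ?M" "finite bad" using EM_finite bad(1) finite_subset by blast+
  have ex: "\<exists>c :: nat => int. e \<in> ?M \<longrightarrow> coef (mpow ?\<phi> e) e' = (\<Sum>i<D. ri (c i) * \<alpha> ^ i) \<and>
      (\<Sum>i<D. \<bar>ri (c i)\<bar>) \<le> (real n * Ca) ^ s" for e e'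
  proof (cases "e \<in> ?M")
    case True
    have "coef (mpow ?\<phi> e) e' \<in> zset \<alpha> D ((real n * Ca) ^ tdeg e)"
      using True Ca by (intro mpow_blin_zset[OF D _ zm]) (auto simp: EM_def)
    then show ?thesis unfolding tdeg_EM[OF True] s_def zset_def by blast
  qed simp
  have "\<forall>x. \<exists>c :: nat => int. fst x \<in> ?M \<longrightarrow> coef (mpow ?\<phi> (fst x)) (snd x) = (\<Sum>i<D. ri (c i) * \<alpha> ^ i) \<and>
      (\<Sum>i<D. \<bar>ri (c i)\<bar>) \<le> (real n * Ca) ^ s" by (intro allI ex)
  from choice[OF this] obtain cf' where
    cf': "\<forall>x. fst x \<in> ?M \<longrightarrow> coef (mpow ?\<phi> (fst x)) (snd x) = (\<Sum>i<D. ri (cf' x i) * \<alpha> ^ i) \<and>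
      (\<Sum>i<D. \<bar>ri (cf' x i)\<bar>) \<le> (real n * Ca) ^ s" ..
  define cf where "cf e e' = cf' (e, e')" for e e'
  have cf: "coef (mpow ?\<phi> e) e' = (\<Sum>i<D. ri (cf e e' i) * \<alpha> ^ i) \<and>
      (\<Sum>i<D. \<bar>ri (cf e e' i)\<bar>) \<le> (real n * Ca) ^ s" if "e \<in> ?M" for e e'
    using cf'[rule_format, of "(e, e')"] that by (simp add: cf_def)
  have nCa: "real n * Ca \<ge> 1" using n Ca by (simp add: mult_ge1_I)
  then have nCas: "(real n * Ca) ^ s \<ge> 1" by (simp add: one_le_power)
  define T where "T = \<lceil>(real n * Ca) ^ s\<rceil>"
  have T1: "T \<ge> 1" using nCas by (simp add: T_def)
  have T2: "ri T \<le> 2 * (real n * Ca) ^ s" using nCas unfolding T_def by linarith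
  have bnd: "\<bar>cf e (fst y) (snd y)\<bar> \<le> T" if "e \<in> ?M" "y \<in> bad \<times> {..<D}" for e y
  proof -
    have "\<bar>ri (cf e (fst y) (snd y))\<bar> \<le> (\<Sum>i<D. \<bar>ri (cf e (fst y) i)\<bar>)"
      using that(2) by (intro member_le_sum) auto
    also have "... \<le> (real n * Ca) ^ s" using cf[OF that(1)] by blast
    finally show ?thesis unfolding T_def by linarith
  qed
  have finY: "finite (bad \<times> {..<D})" using fin by simp
  have card: "2 * card (bad \<times> {..<D}) \<le> card ?M" using bad(2) by (simp add: card_cartesian_product mult.commute)
  obtain p where p: "\<exists>x\<in>?M. p x \<noteq> 0" "\<And>x. \<bar>p x\<bar> \<le> 2 * int (card ?M) * T"
    "\<And>x. x \<notin> ?M ==> p x = 0" "\<And>y. y \<in> bad \<times> {..<D} ==> (\<Sum>x\<in>?M. cf x (fst y) (snd y) * p x) = 0"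
    by (rule siegel[OF fin(1) finY EM_nonempty[OF n] card T1, where c = "\<lambda>y x. cf x (fst y) (snd y)"])
       (use bnd in \<open>blast+\<close>)
  define P where "P = (\<Sum>e\<in>?M. mono1 e (ri (p e)))"
  have cP: "coef P k = ri (p k)" for k
    using fin(1) p(3)[of k] by (simp add: P_def lookup_sum coef_mono1)
  show ?thesis
  proof (rule that[of P])
    show "P \<noteq> 0" using p(1) cP by (metis lookup_zero of_int_eq_0_iff)
    show "intc P" by (simp add: intc_def cP)
    show sub: "supp P \<subseteq> ?M" by (auto simp: in_keys_iff cP) (use p(3) in blast)
    show "\<bar>coef P k\<bar> \<le> 2 * real (card ?M) * (2 * (real n * Ca) ^ s)" for k
    proof -
      have "\<bar>coef P k\<bar> = ri \<bar>p k\<bar>" by (simp add: cP)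
      also have "... \<le> ri (2 * int (card ?M) * T)" using p(2) by (simp only: of_int_le_iff)
      also have "... = 2 * real (card ?M) * ri T" by simp
      also have "... \<le> 2 * real (card ?M) * (2 * (real n * Ca) ^ s)" using T2 by (intro mult_left_mono) auto
      finally show ?thesis .
    qed
    show "coef (subst ?\<phi> P) e' = 0" if e': "e' \<in> bad" for e'
    proof -
      have "coef (subst ?\<phi> P) e' = (\<Sum>e\<in>?M. ri (p e) * coef (mpow ?\<phi> e) e')"
        by (simp add: subst_superset[OF fin(1) sub] lookup_sum coef_Const_mult cP)
      also have "... = (\<Sum>e\<in>?M. \<Sum>i<D. ri (p e * cf e e' i) * \<alpha> ^ i)"
        using cf by (intro sum.cong refl) (simp add: sum_distrib_left mult_ac)
      also have "... = (\<Sum>i<D. \<Sum>e\<in>?M. ri (p e * cf e e' i) * \<alpha> ^ i)" by (rule sum.swap)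
      also have "... = (\<Sum>i<D. ri (\<Sum>e\<in>?M. cf e e' i * p e) * \<alpha> ^ i)"
        by (simp add: sum_distrib_right sum_distrib_left mult_ac)
      also have "... = 0" using p(4)[of "(e', _)"] e' by (intro sum.neutral) auto
      finally show ?thesis .
    qed
  qed
qed

section \<open>Restriction to a pair of coordinates in each block\<close>

definition bidx :: "(nat => real) => nat => bkey => real" where
  "bidx d m k = (\<Sum>j<m. real (coef k (j, 0)) / d j)"

lemma bidx_add: "bidx d m (k + l) = bidx d m k + bidx d m l"
  by (simp add: bidx_def lookup_add add_divide_distrib sum.distrib)

definition bproj :: "nat => bkey => (nat \<Rightarrow>\<^sub>0 nat)" where
  "bproj m k = (\<Sum>j<m. mono1 j (coef k (j, 0)))"

lemma coef_bproj: "coef (bproj m k) j = (if j < m then coef k (j, 0) else 0)"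
  by (simp add: bproj_def lookup_sum coef_mono1)

lemma bidx_bproj: "bidx d m k = widx d m (bproj m k)"
  by (simp add: bidx_def widx_def coef_bproj)

definition odeg :: "nat => nat => bkey => real" where
  "odeg n m k = (\<Sum>j<m. \<Sum>i\<in>{2..<n}. real (coef k (j, i)))"

lemma odeg_add: "odeg n m (k + l) = odeg n m k + odeg n m l"
  by (simp add: odeg_def lookup_add sum.distrib)

lemma supp_le_neg_mono: "supp_le h c f ==> c \<le> c' ==> supp_le h c' f"
  by (auto simp: supp_le_def intro: order_trans)

lemma supp_le_add: "supp_le h c f ==> supp_le h c g ==> supp_le h c (f + g)"
  unfolding supp_le_def using keys_add[of f g] by blast

text \<open>A change of every factor by terms of weight one lower changes the product only by terms
  of weight one lower, through F' G' - F G = (F' - F) G' + F (G' - G).\<close>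

lemma mpow_perturb:
  assumes h: "\<And>k l. h (k + l) = h k + h l"
    and "\<And>v. v \<in> supp e ==> supp_le h (c v) (\<phi> v)" "\<And>v. v \<in> supp e ==> supp_le h (c v - 1) (\<psi> v - \<phi> v)"
  shows "supp_le h ((\<Sum>v\<in>supp e. real (coef e v) * c v) - 1) (mpow \<psi> e - mpow \<phi> e)"
proof -
  have mult: "supp_le h (a + b - 1) (F' * G' - F * G)"
    if "supp_le h a F" "supp_le h (a - 1) (F' - F)" "supp_le h b G" "supp_le h (b - 1) (G' - G)" for a b F F' G G'
  proof -
    have G': "supp_le h b G'"
      using supp_le_add[OF that(3) supp_le_neg_mono[OF that(4), of b]] by simp
    have "supp_le h (a - 1 + b) ((F' - F) * G')" by (intro supp_le_mult[OF h] that G')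
    moreover have "supp_le h (a + (b - 1)) (F * (G' - G))" by (intro supp_le_mult[OF h] that)
    ultimately have "supp_le h (a + b - 1) ((F' - F) * G' + F * (G' - G))"
      by (intro supp_le_add) (simp_all add: algebra_simps)
    then show ?thesis by (simp add: algebra_simps)
  qed
  have pow: "supp_le h (real N * a - 1) (F' ^ N - F ^ N)" if "supp_le h a F" "supp_le h (a - 1) (F' - F)" for a F F' N
  proof (induction N)
    case 0
    then show ?case by (simp add: supp_le_def)
  next
    case (Suc N)
    have "supp_le h (a + real N * a - 1) (F' * F' ^ N - F * F ^ N)"
      by (intro mult that Suc supp_le_power[OF h])
    then show ?case by (simp add: algebra_simps)
  qed
  have "supp_le h ((\<Sum>v\<in>A. real (coef e v) * c v) - 1) ((\<Prod>v\<in>A. \<psi> v ^ coef e v) - (\<Prod>v\<in>A. \<phi> v ^ coef e v))"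
    if "finite A" "A \<subseteq> supp e" for A
    using that
  proof (induction A)
    case empty
    then show ?case by (simp add: supp_le_def)
  next
    case (insert x A)
    have "supp_le h (real (coef e x) * c x + (\<Sum>v\<in>A. real (coef e v) * c v) - 1)
        (\<psi> x ^ coef e x * (\<Prod>v\<in>A. \<psi> v ^ coef e v) - \<phi> x ^ coef e x * (\<Prod>v\<in>A. \<phi> v ^ coef e v))"
      using insert assms(2,3)
      by (intro mult supp_le_power[OF h] supp_le_prod[OF h] pow) auto
    then show ?case using insert.hyps by simp
  qed
  from this[of "supp e"] show ?thesis by (simp add: mpow_def)
qed


lemma mpow_bproj:
  assumes "supp e \<subseteq> {..<m} \<times> {..<n}"
  shows "mpow (\<lambda>v. if snd v = 0 then g (fst v) else 1) e = mpow g (bproj m e)"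
proof -
  have "mpow (\<lambda>v. if snd v = 0 then g (fst v) else 1) e = (\<Prod>v\<in>{..<m} \<times> {..<n}. (if snd v = 0 then g (fst v) else 1) ^ coef e v)"
    using assms by (intro mpow_superset) auto
  also have "... = (\<Prod>v\<in>(\<lambda>j. (j, 0)) ` {..<m} \<inter> {..<m} \<times> {..<n}. (if snd v = 0 then g (fst v) else 1) ^ coef e v)"
    by (rule prod.mono_neutral_right) auto
  also have "... = (\<Prod>v\<in>(\<lambda>j. (j, 0)) ` {..<m}. (if snd v = 0 then g (fst v) else 1) ^ coef e v)"
  proof (rule prod.mono_neutral_left)
    show "\<forall>v\<in>(\<lambda>j. (j, 0)) ` {..<m} - (\<lambda>j. (j, 0)) ` {..<m} \<inter> {..<m} \<times> {..<n}.
        (if snd v = 0 then g (fst v) else 1) ^ coef e v = 1"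
    proof
      fix v assume "v \<in> (\<lambda>j. (j, 0::nat)) ` {..<m} - (\<lambda>j. (j, 0)) ` {..<m} \<inter> {..<m} \<times> {..<n}"
      then have "v \<notin> supp e" using assms by auto
      then show "(if snd v = 0 then g (fst v) else 1) ^ coef e v = 1" by (simp add: in_keys_iff)
    qed
  qed auto
  also have "... = (\<Prod>j<m. g j ^ coef e (j, 0))" by (subst prod.reindex) (auto simp: inj_on_def)
  also have "... = (\<Prod>j<m. g j ^ coef (bproj m e) j)" by (intro prod.cong) (auto simp: coef_bproj)
  also have "... = mpow g (bproj m e)"
    by (intro mpow_superset[symmetric]) (auto simp: in_keys_iff coef_bproj split: if_splits)
  finally show ?thesis .
qed

text \<open>Deleting the coordinates from 2 on could annihilate P. Instead the terms with one fixed
  pattern of exponents in these coordinates are kept, of least total degree there, and coordinate 1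
  is set to 1, which homogeneity permits. \<open>Psi\<close> makes the linear form of the
  hyperplane, divided by \<open>h j 0\<close>, the new coordinate 0, so that the index along the
  hyperplanes becomes the index of R at the point of the ratios
  \<open>- h j 1 / h j 0\<close>.\<close>

lemma pair_restriction:
  fixes P :: "(nat \<times> nat) mp" and h :: "nat => nat => real" and d :: "nat => nat"
  defines "Psi \<equiv> (\<lambda>j i k. if i = 0 then (if k = 0 then 1 else - h j k / h j 0) else if i = k then 1 else (0::real))"
  assumes n: "n \<ge> 2" and P: "P \<noteq> 0" "intc P" "supp P \<subseteq> EM n m d"
    and \<theta>: "supp_le (\<lambda>k. - bidx dr m k) (- \<theta>) (subst (blin n Psi) P)"
  obtains R where "R \<noteq> 0" "intc R" "in_vars {..<m} R" "\<And>k j. k \<in> supp R ==> j < m ==> coef k j \<le> d j"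
    "l1norm R \<le> l1norm P" "\<And>k. k \<in> supp (shift (\<lambda>j. - h j 1 / h j 0) R) ==> \<theta> \<le> widx dr m k"
proof -
  define \<beta> where "\<beta> j = - h j 1 / h j 0" for j
  define Psi0 where "Psi0 j i k = (if i = 0 then (if k = 0 then 1 else if k = 1 then \<beta> j else 0) else if i = k then 1 else (0::real))" for j i k :: nat
  have "Min (odeg n m ` supp P) \<in> odeg n m ` supp P" using P(1) by (intro Min_in) auto
  then obtain e0 where e0: "e0 \<in> supp P" "odeg n m e0 = Min (odeg n m ` supp P)" by force
  have e0min: "odeg n m e0 \<le> odeg n m e" if "e \<in> supp P" for e
    using that unfolding e0(2) by (intro Min_le) auto
  define same where "same k \<longleftrightarrow> (\<forall>j<m. \<forall>i\<in>{2..<n}. coef k (j, i) = coef e0 (j, i))" for k :: bkey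
  have same_odeg: "odeg n m k = odeg n m e0" if "same k" for k
    using that by (simp add: odeg_def same_def)
  \<comment> \<open>Keeps the terms with the pattern of \<open>e0\<close> in the coordinates from 2
    on and records only the exponents of coordinate 0, that is, it sets all other variables to
    1.\<close>
  define X where "X F = (\<Sum>k\<in>{k\<in>supp F. same k}. mono1 (bproj m k) (coef F k))" for F :: "(nat \<times> nat) mp"
  have Xsup: "X F = (\<Sum>k\<in>{k\<in>B. same k}. mono1 (bproj m k) (coef F k))" if "finite B" "supp F \<subseteq> B" for F B
    unfolding X_def using that by (intro sum.mono_neutral_left) (auto simp: in_keys_iff)
  have Xadd: "X (F + G) = X F + X G" for F G
    using keys_add[of F G]
    by (subst (1 2 3) Xsup[where B = "supp F \<union> supp G"]) (auto simp: lookup_add single_add sum.distrib)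
  have X0: "X F = 0" if "\<And>k. k \<in> supp F ==> \<not> same k" for F
    unfolding X_def using that by (intro sum.neutral) auto
  have Xsum: "X (sum G A) = (\<Sum>i\<in>A. X (G i))" for G :: "bkey => (nat \<times> nat) mp" and A
  proof -
    have "X 0 = 0" by (simp add: X_def)
    then show ?thesis by (induction A rule: infinite_finite_induct) (simp_all add: Xadd)
  qed
  have XC: "X (Const c * F) = Const c * X F" for c F
  proof -
    have "supp (Const c * F) \<subseteq> supp F" by (auto simp: in_keys_iff coef_Const_mult)
    then show ?thesis
      by (subst (1 2) Xsup[where B = "supp F"]) (auto simp: coef_Const_mult sum_distrib_left Const_mono1)
  qed
  have PE: "e \<in> EM n m d" if "e \<in> supp P" for e using P(3) that by blast
  \<comment> \<open>\<open>Psi0\<close> is \<open>Psi\<close> without the entries of row 0 beyond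
    column 1. The difference has higher degree in the coordinates from 2 on and is invisible to
    \<open>X\<close> by the minimality of \<open>e0\<close>.\<close>
  have main: "X (mpow (blin n Psi) e) = (if same e then shift \<beta> (mono1 (bproj m e) 1) else 0)" if e: "e \<in> supp P" for e
  proof -
    let ?F = "mpow (blin n Psi) e" and ?G = "mpow (blin n Psi0) e"
    have eE: "e \<in> EM n m d" by (rule PE[OF e])
    have vE: "fst v < m" "snd v < n" if "v \<in> supp e" for v using eE that by (auto simp: EM_def)
    have om: "odeg n m (mono1 (j, i) (Suc 0)) = (if j < m \<and> 2 \<le> i \<and> i < n then 1 else 0)" for j i
    proof -
      have "odeg n m (mono1 (j, i) (Suc 0)) = (\<Sum>j'<m. \<Sum>i'\<in>{2..<n}. if j = j' \<and> i = i' then 1 else 0)"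
        unfolding odeg_def by (intro sum.cong refl) (auto simp: coef_mono1)
      also have "... = (\<Sum>j'<m. if j = j' then (if 2 \<le> i \<and> i < n then 1 else 0) else 0)"
        by (intro sum.cong refl) (auto cong: if_cong)
      also have "... = (if j < m \<and> 2 \<le> i \<and> i < n then 1 else 0)" by simp
      finally show ?thesis .
    qed
    define c where "c v = (if 2 \<le> snd v then -1 else (0::real))" for v :: "nat \<times> nat"
    have "(\<Sum>v\<in>supp e. real (coef e v) * c v) = - odeg n m e"
    proof -
      have "(\<Sum>i<n. real (coef e (j, i)) * c (j, i)) = (\<Sum>i\<in>{2..<n}. - real (coef e (j, i)))" for j
        by (rule sum.mono_neutral_cong_right) (auto simp: c_def)
      then show ?thesis unfolding sum_supp_EM[OF eE] by (simp add: odeg_def sum_negf)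
    qed
    moreover have "supp_le (\<lambda>k. - odeg n m k) ((\<Sum>v\<in>supp e. real (coef e v) * c v) - 1) (?F - ?G)"
    proof (rule mpow_perturb[where c = c and \<phi> = "blin n Psi0" and \<psi> = "blin n Psi"])
      fix v assume v: "v \<in> supp e"
      show "supp_le (\<lambda>k. - odeg n m k) (c v) (blin n Psi0 v)"
        by (rule supp_le_blin) (use vE[OF v] in \<open>auto simp: odeg_add om c_def Psi0_def split: if_splits\<close>)
    next
      fix v assume v: "v \<in> supp e"
      have "blin n Psi v - blin n Psi0 v = blin n (\<lambda>j i k. Psi j i k - Psi0 j i k) v"
        unfolding blin_def sum_subtractf[symmetric]
        by (intro sum.cong refl poly_mapping_eqI) (simp add: lookup_minus coef_Const_mult left_diff_distrib)
      moreover have "supp_le (\<lambda>k. - odeg n m k) (c v - 1) (blin n (\<lambda>j i k. Psi j i k - Psi0 j i k) v)"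
        by (rule supp_le_blin) (use vE[OF v] in \<open>auto simp: odeg_add om c_def Psi_def Psi0_def \<beta>_def split: if_splits\<close>)
      ultimately show "supp_le (\<lambda>k. - odeg n m k) (c v - 1) (blin n Psi v - blin n Psi0 v)" by simp
    qed (simp add: odeg_add)
    ultimately have 1: "odeg n m e + 1 \<le> odeg n m k" if "k \<in> supp (?F - ?G)" for k
      using that by (force simp: supp_le_def)
    have "X (?F - ?G) = 0"
      using 1 same_odeg e0min[OF e] by (intro X0) force
    moreover have "X ?F = X (?F - ?G) + X ?G" by (simp flip: Xadd)
    ultimately have XF: "X ?F = X ?G" by simp
    have agree: "coef k (j, i) = coef e (j, i)" if k: "k \<in> supp ?G" and ji: "j < m" "i \<in> {2..<n}" for k j i
    proof -
      have "supp_le (\<lambda>k. s * real (coef k (j, i))) (\<Sum>v\<in>supp e. real (coef e v) * (if v = (j, i) then s else 0)) ?G" for s :: real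
        by (rule supp_le_mpow)
           (use ji in \<open>auto simp: lookup_add algebra_simps coef_mono1 Psi0_def split: if_splits intro!: supp_le_blin\<close>)
      moreover have "(\<Sum>v\<in>supp e. real (coef e v) * (if v = (j, i) then s else 0)) = s * real (coef e (j, i))" for s
        by (auto simp: if_distrib in_keys_iff cong: if_cong)
      ultimately have "s * real (coef k (j, i)) \<le> s * real (coef e (j, i))" for s using k by (auto simp: supp_le_def)
      from this[of 1] this[of "-1"] show ?thesis by simp
    qed
    show ?thesis
    proof (cases "same e")
      case False
      then have "\<not> same k" if "k \<in> supp ?G" for k using agree[OF that] by (auto simp: same_def)
      then show ?thesis using XF X0 False by simp
    next
      case True
      then have sm: "same k" if "k \<in> supp ?G" for k using agree[OF that] by (auto simp: same_def)
      define \<rho> where "\<rho> v = (if snd v = 0 then Var (fst v) else 1)" for v :: "nat \<times> nat"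
      have kE: "supp k \<subseteq> {..<m} \<times> {..<n}" if "k \<in> supp ?G" for k
        using supp_mpow_blin_EM[OF eE, of Psi0] that by (auto simp: EM_def)
      have "{k \<in> supp ?G. same k} = supp ?G" using sm by blast
      then have "X ?G = (\<Sum>k\<in>supp ?G. mono1 (bproj m k) (coef ?G k))" by (simp add: X_def)
      also have "... = subst \<rho> ?G"
        unfolding subst_def
      proof (intro sum.cong refl)
        fix k assume k: "k \<in> supp ?G"
        have "mpow \<rho> k = mono1 (bproj m k) 1"
          using mpow_bproj[OF kE[OF k], of Var] by (simp add: \<rho>_def[abs_def] mpow_Var)
        then show "mono1 (bproj m k) (coef ?G k) = Const (coef ?G k) * mpow \<rho> k" by (simp add: Const_mono1)
      qed
      also have "... = mpow (\<lambda>v. subst \<rho> (blin n Psi0 v)) e" by (rule subst_mpow)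
      also have "... = mpow (\<lambda>v. if snd v = 0 then Var (fst v) + Const (\<beta> (fst v)) else 1) e"
      proof (rule mpow_cong)
        fix v assume v: "v \<in> supp e"
        have "subst \<rho> (blin n Psi0 v) = (\<Sum>k<n. Const (Psi0 (fst v) (snd v) k) * \<rho> (fst v, k))"
          by (simp add: blin_def subst_sum subst_mult)
        also have "... = (if snd v = 0 then Var (fst v) + Const (\<beta> (fst v)) else 1)"
        proof (cases "snd v = 0")
          case True
          have "(\<Sum>k<n. Const (Psi0 (fst v) (snd v) k) * \<rho> (fst v, k)) = (\<Sum>k\<in>{0, 1}. Const (Psi0 (fst v) (snd v) k) * \<rho> (fst v, k))"
            using n True by (intro sum.mono_neutral_right) (auto simp: Psi0_def)
          then show ?thesis using True by (simp add: Psi0_def \<rho>_def)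
        next
          case False
          have "(\<Sum>k<n. Const (Psi0 (fst v) (snd v) k) * \<rho> (fst v, k)) = (\<Sum>k\<in>{snd v}. Const (Psi0 (fst v) (snd v) k) * \<rho> (fst v, k))"
            using vE[OF v] False by (intro sum.mono_neutral_right) (auto simp: Psi0_def)
          then show ?thesis using False by (simp add: Psi0_def \<rho>_def)
        qed
        finally show "subst \<rho> (blin n Psi0 v) = (if snd v = 0 then Var (fst v) + Const (\<beta> (fst v)) else 1)" .
      qed
      also have "... = mpow (\<lambda>j. Var j + Const (\<beta> j)) (bproj m e)"
        using eE by (intro mpow_bproj[where n = n]) (auto simp: EM_def)
      also have "... = shift \<beta> (mono1 (bproj m e) 1)" by (simp add: shift_def subst_mono1)
      finally show ?thesis using XF True by simp
    qed
  qed
  define R where "R = X P"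
  have "X (subst (blin n Psi) P) = (\<Sum>e\<in>supp P. Const (coef P e) * X (mpow (blin n Psi) e))"
    unfolding subst_def by (simp add: Xsum XC)
  also have "... = (\<Sum>e\<in>{e\<in>supp P. same e}. Const (coef P e) * shift \<beta> (mono1 (bproj m e) 1))"
    by (rule sum.mono_neutral_cong_right) (auto simp: main)
  also have "... = shift \<beta> R"
    unfolding R_def X_def shift_def by (simp add: subst_sum subst_mono1)
  finally have XR: "X (subst (blin n Psi) P) = shift \<beta> R" .
  have Xkeys: "\<exists>k\<in>supp F. same k \<and> l = bproj m k" if "l \<in> supp (X F)" for l F
  proof -
    have "(\<Sum>k\<in>{k\<in>supp F. same k}. coef (mono1 (bproj m k) (coef F k)) l) \<noteq> 0"
      using that by (simp add: X_def in_keys_iff lookup_sum)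
    then obtain k where "k \<in> {k\<in>supp F. same k}" "coef (mono1 (bproj m k) (coef F k)) l \<noteq> 0"
      by (rule sum.not_neutral_contains_not_neutral) blast
    then show ?thesis by (auto simp: coef_mono1 split: if_splits)
  qed
  \<comment> \<open>The exponent of coordinate 1 is determined by the degree of the block, so no
    other term merges with \<open>e0\<close>.\<close>
  have inj: "k = e0" if k: "k \<in> supp P" "same k" "bproj m k = bproj m e0" for k
  proof (rule poly_mapping_eqI)
    fix v :: "nat \<times> nat"
    obtain j i where v: "v = (j, i)" by force
    have kE: "k \<in> EM n m d" "e0 \<in> EM n m d" using PE k e0 by auto
    show "coef k v = coef e0 v"
    proof (cases "j < m \<and> i < n")
      case False
      then have "v \<notin> supp k" "v \<notin> supp e0" using kE v by (auto simp: EM_def)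
      then show ?thesis by (simp add: in_keys_iff)
    next
      case True
      have z: "coef k (j, 0) = coef e0 (j, 0)"
        using k(3) coef_bproj[of m k j] coef_bproj[of m e0 j] True by simp
      have o: "coef k (j, i') = coef e0 (j, i')" if "i' < n" "i' \<noteq> 1" for i'
        using z k(2) True that by (cases "i' = 0") (auto simp: same_def)
      have "(\<Sum>i<n. coef k (j, i)) = (\<Sum>i<n. coef e0 (j, i))" using kE True by (auto simp: EM_def)
      moreover have "(\<Sum>i<n. coef x (j, i)) = coef x (j, 1) + (\<Sum>i\<in>{..<n} - {1}. coef x (j, i))" for x :: bkey
        using n by (intro sum.remove) auto
      moreover have "(\<Sum>i\<in>{..<n} - {1}. coef k (j, i)) = (\<Sum>i\<in>{..<n} - {1}. coef e0 (j, i))"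
        by (intro sum.cong refl o) auto
      ultimately have "coef k (j, 1) = coef e0 (j, 1)" by simp
      then show ?thesis using o[of i] True v by (cases "i = 1") auto
    qed
  qed
  show ?thesis
  proof (rule that[of R])
    have "coef R (bproj m e0) = (\<Sum>k\<in>{k\<in>supp P. same k}. if k = e0 then coef P e0 else 0)"
      unfolding R_def X_def lookup_sum coef_mono1 using inj by (intro sum.cong refl) auto
    also have "... = coef P e0" using e0(1) by (simp add: same_def)
    finally show "R \<noteq> 0" using e0(1) by (auto simp: in_keys_iff)
    show "intc R" unfolding R_def X_def using P(2) by (intro intc_sum intc_mono1) (auto simp: intc_def)
    show "in_vars {..<m} R"
      unfolding in_vars_def
    proof
      fix k assume "k \<in> supp R"
      then obtain k' where "k = bproj m k'" using Xkeys by (auto simp: R_def)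
      then show "supp k \<subseteq> {..<m}" by (auto simp: in_keys_iff coef_bproj split: if_splits)
    qed
    show "coef k j \<le> d j" if kj: "k \<in> supp R" "j < m" for k j
    proof -
      obtain k' where k': "k' \<in> supp P" "k = bproj m k'" using Xkeys kj(1) by (auto simp: R_def)
      then show ?thesis using EM_le[OF PE[OF k'(1)] kj(2), of 0] n kj(2) by (simp add: coef_bproj)
    qed
    have "l1norm R \<le> (\<Sum>k\<in>{k\<in>supp P. same k}. l1norm (mono1 (bproj m k) (coef P k)))"
      unfolding R_def X_def by (rule wnorm_sum) simp
    also have "... = (\<Sum>k\<in>{k\<in>supp P. same k}. \<bar>coef P k\<bar>)" by (simp add: wnorm_mono1)
    also have "... \<le> (\<Sum>k\<in>supp P. \<bar>coef P k\<bar>)" by (intro sum_mono2) auto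
    finally show "l1norm R \<le> l1norm P" by (simp add: wnorm_def)
    show "\<theta> \<le> widx dr m k" if k: "k \<in> supp (shift (\<lambda>j. - h j 1 / h j 0) R)" for k
    proof -
      have "k \<in> supp (X (subst (blin n Psi) P))" using k XR by (simp add: \<beta>_def[abs_def])
      then obtain k' where k': "k' \<in> supp (subst (blin n Psi) P)" "k = bproj m k'" using Xkeys by blast
      have "- bidx dr m k' \<le> - \<theta>" using \<theta> k'(1) by (simp add: supp_le_def)
      then show ?thesis using k'(2) by (simp add: bidx_bproj)
    qed
  qed
qed

section \<open>A subspace-type theorem for hyperplanes\<close>

text \<open>t measures logarithmic size. The integer points y 1, ..., y (n - 1) span the hyperplane
  with normal vector \<open>h\<close>, and the i-th form is at most exp (t w_i) on them, with a
  negative sum of exponents. The fraction a / b = - h 1 / h 0 in lowest terms is the point for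
  Roth's lemma; its denominator is at least exp (t / C).\<close>

definition approx_datum where
  "approx_datum n Lf C \<delta> t w y h a b \<longleftrightarrow>
    (\<forall>i<n. \<bar>w i\<bar> \<le> C) \<and> (\<Sum>i<n. w i) \<le> - \<delta> \<and>
    (\<forall>k\<in>{1..<n}. \<forall>i<n. \<bar>\<Sum>l<n. Lf i l * ri (y k l)\<bar> \<le> exp (t * w i)) \<and>
    h 0 \<noteq> 0 \<and> b > 0 \<and> coprime a b \<and> ri a * h 0 = - ri b * h 1 \<and> t \<le> C * ln (ri b) \<and>
    (\<forall>x. (\<Sum>l<n. h l * x l) = 0 \<longrightarrow> (\<exists>u. \<forall>l<n. x l = (\<Sum>k\<in>{1..<n}. u k * ri (y k l))))"
  for n :: nat and Lf :: "nat => nat => real" and C \<delta> t :: real and w :: "nat => real"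
    and y :: "nat => nat => int" and h :: "nat => real" and a b :: int

lemma growing_choice:
  fixes Q :: "real => bool"
  assumes "\<And>T. \<exists>t\<ge>T. Q t"
  shows "\<exists>t. t 0 \<ge> T0 \<and> (\<forall>j. Q (t j)) \<and> (\<forall>j. t (Suc j) \<ge> c * t j)"
proof -
  obtain g where g: "\<And>T. g T \<ge> T \<and> Q (g T)" using assms by metis
  define t where "t = rec_nat (g T0) (\<lambda>_ x. g (c * x))"
  have "t 0 = g T0" "\<And>j. t (Suc j) = g (c * t j)" by (simp_all add: t_def)
  moreover have "Q (t j)" for j using g calculation by (cases j) auto
  ultimately show ?thesis using g by (intro exI[of _ t]) auto
qed

text \<open>The columns of \<open>Bm\<close> are the first unit vector and the points y_k, so the
  new coordinate 0 measures the distance from the hyperplane. In terms of the forms, P has only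
  monomials of strongly negative exponent sum, and the i-th form is at most exp (t_j w_ji) on the
  y_k. The weight exp (- C t_j) on coordinate 0 gives the unit vector a comparable bound, at the
  price of the last factor of the estimate.\<close>

lemma small_coefficients:
  fixes t d :: "nat => real"
  assumes n: "n \<ge> 1" and C: "C \<ge> 0" and \<kappa>: "\<kappa> \<ge> 1"
    and inv: "\<And>i l. i < n ==> l < n ==> (\<Sum>k<n. A i k * Lf k l) = (if i = l then \<kappa> else 0)"
    and w: "\<And>j i. j < m ==> i < n ==> \<bar>w j i\<bar> \<le> C"
    and y: "\<And>j k i. j < m ==> k \<in> {1..<n} ==> i < n ==> \<bar>\<Sum>l<n. Lf i l * ri (y j k l)\<bar> \<le> exp (t j * w j i)"
    and t: "\<And>j. j < m ==> t j \<ge> 0"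
    and Lb: "\<And>i. i < n ==> \<bar>Lf i 0\<bar> + real n \<le> C2" and C2: "C2 \<ge> 1"
    and P: "supp P \<subseteq> EM n m d0"
    and cb: "\<And>e. \<bar>coef (subst (blin n (\<lambda>_. A)) P) e\<bar> \<le> Cm" "Cm \<ge> 0"
    and good: "\<And>e. e \<in> supp (subst (blin n (\<lambda>_. A)) P) ==>
       (\<Sum>j<m. \<Sum>i<n. t j * w j i * real (coef e (j, i))) \<le> - B"
  defines "Bm \<equiv> (\<lambda>j l k. if k = 0 then (if l = 0 then 1 else 0) else ri (y j k l))"
  shows "\<bar>coef (subst (blin n Bm) P) k\<bar> \<le>
    real (card (EM n m d0)) * Cm * C2 ^ (\<Sum>j<m. d0 j) * exp (- B) * exp (C * (\<Sum>j<m. t j * real (coef k (j, 0))))"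
proof (cases "k \<in> supp (subst (blin n Bm) P)")
  case False
  then show ?thesis using cb(2) C2 by (simp add: in_keys_iff)
next
  case True
  let ?c = "subst (blin n (\<lambda>_. A)) P"
  let ?s = "\<Sum>j<m. d0 j"
  define La where "La j i k = (\<Sum>l<n. Lf i l * Bm j l k)" for j i k
  define \<tau> where "\<tau> v = (if snd v = 0 \<and> fst v < m then exp (- C * t (fst v)) else 1)" for v :: "nat \<times> nat"
  have \<tau>: "\<tau> v \<ge> 0" for v by (simp add: \<tau>_def)
  have subEM: "supp (subst (blin n B) P) \<subseteq> EM n m d0" for B
  proof
    fix k assume "k \<in> supp (subst (blin n B) P)"
    then have "(\<Sum>e\<in>supp P. coef P e * coef (mpow (blin n B) e) k) \<noteq> 0"
      by (simp add: subst_def in_keys_iff lookup_sum coef_Const_mult)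
    then obtain e where e: "e \<in> supp P" "coef P e * coef (mpow (blin n B) e) k \<noteq> 0"
      by (rule sum.not_neutral_contains_not_neutral) blast
    then have "k \<in> supp (mpow (blin n B) e)" by (simp add: in_keys_iff)
    moreover have "e \<in> EM n m d0" using e(1) P by blast
    ultimately show "k \<in> EM n m d0" using supp_mpow_blin_EM by blast
  qed
  \<comment> \<open>\<open>A\<close> is \<kappa> times the inverse of the matrix of forms, so going
    to the forms and back multiplies each linear factor by \<kappa>.\<close>
  have "subst (blin n La) ?c = subst (\<lambda>v. Const \<kappa> * blin n Bm v) P"
    unfolding subst_subst
  proof (rule subst_cong)
    fix e v assume ev: "e \<in> supp P" "v \<in> supp e"
    then have "e \<in> EM n m d0" using P by blast
    then have v: "snd v < n" using ev(2) by (auto simp: EM_def)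
    have "subst (blin n La) (blin n (\<lambda>_. A) v) = blin n (\<lambda>j i k. \<Sum>l<n. A i l * La j l k) v"
      by (rule subst_blin)
    also have "... = blin n (\<lambda>j i k. \<kappa> * Bm j i k) v"
    proof (rule blin_cong)
      fix k
      have "(\<Sum>l<n. A (snd v) l * La (fst v) l k) = (\<Sum>l<n. \<Sum>l'<n. A (snd v) l * Lf l l' * Bm (fst v) l' k)"
        by (simp add: La_def sum_distrib_left mult.assoc)
      also have "... = (\<Sum>l'<n. \<Sum>l<n. A (snd v) l * Lf l l' * Bm (fst v) l' k)" by (rule sum.swap)
      also have "... = (\<Sum>l'<n. (if snd v = l' then \<kappa> else 0) * Bm (fst v) l' k)"
        using inv[OF v] by (simp flip: sum_distrib_right)
      also have "... = \<kappa> * Bm (fst v) (snd v) k" using v by (simp add: if_distrib[of "\<lambda>x. x * _"] cong: if_cong)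
      finally show "(\<Sum>l<n. A (snd v) l * La (fst v) l k) = \<kappa> * Bm (fst v) (snd v) k" .
    qed
    also have "... = Const \<kappa> * blin n Bm v" by (rule blin_scaled_delta[OF v])
    finally show "subst (blin n La) (blin n (\<lambda>_. A) v) = Const \<kappa> * blin n Bm v" .
  qed
  also have "... = Const (\<kappa> ^ ?s) * subst (blin n Bm) P"
    by (rule subst_scale) (use P tdeg_EM in \<open>auto simp: mpow_const_tdeg\<close>)
  finally have eq: "subst (blin n La) ?c = Const (\<kappa> ^ ?s) * subst (blin n Bm) P" .
  have form: "wnorm \<tau> (blin n La (j, i)) \<le> C2 * exp (t j * w j i)" if ji: "j < m" "i < n" for j i
  proof -
    have "wnorm \<tau> (blin n La (j, i)) \<le> (\<Sum>k<n. wnorm \<tau> (Const (La j i k) * Var (j, k)))"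
      unfolding blin_def by (rule order_trans[OF wnorm_sum[OF \<tau>]]) simp
    also have "... = (\<Sum>k<n. \<bar>La j i k\<bar> * \<tau> (j, k))"
      by (simp add: Var_def Const_mono1 wnorm_mono1 mpow_mono1)
    also have "... = \<bar>La j i 0\<bar> * \<tau> (j, 0) + (\<Sum>k\<in>{1..<n}. \<bar>La j i k\<bar> * \<tau> (j, k))"
      using n by (simp add: lessThan_atLeast0 sum.atLeast_Suc_lessThan)
    also have "\<bar>La j i 0\<bar> * \<tau> (j, 0) \<le> \<bar>Lf i 0\<bar> * exp (t j * w j i)"
    proof -
      have "La j i 0 = (\<Sum>l<n. if l = 0 then Lf i l else 0)"
        unfolding La_def by (intro sum.cong) (auto simp: Bm_def)
      then have "La j i 0 = Lf i 0" using n by simp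
      moreover have "- C * t j \<le> t j * w j i"
        using w[OF ji] t[OF ji(1)] mult_left_mono[of "- C" "w j i" "t j"] by (simp add: mult.commute)
      ultimately show ?thesis using ji by (simp add: \<tau>_def mult_left_mono)
    qed
    also have "(\<Sum>k\<in>{1..<n}. \<bar>La j i k\<bar> * \<tau> (j, k)) \<le> (\<Sum>k\<in>{1..<n}. exp (t j * w j i))"
      using y[OF ji(1) _ ji(2)] by (intro sum_mono) (auto simp: \<tau>_def La_def Bm_def)
    also have "(\<Sum>k\<in>{1..<n}. exp (t j * w j i)) \<le> real n * exp (t j * w j i)" by simp
    also have "\<bar>Lf i 0\<bar> * exp (t j * w j i) + real n * exp (t j * w j i) = (\<bar>Lf i 0\<bar> + real n) * exp (t j * w j i)"
      by (simp add: algebra_simps)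
    also have "... \<le> C2 * exp (t j * w j i)" using Lb[OF ji(2)] by (intro mult_right_mono) auto
    finally show ?thesis by simp
  qed
  have mono: "mpow (\<lambda>v. wnorm \<tau> (blin n La v)) e \<le> C2 ^ ?s * exp (- B)" if e: "e \<in> supp ?c" for e
  proof -
    have eE: "e \<in> EM n m d0" using e subEM by blast
    have "mpow (\<lambda>v. wnorm \<tau> (blin n La v)) e \<le> mpow (\<lambda>v. C2 * exp (t (fst v) * w (fst v) (snd v))) e"
    proof (rule mpow_le_mono)
      fix v assume "v \<in> supp e"
      then have "fst v < m" "snd v < n" using eE by (auto simp: EM_def)
      then show "0 \<le> wnorm \<tau> (blin n La v) \<and> wnorm \<tau> (blin n La v) \<le> C2 * exp (t (fst v) * w (fst v) (snd v))"
        using form[of "fst v" "snd v"] wnorm_nonneg[where \<tau> = \<tau> and f = "blin n La v", OF \<tau>] by simp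
    qed
    also have "... = C2 ^ ?s * mpow (\<lambda>v. exp (t (fst v) * w (fst v) (snd v))) e"
      by (simp add: mpow_mult mpow_const_tdeg tdeg_EM[OF eE])
    also have "mpow (\<lambda>v. exp (t (fst v) * w (fst v) (snd v))) e = exp (\<Sum>v\<in>supp e. real (coef e v) * (t (fst v) * w (fst v) (snd v)))"
      by (simp add: mpow_def exp_sum flip: exp_of_nat_mult)
    also have "(\<Sum>v\<in>supp e. real (coef e v) * (t (fst v) * w (fst v) (snd v))) = (\<Sum>j<m. \<Sum>i<n. t j * w j i * real (coef e (j, i)))"
      unfolding sum_supp_EM[OF eE] by (simp add: mult_ac)
    also have "C2 ^ ?s * exp (\<Sum>j<m. \<Sum>i<n. t j * w j i * real (coef e (j, i))) \<le> C2 ^ ?s * exp (- B)"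
      using good[OF e] C2 by (intro mult_left_mono) auto
    finally show ?thesis .
  qed
  have "wnorm \<tau> (subst (blin n La) ?c) \<le> (\<Sum>e\<in>supp ?c. \<bar>coef ?c e\<bar> * mpow (\<lambda>v. wnorm \<tau> (blin n La v)) e)"
    by (rule wnorm_subst[OF \<tau>])
  also have "... \<le> (\<Sum>e\<in>supp ?c. Cm * (C2 ^ ?s * exp (- B)))"
    by (intro sum_mono mult_mono mono cb mpow_nonneg wnorm_nonneg \<tau>) auto
  also have "... = real (card (supp ?c)) * (Cm * (C2 ^ ?s * exp (- B)))" by simp
  also have "... \<le> real (card (EM n m d0)) * (Cm * (C2 ^ ?s * exp (- B)))"
    using cb(2) C2 subEM card_mono[OF EM_finite subEM] by (intro mult_right_mono) auto
  finally have nb: "wnorm \<tau> (subst (blin n La) ?c) \<le> real (card (EM n m d0)) * (Cm * (C2 ^ ?s * exp (- B)))" .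
  have kE: "k \<in> EM n m d0" using True subEM by blast
  have "\<bar>coef (subst (blin n Bm) P) k\<bar> * mpow \<tau> k \<le> \<bar>coef (subst (blin n La) ?c) k\<bar> * mpow \<tau> k"
  proof (intro mult_right_mono mpow_nonneg \<tau>)
    have "1 * \<bar>coef (subst (blin n Bm) P) k\<bar> \<le> \<kappa> ^ ?s * \<bar>coef (subst (blin n Bm) P) k\<bar>"
      using \<kappa> by (intro mult_right_mono one_le_power) auto
    then show "\<bar>coef (subst (blin n Bm) P) k\<bar> \<le> \<bar>coef (subst (blin n La) ?c) k\<bar>"
      unfolding eq coef_Const_mult abs_mult using \<kappa> by simp
  qed
  also have "... \<le> wnorm \<tau> (subst (blin n La) ?c)" by (rule coef_le_wnorm[OF \<tau>])
  finally have "\<bar>coef (subst (blin n Bm) P) k\<bar> * mpow \<tau> k \<le> real (card (EM n m d0)) * (Cm * (C2 ^ ?s * exp (- B)))"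
    using nb by linarith
  moreover have "mpow \<tau> k = exp (- (C * (\<Sum>j<m. t j * real (coef k (j, 0)))))"
  proof -
    have "mpow \<tau> k = mpow (\<lambda>v. if snd v = 0 then exp (- C * t (fst v)) else 1) k"
      using kE by (intro mpow_cong) (auto simp: \<tau>_def EM_def)
    also have "... = mpow (\<lambda>j. exp (- C * t j)) (bproj m k)"
      using kE by (intro mpow_bproj[where n = n]) (auto simp: EM_def)
    also have "... = (\<Prod>j<m. exp (- C * t j) ^ coef (bproj m k) j)"
      by (intro mpow_superset) (auto simp: in_keys_iff coef_bproj split: if_splits)
    also have "... = exp (\<Sum>j<m. - (C * (t j * real (coef k (j, 0)))))"
      by (simp add: exp_sum coef_bproj mult_ac flip: exp_of_nat_mult)
    finally show ?thesis by (simp add: sum_negf sum_distrib_left)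
  qed
  ultimately have "\<bar>coef (subst (blin n Bm) P) k\<bar> \<le> real (card (EM n m d0)) * (Cm * (C2 ^ ?s * exp (- B))) / exp (- (C * (\<Sum>j<m. t j * real (coef k (j, 0)))))"
    by (simp add: pos_le_divide_eq)
  then show ?thesis by (simp add: exp_minus field_simps)
qed

text \<open>The coefficients of low order along the hyperplanes are integers, since the spanning
  points are integral, and are shown to be below 1 in absolute value. This gives the auxiliary
  polynomial index \<theta> along m hyperplanes of very different heights, against Roth's
  lemma.\<close>

theorem hyperplane_subspace_theorem:
  fixes Lf A :: "nat => nat => real" and \<alpha> \<kappa> C \<delta> Ca :: real and n D :: nat
  assumes n: "n \<ge> 2" and D: "D \<ge> 1" and Ca: "Ca \<ge> 1"
    and zm: "\<And>i k. i < n ==> k < n ==> zmul \<alpha> D Ca (A i k)"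
    and inv: "\<And>i l. i < n ==> l < n ==> (\<Sum>k<n. A i k * Lf k l) = (if i = l then \<kappa> else 0)"
    and \<kappa>: "\<kappa> \<ge> 1" and C: "C \<ge> 1" and \<delta>: "\<delta> > 0"
    and data: "\<And>T. \<exists>t\<ge>T. \<exists>w y h a b. approx_datum n Lf C \<delta> t w y h a b"
  shows False
proof -
  \<comment> \<open>Chebyshev leaves a proportion of at most 64 n^2 C^2 / (\<delta>^2 m) bad
    exponents, which has to be at most 1 / (2 D).\<close>
  define m where "m = nat \<lceil>128 * real n ^ 2 * C\<^sup>2 * real D / \<delta>\<^sup>2\<rceil> + 1"
  have m1: "m \<ge> 1" by (simp add: m_def)
  have m: "128 * real n ^ 2 * C\<^sup>2 * real D \<le> real m * \<delta>\<^sup>2"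
  proof -
    have "128 * real n ^ 2 * C\<^sup>2 * real D / \<delta>\<^sup>2 \<le> real m" unfolding m_def by linarith
    then show ?thesis using \<delta> by (simp add: field_simps)
  qed
  \<comment> \<open>With this index the loss C Dd \<theta> is one half of the guaranteed gain
    \<delta> Dd / (4 n).\<close>
  define \<theta> where "\<theta> = \<delta> / (8 * real n * C)"
  have \<theta>: "\<theta> > 0" using \<delta> n C by (simp add: \<theta>_def)
  obtain \<omega> where \<omega>: "\<omega> > 0" and roth: "\<And>d a b E f. roth_data \<omega> m d a b E f ==>
    \<exists>k\<in>supp (shift (\<lambda>j. ri (a j) / ri (b j)) f). widx d m k < \<theta>"
    using roth_lemma[OF \<theta>, of m] by blast
  \<comment> \<open>\<open>q1 ^ s\<close> bounds the norm of P and \<open>q2 ^ s\<close> collects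
    all factors exponential in the total degree s. \<open>T0\<close> will make the degrees so small
    compared with \<open>Dd\<close> that both are negligible.\<close>
  define q1 where "q1 = 2 ^ n * (2 * 2 ^ n * (2 * (real n * Ca)))"
  define C2 where "C2 = 1 + (\<Sum>i<n. \<bar>Lf i 0\<bar>) + real n"
  define q2 where "q2 = 2 ^ n * (q1 * ((real n * Ca) * (1 + \<bar>\<alpha>\<bar>) ^ D)) * C2"
  have nCa: "real n * Ca \<ge> 1" using n Ca by (simp add: mult_ge1_I)
  have q1: "q1 \<ge> 1" unfolding q1_def using n Ca by (intro mult_ge1_I one_le_power) auto
  have C2: "C2 \<ge> 1" unfolding C2_def by (simp add: sum_nonneg)
  have a1: "(1 + \<bar>\<alpha>\<bar>) ^ D \<ge> 1" by (simp add: one_le_power)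
  have q2: "q2 \<ge> 1" unfolding q2_def using n Ca q1 C2 a1 by (intro mult_ge1_I one_le_power) auto
  define T0 where "T0 = 1 + 2 * C / \<omega> + 2 * C * real m * ln q1 / \<omega> + 16 * real n * real m * ln q2 / \<delta>"
  have lnq: "ln q1 \<ge> 0" "ln q2 \<ge> 0" using q1 q2 by auto
  have T0: "T0 \<ge> 1" "T0 \<ge> 2 * C / \<omega>" "T0 \<ge> 2 * C * real m * ln q1 / \<omega>" "T0 > 16 * real n * real m * ln q2 / \<delta>"
  proof -
    have "2 * C / \<omega> \<ge> 0" "2 * C * real m * ln q1 / \<omega> \<ge> 0" "16 * real n * real m * ln q2 / \<delta> \<ge> 0"
      using C \<omega> \<delta> lnq by auto
    then show "T0 \<ge> 1" "T0 \<ge> 2 * C / \<omega>" "T0 \<ge> 2 * C * real m * ln q1 / \<omega>" "T0 > 16 * real n * real m * ln q2 / \<delta>"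
      unfolding T0_def by linarith+
  qed
  obtain t where t0: "t 0 \<ge> T0" and td: "\<forall>j. \<exists>w y h a b. approx_datum n Lf C \<delta> (t j) w y h a b"
    and tS: "\<And>j. t (Suc j) \<ge> max 1 (2 / \<omega>) * t j"
    using growing_choice[of "\<lambda>t. \<exists>w y h a b. approx_datum n Lf C \<delta> t w y h a b" T0 "max 1 (2 / \<omega>)", OF data] by blast
  from td have "\<forall>j. \<exists>x. case x of (w, y, h, a, b) => approx_datum n Lf C \<delta> (t j) w y h a b" by fastforce
  from choice[OF this] obtain x where x: "\<forall>j. case x j of (w, y, h, a, b) => approx_datum n Lf C \<delta> (t j) w y h a b" ..
  define w where "w j = fst (x j)" for j
  define y where "y j = fst (snd (x j))" for j
  define h where "h j = fst (snd (snd (x j)))" for j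
  define a where "a j = fst (snd (snd (snd (x j))))" for j
  define b where "b j = snd (snd (snd (snd (x j))))" for j
  have dat: "approx_datum n Lf C \<delta> (t j) (w j) (y j) (h j) (a j) (b j)" for j
    using x[rule_format, of j] by (simp add: w_def y_def h_def a_def b_def case_prod_beta)
  have dw: "\<And>j i. i < n ==> \<bar>w j i\<bar> \<le> C" and dsum: "\<And>j. (\<Sum>i<n. w j i) \<le> - \<delta>"
    and dy: "\<And>j k i. k \<in> {1..<n} ==> i < n ==> \<bar>\<Sum>l<n. Lf i l * ri (y j k l)\<bar> \<le> exp (t j * w j i)"
    and dh: "\<And>j. h j 0 \<noteq> 0" and db: "\<And>j. b j > 0" "\<And>j. coprime (a j) (b j)"
    and dab: "\<And>j. ri (a j) * h j 0 = - ri (b j) * h j 1"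
    and dt: "\<And>j. t j \<le> C * ln (ri (b j))"
    and dsp: "\<And>j x. (\<Sum>l<n. h j l * x l) = 0 ==> \<exists>u. \<forall>l<n. x l = (\<Sum>k\<in>{1..<n}. u k * ri (y j k l))"
    using dat unfolding approx_datum_def by blast+
  have tmono: "t j \<ge> T0 \<and> t j \<le> t (Suc j)" for j
  proof (induction j)
    case 0
    have "1 * t 0 \<le> max 1 (2 / \<omega>) * t 0" using t0 T0(1) by (intro mult_right_mono) auto
    then show ?case using t0 tS[of 0] by linarith
  next
    case (Suc j)
    have "1 * t (Suc j) \<le> max 1 (2 / \<omega>) * t (Suc j)" using Suc T0(1) by (intro mult_right_mono) auto
    then show ?case using Suc tS[of "Suc j"] by linarith
  qed
  have tpos: "t j \<ge> 1" "t j > 0" for j using tmono[of j] T0(1) by linarith+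
  have tle: "i \<le> j ==> t i \<le> t j" for i j
    by (rule lift_Suc_mono_le[of t]) (use tmono in auto)
  define Dd where "Dd = t (m - 1)"
  \<comment> \<open>Degrees inversely proportional to t_j: every block has weight d_j t_j between Dd
    / 2 and Dd, and rapidly growing t_j produce the rapidly decreasing degrees of Roth's
    lemma.\<close>
  define d where "d j = nat \<lfloor>Dd / t j\<rfloor>" for j
  have Dd: "Dd \<ge> 1" by (simp add: Dd_def tpos)
  have d1: "real (d j) \<ge> 1" "real (d j) * t j \<le> Dd" "real (d j) * t j \<ge> Dd / 2" "real (d j) \<le> Dd / T0" if "j < m" for j
  proof -
    have "t j \<le> Dd" unfolding Dd_def using that by (intro tle) auto
    then have r: "Dd / t j \<ge> 1" using tpos[of j] by simp
    have f: "real (d j) = of_int \<lfloor>Dd / t j\<rfloor>" unfolding d_def using r by simp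
    show 1: "real (d j) \<ge> 1" unfolding f using r by simp
    have le: "real (d j) \<le> Dd / t j" unfolding f by simp
    then show "real (d j) * t j \<le> Dd" using tpos(2)[of j] by (simp add: field_simps)
    have "Dd / t j \<le> real (d j) + 1" unfolding f by linarith
    then have "Dd / t j \<le> 2 * real (d j)" using 1 by linarith
    then show "real (d j) * t j \<ge> Dd / 2" using tpos(2)[of j] by (simp add: field_simps)
    have "Dd / t j \<le> Dd / T0" using tmono[of j] T0(1) Dd by (intro divide_left_mono) auto
    with le show "real (d j) \<le> Dd / T0" by linarith
  qed
  define s where "s = (\<Sum>j<m. d j)"
  have sle: "real s \<le> real m * (Dd / T0)"
  proof -
    have "real s = (\<Sum>j<m. real (d j))" by (simp add: s_def)
    also have "... \<le> (\<Sum>j<m. Dd / T0)" by (intro sum_mono d1) auto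
    finally show ?thesis by simp
  qed
  have s1: "s \<ge> 1"
  proof -
    have "d 0 \<ge> 1" using d1(1)[of 0] m1 by simp
    also have "d 0 \<le> s" unfolding s_def using m1 by (intro member_le_sum) auto
    finally show ?thesis .
  qed
  let ?M = "EM n m d"
  have cardM: "real (card ?M) \<le> (2 ^ n) ^ s"
  proof -
    have "card ?M \<le> 2 ^ (n * s)" using EM_finite_card[of n m d] by (simp add: s_def)
    then have "real (card ?M) \<le> real (2 ^ (n * s))" by (simp only: of_nat_le_iff)
    then show ?thesis by (simp add: power_mult)
  qed
  define S where "S e = (\<Sum>j<m. \<Sum>i<n. t j * w j i * real (coef e (j, i)))" for e :: bkey
  define Mt where "Mt = (\<Sum>j<m. \<Sum>i<n. t j * w j i * (real (d j) / real n))"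
  \<comment> \<open>The mean \<open>Mt\<close> is at most -2 \<open>lam\<close>, so every exponent
    that is not bad has S below - \<open>lam\<close>.\<close>
  define lam where "lam = \<delta> * real m * Dd / (4 * real n)"
  have lam: "lam > 0" unfolding lam_def using \<delta> m1 Dd n by simp
  define bad where "bad = {e \<in> ?M. S e \<ge> Mt + lam}"
  have Mt: "Mt \<le> - (\<delta> * real m * Dd / (2 * real n))"
  proof -
    have "(\<Sum>i<n. t j * w j i * (real (d j) / real n)) \<le> - (\<delta> * Dd / (2 * real n))" if j: "j < m" for j
    proof -
      have "(\<Sum>i<n. t j * w j i * (real (d j) / real n)) = (real (d j) * t j / real n) * (\<Sum>i<n. w j i)"
        by (simp add: sum_distrib_left sum_divide_distrib mult_ac)
      also have "... \<le> (real (d j) * t j / real n) * (- \<delta>)"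
        using dsum tpos(2)[of j] by (intro mult_left_mono) auto
      also have "... \<le> (Dd / 2 / real n) * (- \<delta>)"
        using d1(3)[OF j] n \<delta> by (intro mult_right_mono_neg divide_right_mono) auto
      finally show ?thesis by (simp add: mult_ac)
    qed
    then have "Mt \<le> (\<Sum>j<m. - (\<delta> * Dd / (2 * real n)))" unfolding Mt_def by (intro sum_mono) auto
    then show ?thesis by (simp add: mult_ac)
  qed
  have badc: "2 * (D * card bad) \<le> card ?M"
  proof -
    have "real (card bad) * lam\<^sup>2 \<le> 4 * (C * Dd)\<^sup>2 * real m * real (card ?M)"
      unfolding bad_def S_def Mt_def
    proof (rule EM_chebyshev)
      fix j i assume ji: "j < m" "i < n"
      have "\<bar>t j * w j i\<bar> * real (d j) = \<bar>w j i\<bar> * (real (d j) * t j)"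
        using tpos(2)[of j] by (simp add: abs_mult)
      also have "... \<le> C * Dd" using dw[OF ji(2), of j] d1(2)[OF ji(1)] tpos(2)[of j] C by (intro mult_mono) auto
      finally show "\<bar>t j * w j i\<bar> * real (d j) \<le> C * Dd" .
    qed (use n lam in auto)
    then have "real (card bad) * (\<delta> * real m / (4 * real n))\<^sup>2 * Dd\<^sup>2 \<le> 4 * C\<^sup>2 * real m * real (card ?M) * Dd\<^sup>2"
      by (simp add: lam_def power_mult_distrib power_divide algebra_simps)
    then have "real (card bad) * (\<delta> * real m / (4 * real n))\<^sup>2 \<le> 4 * C\<^sup>2 * real m * real (card ?M)"
      using Dd by (subst (asm) mult_le_cancel_right_pos) auto
    then have "real (card bad) * (\<delta>\<^sup>2 * real m * real m) \<le> 64 * real n ^ 2 * C\<^sup>2 * real m * real (card ?M)"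
      using n by (simp add: power_mult_distrib power_divide field_simps power2_eq_square)
    then have "(real (card bad) * (\<delta>\<^sup>2 * real m)) * real m \<le> (64 * real n ^ 2 * C\<^sup>2 * real (card ?M)) * real m"
      by (simp add: mult_ac)
    then have 1: "real (card bad) * (\<delta>\<^sup>2 * real m) \<le> 64 * real n ^ 2 * C\<^sup>2 * real (card ?M)"
      using m1 by (subst (asm) mult_le_cancel_right_pos) auto
    have "(2 * real D * real (card bad)) * (64 * real n ^ 2 * C\<^sup>2) \<le> real (card bad) * (\<delta>\<^sup>2 * real m)"
      using mult_left_mono[OF m, of "real (card bad)"] by (simp add: mult_ac)
    also have "... \<le> real (card ?M) * (64 * real n ^ 2 * C\<^sup>2)" using 1 by (simp add: mult_ac)
    finally have "2 * real D * real (card bad) \<le> real (card ?M)"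
      using n C by (subst (asm) mult_le_cancel_right_pos) auto
    then have "real (2 * (D * card bad)) \<le> real (card ?M)" by simp
    then show ?thesis by (simp only: of_nat_le_iff)
  qed
  have n1: "n \<ge> 1" using n by simp
  have badsub: "bad \<subseteq> ?M" by (auto simp: bad_def)
  obtain P where P: "P \<noteq> 0" "intc P" "supp P \<subseteq> ?M"
    and Pb: "\<And>k. \<bar>coef P k\<bar> \<le> 2 * real (card ?M) * (2 * (real n * Ca) ^ s)"
    and Pbad: "\<And>e'. e' \<in> bad ==> coef (subst (blin n (\<lambda>_. A)) P) e' = 0"
    by (rule auxiliary_polynomial[where A = A and \<alpha> = \<alpha>, OF D n1 Ca zm badsub badc, folded s_def]) blast+
  have l1P: "real (card ?M) * (2 * real (card ?M) * (2 * (real n * Ca) ^ s)) \<le> q1 ^ s"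
  proof -
    have "(2::real) ^ 1 \<le> 2 ^ s" using s1 by (intro power_increasing) auto
    then have two: "(2::real) \<le> 2 ^ s" by simp
    have "real (card ?M) * (2 * real (card ?M) * (2 * (real n * Ca) ^ s)) \<le>
        (2 ^ n) ^ s * (2 ^ s * (2 ^ n) ^ s * (2 ^ s * (real n * Ca) ^ s))"
      using cardM two nCa by (intro mult_mono) auto
    also have "... = q1 ^ s" by (simp only: q1_def power_mult_distrib mult.assoc)
    finally show ?thesis .
  qed
  have l1P': "l1norm P \<le> q1 ^ s"
  proof -
    have "l1norm P \<le> (\<Sum>k\<in>?M. \<bar>coef P k\<bar>)" using wnorm_superset[OF EM_finite P(3), of "\<lambda>_. 1"] by simp
    also have "... \<le> (\<Sum>k\<in>?M. 2 * real (card ?M) * (2 * (real n * Ca) ^ s))" by (intro sum_mono Pb)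
    also have "... = real (card ?M) * (2 * real (card ?M) * (2 * (real n * Ca) ^ s))" by simp
    finally show ?thesis using l1P by linarith
  qed
  define Cm where "Cm = q1 ^ s * ((real n * Ca) ^ s * (1 + \<bar>\<alpha>\<bar>) ^ D)"
  have cbound: "\<bar>coef (subst (blin n (\<lambda>_. A)) P) e\<bar> \<le> Cm" for e
  proof -
    have "\<bar>coef (subst (blin n (\<lambda>_. A)) P) e\<bar> = \<bar>\<Sum>k\<in>supp P. coef P k * coef (mpow (blin n (\<lambda>_. A)) k) e\<bar>"
      by (simp add: subst_def lookup_sum coef_Const_mult)
    also have "... \<le> (\<Sum>k\<in>supp P. \<bar>coef P k * coef (mpow (blin n (\<lambda>_. A)) k) e\<bar>)" by (rule sum_abs)
    also have "... \<le> (\<Sum>k\<in>supp P. \<bar>coef P k\<bar> * ((real n * Ca) ^ s * (1 + \<bar>\<alpha>\<bar>) ^ D))"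
    proof (intro sum_mono)
      fix k assume "k \<in> supp P"
      then have kE: "k \<in> ?M" using P by blast
      have "coef (mpow (blin n (\<lambda>_. A)) k) e \<in> zset \<alpha> D ((real n * Ca) ^ tdeg k)"
        using kE Ca by (intro mpow_blin_zset[OF D _ zm]) (auto simp: EM_def)
      from zset_abs[OF this] have "\<bar>coef (mpow (blin n (\<lambda>_. A)) k) e\<bar> \<le> (real n * Ca) ^ s * (1 + \<bar>\<alpha>\<bar>) ^ D"
        by (simp add: tdeg_EM[OF kE] s_def)
      then show "\<bar>coef P k * coef (mpow (blin n (\<lambda>_. A)) k) e\<bar> \<le> \<bar>coef P k\<bar> * ((real n * Ca) ^ s * (1 + \<bar>\<alpha>\<bar>) ^ D)"
        unfolding abs_mult by (intro mult_left_mono) auto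
    qed
    also have "... = l1norm P * ((real n * Ca) ^ s * (1 + \<bar>\<alpha>\<bar>) ^ D)" by (simp add: wnorm_def sum_distrib_right)
    also have "... \<le> Cm" unfolding Cm_def using l1P' nCa by (intro mult_right_mono) auto
    finally show ?thesis .
  qed
  define B where "B = lam"
  have good: "(\<Sum>j<m. \<Sum>i<n. t j * w j i * real (coef e (j, i))) \<le> - B" if e: "e \<in> supp (subst (blin n (\<lambda>_. A)) P)" for e
  proof -
    have "e \<in> ?M"
    proof -
      from e have "(\<Sum>k\<in>supp P. coef P k * coef (mpow (blin n (\<lambda>_. A)) k) e) \<noteq> 0"
        by (simp add: subst_def in_keys_iff lookup_sum coef_Const_mult)
      then obtain k where k: "k \<in> supp P" "coef P k * coef (mpow (blin n (\<lambda>_. A)) k) e \<noteq> 0"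
        by (rule sum.not_neutral_contains_not_neutral) blast
      then have "e \<in> supp (mpow (blin n (\<lambda>_. A)) k)" by (simp add: in_keys_iff)
      moreover have "k \<in> ?M" using k(1) P(3) by blast
      ultimately show ?thesis using supp_mpow_blin_EM by blast
    qed
    moreover have "e \<notin> bad" using Pbad e by (auto simp: in_keys_iff)
    ultimately have "S e < Mt + lam" by (simp add: bad_def)
    also have "Mt + lam \<le> - lam"
    proof -
      have "2 * lam = \<delta> * real m * Dd / (2 * real n)" by (simp add: lam_def)
      then show ?thesis using Mt by linarith
    qed
    finally show ?thesis by (simp add: S_def B_def)
  qed
  define Bm where "Bm = (\<lambda>j l k. if k = 0 then (if l = 0 then 1 else 0) else ri (y j k l))"
  let ?G = "subst (blin n Bm) P"
  have intG: "intc ?G"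
    using P(2) by (intro intc_subst intc_blin) (auto simp: Bm_def)
  have idx: "supp_le (\<lambda>k. - bidx (\<lambda>j. real (d j)) m k) (- \<theta>) ?G"
    unfolding supp_le_def
  proof (rule ballI, rule ccontr)
    fix k assume k: "k \<in> supp ?G" and "\<not> - bidx (\<lambda>j. real (d j)) m k \<le> - \<theta>"
    then have b\<theta>: "bidx (\<lambda>j. real (d j)) m k < \<theta>" by simp
    have "\<bar>coef ?G k\<bar> \<le> real (card ?M) * Cm * C2 ^ s * exp (- B) * exp (C * (\<Sum>j<m. t j * real (coef k (j, 0))))"
      unfolding Bm_def s_def
    proof (rule small_coefficients[where A = A and Lf = Lf and \<kappa> = \<kappa> and w = w and t = t])
      show "1 \<le> n" by (rule n1)
      show "0 \<le> C" using C by simp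
      show "1 \<le> \<kappa>" by (rule \<kappa>)
      show "(\<Sum>k<n. A i k * Lf k l) = (if i = l then \<kappa> else 0)" if "i < n" "l < n" for i l by (rule inv[OF that])
      show "\<bar>w j i\<bar> \<le> C" if "j < m" "i < n" for j i by (rule dw[OF that(2)])
      show "\<bar>\<Sum>l<n. Lf i l * ri (y j k l)\<bar> \<le> exp (t j * w j i)" if "j < m" "k \<in> {1..<n}" "i < n" for j k i
        by (rule dy[OF that(2,3)])
      show "1 \<le> C2" by (rule C2)
      show "supp P \<subseteq> ?M" by (rule P(3))
      show "\<bar>coef (subst (blin n (\<lambda>_. A)) P) e\<bar> \<le> Cm" for e by (rule cbound)
      show "(\<Sum>j<m. \<Sum>i<n. t j * w j i * real (coef e (j, i))) \<le> - B" if "e \<in> supp (subst (blin n (\<lambda>_. A)) P)" for e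
        by (rule good[OF that])
      show "\<bar>Lf i 0\<bar> + real n \<le> C2" if "i < n" for i
        unfolding C2_def using member_le_sum[of i "{..<n}" "\<lambda>i. \<bar>Lf i 0\<bar>"] that by simp
      show "0 \<le> t j" for j using tpos(2)[of j] by simp
      show "Cm \<ge> 0" unfolding Cm_def using q1 nCa by simp
    qed
    also have "... \<le> q2 ^ s * exp (- B) * exp (C * Dd * \<theta>)"
    proof (intro mult_mono)
      have "(1 + \<bar>\<alpha>\<bar>) ^ D = ((1 + \<bar>\<alpha>\<bar>) ^ D) ^ 1" by simp
      also have "... \<le> ((1 + \<bar>\<alpha>\<bar>) ^ D) ^ s" using a1 s1 by (intro power_increasing) auto
      finally have "Cm \<le> q1 ^ s * ((real n * Ca) ^ s * ((1 + \<bar>\<alpha>\<bar>) ^ D) ^ s)"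
        unfolding Cm_def using q1 nCa by (intro mult_left_mono) auto
      then have "real (card ?M) * Cm * C2 ^ s \<le> (2 ^ n) ^ s * (q1 ^ s * ((real n * Ca) ^ s * ((1 + \<bar>\<alpha>\<bar>) ^ D) ^ s)) * C2 ^ s"
        using cardM q1 nCa C2 by (intro mult_mono) (auto simp: Cm_def)
      also have "... = q2 ^ s" by (simp add: q2_def power_mult_distrib)
      finally show "real (card ?M) * Cm * C2 ^ s \<le> q2 ^ s" .
      have "(\<Sum>j<m. t j * real (coef k (j, 0))) \<le> (\<Sum>j<m. Dd * (real (coef k (j, 0)) / real (d j)))"
      proof (intro sum_mono)
        fix j assume j: "j \<in> {..<m}"
        have "t j \<le> Dd / real (d j)" using d1(1,2)[of j] j by (simp add: field_simps)
        then have "t j * real (coef k (j, 0)) \<le> Dd / real (d j) * real (coef k (j, 0))" by (intro mult_right_mono) auto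
        then show "t j * real (coef k (j, 0)) \<le> Dd * (real (coef k (j, 0)) / real (d j))" by simp
      qed
      also have "... = Dd * bidx (\<lambda>j. real (d j)) m k" by (simp add: bidx_def sum_distrib_left)
      also have "... \<le> Dd * \<theta>" using b\<theta> Dd by (intro mult_left_mono) auto
      finally show "exp (C * (\<Sum>j<m. t j * real (coef k (j, 0)))) \<le> exp (C * Dd * \<theta>)"
        using C by (simp add: mult.assoc)
    qed (use q2 in auto)
    also have "... = exp (real s * ln q2 - B + C * Dd * \<theta>)"
    proof -
      have "q2 ^ s = exp (real s * ln q2)" using q2 by (simp add: exp_of_nat_mult)
      then show ?thesis by (simp add: exp_add exp_diff exp_minus field_simps)
    qed
    also have "... < exp 0"
    proof -
      have 1: "real s * ln q2 < \<delta> * Dd / (16 * real n)"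
      proof -
        have "real s * ln q2 \<le> real m * (Dd / T0) * ln q2" using sle lnq by (intro mult_right_mono) auto
        also have "... = (Dd / T0) * (real m * ln q2)" by simp
        also have "real m * ln q2 < T0 * (\<delta> / (16 * real n))" using T0(4) n \<delta> by (simp add: field_simps)
        then have "(Dd / T0) * (real m * ln q2) < (Dd / T0) * (T0 * (\<delta> / (16 * real n)))"
          using Dd T0(1) by (intro mult_strict_left_mono) auto
        also have "... = \<delta> * Dd / (16 * real n)" using T0(1) by simp
        finally show ?thesis .
      qed
      have 2: "B \<ge> \<delta> * Dd / (4 * real n)"
      proof -
        have "\<delta> * Dd * 1 \<le> \<delta> * Dd * real m" using m1 \<delta> Dd by (intro mult_left_mono) auto
        then show ?thesis unfolding B_def lam_def using n by (simp add: field_simps)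
      qed
      have 3: "C * Dd * \<theta> = \<delta> * Dd / (8 * real n)" using C by (simp add: \<theta>_def)
      have "\<delta> * Dd / (16 * real n) + \<delta> * Dd / (8 * real n) < \<delta> * Dd / (4 * real n)"
        using \<delta> Dd n by (simp add: field_simps)
      then have "real s * ln q2 - B + C * Dd * \<theta> < 0" using 1 2 3 by linarith
      then show ?thesis by simp
    qed
    finally have "\<bar>coef ?G k\<bar> < 1" by simp
    moreover have "coef ?G k \<in> \<int>" using intG by (simp add: intc_def)
    ultimately have "coef ?G k = 0" by (auto elim!: Ints_cases)
    then show False using k by (simp add: in_keys_iff)
  qed
  define Psi where "Psi = (\<lambda>j i k. if i = 0 then (if k = 0 then 1 else - h j k / h j 0) else if i = k then 1 else (0::real))"
  have "\<exists>u. \<forall>l<n. Psi j l k = (\<Sum>k'\<in>{1..<n}. u k' * ri (y j k' l))" if k: "k \<in> {1..<n}" for j k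
  proof -
    have "(\<Sum>l<n. h j l * Psi j l k) = (\<Sum>l\<in>{0, k}. h j l * Psi j l k)"
      using k by (intro sum.mono_neutral_right) (auto simp: Psi_def)
    also have "... = 0" using k dh[of j] by (simp add: Psi_def)
    finally show ?thesis by (rule dsp)
  qed
  then have "\<forall>x. \<exists>u. snd x \<in> {1..<n} \<longrightarrow> (\<forall>l<n. Psi (fst x) l (snd x) = (\<Sum>k'\<in>{1..<n}. u k' * ri (y (fst x) k' l)))"
    by blast
  from choice[OF this] obtain u where u: "\<forall>x. snd x \<in> {1..<n} \<longrightarrow> (\<forall>l<n. Psi (fst x) l (snd x) = (\<Sum>k'\<in>{1..<n}. u x k' * ri (y (fst x) k' l)))" ..
  \<comment> \<open>The columns of \<open>Psi\<close> other than the first lie in the hyperplane and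
    are combinations of the y_k. So \<open>Psi\<close> arises from \<open>Bm\<close> by a linear
    change among the coordinates from 1 on, which respects the index in coordinate 0.\<close>
  define Ch where "Ch = (\<lambda>j k i. if k = 0 then (if i = 0 then 1 else 0) else if i = 0 then 0 else u (j, i) k)"
  have PsiG: "subst (blin n Psi) P = subst (blin n Ch) ?G"
    unfolding subst_subst
  proof (rule subst_cong)
    fix e v assume ev: "e \<in> supp P" "v \<in> supp e"
    then have "e \<in> ?M" using P(3) by blast
    then have v: "snd v < n" using ev(2) by (auto simp: EM_def)
    have "subst (blin n Ch) (blin n Bm v) = blin n (\<lambda>j i k. \<Sum>l<n. Bm j i l * Ch j l k) v" by (rule subst_blin)
    also have "... = blin n Psi v"
    proof (rule blin_cong)
      fix k assume k: "k < n"
      have "(\<Sum>l<n. Bm (fst v) (snd v) l * Ch (fst v) l k) = Bm (fst v) (snd v) 0 * Ch (fst v) 0 k + (\<Sum>l\<in>{1..<n}. Bm (fst v) (snd v) l * Ch (fst v) l k)"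
        using n by (simp add: lessThan_atLeast0 sum.atLeast_Suc_lessThan)
      also have "... = Psi (fst v) (snd v) k"
      proof (cases "k = 0")
        case True
        then show ?thesis by (simp add: Bm_def Ch_def Psi_def)
      next
        case False
        then have "Psi (fst v) (snd v) k = (\<Sum>k'\<in>{1..<n}. u (fst v, k) k' * ri (y (fst v) k' (snd v)))"
          using u[rule_format, of "(fst v, k)" "snd v"] k v by simp
        also have "... = (\<Sum>l\<in>{1..<n}. Bm (fst v) (snd v) l * Ch (fst v) l k)"
          using False by (intro sum.cong) (auto simp: Bm_def Ch_def)
        finally show ?thesis using False by (simp add: Bm_def Ch_def)
      qed
      finally show "(\<Sum>l<n. Bm (fst v) (snd v) l * Ch (fst v) l k) = Psi (fst v) (snd v) k" .
    qed
    finally show "blin n Psi v = subst (blin n Ch) (blin n Bm v)" by simp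
  qed
  have idx': "supp_le (\<lambda>k. - bidx (\<lambda>j. real (d j)) m k) (- \<theta>) (subst (blin n Psi) P)"
    unfolding PsiG
  proof (rule supp_le_subst)
    fix k assume k: "k \<in> supp ?G"
    have "supp_le (\<lambda>k. - bidx (\<lambda>j. real (d j)) m k)
        (\<Sum>v\<in>supp k. real (coef k v) * (if snd v = 0 \<and> fst v < m then - 1 / real (d (fst v)) else 0)) (mpow (blin n Ch) k)"
    proof (rule supp_le_mpow)
      fix v
      have bm: "bidx (\<lambda>j. real (d j)) m (mono1 (j, i) (Suc 0)) = (if j < m \<and> i = 0 then 1 / real (d j) else 0)" for j i
      proof -
        have "bidx (\<lambda>j. real (d j)) m (mono1 (j, i) (Suc 0)) = (\<Sum>j'<m. if j = j' then (if i = 0 then 1 / real (d j) else 0) else 0)"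
          unfolding bidx_def by (intro sum.cong) (auto simp: coef_mono1)
        then show ?thesis by simp
      qed
      show "supp_le (\<lambda>k. - bidx (\<lambda>j. real (d j)) m k) (if snd v = 0 \<and> fst v < m then - 1 / real (d (fst v)) else 0) (blin n Ch v)"
        by (rule supp_le_blin) (auto simp: bidx_add bm Ch_def split: if_splits)
    qed (simp add: bidx_add)
    moreover have "(\<Sum>v\<in>supp k. real (coef k v) * (if snd v = 0 \<and> fst v < m then - 1 / real (d (fst v)) else 0)) = - bidx (\<lambda>j. real (d j)) m k"
    proof -
      have "(\<Sum>v\<in>supp k. real (coef k v) * (if snd v = 0 \<and> fst v < m then - 1 / real (d (fst v)) else 0))
          = (\<Sum>v\<in>supp k \<inter> (\<lambda>j. (j, 0)) ` {..<m}. real (coef k v) * (- 1 / real (d (fst v))))"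
        by (rule sum.mono_neutral_cong_right) (auto simp: image_iff)
      also have "... = (\<Sum>v\<in>(\<lambda>j. (j, 0)) ` {..<m}. real (coef k v) * (- 1 / real (d (fst v))))"
        by (rule sum.mono_neutral_left) (auto simp: in_keys_iff)
      also have "... = (\<Sum>j<m. real (coef k (j, 0)) * (- 1 / real (d j)))"
        by (subst sum.reindex) (auto simp: inj_on_def)
      finally show ?thesis by (simp add: bidx_def sum_negf)
    qed
    ultimately have "supp_le (\<lambda>k. - bidx (\<lambda>j. real (d j)) m k) (- bidx (\<lambda>j. real (d j)) m k) (mpow (blin n Ch) k)" by simp
    moreover have "- bidx (\<lambda>j. real (d j)) m k \<le> - \<theta>" using idx k by (simp add: supp_le_def)
    ultimately show "supp_le (\<lambda>k. - bidx (\<lambda>j. real (d j)) m k) (- \<theta>) (mpow (blin n Ch) k)" by (rule supp_le_neg_mono)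
  qed (simp add: bidx_add)
  obtain R where R: "R \<noteq> 0" "intc R" "in_vars {..<m} R" "\<And>k j. k \<in> supp R ==> j < m ==> coef k j \<le> d j"
    "l1norm R \<le> l1norm P" "\<And>k. k \<in> supp (shift (\<lambda>j. - h j 1 / h j 0) R) ==> \<theta> \<le> widx (\<lambda>j. real (d j)) m k"
    by (rule pair_restriction[OF n P, of "\<lambda>j. real (d j)" \<theta> h]) (use idx' in \<open>auto simp: Psi_def\<close>)
  have beta: "(\<lambda>j. - h j 1 / h j 0) = (\<lambda>j. ri (a j) / ri (b j))"
  proof
    fix j
    show "- h j 1 / h j 0 = ri (a j) / ri (b j)"
      using dab[of j] dh[of j] db(1)[of j] by (simp add: field_simps)
  qed
  \<comment> \<open>d_j ln b_j is at least d_j t_j / C, hence at least Dd / (2 C).\<close>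
  define E where "E = Dd / (2 * C)"
  have "roth_data \<omega> m (\<lambda>j. real (d j)) a b E R"
    unfolding roth_data_def
  proof (intro conjI allI impI ballI)
    fix j assume j: "j < m"
    show "real (d j) \<ge> 1" "b j > 0" "coprime (a j) (b j)" using d1(1)[OF j] db by auto
    have "Dd / 2 \<le> real (d j) * (C * ln (ri (b j)))"
      using d1(3)[OF j] mult_left_mono[OF dt[of j], of "real (d j)"] by linarith
    then show "E \<le> real (d j) * ln (ri (b j))" using C by (simp add: E_def field_simps)
    have "Dd / T0 \<le> \<omega> * E"
    proof -
      have "2 * C \<le> \<omega> * T0" using T0(2) \<omega> by (simp add: field_simps)
      then have "Dd * (2 * C) \<le> Dd * (\<omega> * T0)" using Dd by (intro mult_left_mono) auto
      then show ?thesis using T0(1) C by (simp add: E_def field_simps)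
    qed
    then show "real (d j) \<le> \<omega> * E" using d1(4)[OF j] by linarith
  next
    fix j assume j: "Suc j < m"
    have "2 / \<omega> * t j \<le> max 1 (2 / \<omega>) * t j" using tpos(2)[of j] by (intro mult_right_mono) auto
    then have tt: "2 / \<omega> * t j \<le> t (Suc j)" using tS[of j] by linarith
    have "real (d (Suc j)) * (2 / \<omega> * t j) \<le> real (d (Suc j)) * t (Suc j)" using tt by (intro mult_left_mono) auto
    also have "... \<le> Dd" using d1(2)[OF j] .
    also have "... \<le> 2 * (real (d j) * t j)" using d1(3)[of j] j by simp
    finally have "(real (d (Suc j)) / \<omega>) * (2 * t j) \<le> real (d j) * (2 * t j)" by (simp add: mult_ac)
    then have "real (d (Suc j)) / \<omega> \<le> real (d j)" using tpos(2)[of j] by (subst (asm) mult_le_cancel_right_pos) auto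
    then show "real (d (Suc j)) \<le> \<omega> * real (d j)" using \<omega> by (simp add: field_simps)
  next
    show "E > 0" using Dd C by (simp add: E_def)
    have "l1norm R \<le> q1 ^ s" using R(5) l1P' by linarith
    then have "ln (l1norm R) \<le> real s * ln q1"
      using l1norm_pos[OF R(1)] q1 by (metis ln_le_cancel_iff ln_realpow less_le_trans zero_less_one zero_less_power)
    also have "... \<le> real m * (Dd / T0) * ln q1" using sle lnq by (intro mult_right_mono) auto
    also have "... \<le> \<omega> * E"
    proof -
      have "2 * C * real m * ln q1 \<le> \<omega> * T0" using T0(3) \<omega> by (simp add: field_simps)
      then have "Dd * (2 * C * real m * ln q1) \<le> Dd * (\<omega> * T0)" using Dd by (intro mult_left_mono) auto
      then show ?thesis using T0(1) C by (simp add: E_def field_simps)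
    qed
    finally show "ln (l1norm R) \<le> \<omega> * E" .
  qed (use R in auto)
  from roth[OF this] obtain k where "k \<in> supp (shift (\<lambda>j. ri (a j) / ri (b j)) R)" "widx (\<lambda>j. real (d j)) m k < \<theta>"
    by blast
  then show False using R(6)[of k] unfolding beta by force
qed

section \<open>Continued fractions with large partial quotients\<close>

text \<open>The index is shifted: the \<open>r\<close>-th convergent is \<open>cp A (Suc r) / cq A (Suc r)\<close>.\<close>

fun cq :: "(nat => int) => nat => int" where
  "cq A 0 = 0"
| "cq A (Suc 0) = 1"
| "cq A (Suc (Suc k)) = A (Suc k) * cq A (Suc k) + cq A k"

fun cp :: "(nat => int) => nat => int" where
  "cp A 0 = 1"
| "cp A (Suc 0) = 0"
| "cp A (Suc (Suc k)) = A (Suc k) * cp A (Suc k) + cp A k"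

lemma cf_det: "cp A (Suc k) * cq A k - cp A k * cq A (Suc k) = (- 1) ^ Suc k"
proof (induction k)
  case (Suc k)
  have "cp A (Suc (Suc k)) * cq A (Suc k) - cp A (Suc k) * cq A (Suc (Suc k)) =
      - (cp A (Suc k) * cq A k - cp A k * cq A (Suc k))" by (simp add: algebra_simps)
  then show ?case using Suc by simp
qed simp

text \<open>\<open>Y k\<close> is the complete quotient [0; A (k + 1), A (k + 2), ...]. The partial
  quotients have arbitrary signs; absolute values of at least 6 take the place of positivity and
  make denominators grow and remainders shrink geometrically.\<close>

locale cfrac =
  fixes A :: "nat => int" and Y :: "nat => real" and M :: real
  assumes Yrec: "\<And>k. Y k * (ri (A (Suc k)) + Y (Suc k)) = 1"
    and A6: "\<And>k. \<bar>ri (A (Suc k))\<bar> \<ge> 6" and AM: "\<And>k. \<bar>ri (A (Suc k))\<bar> \<le> M"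
    and Y1: "\<And>k. \<bar>Y k\<bar> \<le> 1"
begin

abbreviation q where "q k \<equiv> ri (cq A k)"
abbreviation p where "p k \<equiv> ri (cp A k)"

definition dd :: "nat => real" where "dd k = q k * Y 0 - p k"

lemma M6: "M \<ge> 6" using A6[of 0] AM[of 0] by linarith

lemma Y0: "Y k \<noteq> 0" using Yrec[of k] by auto

lemma Y_inv: "1 / Y k = ri (A (Suc k)) + Y (Suc k)"
  using Yrec[of k] Y0[of k] by (simp add: field_simps)

lemma Y5: "\<bar>Y k\<bar> \<le> 1/5"
proof -
  have "\<bar>ri (A (Suc k)) + Y (Suc k)\<bar> \<ge> 5" using A6[of k] Y1[of "Suc k"] by linarith
  then have "\<bar>Y k\<bar> * 5 \<le> \<bar>Y k\<bar> * \<bar>ri (A (Suc k)) + Y (Suc k)\<bar>" by (intro mult_left_mono) auto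
  also have "... = 1" using Yrec[of k] by (simp flip: abs_mult)
  finally show ?thesis by simp
qed

lemma Y_lower: "\<bar>Y k\<bar> \<ge> 1 / (M + 1)"
proof -
  have "\<bar>ri (A (Suc k)) + Y (Suc k)\<bar> \<le> M + 1" using AM[of k] Y1[of "Suc k"] by linarith
  then have "\<bar>Y k\<bar> * \<bar>ri (A (Suc k)) + Y (Suc k)\<bar> \<le> \<bar>Y k\<bar> * (M + 1)" by (intro mult_left_mono) auto
  moreover have "\<bar>Y k\<bar> * \<bar>ri (A (Suc k)) + Y (Suc k)\<bar> = 1" using Yrec[of k] by (simp flip: abs_mult)
  ultimately show ?thesis using M6 by (simp add: field_simps)
qed

lemma dd_Suc: "dd (Suc k) = - Y k * dd k"
proof (induction k)
  case (Suc k)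
  have "dd (Suc (Suc k)) = ri (A (Suc k)) * dd (Suc k) + dd k"
    by (simp add: dd_def algebra_simps)
  also have "dd k = - (ri (A (Suc k)) + Y (Suc k)) * dd (Suc k)"
  proof -
    have "(ri (A (Suc k)) + Y (Suc k)) * dd (Suc k) = - (Y k * (ri (A (Suc k)) + Y (Suc k))) * dd k"
      unfolding Suc by simp
    then show ?thesis unfolding Yrec mult_minus_left mult_1 by linarith
  qed
  finally show ?case by (simp add: algebra_simps)
qed (simp add: dd_def)

lemma dd_0 [simp]: "dd 0 = -1" by (simp add: dd_def)

lemma dd_Suc_le: "\<bar>dd (Suc k)\<bar> \<le> \<bar>dd k\<bar> / 5"
  unfolding dd_Suc abs_mult using mult_right_mono[OF Y5[of k], of "\<bar>dd k\<bar>"] by simp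

lemma dd_le: "\<bar>dd k\<bar> \<le> (1/5) ^ k"
proof (induction k)
  case (Suc k)
  then show ?case using dd_Suc_le[of k] by simp
qed simp

lemma q_growth: "\<bar>q (Suc k)\<bar> \<ge> 1 \<and> \<bar>q k\<bar> \<le> \<bar>q (Suc k)\<bar> \<and> 5 * \<bar>q (Suc k)\<bar> \<le> \<bar>q (Suc (Suc k))\<bar>
  \<and> \<bar>q (Suc (Suc k))\<bar> \<le> (M + 1) * \<bar>q (Suc k)\<bar>"
proof (induction k)
  case 0
  then show ?case using A6[of 0] AM[of 0] by auto
next
  case (Suc k)
  let ?a = "ri (A (Suc (Suc k)))"
  have e: "q (Suc (Suc (Suc k))) = ?a * q (Suc (Suc k)) + q (Suc k)" by simp
  have qs: "\<bar>q (Suc k)\<bar> \<le> \<bar>q (Suc (Suc k))\<bar>" using Suc by linarith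
  have 1: "\<bar>?a * q (Suc (Suc k))\<bar> \<ge> 6 * \<bar>q (Suc (Suc k))\<bar>"
    unfolding abs_mult using A6[of "Suc k"] by (intro mult_right_mono) auto
  have 2: "\<bar>?a * q (Suc (Suc k))\<bar> \<le> M * \<bar>q (Suc (Suc k))\<bar>"
    unfolding abs_mult using AM[of "Suc k"] by (intro mult_right_mono) auto
  have "\<bar>q (Suc (Suc (Suc k)))\<bar> \<ge> 5 * \<bar>q (Suc (Suc k))\<bar>" unfolding e using 1 qs by linarith
  moreover have "\<bar>q (Suc (Suc (Suc k)))\<bar> \<le> (M + 1) * \<bar>q (Suc (Suc k))\<bar>"
    using 2 qs abs_triangle_ineq[of "?a * q (Suc (Suc k))" "q (Suc k)"]
    unfolding e distrib_right mult_1 by linarith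
  ultimately show ?case using Suc qs by linarith
qed

lemma q_ge1: "\<bar>q (Suc k)\<bar> \<ge> 1" and q_mono: "\<bar>q k\<bar> \<le> \<bar>q (Suc k)\<bar>"
  and q_5: "5 * \<bar>q (Suc k)\<bar> \<le> \<bar>q (Suc (Suc k))\<bar>"
  using q_growth[of k] by auto

lemma q_M: "\<bar>q (Suc (Suc k))\<bar> \<le> (M + 1) * \<bar>q (Suc k)\<bar>"
  using q_growth[of k] by auto

lemma q_lower: "\<bar>q (Suc k)\<bar> \<ge> 5 ^ k"
proof (induction k)
  case (Suc k)
  then show ?case using q_5[of k] by simp
qed simp

lemma q_upper: "\<bar>q (Suc k)\<bar> \<le> (M + 1) ^ k"
proof (induction k)
  case (Suc k)
  have "\<bar>q (Suc (Suc k))\<bar> \<le> (M + 1) * \<bar>q (Suc k)\<bar>" by (rule q_M)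
  also have "... \<le> (M + 1) * (M + 1) ^ k" using Suc M6 by (intro mult_left_mono) auto
  finally show ?case by simp
qed simp

text \<open>The two products in the determinant identity differ by 1, and the second is at most a
  fifth of the first in absolute value; hence the bounds 1 / (1 + 1/5) and 1 / (1 - 1/5).\<close>

lemma dd_q: "\<bar>dd k\<bar> * \<bar>q (Suc k)\<bar> \<le> 5/4" "\<bar>dd k\<bar> * \<bar>q (Suc k)\<bar> \<ge> 5/6"
proof -
  have "dd k * q (Suc k) - dd (Suc k) * q k = ri (cp A (Suc k) * cq A k - cp A k * cq A (Suc k))"
    by (simp add: dd_def algebra_simps)
  also have "... = (- 1) ^ Suc k" by (simp only: cf_det) simp
  finally have e: "\<bar>dd k * q (Suc k) - dd (Suc k) * q k\<bar> = 1" by simp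
  have "\<bar>dd (Suc k) * q k\<bar> \<le> (\<bar>dd k\<bar> / 5) * \<bar>q (Suc k)\<bar>"
    unfolding abs_mult using dd_Suc_le[of k] q_mono[of k] by (intro mult_mono) auto
  moreover have "\<bar>dd k * q (Suc k)\<bar> = \<bar>dd k\<bar> * \<bar>q (Suc k)\<bar>" by (rule abs_mult)
  ultimately show "\<bar>dd k\<bar> * \<bar>q (Suc k)\<bar> \<le> 5/4" "\<bar>dd k\<bar> * \<bar>q (Suc k)\<bar> \<ge> 5/6"
    using e by linarith+
qed

lemma p_eq: "p k = q k * Y 0 - dd k" by (simp add: dd_def)

text \<open>Take the first k with |dd k| |y| at most 1/2. Consecutive convergents are independent,
  so x / y differs from this one or from the next; the nonzero integer determinant is at least 1,
  and |dd| |y| accounts for at most half of it.\<close>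

lemma badly_approximable:
  fixes x y :: int
  assumes "y \<noteq> 0"
  shows "\<bar>ri y * Y 0 - ri x\<bar> \<ge> 1 / (5 * (M + 1) * \<bar>ri y\<bar>)"
proof -
  define e where "e = ri y * Y 0 - ri x"
  have y1: "\<bar>ri y\<bar> \<ge> 1" using assms by linarith
  have "\<exists>k. \<bar>dd k\<bar> * \<bar>ri y\<bar> \<le> 1/2"
  proof -
    obtain k where "(1/5::real) ^ k < 1 / (2 * \<bar>ri y\<bar>)"
      using real_arch_pow_inv[of "1 / (2 * \<bar>ri y\<bar>)" "1/5"] y1 by auto
    with dd_le[of k] have "\<bar>dd k\<bar> \<le> 1 / (2 * \<bar>ri y\<bar>)" by linarith
    then show ?thesis using y1 by (intro exI[of _ k]) (simp add: field_simps)
  qed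
  then obtain k where k: "\<bar>dd k\<bar> * \<bar>ri y\<bar> \<le> 1/2" "\<And>j. j < k ==> \<not> \<bar>dd j\<bar> * \<bar>ri y\<bar> \<le> 1/2"
    using exists_least_iff[of "\<lambda>k. \<bar>dd k\<bar> * \<bar>ri y\<bar> \<le> 1/2"] by auto
  have "k \<noteq> 0" using k(1) y1 by (intro notI) auto
  then obtain k' where k': "k = Suc k'" by (cases k) auto
  have "\<bar>dd k'\<bar> * \<bar>ri y\<bar> > 1/2" using k(2)[of k'] k' by simp
  have qk: "\<bar>q k\<bar> \<le> 5/2 * \<bar>ri y\<bar>"
  proof -
    have "\<bar>q k\<bar> * (1/2) \<le> \<bar>q k\<bar> * (\<bar>dd k'\<bar> * \<bar>ri y\<bar>)"
      using \<open>\<bar>dd k'\<bar> * \<bar>ri y\<bar> > 1/2\<close> by (intro mult_left_mono) auto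
    also have "... = (\<bar>dd k'\<bar> * \<bar>q (Suc k')\<bar>) * \<bar>ri y\<bar>" by (simp add: k' mult_ac)
    also have "... \<le> 5/4 * \<bar>ri y\<bar>" using dd_q(1)[of k'] by (intro mult_right_mono) auto
    finally show ?thesis by simp
  qed
  have q2: "\<bar>q (Suc k)\<bar> \<le> (M + 1) * (5/2 * \<bar>ri y\<bar>)"
  proof -
    have "\<bar>q (Suc k)\<bar> \<le> (M + 1) * \<bar>q k\<bar>" using q_M[of k'] by (simp add: k')
    also have "... \<le> (M + 1) * (5/2 * \<bar>ri y\<bar>)" using qk M6 by (intro mult_left_mono) auto
    finally show ?thesis .
  qed
  have key: "1 / (5 * (M + 1) * \<bar>ri y\<bar>) \<le> \<bar>e\<bar>"
    if j: "\<bar>dd j\<bar> * \<bar>ri y\<bar> \<le> 1/2" "\<bar>q j\<bar> \<le> (M + 1) * (5/2 * \<bar>ri y\<bar>)" "cq A j * x - cp A j * y \<noteq> 0" for j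
  proof -
    have "ri (cq A j * x - cp A j * y) = dd j * ri y - q j * e"
      by (simp add: e_def dd_def algebra_simps)
    moreover have "\<bar>ri (cq A j * x - cp A j * y)\<bar> \<ge> 1" using j(3) by linarith
    ultimately have "1 \<le> \<bar>dd j\<bar> * \<bar>ri y\<bar> + \<bar>q j\<bar> * \<bar>e\<bar>"
      using abs_triangle_ineq4[of "dd j * ri y" "q j * e"] unfolding abs_mult by linarith
    then have "1/2 \<le> \<bar>q j\<bar> * \<bar>e\<bar>" using j(1) by linarith
    also have "... \<le> (M + 1) * (5/2 * \<bar>ri y\<bar>) * \<bar>e\<bar>" using j(2) by (intro mult_right_mono) auto
    finally show ?thesis using M6 y1 
      by (subst pos_divide_le_eq) (auto simp: algebra_simps intro!: mult_pos_pos add_pos_pos)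
  qed
  show ?thesis
  proof (cases "cq A k * x - cp A k * y = 0")
    case False
    have "\<bar>q k\<bar> \<le> (M + 1) * (5/2 * \<bar>ri y\<bar>)"
    proof -
      have "1 * (5/2 * \<bar>ri y\<bar>) \<le> (M + 1) * (5/2 * \<bar>ri y\<bar>)" using M6 by (intro mult_right_mono) auto
      then show ?thesis using qk by linarith
    qed
    then show ?thesis using key[OF k(1) _ False] by (simp add: e_def)
  next
    case True
    have "cq A (Suc k) * x - cp A (Suc k) * y \<noteq> 0"
    proof
      assume z: "cq A (Suc k) * x - cp A (Suc k) * y = 0"
      have "(cp A (Suc k) * cq A k - cp A k * cq A (Suc k)) * y = 0"
      proof -
        have "(cp A (Suc k) * cq A k - cp A k * cq A (Suc k)) * y =
            cq A (Suc k) * (cq A k * x - cp A k * y) - cq A k * (cq A (Suc k) * x - cp A (Suc k) * y)"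
          by (simp add: algebra_simps)
        then show ?thesis using z True by simp
      qed
      then show False using assms unfolding cf_det by simp
    qed
    moreover have "\<bar>dd (Suc k)\<bar> * \<bar>ri y\<bar> \<le> 1/2"
    proof -
      have "\<bar>dd (Suc k)\<bar> \<le> \<bar>dd k\<bar>" using dd_Suc_le[of k] by linarith
      then have "\<bar>dd (Suc k)\<bar> * \<bar>ri y\<bar> \<le> \<bar>dd k\<bar> * \<bar>ri y\<bar>" by (intro mult_right_mono) auto
      then show ?thesis using k(1) by linarith
    qed
    ultimately show ?thesis using key[OF _ q2] by (simp add: e_def)
  qed
qed

lemma shift_cfrac: "cfrac (\<lambda>k. A (k + r)) (\<lambda>k. Y (k + r)) M"
  by unfold_locales (use Yrec A6 AM Y1 in auto)

lemma badly_approximable_shift: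
  fixes x y :: int
  assumes "y \<noteq> 0"
  shows "\<bar>ri y * Y r - ri x\<bar> \<ge> 1 / (5 * (M + 1) * \<bar>ri y\<bar>)"
  using cfrac.badly_approximable[OF shift_cfrac[of r] assms, of x] by simp

text \<open>Each common partial quotient multiplies the difference by Y r Y r', which is at most
  1/25 in absolute value.\<close>

lemma Y_close:
  "(\<And>k. k < t ==> A (r + k + 1) = A (r' + k + 1)) ==> \<bar>Y r - Y r'\<bar> \<le> (1/25) ^ t"
proof (induction t arbitrary: r r')
  case 0
  then show ?case using Y5[of r] Y5[of r'] by auto
next
  case (Suc t)
  have IH: "\<bar>Y (Suc r) - Y (Suc r')\<bar> \<le> (1/25) ^ t"
    using Suc.prems[of "Suc _"] by (intro Suc.IH) auto
  have "A (Suc r) = A (Suc r')" using Suc.prems[of 0] by simp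
  then have "1 / Y r - 1 / Y r' = Y (Suc r) - Y (Suc r')" by (simp add: Y_inv)
  then have "Y r' - Y r = Y r * Y r' * (Y (Suc r) - Y (Suc r'))" using Y0[of r] Y0[of r'] by (simp add: field_simps)
  then have "\<bar>Y r - Y r'\<bar> = \<bar>Y r\<bar> * \<bar>Y r'\<bar> * \<bar>Y (Suc r) - Y (Suc r')\<bar>"
    by (metis abs_minus_commute abs_mult)
  also have "... \<le> (1/5 * (1/5)) * (1/25) ^ t" using Y5[of r] Y5[of r'] IH by (intro mult_mono) auto
  finally show ?case by simp
qed

lemma Y_eq_imp_A_eq:
  assumes "Y r = Y r'"
  shows "Y (r + k) = Y (r' + k) \<and> A (r + k + 1) = A (r' + k + 1)"
proof -
  have step: "A (Suc i) = A (Suc j) \<and> Y (Suc i) = Y (Suc j)" if "Y i = Y j" for i j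
  proof -
    have "ri (A (Suc i)) + Y (Suc i) = ri (A (Suc j)) + Y (Suc j)"
      using that by (simp flip: Y_inv)
    then have "\<bar>ri (A (Suc i) - A (Suc j))\<bar> < 1" using Y5[of "Suc i"] Y5[of "Suc j"] unfolding of_int_diff by linarith
    then have "A (Suc i) = A (Suc j)" by linarith
    then show ?thesis using \<open>ri (A (Suc i)) + Y (Suc i) = ri (A (Suc j)) + Y (Suc j)\<close> by simp
  qed
  have "Y (r + k) = Y (r' + k)" 
  proof (induction k)
    case (Suc k)
    then show ?case using step[of "r + k" "r' + k"] by simp
  qed (simp add: assms)
  with step[OF this] show ?thesis by simp
qed

text \<open>Lagrange's theorem: the transformed quadratic forms have bounded coefficients.\<close>

lemma quadratic_imp_periodic:
  fixes a b c :: int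
  assumes nz: "a \<noteq> 0 \<or> b \<noteq> 0 \<or> c \<noteq> 0" and root: "ri a * (Y 0)\<^sup>2 + ri b * Y 0 + ri c = 0"
  shows "\<exists>l\<ge>1. \<exists>N\<ge>1. \<forall>n\<ge>N. A (n + l) = A n"
proof -
  define F where "F x y = a * x\<^sup>2 + b * x * y + c * y\<^sup>2" for x y :: int
  \<comment> \<open>The coefficients of the form transformed by the matrix of two consecutive
    convergents. \<open>Y r\<close> is a root of it because p (Suc r) + Y r p r is Y 0 times the
    same combination of denominators.\<close>
  define ka where "ka r = F (cp A (Suc r)) (cq A (Suc r))" for r
  define kc where "kc r = F (cp A r) (cq A r)" for r
  define kb where "kb r = 2 * a * cp A (Suc r) * cp A r + b * (cp A (Suc r) * cq A r + cp A r * cq A (Suc r)) + 2 * c * cq A (Suc r) * cq A r" for r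
  define K where "K = 2 * (2 * \<bar>ri a\<bar> + \<bar>ri b\<bar>) + \<bar>ri a\<bar>"
  have K0: "K \<ge> 0" by (simp add: K_def)
  have val: "ri (F (cp A r) (cq A r)) = - (2 * ri a * Y 0 + ri b) * (q r * dd r) + ri a * (dd r)\<^sup>2" for r
  proof -
    have "ri (F (cp A r) (cq A r)) = ri a * (p r)\<^sup>2 + ri b * p r * q r + ri c * (q r)\<^sup>2"
      by (simp add: F_def)
    also have "... = (q r)\<^sup>2 * (ri a * (Y 0)\<^sup>2 + ri b * Y 0 + ri c)
        - (2 * ri a * Y 0 + ri b) * (q r * dd r) + ri a * (dd r)\<^sup>2"
      unfolding p_eq by (simp add: algebra_simps power2_eq_square)
    finally show ?thesis unfolding root mult_minus_left mult_zero_right by linarith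
  qed
  have bound: "\<bar>ri (F (cp A r) (cq A r))\<bar> \<le> K" for r
  proof -
    have 1: "\<bar>q r * dd r\<bar> \<le> 2"
    proof -
      have "\<bar>q r * dd r\<bar> = \<bar>dd r\<bar> * \<bar>q r\<bar>" by (simp add: abs_mult)
      also have "... \<le> \<bar>dd r\<bar> * \<bar>q (Suc r)\<bar>" using q_mono[of r] by (intro mult_left_mono) auto
      finally show ?thesis using dd_q(1)[of r] by linarith
    qed
    have d1: "\<bar>dd r\<bar> \<le> 1" using dd_le[of r] power_le_one[of "1/5::real" r] by linarith
    have 2: "(dd r)\<^sup>2 \<le> 1" using d1 by (simp add: abs_square_le_1)
    have 3: "\<bar>2 * ri a * Y 0 + ri b\<bar> \<le> 2 * \<bar>ri a\<bar> + \<bar>ri b\<bar>"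
    proof -
      have "\<bar>2 * ri a * Y 0\<bar> \<le> 2 * \<bar>ri a\<bar> * 1"
        unfolding abs_mult using Y1[of 0] by (intro mult_mono) auto
      then show ?thesis by linarith
    qed
    have "\<bar>(2 * ri a * Y 0 + ri b) * (q r * dd r)\<bar> \<le> (2 * \<bar>ri a\<bar> + \<bar>ri b\<bar>) * 2"
      unfolding abs_mult[of "2 * ri a * Y 0 + ri b"] using 1 3 by (intro mult_mono) auto
    moreover have "\<bar>ri a * (dd r)\<^sup>2\<bar> \<le> \<bar>ri a\<bar> * 1"
      unfolding abs_mult using 2 by (intro mult_left_mono) auto
    ultimately show ?thesis unfolding val K_def by linarith
  qed
  have rel: "ri (ka r) + ri (kb r) * Y r + ri (kc r) * (Y r)\<^sup>2 = 0" for r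
  proof -
    have "dd (Suc r) + Y r * dd r = 0" by (simp add: dd_Suc)
    then have e: "p (Suc r) + Y r * p r = Y 0 * (q (Suc r) + Y r * q r)" by (simp add: p_eq algebra_simps)
    have "ri (ka r) + ri (kb r) * Y r + ri (kc r) * (Y r)\<^sup>2 =
        ri a * (p (Suc r) + Y r * p r)\<^sup>2 + ri b * (p (Suc r) + Y r * p r) * (q (Suc r) + Y r * q r)
        + ri c * (q (Suc r) + Y r * q r)\<^sup>2"
      by (simp add: ka_def kb_def kc_def F_def power2_eq_square algebra_simps)
    also have "... = (q (Suc r) + Y r * q r)\<^sup>2 * (ri a * (Y 0)\<^sup>2 + ri b * Y 0 + ri c)"
      unfolding e by (simp add: power2_eq_square algebra_simps)
    finally show ?thesis unfolding root by simp
  qed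
  define N where "N = \<lceil>(M + 1) * (2 * K)\<rceil>"
  have KN: "K \<le> ri N" "(M + 1) * (2 * K) \<le> ri N"
  proof -
    show 1: "(M + 1) * (2 * K) \<le> ri N" by (simp add: N_def)
    have "1 * (2 * K) \<le> (M + 1) * (2 * K)" using M6 K0 by (intro mult_right_mono) auto
    then show "K \<le> ri N" using 1 K0 by linarith
  qed
  have bka: "\<bar>ka r\<bar> \<le> N" "\<bar>kc r\<bar> \<le> N" for r
    using bound[of "Suc r"] bound[of r] KN(1) unfolding ka_def kc_def by linarith+
  \<comment> \<open>The middle coefficient is recovered from the root relation, by means of the
    lower bound for |Y r|.\<close>
  have bkb: "\<bar>kb r\<bar> \<le> N" for r
  proof -
    have "ri (kb r) * Y r = - (ri (ka r) + ri (kc r) * (Y r)\<^sup>2)" using rel[of r] by linarith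
    then have "\<bar>ri (kb r)\<bar> * \<bar>Y r\<bar> = \<bar>ri (ka r) + ri (kc r) * (Y r)\<^sup>2\<bar>"
      by (metis abs_minus_cancel abs_mult)
    also have "... \<le> \<bar>ri (ka r)\<bar> + \<bar>ri (kc r)\<bar> * (Y r)\<^sup>2"
      using abs_triangle_ineq[of "ri (ka r)" "ri (kc r) * (Y r)\<^sup>2"] by (simp add: abs_mult)
    also have "... \<le> K + K * 1"
    proof (intro add_mono mult_mono)
      show "(Y r)\<^sup>2 \<le> 1" using Y1[of r] by (simp add: abs_square_le_1)
    qed (use bound[of "Suc r"] bound[of r] K0 in \<open>auto simp: ka_def kc_def\<close>)
    finally have 1: "\<bar>ri (kb r)\<bar> * \<bar>Y r\<bar> \<le> 2 * K" by simp
    have "\<bar>ri (kb r)\<bar> * (1 / (M + 1)) \<le> \<bar>ri (kb r)\<bar> * \<bar>Y r\<bar>" using Y_lower[of r] by (intro mult_left_mono) auto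
    with 1 have "\<bar>ri (kb r)\<bar> \<le> (M + 1) * (2 * K)" 
    proof -
      have "\<bar>ri (kb r)\<bar> * (1 / (M + 1)) \<le> 2 * K"
        using \<open>\<bar>ri (kb r)\<bar> * (1 / (M + 1)) \<le> \<bar>ri (kb r)\<bar> * \<bar>Y r\<bar>\<close> 1 by linarith
      then show ?thesis using M6 by (simp add: pos_divide_le_eq mult.commute)
    qed
    then show ?thesis using KN(2) by linarith
  qed
  have nzr: "ka r \<noteq> 0 \<or> kb r \<noteq> 0 \<or> kc r \<noteq> 0" for r
  proof (rule ccontr)
    assume "\<not> (ka r \<noteq> 0 \<or> kb r \<noteq> 0 \<or> kc r \<noteq> 0)"
    then have z: "ka r = 0" "kb r = 0" "kc r = 0" by auto
    let ?P = "cp A (Suc r)" and ?Q = "cq A (Suc r)" and ?P' = "cp A r" and ?Q' = "cq A r"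
    let ?D = "?P * ?Q' - ?P' * ?Q"
    have D: "?D \<noteq> 0" by (simp only: cf_det) simp
    have "a * ?D\<^sup>2 = ka r * ?Q'\<^sup>2 - kb r * ?Q * ?Q' + kc r * ?Q\<^sup>2"
      by (simp add: ka_def kb_def kc_def F_def power2_eq_square algebra_simps)
    moreover have "b * ?D\<^sup>2 = - 2 * ka r * ?P' * ?Q' + kb r * (?P * ?Q' + ?P' * ?Q) - 2 * kc r * ?P * ?Q"
      by (simp add: ka_def kb_def kc_def F_def power2_eq_square algebra_simps)
    moreover have "c * ?D\<^sup>2 = ka r * ?P'\<^sup>2 - kb r * ?P * ?P' + kc r * ?P\<^sup>2"
      by (simp add: ka_def kb_def kc_def F_def power2_eq_square algebra_simps)
    ultimately show False using nz D by (simp add: z)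
  qed
  \<comment> \<open>The roots of finitely many nonzero quadratics. As all \<open>Y r\<close> lie in
    this finite set, two of them coincide, which yields a period.\<close>
  define S where "S = (\<Union>x\<in>{-N..N}. \<Union>y\<in>{-N..N}. \<Union>z\<in>{-N..N}. {u. [:ri x, ri y, ri z:] \<noteq> 0 \<and> poly [:ri x, ri y, ri z:] u = 0})"
  have "finite S"
  proof -
    have "finite {u. P \<noteq> 0 \<and> poly P u = 0}" for P :: "real poly"
      by (cases "P = 0") (simp_all add: poly_roots_finite)
    then show ?thesis unfolding S_def by (intro finite_UN_I finite_atLeastAtMost_int) blast
  qed
  moreover have "Y r \<in> S" for r
  proof -
    have "[:ri (ka r), ri (kb r), ri (kc r):] \<noteq> 0" using nzr[of r] by auto
    moreover have "poly [:ri (ka r), ri (kb r), ri (kc r):] (Y r) = 0"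
      using rel[of r] by (simp add: power2_eq_square algebra_simps)
    moreover have "ka r \<in> {-N..N}" "kb r \<in> {-N..N}" "kc r \<in> {-N..N}" using bka[of r] bkb[of r] by (auto simp: abs_le_iff)
    ultimately show ?thesis unfolding S_def by blast
  qed
  ultimately have "\<not> inj Y" by (metis (mono_tags, lifting) finite_imageD finite_subset image_subset_iff infinite_UNIV_nat)
  then obtain r r' where "Y r = Y r'" "r \<noteq> r'" by (auto simp: inj_on_def)
  then obtain r r' where rr: "Y r = Y r'" "r < r'" by (metis nat_neq_iff)
  have "A (n + (r' - r)) = A n" if n: "n \<ge> r + 1" for n
  proof -
    have "A (r + (n - r - 1) + 1) = A (r' + (n - r - 1) + 1)" using Y_eq_imp_A_eq[OF rr(1)] by blast
    moreover have "r + (n - r - 1) + 1 = n" "r' + (n - r - 1) + 1 = n + (r' - r)" using n rr(2) by auto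
    ultimately show ?thesis by simp
  qed
  then show ?thesis using rr(2) by (intro exI[of _ "r' - r"] conjI exI[of _ "r + 1"]) auto
qed

end

section \<open>A Liouville inequality for quadratic polynomials at an algebraic number\<close>

lemma quadratic_pseudo_division:
  fixes G :: "int poly" and a b c :: int and H L :: real
  assumes H: "\<bar>ri a\<bar> \<le> H" "\<bar>ri b\<bar> \<le> H" "\<bar>ri c\<bar> \<le> H" "H \<ge> 1"
    and \<alpha>: "\<bar>\<alpha>\<bar> \<le> 1" and L: "L \<ge> 0"
  shows "degree G \<le> n ==> (\<And>i. \<bar>ri (coeff G i)\<bar> \<le> L) ==>
    \<exists>Q u v. smult (a ^ n) G = [:c, b, a:] * Q + [:v, u:] \<and> \<bar>ri u\<bar> \<le> (3 * H) ^ n * L \<and>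
      \<bar>ri v\<bar> \<le> (3 * H) ^ n * L \<and> \<bar>poly (rpoly Q) \<alpha>\<bar> \<le> (4 * H) ^ n * L"
proof (induction n arbitrary: G)
  case 0
  then obtain x where "G = [:x:]" by (metis degree_eq_zeroE le_zero_eq)
  then show ?case using 0(2)[of 0] L by (intro exI[of _ 0] exI[of _ x]) auto
next
  case (Suc n)
  obtain x G' where G: "G = pCons x G'" by (rule pCons_cases[of G]) blast
  have d: "degree G' \<le> n" using Suc.prems(1) G by (cases "G' = 0") auto
  have c': "\<bar>ri (coeff G' i)\<bar> \<le> L" for i using Suc.prems(2)[of "Suc i"] G by simp
  have x: "\<bar>ri x\<bar> \<le> L" using Suc.prems(2)[of 0] G by simp
  obtain Q u v where IH: "smult (a ^ n) G' = [:c, b, a:] * Q + [:v, u:]" "\<bar>ri u\<bar> \<le> (3 * H) ^ n * L"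
      "\<bar>ri v\<bar> \<le> (3 * H) ^ n * L" "\<bar>poly (rpoly Q) \<alpha>\<bar> \<le> (4 * H) ^ n * L"
    using Suc.IH[OF d c'] by blast
  have "smult (a ^ Suc n) G = [:a ^ Suc n * x:] + [:0, a:] * smult (a ^ n) G'" by (simp add: G mult.commute)
  also have "... = [:c, b, a:] * ([:0, a:] * Q + [:u:]) + [:a ^ Suc n * x - c * u, a * v - b * u:]"
    unfolding IH(1) by (simp add: algebra_simps)
  finally have e: "smult (a ^ Suc n) G = [:c, b, a:] * ([:0, a:] * Q + [:u:]) + [:a ^ Suc n * x - c * u, a * v - b * u:]" .
  let ?S = "(3 * H) ^ n * L"
  have S0: "?S \<ge> 0" using H L by simp
  have HS: "H * (H ^ n * L) \<le> H * ?S"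
    using H L by (intro mult_left_mono mult_right_mono power_mono) auto
  have m: "\<bar>ri z * ri w\<bar> \<le> H * ?S" if "\<bar>ri z\<bar> \<le> H" "\<bar>ri w\<bar> \<le> ?S" for z w :: int
    unfolding abs_mult using that S0 H by (intro mult_mono) auto
  have ax: "\<bar>ri (a ^ Suc n * x)\<bar> \<le> H * ?S"
  proof -
    have "\<bar>ri (a ^ Suc n * x)\<bar> = \<bar>ri a\<bar> ^ Suc n * \<bar>ri x\<bar>" by (simp add: abs_mult power_abs)
    also have "... \<le> H ^ Suc n * L" using H x by (intro mult_mono power_mono) auto
    also have "... \<le> H * ?S" using HS by simp
    finally show ?thesis .
  qed
  \<comment> \<open>Each coefficient of the new remainder is a sum of two terms of at most this
    size, which the factor 3 covers.\<close>
  have three: "(3 * H) ^ Suc n * L = 3 * (H * ?S)" by simp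
  have HS0: "H * ?S \<ge> 0" using H S0 by simp
  have "\<bar>ri (a * v - b * u)\<bar> \<le> (3 * H) ^ Suc n * L"
    unfolding three using m[OF H(1) IH(3)] m[OF H(2) IH(2)] HS0 by simp
  moreover have "\<bar>ri (a ^ Suc n * x - c * u)\<bar> \<le> (3 * H) ^ Suc n * L"
    unfolding three using ax m[OF H(3) IH(2)] HS0 
    abs_triangle_ineq4[of "ri (a ^ Suc n * x)" "ri (c * u)"] by (simp only: of_int_diff of_int_mult[of c u])
  moreover have "\<bar>poly (rpoly ([:0, a:] * Q + [:u:])) \<alpha>\<bar> \<le> (4 * H) ^ Suc n * L"
  proof -
    have "poly (rpoly ([:0, a:] * Q + [:u:])) \<alpha> = \<alpha> * ri a * poly (rpoly Q) \<alpha> + ri u"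
      unfolding rpoly_add rpoly_mult by (simp add: map_poly_pCons)
    also have "\<bar>...\<bar> \<le> \<bar>\<alpha> * ri a\<bar> * \<bar>poly (rpoly Q) \<alpha>\<bar> + \<bar>ri u\<bar>"
      by (metis abs_mult abs_triangle_ineq)
    also have "... \<le> H * ((4 * H) ^ n * L) + (3 * H) ^ n * L"
    proof (intro add_mono IH(2) mult_mono IH(4))
      have "\<bar>\<alpha> * ri a\<bar> \<le> 1 * H" unfolding abs_mult using \<alpha> H by (intro mult_mono) auto
      then show "\<bar>\<alpha> * ri a\<bar> \<le> H" by simp
    qed (use H in auto)
    also have "(3 * H) ^ n * L \<le> H * ((4 * H) ^ n * L)"
    proof -
      have "(3 * H) ^ n * L \<le> (4 * H) ^ n * L" using H L by (intro mult_right_mono power_mono) auto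
      also have "... \<le> H * ((4 * H) ^ n * L)" using mult_right_mono[OF H(4), of "(4 * H) ^ n * L"] H L by simp
      finally show ?thesis .
    qed
    also have "H * ((4 * H) ^ n * L) + H * ((4 * H) ^ n * L) \<le> (4 * H) ^ Suc n * L"
      using H L by simp
    finally show ?thesis by simp
  qed
  ultimately show ?case using e by blast
qed

context cfrac begin

text \<open>Divide an integral polynomial of least degree vanishing at Y 0 by the quadratic. The
  linear remainder is nonzero by minimality, and bad approximability bounds its value from below; up
  to sign that value is the value of the quadratic times a bounded value of the quotient. The value
  of the quadratic is nonzero by Lagrange's theorem.\<close>

lemma quadratic_liouville:
  fixes g :: "int poly"
  assumes g: "g \<noteq> 0" "poly (rpoly g) (Y 0) = 0" and np: "\<not> (\<exists>l\<ge>1. \<exists>N\<ge>1. \<forall>n\<ge>N. A (n + l) = A n)"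
  obtains \<kappa> :: nat and C0 :: real where "C0 \<ge> 1"
    "\<And>a b c :: int. \<And>H. a \<noteq> 0 \<or> b \<noteq> 0 \<or> c \<noteq> 0 ==> \<bar>ri a\<bar> \<le> H ==> \<bar>ri b\<bar> \<le> H ==>
      \<bar>ri c\<bar> \<le> H ==> H \<ge> 1 ==> 1 \<le> C0 * H ^ \<kappa> * \<bar>ri a * (Y 0)\<^sup>2 + ri b * Y 0 + ri c\<bar>"
proof -
  define \<alpha> where "\<alpha> = Y 0"
  obtain g0 where g0: "g0 \<noteq> 0 \<and> poly (rpoly g0) \<alpha> = 0" "\<And>g'. g' \<noteq> 0 \<and> poly (rpoly g') \<alpha> = 0 ==> degree g0 \<le> degree g'"
    using arg_min_nat_lemma[of "\<lambda>g. g \<noteq> 0 \<and> poly (rpoly g) \<alpha> = 0" g degree] g unfolding \<alpha>_def by blast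
  define n where "n = degree g0"
  define L where "L = 1 + (\<Sum>i\<le>n. \<bar>ri (coeff g0 i)\<bar>)"
  have L: "\<bar>ri (coeff g0 i)\<bar> \<le> L" for i
  proof (cases "i \<le> n")
    case True
    then have "\<bar>ri (coeff g0 i)\<bar> \<le> (\<Sum>i\<le>n. \<bar>ri (coeff g0 i)\<bar>)" by (intro member_le_sum) auto
    then show ?thesis by (simp add: L_def)
  next
    case False
    then have "coeff g0 i = 0" by (simp add: n_def coeff_eq_0)
    then show ?thesis by (simp add: L_def sum_nonneg)
  qed
  have L1: "L \<ge> 1" by (simp add: L_def sum_nonneg)
  define B where "B = 5 * (M + 1)"
  have B: "B \<ge> 1" using M6 by (simp add: B_def)
  have lin: "1 \<le> B * U * \<bar>ri u * \<alpha> + ri v\<bar>"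
    if "u \<noteq> 0 \<or> v \<noteq> 0" "\<bar>ri u\<bar> \<le> U" "U \<ge> 1" for u v :: int and U
  proof (cases "u = 0")
    case True
    then have "\<bar>ri u * \<alpha> + ri v\<bar> \<ge> 1" 
  proof -
    have "v \<noteq> 0" using True that by simp
    then have "\<bar>ri v\<bar> \<ge> 1" by linarith
    then show ?thesis using True by simp
  qed
    moreover have "B * U \<ge> 1" using B that by (simp add: mult_ge1_I)
    ultimately show ?thesis by (simp add: mult_ge1_I)
  next
    case False
    have u1: "\<bar>ri u\<bar> > 0" using False by simp
    have "1 / (B * \<bar>ri u\<bar>) \<le> \<bar>ri u * \<alpha> + ri v\<bar>"
      using badly_approximable[OF False, of "- v"] by (simp add: B_def \<alpha>_def)
    then have "1 \<le> B * \<bar>ri u\<bar> * \<bar>ri u * \<alpha> + ri v\<bar>" using B u1 by (simp add: field_simps)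
    also have "... \<le> B * U * \<bar>ri u * \<alpha> + ri v\<bar>" using B that by (intro mult_right_mono mult_left_mono) auto
    finally show ?thesis .
  qed
  define C0 where "C0 = B * (3 ^ n * L) * (4 ^ n * L)"
  have C0: "C0 \<ge> B" "C0 \<ge> 1"
  proof -
    have "B * 1 * 1 \<le> C0" unfolding C0_def using B L1 by (intro mult_mono mult_ge1_I one_le_power) auto
    then show "C0 \<ge> B" "C0 \<ge> 1" using B by linarith+
  qed
  show ?thesis
  proof (rule that[of C0 "2 * n + 1"])
    show "C0 \<ge> 1" by (rule C0)
    fix a b c :: int and H :: real
    assume nz: "a \<noteq> 0 \<or> b \<noteq> 0 \<or> c \<noteq> 0" and H: "\<bar>ri a\<bar> \<le> H" "\<bar>ri b\<bar> \<le> H" "\<bar>ri c\<bar> \<le> H" "H \<ge> 1"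
    define f where "f = ri a * \<alpha>\<^sup>2 + ri b * \<alpha> + ri c"
    have f0: "f \<noteq> 0" using quadratic_imp_periodic[OF nz] np unfolding f_def \<alpha>_def by blast
    have "1 \<le> C0 * H ^ (2 * n + 1) * \<bar>f\<bar>"
    proof (cases "a = 0")
      case True
      have "1 \<le> B * H * \<bar>f\<bar>" using lin[of b c H] nz True H by (simp add: f_def)
      also have "... \<le> C0 * H ^ (2 * n + 1) * \<bar>f\<bar>"
      proof (intro mult_right_mono mult_mono)
        show "H \<le> H ^ (2 * n + 1)" using power_increasing[of 1 "2 * n + 1" H] H by simp
      qed (use C0 H B in auto)
      finally show ?thesis .
    next
      case False
      have "\<bar>\<alpha>\<bar> \<le> 1" using Y1 by (simp add: \<alpha>_def)
      from quadratic_pseudo_division[OF H this, of L g0 n] L1 L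
      obtain Q u v where Q: "smult (a ^ n) g0 = [:c, b, a:] * Q + [:v, u:]" "\<bar>ri u\<bar> \<le> (3 * H) ^ n * L"
        "\<bar>poly (rpoly Q) \<alpha>\<bar> \<le> (4 * H) ^ n * L" unfolding n_def by auto
      have ev: "0 = f * poly (rpoly Q) \<alpha> + (ri u * \<alpha> + ri v)"
      proof -
        have "poly (rpoly (smult (a ^ n) g0)) \<alpha> = 0" unfolding rpoly_smult using g0(1) by simp
        then show ?thesis unfolding Q(1) rpoly_add rpoly_mult
          by (simp add: map_poly_pCons f_def power2_eq_square algebra_simps)
      qed
      have uv: "u \<noteq> 0 \<or> v \<noteq> 0"
      proof (rule ccontr)
        assume "\<not> (u \<noteq> 0 \<or> v \<noteq> 0)"
        then have z: "u = 0" "v = 0" by auto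
        then have Q0: "poly (rpoly Q) \<alpha> = 0" using ev f0 by simp
        have e: "smult (a ^ n) g0 = [:c, b, a:] * Q" using Q(1) z by simp
        have "Q \<noteq> 0" using e False g0(1) by auto
        then have "degree (smult (a ^ n) g0) = 2 + degree Q" unfolding e using False by (subst degree_mult_eq) auto
        then have "degree Q < degree g0" using False by simp
        moreover have "degree g0 \<le> degree Q" using g0(2)[of Q] \<open>Q \<noteq> 0\<close> Q0 by blast
        ultimately show False by simp
      qed
      have U1: "(3 * H) ^ n * L \<ge> 1" using H L1 by (intro mult_ge1_I one_le_power) auto
      have "1 \<le> B * ((3 * H) ^ n * L) * \<bar>ri u * \<alpha> + ri v\<bar>" by (rule lin[OF uv Q(2) U1])
      also have "\<bar>ri u * \<alpha> + ri v\<bar> = \<bar>f\<bar> * \<bar>poly (rpoly Q) \<alpha>\<bar>"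
      proof -
        have "ri u * \<alpha> + ri v = - (f * poly (rpoly Q) \<alpha>)" using ev by linarith
        then show ?thesis by (simp add: abs_mult)
      qed
      also have "B * ((3 * H) ^ n * L) * (\<bar>f\<bar> * \<bar>poly (rpoly Q) \<alpha>\<bar>) \<le> B * ((3 * H) ^ n * L) * (\<bar>f\<bar> * ((4 * H) ^ n * L))"
        using Q(3) B U1 by (intro mult_left_mono) auto
      also have "... = C0 * H ^ (2 * n) * \<bar>f\<bar>"
        by (simp add: C0_def power_mult_distrib mult_2 power_add)
      also have "... \<le> C0 * H ^ (2 * n + 1) * \<bar>f\<bar>"
        using C0 H by (intro mult_right_mono mult_left_mono power_increasing) auto
      finally show ?thesis .
    qed
    then show "1 \<le> C0 * H ^ (2 * n + 1) * \<bar>ri a * (Y 0)\<^sup>2 + ri b * Y 0 + ri c\<bar>"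
      by (simp add: f_def \<alpha>_def)
  qed
qed

end

section \<open>Three-dimensional geometry of numbers\<close>

text \<open>The gauge of a parallelepiped of volume 8 R \<rho>^2 in the space of symmetric matrices
  with entries a, b, b, c. The last two terms measure the matrix applied to (- Y, 1).\<close>

definition tn :: "real => real => real => real => real => real => real" where
  "tn Y R \<rho> a b c = max (\<bar>a\<bar> / R) (max (\<bar>b - Y * a\<bar> / \<rho>) (\<bar>c - Y * b\<bar> / \<rho>))"

lemma tn_le_iff:
  assumes "R > 0" "\<rho> > 0"
  shows "tn Y R \<rho> a b c \<le> m \<longleftrightarrow> \<bar>a\<bar> \<le> m * R \<and> \<bar>b - Y * a\<bar> \<le> m * \<rho> \<and> \<bar>c - Y * b\<bar> \<le> m * \<rho>"
  using assms by (simp add: tn_def pos_divide_le_eq)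

lemma tn_add:
  assumes "R > 0" "\<rho> > 0"
  shows "tn Y R \<rho> (a + a') (b + b') (c + c') \<le> tn Y R \<rho> a b c + tn Y R \<rho> a' b' c'"
proof -
  note iff = tn_le_iff[OF assms]
  have 1: "\<bar>a\<bar> \<le> tn Y R \<rho> a b c * R \<and> \<bar>b - Y * a\<bar> \<le> tn Y R \<rho> a b c * \<rho> \<and> \<bar>c - Y * b\<bar> \<le> tn Y R \<rho> a b c * \<rho>"
    using iff[of Y a b c "tn Y R \<rho> a b c"] by simp
  have 2: "\<bar>a'\<bar> \<le> tn Y R \<rho> a' b' c' * R \<and> \<bar>b' - Y * a'\<bar> \<le> tn Y R \<rho> a' b' c' * \<rho> \<and> \<bar>c' - Y * b'\<bar> \<le> tn Y R \<rho> a' b' c' * \<rho>"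
    using iff[of Y a' b' c' "tn Y R \<rho> a' b' c'"] by simp
  show ?thesis unfolding iff distrib_right distrib_left
  proof (intro conjI)
    show "\<bar>a + a'\<bar> \<le> tn Y R \<rho> a b c * R + tn Y R \<rho> a' b' c' * R"
      using 1 2 abs_triangle_ineq[of a a'] by linarith
    show "\<bar>b + b' - (Y * a + Y * a')\<bar> \<le> tn Y R \<rho> a b c * \<rho> + tn Y R \<rho> a' b' c' * \<rho>"
      using 1 2 abs_triangle_ineq[of "b - Y * a" "b' - Y * a'"] by (simp only: add_diff_add) linarith
    show "\<bar>c + c' - (Y * b + Y * b')\<bar> \<le> tn Y R \<rho> a b c * \<rho> + tn Y R \<rho> a' b' c' * \<rho>"
      using 1 2 abs_triangle_ineq[of "c - Y * b" "c' - Y * b'"] by (simp only: add_diff_add) linarith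
  qed
qed

lemma tn_scale_le:
  assumes "R > 0" "\<rho> > 0"
  shows "tn Y R \<rho> (u * a) (u * b) (u * c) \<le> \<bar>u\<bar> * tn Y R \<rho> a b c"
proof -
  note iff = tn_le_iff[OF assms]
  have 1: "\<bar>a\<bar> \<le> tn Y R \<rho> a b c * R" "\<bar>b - Y * a\<bar> \<le> tn Y R \<rho> a b c * \<rho>" "\<bar>c - Y * b\<bar> \<le> tn Y R \<rho> a b c * \<rho>"
    using iff[of Y a b c "tn Y R \<rho> a b c"] by auto
  have e: "u * b - Y * (u * a) = u * (b - Y * a)" "u * c - Y * (u * b) = u * (c - Y * b)"
    by (simp_all add: algebra_simps)
  show ?thesis unfolding iff e abs_mult mult.assoc using 1 by (intro conjI mult_left_mono) auto
qed

lemma tn_nonneg: "R > 0 ==> tn Y R \<rho> a b c \<ge> 0"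
  by (simp add: tn_def le_max_iff_disj)

lemma finite_tn_le:
  assumes "R > 0" "\<rho> > 0"
  shows "finite {(a :: int, b :: int, c :: int). tn Y R \<rho> (ri a) (ri b) (ri c) \<le> m}"
proof -
  define K1 where "K1 = m * R"
  define K2 where "K2 = m * \<rho> + \<bar>Y\<bar> * K1"
  define K3 where "K3 = m * \<rho> + \<bar>Y\<bar> * K2"
  have "{(a :: int, b :: int, c :: int). tn Y R \<rho> (ri a) (ri b) (ri c) \<le> m}
      \<subseteq> {-\<lceil>K1\<rceil>..\<lceil>K1\<rceil>} \<times> {-\<lceil>K2\<rceil>..\<lceil>K2\<rceil>} \<times> {-\<lceil>K3\<rceil>..\<lceil>K3\<rceil>}"
  proof
    fix x assume "x \<in> {(a :: int, b :: int, c :: int). tn Y R \<rho> (ri a) (ri b) (ri c) \<le> m}"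
    then obtain a b c where x: "x = (a, b, c)" and "tn Y R \<rho> (ri a) (ri b) (ri c) \<le> m" by auto
    then have t: "\<bar>ri a\<bar> \<le> K1" "\<bar>ri b - Y * ri a\<bar> \<le> m * \<rho>" "\<bar>ri c - Y * ri b\<bar> \<le> m * \<rho>"
      unfolding tn_le_iff[OF assms] K1_def by auto
    have "\<bar>Y * ri a\<bar> \<le> \<bar>Y\<bar> * K1" unfolding abs_mult using t(1) by (intro mult_left_mono) auto
    then have b: "\<bar>ri b\<bar> \<le> K2" using t(2) unfolding K2_def by linarith
    have "\<bar>Y * ri b\<bar> \<le> \<bar>Y\<bar> * K2" unfolding abs_mult using b by (intro mult_left_mono) auto
    then have c: "\<bar>ri c\<bar> \<le> K3" using t(3) unfolding K3_def by linarith
    have box: "x \<in> {-\<lceil>K\<rceil>..\<lceil>K\<rceil>}" if "\<bar>ri x\<bar> \<le> K" for x :: int and K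
      using that by (auto simp: abs_le_iff) linarith+
    show "x \<in> {-\<lceil>K1\<rceil>..\<lceil>K1\<rceil>} \<times> {-\<lceil>K2\<rceil>..\<lceil>K2\<rceil>} \<times> {-\<lceil>K3\<rceil>..\<lceil>K3\<rceil>}"
      using box[OF t(1)] box[OF b] box[OF c] unfolding x by blast
  qed
  then show ?thesis by (rule finite_subset) auto
qed

text \<open>The pigeonhole argument for the chain s, floor of Y s, floor of Y times that integer:
  the two fractional parts fall into m^2 cells, so two of m^2 + 1 values of s share a cell.\<close>

lemma dirichlet_pair:
  fixes Y :: real and m :: nat
  assumes m: "m > 0"
  shows "\<exists>a b c :: int. a \<noteq> 0 \<and> \<bar>ri a\<bar> \<le> (real m)\<^sup>2 \<and> \<bar>ri b - Y * ri a\<bar> \<le> 1 / real m \<and>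
    \<bar>ri c - Y * ri b\<bar> \<le> 1 / real m"
proof -
  define B where "B s = \<lfloor>Y * real s\<rfloor>" for s :: nat
  define C where "C s = \<lfloor>Y * ri (B s)\<rfloor>" for s
  define u where "u s = Y * real s - ri (B s)" for s
  define v where "v s = Y * ri (B s) - ri (C s)" for s
  define F where "F s = (\<lfloor>real m * u s\<rfloor>, \<lfloor>real m * v s\<rfloor>)" for s
  have bin: "\<lfloor>real m * x\<rfloor> \<in> {0..<int m}" if "0 \<le> x" "x < 1" for x
  proof -
    have "real m * x < real m" using that m by simp
    then show ?thesis using that m by (auto simp: floor_less_iff)
  qed
  have "u s \<ge> 0" "u s < 1" "v s \<ge> 0" "v s < 1" for s
    unfolding u_def v_def B_def C_def by linarith+
  then have sub: "F ` {0..m * m} \<subseteq> {0..<int m} \<times> {0..<int m}" unfolding F_def using bin by blast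
  have "\<not> inj_on F {0..m * m}"
  proof
    assume "inj_on F {0..m * m}"
    then have "card {0..m * m} \<le> card ({0..<int m} \<times> {0..<int m})" using sub by (intro card_inj_on_le) auto
    then show False by simp
  qed
  then obtain s s' where ss: "s \<noteq> s'" "s \<le> m * m" "s' \<le> m * m" "F s = F s'" by (auto simp: inj_on_def)
  have close: "\<bar>x - y\<bar> \<le> 1 / real m" if "\<lfloor>real m * x\<rfloor> = \<lfloor>real m * y\<rfloor>" for x y
  proof -
    have "\<bar>real m * x - real m * y\<bar> \<le> 1" using that by linarith
    then have "real m * \<bar>x - y\<bar> \<le> 1" by (simp add: abs_mult flip: right_diff_distrib)
    then show ?thesis using m by (simp add: field_simps)
  qed
  have uv: "\<bar>u s - u s'\<bar> \<le> 1 / real m" "\<bar>v s - v s'\<bar> \<le> 1 / real m" using close ss(4) unfolding F_def by auto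
  let ?a = "int s - int s'" and ?b = "B s - B s'" and ?c = "C s - C s'"
  have "ri ?b - Y * ri ?a = - (u s - u s')" "ri ?c - Y * ri ?b = - (v s - v s')"
    by (simp_all add: u_def v_def algebra_simps)
  then have "\<bar>ri ?b - Y * ri ?a\<bar> \<le> 1 / real m" "\<bar>ri ?c - Y * ri ?b\<bar> \<le> 1 / real m"
    using uv by (simp_all only: abs_minus_cancel)
  moreover have "\<bar>ri ?a\<bar> \<le> (real m)\<^sup>2"
  proof -
    have "real s \<le> real (m * m)" "real s' \<le> real (m * m)" using ss by (simp_all only: of_nat_le_iff)
    then show ?thesis unfolding power2_eq_square by auto
  qed
  moreover have "?a \<noteq> 0" using ss(1) by simp
  ultimately show ?thesis by blast
qed

lemma primitive_triple:
  fixes a b c :: int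
  assumes "a \<noteq> 0 \<or> b \<noteq> 0 \<or> c \<noteq> 0"
  obtains g a' b' c' u v w :: int where "g \<noteq> 0" "a = g * a'" "b = g * b'" "c = g * c'" "u * a' + v * b' + w * c' = 1"
proof -
  define g where "g = gcd a (gcd b c)"
  have g: "g \<noteq> 0" using assms by (simp add: g_def)
  obtain x y where xy: "x * a + y * gcd b c = g" using bezout_int[of a "gcd b c"] unfolding g_def by blast
  obtain v w where vw: "v * b + w * c = gcd b c" using bezout_int[of b c] by blast
  have d: "g dvd a" "g dvd b" "g dvd c" by (auto simp: g_def intro: dvd_trans)
  then obtain a' b' c' where e: "a = g * a'" "b = g * b'" "c = g * c'" by (metis dvd_def)
  have "g * (x * a' + y * v * b' + y * w * c') = x * a + y * (v * b + w * c)" unfolding e by (simp add: algebra_simps)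
  then have "g * (x * a' + y * v * b' + y * w * c') = g * 1" using xy vw by simp
  then have "x * a' + y * v * b' + y * w * c' = 1" using g by simp
  then show thesis using that[of g a' b' c' x "y * v" "y * w"] g e by blast
qed

text \<open>(k1, k2, k3) is the cross product of the two vectors and d its squared length. The
  identities expand d times a vector in the two vectors and the normal; the normal component
  vanishes by orthogonality.\<close>

lemma plane_combination:
  fixes a1 b1 c1 a2 b2 c2 a b c :: real
  defines "k1 \<equiv> b1 * c2 - c1 * b2" and "k2 \<equiv> c1 * a2 - a1 * c2" and "k3 \<equiv> a1 * b2 - b1 * a2"
  assumes "k1 \<noteq> 0 \<or> k2 \<noteq> 0 \<or> k3 \<noteq> 0" and perp: "k1 * a + k2 * b + k3 * c = 0"
  shows "\<exists>u v. a = u * a1 + v * a2 \<and> b = u * b1 + v * b2 \<and> c = u * c1 + v * c2"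
proof -
  define d where "d = k1 * k1 + k2 * k2 + k3 * k3"
  have d: "d \<noteq> 0" using assms(4) unfolding d_def by (metis add_nonneg_eq_0_iff add_nonneg_nonneg mult_eq_0_iff zero_le_square)
  define u where "u = (b * c2 - c * b2) * k1 + (c * a2 - a * c2) * k2 + (a * b2 - b * a2) * k3"
  define v where "v = (b1 * c - c1 * b) * k1 + (c1 * a - a1 * c) * k2 + (a1 * b - b1 * a) * k3"
  have "d * a = u * a1 + v * a2 + k1 * (k1 * a + k2 * b + k3 * c)"
       "d * b = u * b1 + v * b2 + k2 * (k1 * a + k2 * b + k3 * c)"
       "d * c = u * c1 + v * c2 + k3 * (k1 * a + k2 * b + k3 * c)"
    unfolding d_def u_def v_def k1_def k2_def k3_def by (simp_all add: algebra_simps)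
  then have "a = u / d * a1 + v / d * a2" "b = u / d * b1 + v / d * b2" "c = u / d * c1 + v / d * c2"
    using d unfolding perp by (simp_all add: field_simps)
  then show ?thesis by blast
qed

text \<open>Dual to \<open>tn\<close>: C a + B b + A c = A (c - Y b) + (A Y + B) (b - Y a) + (A Y^2
  + B Y + C) a, so the three bounds limit the dual norm. The Bezout condition makes the form
  primitive.\<close>

definition small_form :: "real => real => real => int => int => int => bool" where
  "small_form Y H \<eta> A B C \<longleftrightarrow> (\<exists>u v w. u * A + v * B + w * C = 1) \<and> \<bar>ri A\<bar> \<le> H \<and>
    \<bar>ri A * Y + ri B\<bar> \<le> H \<and> \<bar>ri A * Y\<^sup>2 + ri B * Y + ri C\<bar> \<le> \<eta>"

definition three_short :: "real => real => real => bool" where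
  "three_short Y R \<rho> \<longleftrightarrow> (\<exists>a1 b1 c1 a2 b2 c2 a3 b3 c3 :: int.
    (b1 * c2 - c1 * b2) * a3 + (c1 * a2 - a1 * c2) * b3 + (a1 * b2 - b1 * a2) * c3 \<noteq> 0 \<and>
    tn Y R \<rho> (ri a1) (ri b1) (ri c1) \<le> 1 \<and>
    tn Y R \<rho> (ri a2) (ri b2) (ri c2) \<le> 1 \<and>
    tn Y R \<rho> (ri a3) (ri b3) (ri c3) \<le> 1)"

text \<open>If the second minimum were much larger than the distance of a lattice plane to the next one,
  then reducing a point of that next plane modulo two points of the plane would beat it.\<close>

lemma transference:
  fixes a1 b1 c1 :: int and Y R \<rho> :: real
  assumes R: "R > 0" "\<rho> > 0" and nz: "a1 \<noteq> 0 \<or> b1 \<noteq> 0 \<or> c1 \<noteq> 0"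
    and N1: "tn Y R \<rho> (ri a1) (ri b1) (ri c1) \<le> 1/4"
  shows "three_short Y R \<rho> \<or> (\<exists>A B C. small_form Y (8 / \<rho>) (8 / R) A B C)"
proof -
  define N where "N = (\<lambda>(a :: int, b :: int, c :: int). tn Y R \<rho> (ri a) (ri b) (ri c))"
  define Ind where "Ind = {(a2 :: int, b2 :: int, c2 :: int). b1 * c2 - c1 * b2 \<noteq> 0 \<or> c1 * a2 - a1 * c2 \<noteq> 0 \<or> a1 * b2 - b1 * a2 \<noteq> 0}"
  have "(0, 0, 1) \<in> Ind \<or> (1, 0, 0) \<in> Ind" using nz by (auto simp: Ind_def)
  then obtain s where s: "s \<in> Ind" by blast
  have fin: "finite (Ind \<inter> {x. N x \<le> N s})"
    by (rule finite_subset[OF _ finite_tn_le[OF R, of Y "N s"]]) (auto simp: N_def)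
  \<comment> \<open>A shortest point not proportional to the given one; only finitely many points
    compete.\<close>
  then obtain y2 where y2: "is_arg_min N (\<lambda>x. x \<in> Ind \<inter> {x. N x \<le> N s}) y2"
    using ex_is_arg_min_if_finite[of "Ind \<inter> {x. N x \<le> N s}" N] s by blast
  have y2I: "y2 \<in> Ind" using y2 by (auto simp: is_arg_min_def)
  have y2min: "N y2 \<le> N x" if "x \<in> Ind" for x
  proof (cases "N x \<le> N s")
    case True
    then have "\<not> N x < N y2" using y2 that unfolding is_arg_min_def by blast
    then show ?thesis by simp
  next
    case False
    then show ?thesis using y2 by (auto simp: is_arg_min_def)
  qed
  obtain a2 b2 c2 where y2e: "y2 = (a2, b2, c2)" by (rule prod_cases3[of y2]) blast
  have k: "b1 * c2 - c1 * b2 \<noteq> 0 \<or> c1 * a2 - a1 * c2 \<noteq> 0 \<or> a1 * b2 - b1 * a2 \<noteq> 0" using y2I by (simp add: Ind_def y2e)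
  \<comment> \<open>The primitive normal vector of the plane through both points is the candidate
    form, and (w, v, u) is an integer point on the next parallel plane.\<close>
  obtain g A B C u v w where f: "g \<noteq> 0" "b1 * c2 - c1 * b2 = g * C" "c1 * a2 - a1 * c2 = g * B" "a1 * b2 - b1 * a2 = g * A"
    "w * C + v * B + u * A = 1"
    by (rule primitive_triple[OF k]) blast
  have key: "(b1 * c2 - c1 * b2) * a3 + (c1 * a2 - a1 * c2) * b3 + (a1 * b2 - b1 * a2) * c3 \<noteq> 0 \<and>
      tn Y R \<rho> (ri a2) (ri b2) (ri c2) \<le> 1 \<and> tn Y R \<rho> (ri a3) (ri b3) (ri c3) \<le> 1"
    if fx: "C * a3 + B * b3 + A * c3 = 1" and Nx: "N (a3, b3, c3) \<le> 1/8 + 1/8 + N y2 / 2" for a3 b3 c3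
  proof -
    have "(b1 * c2 - c1 * b2) * a3 + (c1 * a2 - a1 * c2) * b3 + (a1 * b2 - b1 * a2) * c3 = g * (C * a3 + B * b3 + A * c3)"
      unfolding f(2-4) by (simp add: algebra_simps)
    then have det: "(b1 * c2 - c1 * b2) * a3 + (c1 * a2 - a1 * c2) * b3 + (a1 * b2 - b1 * a2) * c3 \<noteq> 0" using fx f(1) by simp
    have "(a3, b3, c3) \<in> Ind"
    proof (rule ccontr)
      assume "(a3, b3, c3) \<notin> Ind"
      then have z: "b1 * c3 = c1 * b3" "c1 * a3 = a1 * c3" "a1 * b3 = b1 * a3" by (auto simp: Ind_def)
      have "(b1 * c2 - c1 * b2) * a3 + (c1 * a2 - a1 * c2) * b3 + (a1 * b2 - b1 * a2) * c3 =
        a2 * (c1 * b3 - b1 * c3) + b2 * (a1 * c3 - c1 * a3) + c2 * (b1 * a3 - a1 * b3)" by (simp add: algebra_simps)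
      then show False using det z by simp
    qed
    \<comment> \<open>N y2 \<le> 1/4 + N y2 / 2 gives N y2 \<le> 1/2, so the third point has norm at
      most 1/2 as well.\<close>
    from y2min[OF this] Nx have "N y2 \<le> 1/2" by linarith
    then show ?thesis using det Nx by (simp add: N_def y2e)
  qed
  \<comment> \<open>A short real point on the next plane differs from (w, v, u) by a real
    combination of the two points found. Rounding the coefficients gives an integer point of that
    plane with coefficients of at most 1/2 left over.\<close>
  have red: "\<exists>a3 b3 c3. C * a3 + B * b3 + A * c3 = 1 \<and> N (a3, b3, c3) \<le> 1/8 + 1/8 + N y2 / 2"
    if W: "ri C * wa + ri B * wb + ri A * wc = 1" "tn Y R \<rho> wa wb wc \<le> 1/8" for wa wb wc
  proof -
    have "\<exists>x y. ri w - wa = x * ri a1 + y * ri a2 \<and> ri v - wb = x * ri b1 + y * ri b2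
        \<and> ri u - wc = x * ri c1 + y * ri c2"
    proof (rule plane_combination)
      have e: "ri b1 * ri c2 - ri c1 * ri b2 = ri (g * C)"
        "ri c1 * ri a2 - ri a1 * ri c2 = ri (g * B)"
        "ri a1 * ri b2 - ri b1 * ri a2 = ri (g * A)"
        unfolding f(2-4)[symmetric] by simp_all
      show "ri b1 * ri c2 - ri c1 * ri b2 \<noteq> 0 \<or>
        ri c1 * ri a2 - ri a1 * ri c2 \<noteq> 0 \<or>
        ri a1 * ri b2 - ri b1 * ri a2 \<noteq> 0"
        unfolding e using k unfolding f(2-4) by simp
      have "ri (w * C + v * B + u * A) = 1" unfolding f(5) by simp
      then have "(ri C * ri w + ri B * ri v + ri A * ri u) -
          (ri C * wa + ri B * wb + ri A * wc) = 0" using W(1) by (simp add: mult_ac)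
      then have "ri g * ((ri C * ri w + ri B * ri v + ri A * ri u) -
          (ri C * wa + ri B * wb + ri A * wc)) = 0" by simp
      then show "(ri b1 * ri c2 - ri c1 * ri b2) * (ri w - wa) +
          (ri c1 * ri a2 - ri a1 * ri c2) * (ri v - wb) +
          (ri a1 * ri b2 - ri b1 * ri a2) * (ri u - wc) = 0"
        unfolding e of_int_mult by (simp add: algebra_simps)
    qed
    then obtain x y where xy: "ri w - wa = x * ri a1 + y * ri a2" "ri v - wb = x * ri b1 + y * ri b2"
        "ri u - wc = x * ri c1 + y * ri c2" by blast
    define x' where "x' = x - ri (round x)"
    define y' where "y' = y - ri (round y)"
    have x': "\<bar>x'\<bar> \<le> 1/2" and y': "\<bar>y'\<bar> \<le> 1/2" unfolding x'_def y'_def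
      using of_int_round_abs_le[of x] of_int_round_abs_le[of y] by linarith+
    define a3 where "a3 = w - round x * a1 - round y * a2"
    define b3 where "b3 = v - round x * b1 - round y * b2"
    define c3 where "c3 = u - round x * c1 - round y * c2"
    have e3: "ri a3 = wa + (x' * ri a1 + y' * ri a2)" "ri b3 = wb + (x' * ri b1 + y' * ri b2)"
      "ri c3 = wc + (x' * ri c1 + y' * ri c2)"
      using xy unfolding a3_def b3_def c3_def x'_def y'_def by (simp_all add: algebra_simps)
    have "N (a3, b3, c3) \<le> tn Y R \<rho> wa wb wc + tn Y R \<rho> (x' * ri a1 + y' * ri a2) (x' * ri b1 + y' * ri b2) (x' * ri c1 + y' * ri c2)"
      unfolding N_def case_prod_conv e3 by (rule tn_add[OF R])
    also have "... \<le> 1/8 + (tn Y R \<rho> (x' * ri a1) (x' * ri b1) (x' * ri c1) + tn Y R \<rho> (y' * ri a2) (y' * ri b2) (y' * ri c2))"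
      by (intro add_mono W(2) tn_add[OF R])
    also have "... \<le> 1/8 + (\<bar>x'\<bar> * tn Y R \<rho> (ri a1) (ri b1) (ri c1) + \<bar>y'\<bar> * tn Y R \<rho> (ri a2) (ri b2) (ri c2))"
      by (intro add_mono order.refl tn_scale_le[OF R])
    also have "... \<le> 1/8 + (1/2 * (1/4) + 1/2 * tn Y R \<rho> (ri a2) (ri b2) (ri c2))"
      using x' y' N1 tn_nonneg[OF R(1)] by (intro add_mono order.refl mult_mono) auto
    finally have "N (a3, b3, c3) \<le> 1/8 + 1/8 + N y2 / 2" by (simp add: N_def y2e)
    moreover have "C * a3 + B * b3 + A * c3 = 1"
    proof -
      have "g * (C * a1 + B * b1 + A * c1) = 0" "g * (C * a2 + B * b2 + A * c2) = 0"
        unfolding distrib_left mult.assoc[symmetric] f(2-4)[symmetric] by (simp_all add: algebra_simps)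
      then have z: "C * a1 + B * b1 + A * c1 = 0" "C * a2 + B * b2 + A * c2 = 0" using f(1) by simp_all
      have "C * a3 + B * b3 + A * c3 = (w * C + v * B + u * A) - round x * (C * a1 + B * b1 + A * c1) - round y * (C * a2 + B * b2 + A * c2)"
        unfolding a3_def b3_def c3_def by (simp add: algebra_simps)
      then show ?thesis unfolding z f(5) by simp
    qed
    ultimately show ?thesis by blast
  qed
  show ?thesis
  proof (rule disjCI)
    assume no: "\<not> (\<exists>A B C. small_form Y (8 / \<rho>) (8 / R) A B C)"
    have "u * A + v * B + w * C = 1" using f(5) by simp
    with no have "\<bar>ri A\<bar> * \<rho> > 8 \<or> \<bar>ri A * Y + ri B\<bar> * \<rho> > 8 \<or>
      \<bar>ri A * Y\<^sup>2 + ri B * Y + ri C\<bar> * R > 8"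
      unfolding small_form_def pos_le_divide_eq[OF R(1)] pos_le_divide_eq[OF R(2)] by (meson not_less)
    \<comment> \<open>If one of the three dual coordinates of the form is large, a short point of
      the next plane is the one for which only the corresponding coordinate among a, b - Y a, c - Y
      b is nonzero.\<close>
    then have "\<exists>wa wb wc. ri C * wa + ri B * wb + ri A * wc = 1 \<and> tn Y R \<rho> wa wb wc \<le> 1/8"
    proof (elim disjE)
      have inv: "\<bar>1 / x\<bar> \<le> 1/8 * K" if "\<bar>x\<bar> * K > 8" for x K :: real
      proof -
        have "x \<noteq> 0" using that by auto
        then show ?thesis using that by (simp add: field_simps)
      qed
      { assume h: "\<bar>ri A\<bar> * \<rho> > 8"
        then have "A \<noteq> 0" by auto
        then have "ri C * 0 + ri B * 0 + ri A * (1 / ri A) = 1" by simp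
        moreover have "tn Y R \<rho> 0 0 (1 / ri A) \<le> 1/8"
          unfolding tn_le_iff[OF R] using inv[OF h] R by simp
        ultimately show ?thesis by blast }
      { assume h: "\<bar>ri A * Y + ri B\<bar> * \<rho> > 8"
        define x where "x = ri A * Y + ri B"
        have x0: "x \<noteq> 0" using h by (auto simp: x_def)
        have "ri C * 0 + ri B * (1 / x) + ri A * (Y * (1 / x)) = x * (1 / x)"
          unfolding x_def by (simp only: distrib_right mult_ac add_ac mult_zero_right add_0_left add_0_right)
        also have "... = 1" using x0 by simp
        finally have "ri C * 0 + ri B * (1 / x) + ri A * (Y * (1 / x)) = 1" .
        moreover have "tn Y R \<rho> 0 (1 / x) (Y * (1 / x)) \<le> 1/8"
          unfolding tn_le_iff[OF R] using inv[OF h] R unfolding x_def[symmetric] by simp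
        ultimately show ?thesis by blast }
      { assume h: "\<bar>ri A * Y\<^sup>2 + ri B * Y + ri C\<bar> * R > 8"
        define x where "x = ri A * Y\<^sup>2 + ri B * Y + ri C"
        have x0: "x \<noteq> 0" using h by (auto simp: x_def)
        have "ri C * (1 / x) + ri B * (Y * (1 / x)) + ri A * (Y * (Y * (1 / x))) = x * (1 / x)"
          unfolding x_def power2_eq_square by (simp only: distrib_right mult_ac add_ac)
        also have "... = 1" using x0 by simp
        finally have "ri C * (1 / x) + ri B * (Y * (1 / x)) + ri A * (Y * (Y * (1 / x))) = 1" .
        moreover have "tn Y R \<rho> (1 / x) (Y * (1 / x)) (Y * (Y * (1 / x))) \<le> 1/8"
          unfolding tn_le_iff[OF R] using inv[OF h] R unfolding x_def[symmetric] by simp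
        ultimately show ?thesis by blast }
    qed
    then obtain wa wb wc where W: "ri C * wa + ri B * wb + ri A * wc = 1" "tn Y R \<rho> wa wb wc \<le> 1/8" by blast
    from red[OF W] obtain a3 b3 c3 where x: "C * a3 + B * b3 + A * c3 = 1" "N (a3, b3, c3) \<le> 1/8 + 1/8 + N y2 / 2" by blast
    have "tn Y R \<rho> (ri a1) (ri b1) (ri c1) \<le> 1" using N1 by linarith
    then show "three_short Y R \<rho>" unfolding three_short_def using key[OF x] by blast
  qed
qed

lemma parallel_primitive:
  fixes a b c a' b' c' u v w :: int
  assumes "u * a + v * b + w * c = 1" "b * c' = c * b'" "c * a' = a * c'" "a * b' = b * a'"
  obtains m where "a' = m * a" "b' = m * b" "c' = m * c"
proof -
  let ?m = "u * a' + v * b' + w * c'"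
  have "(u * a + v * b + w * c) * a' = ?m * a + v * (b * a' - a * b') + w * (c * a' - a * c')"
       "(u * a + v * b + w * c) * b' = ?m * b + u * (a * b' - b * a') - w * (b * c' - c * b')"
       "(u * a + v * b + w * c) * c' = ?m * c - u * (c * a' - a * c') + v * (b * c' - c * b')"
    by (simp_all add: algebra_simps)
  then show thesis using that[of ?m] unfolding assms by simp
qed

text \<open>Dirichlet with m about 4 / \<rho> supplies the short first point: its first coordinate
  is at most (5 / \<rho>)^2, which is at most R / 4 because R \<rho>^2 \<ge> 100.\<close>

lemma three_short_or_small_form:
  assumes \<rho>: "0 < \<rho>" "\<rho> \<le> 1" and R: "R * \<rho>\<^sup>2 \<ge> 100"
  shows "three_short Y R \<rho> \<or> (\<exists>A B C. small_form Y (8 / \<rho>) (8 / R) A B C)"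
proof -
  have R0: "R > 0" using R \<rho> by (metis less_le_trans zero_less_mult_pos2 zero_less_numeral zero_less_power)
  define m where "m = nat \<lceil>4 / \<rho>\<rceil>"
  have m: "4 / \<rho> \<le> real m" "real m \<le> 5 / \<rho>"
  proof -
    have "4 / \<rho> > 0" using \<rho> by simp
    then show "4 / \<rho> \<le> real m" unfolding m_def by linarith
    have "real m \<le> 4 / \<rho> + 1" unfolding m_def using \<open>4 / \<rho> > 0\<close> by linarith
    also have "... \<le> 5 / \<rho>" using \<rho> by (simp add: field_simps)
    finally show "real m \<le> 5 / \<rho>" .
  qed
  have m0: "m > 0" using m(1) \<rho> by (metis divide_pos_pos less_le_trans of_nat_0_less_iff zero_less_numeral)
  obtain a1 b1 c1 :: int where y1: "a1 \<noteq> 0" "\<bar>ri a1\<bar> \<le> (real m)\<^sup>2" "\<bar>ri b1 - Y * ri a1\<bar> \<le> 1 / real m"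
    "\<bar>ri c1 - Y * ri b1\<bar> \<le> 1 / real m" using dirichlet_pair[OF m0, of Y] by blast
  have "1 / real m \<le> 1/4 * \<rho>" using m(1) m0 \<rho> by (simp add: field_simps)
  moreover have "(real m)\<^sup>2 \<le> 1/4 * R"
  proof -
    have "(real m)\<^sup>2 \<le> (5 / \<rho>)\<^sup>2" using m by (intro power_mono) auto
    also have "... \<le> 1/4 * R" using R \<rho> by (simp add: power_divide field_simps)
    finally show ?thesis .
  qed
  ultimately have N1: "tn Y R \<rho> (ri a1) (ri b1) (ri c1) \<le> 1/4"
    unfolding tn_le_iff[OF R0 \<rho>(1)] using y1 by linarith
  have nz: "a1 \<noteq> 0 \<or> b1 \<noteq> 0 \<or> c1 \<noteq> 0" using y1(1) by blast
  from transference[OF R0 \<rho>(1) nz N1] show ?thesis .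
qed

text \<open>Three consecutive distinct forms would be linearly dependent, and the integer point orthogonal to all of
  them would approximate \<open>Y r\<close> too well.\<close>

lemma (in cfrac) form_persists:
  fixes x :: real and r :: nat
  defines "E \<equiv> \<lambda>a. exp (x * a)"
  assumes x: "x > 0" "exp x \<ge> 100 * (M + 1)"
  shows "(\<exists>k\<in>{1000..5000::nat}. three_short (Y r) (E (3 * real k - 1)) (E (- real k))) \<or>
    (\<exists>l hi A B C. 1000 \<le> l \<and> l \<le> 2000 \<and> 19/10 * l \<le> hi \<and> small_form (Y r) (E (l + 1)) (E (2 - 3 * hi)) A B C)"
proof (rule disjCI)
  assume noform: "\<not> (\<exists>l hi A B C. 1000 \<le> l \<and> l \<le> 2000 \<and> 19/10 * l \<le> hi \<and> small_form (Y r) (E (l + 1)) (E (2 - 3 * hi)) A B C)"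
  define y where "y = Y r"
  have Em: "E a * E b = E (a + b)" for a b by (simp add: E_def distrib_left exp_add)
  have E0: "E a > 0" for a by (simp add: E_def)
  have Emono: "E a \<le> E b" if "a \<le> b" for a b using that x by (simp add: E_def)
  have E1: "E 1 \<ge> 100 * (M + 1)" using x by (simp add: E_def)
  have "100 * (M + 1) \<ge> 100" using M6 by simp
  then have E100: "E 1 \<ge> 100" using E1 by (rule order_trans)
  have Einv: "E (- a) = 1 / E a" for a by (simp add: E_def exp_minus field_simps)
  have Es: "100 * E a \<le> E b" if "a + 1 \<le> b" for a b
  proof -
    have "100 * E a \<le> E 1 * E a" using E100 E0[of a] by (intro mult_right_mono) auto
    also have "... = E (a + 1)" by (simp add: Em add.commute)
    also have "... \<le> E b" using that by (rule Emono)
    finally show ?thesis .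
  qed
  have pb: "\<bar>u * v\<bar> \<le> E c" if "\<bar>u\<bar> \<le> E a" "\<bar>v\<bar> \<le> E b" "a + b \<le> c" for u v a b c
  proof -
    have "\<bar>u * v\<bar> \<le> E a * E b" unfolding abs_mult using that E0[of a] by (intro mult_mono) auto
    then show ?thesis using Emono[OF that(3)] by (simp add: Em)
  qed
  show "\<exists>k\<in>{1000..5000::nat}. three_short (Y r) (E (3 * real k - 1)) (E (- real k))"
  proof (rule ccontr)
    assume no: "\<not> ?thesis"
    \<comment> \<open>Here R \<rho>^2 = E (k - 1) is large, so the failure of three short points
      yields a form. One unit in the exponents absorbs the factors 8.\<close>
    have "\<exists>F. small_form y (E (real k + 1)) (E (2 - 3 * real k)) (fst F) (fst (snd F)) (snd (snd F))" if k: "k \<in> {1000..5000}" for k :: nat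
    proof -
      have "E (3 * real k - 1) * (E (- real k))\<^sup>2 = E (real k - 1)" by (simp add: power2_eq_square Em)
      moreover have "E (real k - 1) \<ge> E 1" using k by (intro Emono) auto
      ultimately have "E (3 * real k - 1) * (E (- real k))\<^sup>2 \<ge> 100" using E100 by linarith
      moreover have "E (- real k) \<le> 1" using Emono[of "- real k" 0] by (simp add: E_def)
      ultimately obtain A B C where f: "small_form y (8 / E (- real k)) (8 / E (3 * real k - 1)) A B C"
        using three_short_or_small_form[of "E (- real k)" "E (3 * real k - 1)" y] E0 no k unfolding y_def by blast
      have 1: "8 / E (- real k) \<le> E (real k + 1)" using Es[of "real k" "real k + 1"] E0[of "real k"] by (simp add: Einv)
      have "8 / E (3 * real k - 1) = 8 * E (- (3 * real k - 1))" unfolding Einv by simp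
      also have "... \<le> E (2 - 3 * real k)" using Es[of "- (3 * real k - 1)" "2 - 3 * real k"] E0[of "- (3 * real k - 1)"] by simp
      finally have 2: "8 / E (3 * real k - 1) \<le> E (2 - 3 * real k)" .
      have "small_form y (E (real k + 1)) (E (2 - 3 * real k)) A B C"
        using f 1 2 unfolding small_form_def by (meson order_trans)
      then show ?thesis by (intro exI[of _ "(A, B, C)"]) simp
    qed
    then have "\<forall>k. \<exists>F. k \<in> {1000..5000} \<longrightarrow> small_form y (E (real k + 1)) (E (2 - 3 * real k)) (fst F) (fst (snd F)) (snd (snd F))" by blast
    from choice[OF this] obtain F where F: "\<And>k. k \<in> {1000..5000} ==> small_form y (E (real k + 1)) (E (2 - 3 * real k)) (fst (F k)) (fst (snd (F k))) (snd (snd (F k)))" by blast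
    define A where "A k = fst (F k)" for k
    define B where "B k = fst (snd (F k))" for k
    define C where "C k = snd (snd (F k))" for k
    have sf: "small_form y (E (real k + 1)) (E (2 - 3 * real k)) (A k) (B k) (C k)" if "k \<in> {1000..5000}" for k
      using F[OF that] by (simp add: A_def B_def C_def)
    define A0 where "A0 k = ri (A k)" for k
    define A1 where "A1 k = ri (A k) * y + ri (B k)" for k
    define A2 where "A2 k = ri (A k) * y\<^sup>2 + ri (B k) * y + ri (C k)" for k
    have bd: "\<bar>A0 k\<bar> \<le> E (real k + 1)" "\<bar>A1 k\<bar> \<le> E (real k + 1)" "\<bar>A2 k\<bar> \<le> E (2 - 3 * real k)" if "k \<in> {1000..5000}" for k
      using sf[OF that] by (auto simp: small_form_def A0_def A1_def A2_def)
    define par where "par k j \<longleftrightarrow> B k * C j = C k * B j \<and> C k * A j = A k * C j \<and> A k * B j = B k * A j" for k j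
    \<comment> \<open>The form at scale j is a nonzero integer multiple of the primitive form at
      scale k, so the latter inherits the bound for its value at \<open>y\<close>.\<close>
    have parr: "\<bar>A2 k\<bar> \<le> E (2 - 3 * real j)" if kj: "k \<in> {1000..5000}" "j \<in> {1000..5000}" "par k j" for k j
    proof -
      obtain u v w where u: "u * A k + v * B k + w * C k = 1" using sf[OF kj(1)] by (auto simp: small_form_def)
      obtain m where m: "A j = m * A k" "B j = m * B k" "C j = m * C k"
        by (rule parallel_primitive[OF u, of "C j" "B j" "A j"]) (use kj(3) in \<open>auto simp: par_def\<close>)
      obtain u' v' w' where "u' * A j + v' * B j + w' * C j = 1" using sf[OF kj(2)] by (auto simp: small_form_def)
      then have "m \<noteq> 0" unfolding m by auto
      then have m1: "\<bar>ri m\<bar> \<ge> 1" by linarith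
      have "A2 j = ri m * A2 k" unfolding A2_def m by (simp add: algebra_simps)
      then have "\<bar>A2 j\<bar> \<ge> \<bar>A2 k\<bar>" unfolding abs_mult using mult_right_mono[OF m1, of "\<bar>A2 k\<bar>"] by simp
      then show ?thesis using bd(3)[OF kj(2)] by linarith
    qed
    have parrefl: "par k k" for k by (simp add: par_def)
    \<comment> \<open>A form serving up to 19/10 of its starting scale is what the second
      alternative asks for. The ratio lies between 5/3, which the construction of the plane
      requires, and 2, which the vanishing of \<open>det\<close> below requires.\<close>
    have short: "real hi < 19/10 * real l" if l: "l \<in> {1000..2000}" and hi: "hi \<in> {1000..5000}" "par l hi" for l hi
    proof (rule ccontr)
      assume h: "\<not> real hi < 19/10 * real l"
      have l': "l \<in> {1000..5000}" using l by simp
      have "small_form (Y r) (E (real l + 1)) (E (2 - 3 * real hi)) (A l) (B l) (C l)"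
        using sf[OF l'] parr[OF l' hi] unfolding small_form_def A2_def y_def by blast
      moreover have "1000 \<le> real l" "real l \<le> 2000" using l by auto
      ultimately show False using noform h by (meson not_less)
    qed
    define a where "a = Max {k \<in> {1000..5000}. par 1000 k}"
    have aS: "a \<in> {k \<in> {1000..5000}. par 1000 k}" unfolding a_def using parrefl[of 1000] by (intro Max_in) (auto intro!: exI[of _ 1000])
    have a1: "real a < 1900" using short[of 1000 a] aS by auto
    have amax: "\<not> par 1000 k" if "k > a" "k \<le> 5000" for k
    proof
      assume "par 1000 k"
      then have "k \<le> a" unfolding a_def using that aS by (intro Max_ge) auto
      then show False using that by simp
    qed
    \<comment> \<open>The scale of the second form. The distance 20 from \<open>a\<close> makes the
      exponent \<open>real a + 1026 - 2 * real b\<close> at the end negative. The third form is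
      taken right after the range of the second.\<close>
    define g where "g = a + 20"
    have gI: "g \<in> {1000..2000}" using aS a1 by (auto simp: g_def)
    define b where "b = Max {k \<in> {1000..5000}. par g k}"
    have bS: "b \<in> {k \<in> {1000..5000}. par g k}" unfolding b_def using parrefl[of g] gI by (intro Max_in) (auto intro!: exI[of _ g])
    have gb: "g \<le> b" unfolding b_def using parrefl gI by (intro Max_ge) auto
    have b1: "real b < 19/10 * real g" using short[of g b] gI bS by auto
    then have b2: "b < 3800" using gI by auto
    have bmax: "\<not> par g k" if "k > b" "k \<le> 5000" for k
    proof
      assume "par g k"
      then have "k \<le> b" unfolding b_def using that bS by (intro Max_ge) auto
      then show False using that by simp
    qed
    define h where "h = b + 1"
    have hI: "h \<in> {1000..5000}" using bS b2 by (auto simp: h_def)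
    have npfg: "\<not> par 1000 g" using amax[of g] gI by (auto simp: g_def)
    have npgh: "\<not> par g h" using bmax[of h] b2 by (auto simp: h_def)
    have f0: "\<bar>A0 1000\<bar> \<le> E 1001" "\<bar>A1 1000\<bar> \<le> E 1001" "\<bar>A2 1000\<bar> \<le> E (2 - 3 * real a)"
      using bd(1,2)[of 1000] parr[of 1000 a] aS by auto
    have g0: "\<bar>A0 g\<bar> \<le> E (real a + 21)" "\<bar>A1 g\<bar> \<le> E (real a + 21)" "\<bar>A2 g\<bar> \<le> E (2 - 3 * real b)"
      using bd(1,2)[of g] parr[of g b] bS gI by (auto simp: g_def add.commute)
    have h0: "\<bar>A0 h\<bar> \<le> E (real b + 2)" "\<bar>A1 h\<bar> \<le> E (real b + 2)" "\<bar>A2 h\<bar> \<le> E (- 1 - 3 * real b)"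
      using bd[of h] hI by (auto simp: h_def add.commute)
    have ra: "real a \<ge> 1000" using aS by auto
    have rb: "real b \<ge> real a + 20" using gb by (simp add: g_def)
    have rb2: "real b \<le> 19/10 * real a + 38" using b1 by (simp add: g_def)
    define det where "det = A 1000 * (B g * C h - C g * B h) - B 1000 * (A g * C h - C g * A h) + C 1000 * (A g * B h - B g * A h)"
    \<comment> \<open>An integer that is the sum of six terms of size at most E (- 1). The critical
      terms contain \<open>A2 1000\<close> and need b \<le> 19/10 a + 38 together with a \<ge>
      1000.\<close>
    have "det = 0"
    proof -
      have "ri det = A0 1000 * (A1 g * A2 h - A2 g * A1 h) - A1 1000 * (A0 g * A2 h - A2 g * A0 h) + A2 1000 * (A0 g * A1 h - A1 g * A0 h)"
        unfolding det_def A0_def A1_def A2_def by (simp add: algebra_simps power2_eq_square)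
      also have "... = A0 1000 * (A1 g * A2 h) - A0 1000 * (A2 g * A1 h) - A1 1000 * (A0 g * A2 h) + A1 1000 * (A2 g * A0 h) + A2 1000 * (A0 g * A1 h) - A2 1000 * (A1 g * A0 h)"
        by (simp add: algebra_simps)
      finally have e: "ri det = ..." .
      have t1: "\<bar>A0 1000 * (A1 g * A2 h)\<bar> \<le> E (- 1)" "\<bar>A1 1000 * (A0 g * A2 h)\<bar> \<le> E (- 1)"
        by (rule pb[OF f0(1) pb[OF g0(2) h0(3) order.refl]] pb[OF f0(2) pb[OF g0(1) h0(3) order.refl]]; use ra rb in linarith)+
      have t2: "\<bar>A0 1000 * (A2 g * A1 h)\<bar> \<le> E (- 1)" "\<bar>A1 1000 * (A2 g * A0 h)\<bar> \<le> E (- 1)"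
        by (rule pb[OF f0(1) pb[OF g0(3) h0(2) order.refl]] pb[OF f0(2) pb[OF g0(3) h0(1) order.refl]]; use ra rb in linarith)+
      have t3: "\<bar>A2 1000 * (A0 g * A1 h)\<bar> \<le> E (- 1)" "\<bar>A2 1000 * (A1 g * A0 h)\<bar> \<le> E (- 1)"
        by (rule pb[OF f0(3) pb[OF g0(1) h0(2) order.refl]] pb[OF f0(3) pb[OF g0(2) h0(1) order.refl]]; use ra rb rb2 in linarith)+
      have "E (- 1) \<le> 1/100" using E100 by (simp add: Einv field_simps)
      then have "\<bar>ri det\<bar> < 1" unfolding e using t1 t2 t3 unfolding abs_le_iff abs_less_iff by linarith
      then show ?thesis by linarith
    qed
    define X1 where "X1 k j = A k * B j - B k * A j" for k j
    define X2 where "X2 k j = C k * A j - A k * C j" for k j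
    define X3 where "X3 k j = B k * C j - C k * B j" for k j
    have Xr: "ri (X1 k j) = A0 k * A1 j - A1 k * A0 j" "ri (X2 k j) - y * ri (X1 k j) = A2 k * A0 j - A0 k * A2 j"
      "ri (X3 k j) - y * ri (X2 k j) = A1 k * A2 j - A2 k * A1 j" for k j
      unfolding X1_def X2_def X3_def A0_def A1_def A2_def by (simp_all add: algebra_simps power2_eq_square)
    have Xnz: "X1 k j \<noteq> 0 \<or> X2 k j \<noteq> 0 \<or> X3 k j \<noteq> 0" if "\<not> par k j" for k j
      using that by (auto simp: par_def X1_def X2_def X3_def)
    \<comment> \<open>As \<open>det\<close> vanishes, the cross products of the first two and of the
      last two forms are parallel; s is a primitive vector on their common line.\<close>
    obtain m0 s1 s2 s3 u v w where S: "m0 \<noteq> 0" "X1 1000 g = m0 * s1" "X2 1000 g = m0 * s2" "X3 1000 g = m0 * s3" "u * s1 + v * s2 + w * s3 = 1"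
      by (rule primitive_triple[OF Xnz[OF npfg]]) blast
    have cr: "X2 1000 g * X3 g h - X3 1000 g * X2 g h = - (det * C g)" "X3 1000 g * X1 g h - X1 1000 g * X3 g h = - (det * B g)"
      "X1 1000 g * X2 g h - X2 1000 g * X1 g h = - (det * A g)"
      unfolding X1_def X2_def X3_def det_def by (simp_all add: algebra_simps)
    have "m0 * (s2 * X3 g h) = m0 * (s3 * X2 g h)" "m0 * (s3 * X1 g h) = m0 * (s1 * X3 g h)" "m0 * (s1 * X2 g h) = m0 * (s2 * X1 g h)"
      using cr unfolding S(2-4) \<open>det = 0\<close> by simp_all
    then have "s2 * X3 g h = s3 * X2 g h" "s3 * X1 g h = s1 * X3 g h" "s1 * X2 g h = s2 * X1 g h" using S(1) by simp_all
    then obtain m1 where m1: "X1 g h = m1 * s1" "X2 g h = m1 * s2" "X3 g h = m1 * s3"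
      by (rule parallel_primitive[OF S(5)]) blast
    have m1nz: "m1 \<noteq> 0" using Xnz[OF npgh] m1 by auto
    have ge: "\<bar>z\<bar> \<le> \<bar>ri m * z\<bar>" if "m \<noteq> 0" for m :: int and z :: real
    proof -
      have "\<bar>ri m\<bar> \<ge> 1" using that by linarith
      then show ?thesis unfolding abs_mult using mult_right_mono[of 1 "\<bar>ri m\<bar>" "\<bar>z\<bar>"] by simp
    qed
    \<comment> \<open>The first two forms bound the size of s, the last two its error as an
      approximation of 1, y, y^2. Together this contradicts bad approximability.\<close>
    have s1b: "\<bar>ri s1\<bar> \<le> 2 * E (real a + 1022)"
    proof -
      have "\<bar>ri s1\<bar> \<le> \<bar>ri (X1 1000 g)\<bar>" unfolding S(2) of_int_mult by (rule ge[OF S(1)])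
      moreover have "\<bar>A0 1000 * A1 g\<bar> \<le> E (real a + 1022)" "\<bar>A1 1000 * A0 g\<bar> \<le> E (real a + 1022)"
        by (rule pb[OF f0(1) g0(2)] pb[OF f0(2) g0(1)]; linarith)+
      ultimately show ?thesis unfolding Xr(1) using abs_triangle_ineq4[of "A0 1000 * A1 g" "A1 1000 * A0 g"] by linarith
    qed
    have e1b: "\<bar>ri s2 - y * ri s1\<bar> \<le> 2 * E (4 - 2 * real b)"
    proof -
      have "\<bar>ri s2 - y * ri s1\<bar> \<le> \<bar>ri m1 * (ri s2 - y * ri s1)\<bar>" by (rule ge[OF m1nz])
      also have "ri m1 * (ri s2 - y * ri s1) = ri (X2 g h) - y * ri (X1 g h)"
        unfolding m1 by (simp add: algebra_simps)
      finally have "\<bar>ri s2 - y * ri s1\<bar> \<le> \<bar>A2 g * A0 h - A0 g * A2 h\<bar>" unfolding Xr(2) .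
      moreover have "\<bar>A2 g * A0 h\<bar> \<le> E (4 - 2 * real b)" "\<bar>A0 g * A2 h\<bar> \<le> E (4 - 2 * real b)"
        by (rule pb[OF g0(3) h0(1)] pb[OF g0(1) h0(3)]; use rb in linarith)+
      ultimately show ?thesis using abs_triangle_ineq4[of "A2 g * A0 h" "A0 g * A2 h"] by linarith
    qed
    have e2b: "\<bar>ri s3 - y * ri s2\<bar> \<le> 2 * E (4 - 2 * real b)"
    proof -
      have "\<bar>ri s3 - y * ri s2\<bar> \<le> \<bar>ri m1 * (ri s3 - y * ri s2)\<bar>" by (rule ge[OF m1nz])
      also have "ri m1 * (ri s3 - y * ri s2) = ri (X3 g h) - y * ri (X2 g h)"
        unfolding m1 by (simp add: algebra_simps)
      finally have "\<bar>ri s3 - y * ri s2\<bar> \<le> \<bar>A1 g * A2 h - A2 g * A1 h\<bar>" unfolding Xr(3) .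
      moreover have "\<bar>A2 g * A1 h\<bar> \<le> E (4 - 2 * real b)" "\<bar>A1 g * A2 h\<bar> \<le> E (4 - 2 * real b)"
        by (rule pb[OF g0(3) h0(2)] pb[OF g0(2) h0(3)]; use rb in linarith)+
      ultimately show ?thesis using abs_triangle_ineq4[of "A1 g * A2 h" "A2 g * A1 h"] by linarith
    qed
    have small: "2 * E (4 - 2 * real b) < 1" using Es[of "4 - 2 * real b" 0] ra rb by (simp add: E_def)
    show False
    proof (cases "s1 = 0")
      case True
      then have "\<bar>ri s2\<bar> < 1" using e1b small by simp
      then have s2: "s2 = 0" by linarith
      then have "\<bar>ri s3\<bar> < 1" using e2b small by simp
      then have "s3 = 0" by linarith
      then show False using S(5) True s2 by simp
    next
      case False
      have p: "\<bar>ri s1\<bar> > 0" using False by simp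
      have "1 / (5 * (M + 1) * \<bar>ri s1\<bar>) \<le> \<bar>ri s2 - y * ri s1\<bar>"
        using badly_approximable_shift[OF False, of r s2] by (simp add: y_def abs_minus_commute mult.commute)
      then have "1 \<le> \<bar>ri s2 - y * ri s1\<bar> * (5 * (M + 1) * \<bar>ri s1\<bar>)"
        using p M6 by (subst (asm) pos_divide_le_eq) auto
      also have "... \<le> (2 * E (4 - 2 * real b)) * (5 * (M + 1) * (2 * E (real a + 1022)))"
        using e1b s1b M6 E0 by (intro mult_mono) (auto simp: less_imp_le)
      also have "... = 20 * (M + 1) * E (real a + 1026 - 2 * real b)"
        using Em[of "4 - 2 * real b" "real a + 1022"] by (simp add: algebra_simps)
      also have "... \<le> E 1 * E (- 2)"
        using E1 M6 E0 ra rb by (intro mult_mono Emono) (auto simp: less_imp_le)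
      also have "... = 1 / E 1" unfolding Em Einv[symmetric] by simp
      also have "... < 1" using E100 by simp
      finally show False by simp
    qed
  qed
qed

section \<open>Hyperplanes attached to a repetition\<close>

lemma sum_lessThan_3: "(\<Sum>l<3. F l) = F 0 + F 1 + F (2 :: nat)" for F :: "nat => 'a :: comm_monoid_add"
  by (simp add: eval_nat_numeral)

lemma sum_lessThan_4: "(\<Sum>l<4. F l) = F 0 + F 1 + F 2 + F (3 :: nat)" for F :: "nat => 'a :: comm_monoid_add"
  by (simp add: eval_nat_numeral)

lemma sum_one_3: "(\<Sum>l\<in>{1..<3}. F l) = F 1 + F (2 :: nat)" for F :: "nat => 'a :: comm_monoid_add"
  by (simp add: eval_nat_numeral)

lemma sum_one_4: "(\<Sum>l\<in>{1..<4}. F l) = F 1 + F 2 + F (3 :: nat)" for F :: "nat => 'a :: comm_monoid_add"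
  by (simp add: eval_nat_numeral)

text \<open>Turns explicit bounds for the forms into the exponents w_i = ln (b i) / t. The condition
  \<open>den\<close> is required for every common factor g, so it applies to the fraction in lowest
  terms that is formed inside the proof.\<close>

lemma approx_datumI:
  fixes b :: "nat => real" and H0 H1 :: int
  assumes t: "t > 0" and C: "C > 0"
    and b: "\<And>i. i < n ==> exp (- (C * t)) \<le> b i" "\<And>i. i < n ==> b i \<le> exp (C * t)"
    and prod: "(\<Prod>i<n. b i) \<le> exp (- (\<delta> * t))"
    and small: "\<And>k i. k \<in> {1..<n} ==> i < n ==> \<bar>\<Sum>l<n. Lf i l * ri (y k l)\<bar> \<le> b i"
    and h: "h 0 = ri H0" "h 1 = ri H1" "H0 \<noteq> 0"
    and den: "\<And>a d g. d > 0 ==> H0 = d * g ==> H1 = - a * g ==> exp (t / C) < ri d"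
    and span: "\<And>x. (\<Sum>l<n. h l * x l) = 0 ==> \<exists>u. \<forall>l<n. x l = (\<Sum>k\<in>{1..<n}. u k * ri (y k l))"
  shows "\<exists>w a d. approx_datum n Lf C \<delta> t w y h a d"
proof -
  have b0: "b i > 0" if "i < n" for i using b(1)[OF that] exp_gt_zero[of "- (C * t)"] by linarith
  define w where "w i = ln (b i) / t" for i
  have ew: "exp (t * w i) = b i" if "i < n" for i using b0[OF that] t by (simp add: w_def)
  have wC: "\<bar>w i\<bar> \<le> C" if "i < n" for i
  proof -
    have "ln (b i) \<le> C * t" using b(2)[OF that] b0[OF that] by (metis exp_gt_zero ln_exp ln_le_cancel_iff)
    moreover have "- (C * t) \<le> ln (b i)" using b(1)[OF that] b0[OF that] by (metis exp_gt_zero ln_exp ln_le_cancel_iff)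
    ultimately have "\<bar>ln (b i)\<bar> \<le> C * t" by linarith
    then show ?thesis using t by (simp add: w_def abs_divide pos_divide_le_eq)
  qed
  have "(\<Sum>i<n. w i) \<le> - \<delta>"
  proof -
    have "exp (\<Sum>i<n. t * w i) = (\<Prod>i<n. b i)" unfolding exp_sum[OF finite_lessThan] using ew by (intro prod.cong) auto
    then have "exp (\<Sum>i<n. t * w i) \<le> exp (- (\<delta> * t))" using prod by simp
    then have "(\<Sum>i<n. t * w i) \<le> - (\<delta> * t)" unfolding exp_le_cancel_iff .
    then have "t * (\<Sum>i<n. w i) \<le> t * (- \<delta>)" by (simp add: sum_distrib_left mult.commute)
    then show ?thesis using t by (simp only: mult_le_cancel_left_pos)
  qed
  moreover
  define g where "g = gcd H0 H1"
  have g0: "g > 0" using h(3) by (simp add: g_def)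
  obtain d0 a0 where da: "H0 = d0 * g" "H1 = a0 * g" "coprime d0 a0"
    using gcd_coprime_exists[of H0 H1] h(3) unfolding g_def by auto
  define d where "d = \<bar>d0\<bar>"
  define a where "a = - sgn d0 * a0"
  have d0: "d0 \<noteq> 0" using da(1) h(3) by auto
  have d1: "d > 0" using d0 by (simp add: d_def)
  have cop: "coprime a d" using da(3) unfolding a_def d_def sgn_if using d0 by (auto simp: coprime_commute)
  have H0: "H0 = d * (sgn d0 * g)" unfolding da(1) d_def by (simp add: abs_sgn mult.assoc mult.left_commute flip: mult.assoc)
  have H1: "H1 = - a * (sgn d0 * g)" unfolding da(2) a_def using d0 by (simp add: sgn_if)
  have "ri a * h 0 = - ri d * h 1"
  proof -
    have "a * H0 = - d * H1" unfolding H0 H1 by simp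
    then have "ri (a * H0) = ri (- d * H1)" by simp
    then show ?thesis unfolding h by simp
  qed
  moreover have "t \<le> C * ln (ri d)"
  proof -
    have "exp (t / C) < ri d" by (rule den[OF d1 H0 H1])
    then have "t / C < ln (ri d)" using d1 by (metis exp_less_cancel_iff exp_ln of_int_0_less_iff)
    then show ?thesis using C by (simp add: pos_divide_less_eq mult.commute)
  qed
  ultimately have "approx_datum n Lf C \<delta> t w y h a d"
    unfolding approx_datum_def using wC small ew d1 cop span h by auto
  then show ?thesis by blast
qed

text \<open>The four-dimensional space consists of the 2 by 2 matrices, row by row, with rows and columns labelled \<open>p, q\<close>;
  the forms are the products of \<open>q\<close> and \<open>q \<alpha> - p\<close> in each index. The three-dimensional space consists of the
  symmetric ones among them.\<close>

definition Lf4 :: "real => nat => nat => real" where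
  "Lf4 \<alpha> i l = [[0, 0, 0, 1], [0, 0, -1, \<alpha>], [0, -1, 0, \<alpha>], [1, - \<alpha>, - \<alpha>, \<alpha>\<^sup>2]] ! i ! l"

definition Lf3 :: "real => nat => nat => real" where
  "Lf3 \<alpha> i l = [[0, 0, 1], [0, -1, \<alpha>], [1, - 2 * \<alpha>, \<alpha>\<^sup>2]] ! i ! l"

lemma less4: "i < 4 \<longleftrightarrow> i = 0 \<or> i = 1 \<or> i = 2 \<or> i = (3 :: nat)"
  by auto

lemma less3: "i < 3 \<longleftrightarrow> i = 0 \<or> i = 1 \<or> i = (2 :: nat)"
  by auto

text \<open>The equation of \<alpha> multiplied by the power c^(D - 1) of its leading coefficient is
  a monic equation for c \<alpha>.\<close>

lemma algebraic_integer_multiple: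
  fixes g :: "int poly" and \<alpha> :: real
  assumes g: "g \<noteq> 0" "poly (rpoly g) \<alpha> = 0"
  obtains c :: int and D :: nat and Cg :: real where "c \<noteq> 0" "D \<ge> 1" "Cg \<ge> 1" "zmul (ri c * \<alpha>) D Cg (ri c * \<alpha>)"
proof -
  define D where "D = degree g"
  define c where "c = coeff g D"
  define \<beta> where "\<beta> = ri c * \<alpha>"
  have c0: "c \<noteq> 0" using g(1) by (simp add: c_def D_def)
  have "degree (rpoly g) = D" unfolding D_def by (rule degree_map_poly) simp
  then have ev: "(\<Sum>i\<le>D. ri (coeff g i) * \<alpha> ^ i) = 0"
    using g(2) by (simp add: poly_altdef coeff_map_poly)
  have D1: "D \<ge> 1"
  proof (rule ccontr)
    assume "\<not> D \<ge> 1"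
    then have "D = 0" by simp
    then have "ri (coeff g 0) = 0" using ev by simp
    then show False using c0 \<open>D = 0\<close> by (simp add: c_def)
  qed
  define \<gamma> where "\<gamma> i = - (coeff g i * c ^ (D - 1 - i))" for i
  have "\<beta> ^ D = (\<Sum>i<D. ri (\<gamma> i) * \<beta> ^ i)"
  proof -
    have "ri c ^ (D - 1) * (\<Sum>i\<le>D. ri (coeff g i) * \<alpha> ^ i) = 0" unfolding ev by simp
    moreover have "ri c ^ (D - 1) * (\<Sum>i\<le>D. ri (coeff g i) * \<alpha> ^ i) =
      (\<Sum>i<D. ri c ^ (D - 1) * (ri (coeff g i) * \<alpha> ^ i)) + ri c ^ (D - 1) * (ri c * \<alpha> ^ D)"
      by (simp add: c_def distrib_left sum_distrib_left flip: lessThan_Suc_atMost)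
    moreover have "ri c ^ (D - 1) * (ri c * \<alpha> ^ D) = \<beta> ^ D"
      using D1 power_minus_mult[of D "ri c"] unfolding \<beta>_def power_mult_distrib mult.assoc[symmetric] by simp
    moreover have "(\<Sum>i<D. ri c ^ (D - 1) * (ri (coeff g i) * \<alpha> ^ i)) = - (\<Sum>i<D. ri (\<gamma> i) * \<beta> ^ i)"
      unfolding sum_negf[symmetric]
    proof (intro sum.cong refl)
      fix i assume "i \<in> {..<D}"
      then have "ri c ^ (D - 1) = ri c ^ (D - 1 - i) * ri c ^ i" by (simp flip: power_add)
      then show "ri c ^ (D - 1) * (ri (coeff g i) * \<alpha> ^ i) = - (ri (\<gamma> i) * \<beta> ^ i)"
        by (simp add: \<gamma>_def \<beta>_def power_mult_distrib mult_ac)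
    qed
    ultimately show ?thesis by linarith
  qed
  from zmul_gen[OF D1 this] show thesis
    unfolding \<beta>_def by (intro that[OF c0 D1, of "1 + (\<Sum>i<D. \<bar>ri (\<gamma> i)\<bar>)"]) (auto simp: sum_nonneg)
qed

lemma no_approx_data:
  fixes g :: "int poly" and \<alpha> C \<delta> :: real
  assumes g: "g \<noteq> 0" "poly (rpoly g) \<alpha> = 0" and C: "C \<ge> 1" "\<delta> > 0"
  shows no_approx_data_4: "\<not> (\<forall>T. \<exists>t\<ge>T. \<exists>w y h a b. approx_datum 4 (Lf4 \<alpha>) C \<delta> t w y h a b)"
    and no_approx_data_3: "\<not> (\<forall>T. \<exists>t\<ge>T. \<exists>w y h a b. approx_datum 3 (Lf3 \<alpha>) C \<delta> t w y h a b)"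
proof -
  obtain c D Cg where c: "c \<noteq> 0" "D \<ge> 1" "Cg \<ge> 1" "zmul (ri c * \<alpha>) D Cg (ri c * \<alpha>)"
    by (rule algebraic_integer_multiple[OF g]) blast
  define \<beta> where "\<beta> = ri c * \<alpha>"
  define x where "x = ri c"
  define Ca where "Ca = (Cg + \<bar>x\<bar>)\<^sup>2"
  have x1: "\<bar>x\<bar> \<ge> 1" using c(1) unfolding x_def by linarith
  have Ca_eq: "Ca = Cg * Cg + 2 * \<bar>x\<bar> * Cg + \<bar>x\<bar> * \<bar>x\<bar>" unfolding Ca_def by (simp add: power2_eq_square algebra_simps)
  have p: "Cg * Cg \<ge> 1" "2 * \<bar>x\<bar> * Cg \<ge> 0" "\<bar>x\<bar> * \<bar>x\<bar> \<ge> 1" using c(3) x1 mult_ge1_I[of Cg Cg] mult_ge1_I[of "\<bar>x\<bar>" "\<bar>x\<bar>"] by auto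
  have Ca: "Ca \<ge> 1" unfolding Ca_eq using p by linarith
  note zg = c(4)[folded \<beta>_def]
  have z2: "zmul \<beta> D Ca (\<beta>\<^sup>2)" unfolding power2_eq_square
    by (rule zmul_mono[OF zmul_mult[OF zg zg]]) (use c(3) p in \<open>auto simp: Ca_eq\<close>)
  have z1: "zmul \<beta> D Ca (ri N * \<beta>)" if "\<bar>ri N\<bar> \<le> 2 * \<bar>x\<bar>" for N
  proof (rule zmul_mono[OF zmul_mult[OF zmul_int zg]])
    have "\<bar>ri N\<bar> * Cg \<le> 2 * \<bar>x\<bar> * Cg" using that c(3) by (intro mult_right_mono) auto
    then show "\<bar>ri N\<bar> * Cg \<le> Ca" unfolding Ca_eq using p by linarith
  qed (use c(3) in auto)
  have z0: "zmul \<beta> D Ca (ri N)" if "\<bar>ri N\<bar> \<le> \<bar>x\<bar> * \<bar>x\<bar>" for N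
  proof (rule zmul_mono[OF zmul_int])
    show "\<bar>ri N\<bar> \<le> Ca" unfolding Ca_eq using p that by linarith
  qed
  have zs: "zmul \<beta> D Ca (- (x * \<beta>))" "zmul \<beta> D Ca (- (2 * x * \<beta>))" "zmul \<beta> D Ca (x * \<beta>)" "zmul \<beta> D Ca (x\<^sup>2)" "zmul \<beta> D Ca (- x\<^sup>2)" "zmul \<beta> D Ca 0"
    using z1[of "- c"] z1[of "- 2 * c"] z1[of c] z0[of "c * c"] z0[of "- (c * c)"] z0[of 0] p
    by (auto simp: x_def power2_eq_square abs_mult)
  have k: "x\<^sup>2 \<ge> 1" using p(3) by (simp add: power2_eq_square flip: abs_mult)
  have bx: "\<beta> = x * \<alpha>" by (simp add: \<beta>_def x_def)
  show "\<not> (\<forall>T. \<exists>t\<ge>T. \<exists>w y h a b. approx_datum 4 (Lf4 \<alpha>) C \<delta> t w y h a b)"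
  proof
    assume data: "\<forall>T. \<exists>t\<ge>T. \<exists>w y h a b. approx_datum 4 (Lf4 \<alpha>) C \<delta> t w y h a b"
    \<comment> \<open>The inverse of the matrix of forms times c^2, which turns \<alpha> into the
      integral element \<beta> = c \<alpha>.\<close>
    define B where "B i k = [[\<beta>\<^sup>2, - (x * \<beta>), - (x * \<beta>), x\<^sup>2], [x * \<beta>, 0, - x\<^sup>2, 0], [x * \<beta>, - x\<^sup>2, 0, 0], [x\<^sup>2, 0, 0, 0]] ! i ! k" for i k :: nat
    show False
    proof (rule hyperplane_subspace_theorem[of 4 D Ca \<beta> B "Lf4 \<alpha>" "x\<^sup>2" C \<delta>])
      fix i k :: nat assume ik: "i < 4" "k < 4"
      show "zmul \<beta> D Ca (B i k)" using ik unfolding less4 B_def by (elim disjE) (simp_all add: z2 zs)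
      show "(\<Sum>l<4. B i l * Lf4 \<alpha> l k) = (if i = k then x\<^sup>2 else 0)"
        using ik unfolding less4 sum_lessThan_4 B_def Lf4_def bx
        by (elim disjE) (simp_all add: power2_eq_square algebra_simps)
    qed (use c Ca k C data in auto)
  qed
  show "\<not> (\<forall>T. \<exists>t\<ge>T. \<exists>w y h a b. approx_datum 3 (Lf3 \<alpha>) C \<delta> t w y h a b)"
  proof
    assume data: "\<forall>T. \<exists>t\<ge>T. \<exists>w y h a b. approx_datum 3 (Lf3 \<alpha>) C \<delta> t w y h a b"
    define B where "B i k = [[\<beta>\<^sup>2, - (2 * x * \<beta>), x\<^sup>2], [x * \<beta>, - x\<^sup>2, 0], [x\<^sup>2, 0, 0]] ! i ! k" for i k :: nat
    show False
    proof (rule hyperplane_subspace_theorem[of 3 D Ca \<beta> B "Lf3 \<alpha>" "x\<^sup>2" C \<delta>])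
      fix i k :: nat assume ik: "i < 3" "k < 3"
      show "zmul \<beta> D Ca (B i k)" using ik unfolding less3 B_def by (elim disjE) (simp_all add: z2 zs)
      show "(\<Sum>l<3. B i l * Lf3 \<alpha> l k) = (if i = k then x\<^sup>2 else 0)"
        using ik unfolding less3 sum_lessThan_3 B_def Lf3_def bx
        by (elim disjE) (simp_all add: power2_eq_square algebra_simps)
    qed (use c Ca k C data in auto)
  qed
qed

section \<open>Heights of the normal vectors\<close>

context cfrac begin

text \<open>m Y H0 + H1 equals g (m d Y - a), and bad approximability bounds the second factor from
  below; so a small denominator d forces a small g and small coordinates. The factor m is 1 for the
  four-dimensional normal vector and 2 for the three-dimensional one.\<close>

lemma small_denominator:
  fixes H0 H1 a d g m :: int
  assumes lin: "\<bar>ri m * Y 0 * ri H0 + ri H1\<bar> \<le> K" and m: "m = 1 \<or> m = 2" and X: "X \<ge> 1"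
    and H: "H0 = 0 \<or> (0 < d \<and> ri d \<le> X \<and> H0 = d * g \<and> H1 = - a * g)"
  shows "\<bar>ri H0\<bar> \<le> 10 * (M + 1) * K * X\<^sup>2" "\<bar>ri H1\<bar> \<le> 3 * (10 * (M + 1) * K * X\<^sup>2)"
proof -
  have K0: "K \<ge> 0" using lin by linarith
  have mr: "ri m = 1 \<or> ri m = 2" using m by auto
  have X2: "X\<^sup>2 \<ge> 1" using X by simp
  have KW: "K \<le> 10 * (M + 1) * K * X\<^sup>2"
  proof -
    have "1 * K * 1 \<le> 10 * (M + 1) * K * X\<^sup>2" using M6 K0 X2 by (intro mult_mono) auto
    then show ?thesis by simp
  qed
  show H0: "\<bar>ri H0\<bar> \<le> 10 * (M + 1) * K * X\<^sup>2"
  proof (cases "H0 = 0")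
    case True
    then show ?thesis using K0 KW by simp
  next
    case False
    then have d: "d > 0" "ri d \<le> X" "H0 = d * g" "H1 = - a * g" using H by auto
    define e where "e = ri (m * d) * Y 0 - ri a"
    have "ri m * Y 0 * ri H0 + ri H1 = ri g * e"
      unfolding d e_def by (simp add: algebra_simps)
    then have ge: "\<bar>ri g\<bar> * \<bar>e\<bar> \<le> K" using lin by (simp add: abs_mult)
    have dp: "ri d \<ge> 1" using d(1) by linarith
    have md: "\<bar>ri (m * d)\<bar> \<le> 2 * ri d" using mr d(1) by auto
    have md0: "m * d \<noteq> 0" using m d(1) by auto
    have "1 / (5 * (M + 1) * \<bar>ri (m * d)\<bar>) \<le> \<bar>e\<bar>"
      unfolding e_def by (rule badly_approximable[OF md0])
    then have "1 \<le> \<bar>e\<bar> * (5 * (M + 1) * \<bar>ri (m * d)\<bar>)"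
      using md0 M6 by (subst (asm) pos_divide_le_eq) auto
    also have "... \<le> \<bar>e\<bar> * (5 * (M + 1) * (2 * ri d))"
      using md M6 by (intro mult_left_mono) auto
    finally have "\<bar>ri g\<bar> * 1 \<le> \<bar>ri g\<bar> * (\<bar>e\<bar> * (5 * (M + 1) * (2 * ri d)))"
      by (intro mult_left_mono) auto
    also have "... = (\<bar>ri g\<bar> * \<bar>e\<bar>) * (10 * (M + 1) * ri d)" by (simp add: mult_ac)
    also have "... \<le> K * (10 * (M + 1) * X)" using ge d dp M6 K0 by (intro mult_mono) auto
    finally have gb: "\<bar>ri g\<bar> \<le> K * (10 * (M + 1) * X)" by simp
    have "\<bar>ri H0\<bar> = ri d * \<bar>ri g\<bar>" unfolding d using d(1) by (simp add: abs_mult)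
    also have "... \<le> X * (K * (10 * (M + 1) * X))" using gb d dp X by (intro mult_mono) auto
    finally show ?thesis by (simp add: power2_eq_square mult_ac)
  qed
  have "\<bar>ri m * Y 0 * ri H0\<bar> \<le> 2 * (1/5) * \<bar>ri H0\<bar>"
    unfolding abs_mult using mr Y5[of 0] by (intro mult_right_mono mult_mono) auto
  then show "\<bar>ri H1\<bar> \<le> 3 * (10 * (M + 1) * K * X\<^sup>2)" using lin H0 KW by linarith
qed

text \<open>Normal vector of the hyperplane of all \<open>M r * S * transpose (M r')\<close> with symmetric \<open>S\<close>.\<close>

definition h4 :: "nat => nat => nat => int" where
  "h4 r r' l = [cq A (Suc r) * cq A r' - cq A r * cq A (Suc r'), cq A r * cp A (Suc r') - cq A (Suc r) * cp A r',
    cp A r * cq A (Suc r') - cp A (Suc r) * cq A r', cp A (Suc r) * cp A r' - cp A r * cp A (Suc r')] ! l"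

text \<open>Evaluating one of the two indices at Y 0 turns the convergents at r' into their
  remainders, so the combination is small although \<open>h4\<close> itself is not.\<close>

lemma h4_lin: "Y 0 * ri (h4 r r' 0) + ri (h4 r r' 1) = dd r' * (q (Suc r) + Y r' * q r)"
proof -
  have "Y 0 * ri (h4 r r' 0) + ri (h4 r r' 1) = q (Suc r) * dd r' - q r * dd (Suc r')"
    by (simp add: h4_def dd_def algebra_simps)
  then show ?thesis by (simp add: dd_Suc algebra_simps)
qed

text \<open>Evaluating both indices at Y 0 leaves only remainders and the difference Y r' - Y r,
  which is tiny for a long repetition.\<close>

lemma h4_quad: "ri (h4 r r' 0) * (Y 0)\<^sup>2 + ri (h4 r r' 1 + h4 r r' 2) * Y 0 + ri (h4 r r' 3) = dd r * dd r' * (Y r' - Y r)"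
proof -
  have "ri (h4 r r' 0) * (Y 0)\<^sup>2 + ri (h4 r r' 1 + h4 r r' 2) * Y 0 + ri (h4 r r' 3) =
    dd (Suc r) * dd r' - dd r * dd (Suc r')"
    by (simp add: h4_def dd_def power2_eq_square algebra_simps)
  then show ?thesis by (simp add: dd_Suc algebra_simps)
qed

lemma h4_det: "\<bar>h4 r r' 0 * h4 r r' 3 - h4 r r' 1 * h4 r r' 2\<bar> = 1"
proof -
  have "h4 r r' 0 * h4 r r' 3 - h4 r r' 1 * h4 r r' 2 =
    (cp A (Suc r) * cq A r - cp A r * cq A (Suc r)) * (cp A (Suc r') * cq A r' - cp A r' * cq A (Suc r'))"
    by (simp add: h4_def algebra_simps)
  then show ?thesis unfolding cf_det by (simp add: abs_mult)
qed

lemma q_strict: "r < r' ==> 5 * \<bar>q (Suc r)\<bar> \<le> \<bar>q (Suc r')\<bar>"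
proof (induction r')
  case (Suc r')
  then show ?case using q_5[of r'] q_5[of r] by (cases "r = r'") auto
qed simp

lemma dd_le1: "\<bar>dd k\<bar> \<le> 1"
  using dd_le[of k] power_le_one[of "1/5::real" k] by linarith

lemma q_plus: "\<bar>q (Suc r) + Y k * q r\<bar> \<le> 6/5 * \<bar>q (Suc r)\<bar>"
proof -
  have "\<bar>Y k * q r\<bar> \<le> 1/5 * \<bar>q (Suc r)\<bar>" unfolding abs_mult using Y5[of k] q_mono[of r] by (intro mult_mono) auto
  then show ?thesis by linarith
qed

text \<open>If the denominator were at most X, the first two coordinates would be bounded by powers
  of X, and the determinant 1 with bad approximability would bound the other two. The resulting
  quadratic polynomial has a value of at most \<eta> at Y 0, contrary to the Liouville
  inequality.\<close>

lemma h4_height: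
  fixes C0 :: real and \<kappa> :: nat
  assumes rr: "r < r'" and close: "\<bar>Y r - Y r'\<bar> \<le> \<eta>" and \<eta>: "\<eta> \<le> 1"
    and L: "\<And>a b c :: int. \<And>H. a \<noteq> 0 \<or> b \<noteq> 0 \<or> c \<noteq> 0 ==> \<bar>ri a\<bar> \<le> H ==> \<bar>ri b\<bar> \<le> H ==>
      \<bar>ri c\<bar> \<le> H ==> H \<ge> 1 ==> 1 \<le> C0 * H ^ \<kappa> * \<bar>ri a * (Y 0)\<^sup>2 + ri b * Y 0 + ri c\<bar>"
    and C0: "C0 \<ge> 1" and X: "X \<ge> 1" and small: "C0 * (4 * (10 * (M + 1) * X\<^sup>2) ^ 3) ^ \<kappa> * \<eta> < 1"
  shows "h4 r r' 0 \<noteq> 0" "\<And>a d g. d > 0 ==> h4 r r' 0 = d * g ==> h4 r r' 1 = - a * g ==> X < ri d"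
proof -
  define H0 where "H0 = h4 r r' 0"
  define H1 where "H1 = h4 r r' 1"
  define H2 where "H2 = h4 r r' 2"
  define H3 where "H3 = h4 r r' 3"
  define \<beta> where "\<beta> = Y 0 * ri H0 + ri H1"
  have \<beta>1: "\<bar>\<beta>\<bar> \<le> 3/10"
  proof -
    have "\<bar>\<beta>\<bar> = \<bar>dd r'\<bar> * \<bar>q (Suc r) + Y r' * q r\<bar>" unfolding \<beta>_def H0_def H1_def h4_lin by (rule abs_mult)
    also have "... \<le> \<bar>dd r'\<bar> * (6/5 * (1/5 * \<bar>q (Suc r')\<bar>))"
      using q_plus[of r r'] q_strict[OF rr] by (intro mult_left_mono) auto
    also have "... = 6/25 * (\<bar>dd r'\<bar> * \<bar>q (Suc r')\<bar>)" by simp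
    finally show ?thesis using dd_q(1)[of r'] by linarith
  qed
  have det: "\<bar>ri (H0 * H3 - H1 * H2)\<bar> = 1"
    unfolding H0_def H1_def H2_def H3_def unfolding of_int_abs[symmetric] h4_det by simp
  show nz: "h4 r r' 0 \<noteq> 0"
  proof
    assume "h4 r r' 0 = 0"
    then have z: "H0 = 0" by (simp add: H0_def)
    then have "\<bar>ri H1\<bar> < 1" using \<beta>1 by (simp add: \<beta>_def)
    then have "H1 = 0" by linarith
    then show False using det z by simp
  qed
  fix a d g assume d: "d > 0" "h4 r r' 0 = d * g" "h4 r r' 1 = - a * g"
  show "X < ri d"
  proof (rule ccontr)
    assume "\<not> X < ri d"
    then have dX: "ri d \<le> X" by simp
    define W where "W = 10 * (M + 1) * X\<^sup>2"
    have W: "W \<ge> 10 * (M + 1)" "W \<ge> 1"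
    proof -
      have "10 * (M + 1) * 1 \<le> W" unfolding W_def using M6 X by (intro mult_left_mono) auto
      then show W10: "W \<ge> 10 * (M + 1)" by simp
      have "10 * (M + 1) \<ge> 1" using M6 by simp
      then show "W \<ge> 1" using W10 by linarith
    qed
    have "\<bar>ri 1 * Y 0 * ri H0 + ri H1\<bar> \<le> 1" using \<beta>1 by (simp add: \<beta>_def)
    from small_denominator[OF this _ X, of d g a] d dX
    have H01: "\<bar>ri H0\<bar> \<le> W" "\<bar>ri H1\<bar> \<le> 3 * W" by (simp_all add: H0_def H1_def W_def)
    define \<gamma> where "\<gamma> = Y 0 * ri H2 + ri H3"
    have quad: "ri H0 * (Y 0)\<^sup>2 + ri (H1 + H2) * Y 0 + ri H3 = dd r * dd r' * (Y r' - Y r)"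
      unfolding H0_def H1_def H2_def H3_def by (rule h4_quad)
    have qs: "\<bar>dd r * dd r' * (Y r' - Y r)\<bar> \<le> \<eta>"
    proof -
      have "\<bar>dd r * dd r' * (Y r' - Y r)\<bar> \<le> 1 * 1 * \<eta>"
        unfolding abs_mult using dd_le1 close by (intro mult_mono) (auto simp: abs_minus_commute)
      then show ?thesis by simp
    qed
    have "\<gamma> = dd r * dd r' * (Y r' - Y r) - Y 0 * \<beta>"
      using quad unfolding \<gamma>_def \<beta>_def by (simp add: algebra_simps power2_eq_square)
    moreover have "\<bar>Y 0 * \<beta>\<bar> \<le> 1/5 * (3/10)" unfolding abs_mult using Y5[of 0] \<beta>1 by (intro mult_mono) auto
    ultimately have \<gamma>1: "\<bar>\<gamma>\<bar> \<le> 2" using qs \<eta> by linarith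
    have "ri (H0 * H3 - H1 * H2) = ri H0 * \<gamma> - ri H2 * \<beta>"
      by (simp add: \<gamma>_def \<beta>_def algebra_simps)
    then have "\<bar>ri H2 * \<beta>\<bar> \<le> 1 + \<bar>ri H0 * \<gamma>\<bar>" using det by linarith
    also have "\<bar>ri H0 * \<gamma>\<bar> \<le> W * 2" unfolding abs_mult using H01 \<gamma>1 W by (intro mult_mono) auto
    finally have Hb: "\<bar>ri H2\<bar> * \<bar>\<beta>\<bar> \<le> 3 * W" using W by (simp add: abs_mult)
    have H0nz: "H0 \<noteq> 0" using nz by (simp add: H0_def)
    have "1 / (5 * (M + 1) * \<bar>ri H0\<bar>) \<le> \<bar>\<beta>\<bar>"
      using badly_approximable[OF H0nz, of "- H1"] by (simp add: \<beta>_def mult.commute)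
    then have "1 \<le> \<bar>\<beta>\<bar> * (5 * (M + 1) * \<bar>ri H0\<bar>)"
      using H0nz M6 by (subst (asm) pos_divide_le_eq) auto
    also have "... \<le> \<bar>\<beta>\<bar> * (W / 2 * W)" using H01 W M6 by (intro mult_left_mono mult_mono) auto
    finally have "\<bar>ri H2\<bar> * 1 \<le> \<bar>ri H2\<bar> * (\<bar>\<beta>\<bar> * (W / 2 * W))" by (intro mult_left_mono) auto
    also have "... = (\<bar>ri H2\<bar> * \<bar>\<beta>\<bar>) * (W / 2 * W)" by simp
    also have "... \<le> 3 * W * (W / 2 * W)" using Hb W by (intro mult_right_mono) auto
    also have "... = 3/2 * W ^ 3" by (simp add: power3_eq_cube)
    finally have H2b: "\<bar>ri H2\<bar> \<le> 3/2 * W ^ 3" by simp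
    have W3: "W * 49 \<le> W ^ 3" 
    proof -
      have "W * (7 * 7) \<le> W * (W * W)" using W M6 by (intro mult_left_mono mult_mono) auto
      then show ?thesis by (simp add: power3_eq_cube)
    qed
    have "\<bar>Y 0 * ri H2\<bar> \<le> 1/5 * \<bar>ri H2\<bar>" unfolding abs_mult using Y5[of 0] by (intro mult_right_mono) auto
    then have H3b: "\<bar>ri H3\<bar> \<le> 4 * W ^ 3" using \<gamma>1 H2b W W3 unfolding \<gamma>_def by linarith
    have "1 \<le> C0 * (4 * W ^ 3) ^ \<kappa> * \<bar>ri H0 * (Y 0)\<^sup>2 + ri (H1 + H2) * Y 0 + ri H3\<bar>"
    proof (rule L)
      show "\<bar>ri (H1 + H2)\<bar> \<le> 4 * W ^ 3" using H01 H2b W W3 unfolding of_int_add by linarith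
    qed (use H0nz H01 H3b W W3 in auto)
    also have "... \<le> C0 * (4 * W ^ 3) ^ \<kappa> * \<eta>"
      unfolding quad using qs C0 W by (intro mult_left_mono) auto
    finally show False using small by (simp add: W_def)
  qed
qed

text \<open>Normal vector of the plane of all \<open>M r * S * transpose (M r)\<close> with \<open>S\<close> orthogonal to the form \<open>(fa, fb, fc)\<close>.\<close>

definition h3 :: "nat => int => int => int => nat => int" where
  "h3 r fa fb fc l = [fa * cq A (Suc r) * cq A (Suc r) - fb * cq A (Suc r) * cq A r + fc * cq A r * cq A r,
    - 2 * fa * cp A (Suc r) * cq A (Suc r) + fb * (cq A r * cp A (Suc r) + cp A r * cq A (Suc r)) - 2 * fc * cp A r * cq A r,
    fa * cp A (Suc r) * cp A (Suc r) - fb * cp A (Suc r) * cp A r + fc * cp A r * cp A r] ! l"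

text \<open>The derivative at Y 0 of the quadratic polynomial with coefficients \<open>h3\<close>.
  The remainder \<open>dd r\<close> balances one denominator, so it stays bounded in r.\<close>

lemma h3_lin:
  "2 * Y 0 * ri (h3 r fa fb fc 0) + ri (h3 r fa fb fc 1) =
    dd r * (2 * (ri fa * (Y r)\<^sup>2 + ri fb * Y r + ri fc) * q r
      - (2 * ri fa * Y r + ri fb) * (q (Suc r) + Y r * q r))"
proof -
  have "2 * Y 0 * ri (h3 r fa fb fc 0) + ri (h3 r fa fb fc 1) =
    2 * ri fa * q (Suc r) * dd (Suc r) - ri fb * (dd (Suc r) * q r + q (Suc r) * dd r) + 2 * ri fc * q r * dd r"
    by (simp add: h3_def dd_def algebra_simps)
  then show ?thesis by (simp add: dd_Suc algebra_simps power2_eq_square)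
qed

lemma h3_quad:
  "ri (h3 r fa fb fc 0) * (Y 0)\<^sup>2 + ri (h3 r fa fb fc 1) * Y 0 + ri (h3 r fa fb fc 2) =
    (dd r)\<^sup>2 * (ri fa * (Y r)\<^sup>2 + ri fb * Y r + ri fc)"
proof -
  have "ri (h3 r fa fb fc 0) * (Y 0)\<^sup>2 + ri (h3 r fa fb fc 1) * Y 0 + ri (h3 r fa fb fc 2) =
    ri fa * (dd (Suc r))\<^sup>2 - ri fb * dd (Suc r) * dd r + ri fc * (dd r)\<^sup>2"
    by (simp add: h3_def dd_def power2_eq_square algebra_simps)
  then show ?thesis by (simp add: dd_Suc algebra_simps power2_eq_square)
qed

lemma h3_nz:
  assumes "fa \<noteq> 0 \<or> fb \<noteq> 0 \<or> fc \<noteq> 0"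
  shows "h3 r fa fb fc 0 \<noteq> 0 \<or> h3 r fa fb fc 1 \<noteq> 0 \<or> h3 r fa fb fc 2 \<noteq> 0"
proof (rule ccontr)
  assume "\<not> ?thesis"
  then have z: "h3 r fa fb fc 0 = 0" "h3 r fa fb fc 1 = 0" "h3 r fa fb fc 2 = 0" by auto
  let ?P = "cp A (Suc r)" and ?Q = "cq A (Suc r)" and ?P' = "cp A r" and ?Q' = "cq A r"
  let ?D = "?P * ?Q' - ?P' * ?Q"
  have D: "?D \<noteq> 0" by (simp only: cf_det) simp
  have "fa * ?D\<^sup>2 = h3 r fa fb fc 0 * ?P'\<^sup>2 + h3 r fa fb fc 1 * ?P' * ?Q' + h3 r fa fb fc 2 * ?Q'\<^sup>2"
       "fb * ?D\<^sup>2 = 2 * h3 r fa fb fc 0 * ?P * ?P' + h3 r fa fb fc 1 * (?P * ?Q' + ?P' * ?Q) + 2 * h3 r fa fb fc 2 * ?Q * ?Q'"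
       "fc * ?D\<^sup>2 = h3 r fa fb fc 0 * ?P\<^sup>2 + h3 r fa fb fc 1 * ?P * ?Q + h3 r fa fb fc 2 * ?Q\<^sup>2"
    by (simp_all add: h3_def power2_eq_square algebra_simps)
  then show False using assms D unfolding z by simp
qed

text \<open>As in \<open>h4_height\<close>, but the third coordinate is bounded through the value of
  the polynomial, and the smallness comes from (dd r)^2, at most (1/25)^r. This is where r itself
  has to be large, not only the length of the repetition.\<close>

lemma h3_height:
  fixes C0 :: real and \<kappa> :: nat
  assumes sf: "small_form (Y r) F \<eta> fa fb fc" and F: "F \<ge> 1" and \<eta>: "\<eta> \<le> 1"
    and L: "\<And>a b c :: int. \<And>H. a \<noteq> 0 \<or> b \<noteq> 0 \<or> c \<noteq> 0 ==> \<bar>ri a\<bar> \<le> H ==> \<bar>ri b\<bar> \<le> H ==>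
      \<bar>ri c\<bar> \<le> H ==> H \<ge> 1 ==> 1 \<le> C0 * H ^ \<kappa> * \<bar>ri a * (Y 0)\<^sup>2 + ri b * Y 0 + ri c\<bar>"
    and C0: "C0 \<ge> 1" and X: "X \<ge> 1" and small: "C0 * (5 * (10 * (M + 1) * (5 * F) * X\<^sup>2)) ^ \<kappa> * (1/25) ^ r < 1"
  shows "h3 r fa fb fc 0 \<noteq> 0" "\<And>a d g. d > 0 ==> h3 r fa fb fc 0 = d * g ==> h3 r fa fb fc 1 = - a * g ==> X < ri d"
proof -
  define H0 where "H0 = h3 r fa fb fc 0"
  define H1 where "H1 = h3 r fa fb fc 1"
  define H2 where "H2 = h3 r fa fb fc 2"
  define fy where "fy = ri fa * (Y r)\<^sup>2 + ri fb * Y r + ri fc"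
  have nz: "fa \<noteq> 0 \<or> fb \<noteq> 0 \<or> fc \<noteq> 0" and fA: "\<bar>ri fa\<bar> \<le> F" "\<bar>ri fa * Y r + ri fb\<bar> \<le> F" and fy: "\<bar>fy\<bar> \<le> 1"
    using sf \<eta> by (auto simp: small_form_def fy_def)
  have fd: "\<bar>2 * ri fa * Y r + ri fb\<bar> \<le> 6/5 * F"
  proof -
    have "\<bar>ri fa * Y r\<bar> \<le> F * (1/5)" unfolding abs_mult using fA Y5[of r] by (intro mult_mono) auto
    then show ?thesis using fA(2) by linarith
  qed
  have lin: "\<bar>ri 2 * Y 0 * ri H0 + ri H1\<bar> \<le> 5 * F"
  proof -
    have e: "ri 2 * Y 0 * ri H0 + ri H1 =
      dd r * (2 * fy * q r - (2 * ri fa * Y r + ri fb) * (q (Suc r) + Y r * q r))"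
      unfolding H0_def H1_def fy_def h3_lin[symmetric] by simp
    have 1: "\<bar>2 * fy * q r\<bar> \<le> 2 * 1 * \<bar>q (Suc r)\<bar>" unfolding abs_mult using fy q_mono[of r] by (intro mult_mono) auto
    have 2: "\<bar>(2 * ri fa * Y r + ri fb) * (q (Suc r) + Y r * q r)\<bar> \<le> 6/5 * F * (6/5 * \<bar>q (Suc r)\<bar>)"
      unfolding abs_mult using fd q_plus[of r r] F by (intro mult_mono) auto
    have 3: "\<bar>q (Suc r)\<bar> \<le> F * \<bar>q (Suc r)\<bar>" using mult_right_mono[OF F, of "\<bar>q (Suc r)\<bar>"] by simp
    have 4: "\<bar>2 * fy * q r - (2 * ri fa * Y r + ri fb) * (q (Suc r) + Y r * q r)\<bar> \<le> 4 * (F * \<bar>q (Suc r)\<bar>)"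
      using 1 2 3 by linarith
    have "\<bar>ri 2 * Y 0 * ri H0 + ri H1\<bar> \<le> \<bar>dd r\<bar> * (4 * (F * \<bar>q (Suc r)\<bar>))"
      unfolding e abs_mult using 4 by (intro mult_left_mono) auto
    also have "... = 4 * F * (\<bar>dd r\<bar> * \<bar>q (Suc r)\<bar>)" by simp
    also have "... \<le> 4 * F * (5/4)" using dd_q(1)[of r] F by (intro mult_left_mono) auto
    finally show ?thesis by simp
  qed
  define W where "W = 10 * (M + 1) * (5 * F) * X\<^sup>2"
  have W: "W \<ge> 1" unfolding W_def using M6 F X by (intro mult_ge1_I) auto
  have quad: "ri H0 * (Y 0)\<^sup>2 + ri H1 * Y 0 + ri H2 = (dd r)\<^sup>2 * fy"
    unfolding H0_def H1_def H2_def fy_def by (rule h3_quad)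
  have d2: "\<bar>(dd r)\<^sup>2 * fy\<bar> \<le> (1/25) ^ r"
  proof -
    have "\<bar>dd r\<bar>\<^sup>2 \<le> ((1/5) ^ r)\<^sup>2" using dd_le[of r] by (intro power_mono) auto
    also have "((1/5 :: real) ^ r)\<^sup>2 = (1/25) ^ r" by (simp add: power2_eq_square flip: power_mult_distrib)
    finally have "\<bar>(dd r)\<^sup>2\<bar> * \<bar>fy\<bar> \<le> (1/25) ^ r * 1" using fy by (intro mult_mono) auto
    then show ?thesis by (simp add: abs_mult)
  qed
  have main: False if "H0 = 0 \<or> (0 < d \<and> ri d \<le> X \<and> H0 = d * g \<and> H1 = - a * g)" for a d g
  proof -
    have H01: "\<bar>ri H0\<bar> \<le> W" "\<bar>ri H1\<bar> \<le> 3 * W"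
      using small_denominator[OF lin _ X that] unfolding W_def by auto
    have "(Y 0)\<^sup>2 \<le> 1" using Y1[of 0] by (simp add: abs_square_le_1)
    then have "\<bar>ri H0 * (Y 0)\<^sup>2\<bar> \<le> W * 1" unfolding abs_mult using H01 W by (intro mult_mono) auto
    moreover have "\<bar>ri H1 * Y 0\<bar> \<le> (3 * W) * (1/5)" unfolding abs_mult using H01 Y5[of 0] W by (intro mult_mono) auto
    moreover have "\<bar>(dd r)\<^sup>2 * fy\<bar> \<le> 1" using d2 power_le_one[of "1/25::real" r] by linarith
    ultimately have H2b: "\<bar>ri H2\<bar> \<le> 5 * W" using quad W by linarith
    have "1 \<le> C0 * (5 * W) ^ \<kappa> * \<bar>ri H0 * (Y 0)\<^sup>2 + ri H1 * Y 0 + ri H2\<bar>"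
      by (rule L) (use h3_nz[OF nz, of r] H01 H2b W in \<open>auto simp: H0_def H1_def H2_def\<close>)
    also have "... \<le> C0 * (5 * W) ^ \<kappa> * (1/25) ^ r" unfolding quad using d2 C0 W by (intro mult_left_mono) auto
    finally show False using small by (simp add: W_def)
  qed
  show "h3 r fa fb fc 0 \<noteq> 0" using main by (auto simp: H0_def)
  show "X < ri d" if "d > 0" "h3 r fa fb fc 0 = d * g" "h3 r fa fb fc 1 = - a * g" for a d g
    
  proof (rule ccontr)
    assume "\<not> X < ri d"
    then show False using main[of d g a] that unfolding H0_def H1_def by auto
  qed
qed

end

section \<open>Sizes of the linear forms and of their product\<close>

lemma triple_bound:
  fixes a b c Y R \<rho> :: real
  assumes "\<bar>a\<bar> \<le> R" "\<bar>b - Y * a\<bar> \<le> \<rho>" "\<bar>c - Y * b\<bar> \<le> \<rho>" "\<bar>Y\<bar> \<le> 1/5" "\<rho> \<le> R / 2"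
  shows "\<bar>b\<bar> \<le> R" "\<bar>c\<bar> \<le> R"
proof -
  have "\<bar>Y * a\<bar> \<le> 1/5 * R" unfolding abs_mult using assms by (intro mult_mono) auto
  then show b: "\<bar>b\<bar> \<le> R" using assms by linarith
  have "\<bar>Y * b\<bar> \<le> 1/5 * R" unfolding abs_mult using assms b by (intro mult_mono) auto
  then show "\<bar>c\<bar> \<le> R" using assms by linarith
qed

lemma cramer3:
  fixes a1 b1 c1 a2 b2 c2 a3 b3 c3 a b c :: real
  assumes det: "(b1 * c2 - c1 * b2) * a3 + (c1 * a2 - a1 * c2) * b3 + (a1 * b2 - b1 * a2) * c3 \<noteq> 0" (is "?d \<noteq> 0")
  shows "\<exists>u v w. a = u * a1 + v * a2 + w * a3 \<and> b = u * b1 + v * b2 + w * b3 \<and> c = u * c1 + v * c2 + w * c3"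
proof -
  define u where "u = (b2 * c3 - c2 * b3) * a + (c2 * a3 - a2 * c3) * b + (a2 * b3 - b2 * a3) * c"
  define v where "v = (b3 * c1 - c3 * b1) * a + (c3 * a1 - a3 * c1) * b + (a3 * b1 - b3 * a1) * c"
  define w where "w = (b1 * c2 - c1 * b2) * a + (c1 * a2 - a1 * c2) * b + (a1 * b2 - b1 * a2) * c"
  have "a * ?d = u * a1 + v * a2 + w * a3" "b * ?d = u * b1 + v * b2 + w * b3" "c * ?d = u * c1 + v * c2 + w * c3"
    unfolding u_def v_def w_def by (simp_all add: algebra_simps)
  then have "a = u / ?d * a1 + v / ?d * a2 + w / ?d * a3" "b = u / ?d * b1 + v / ?d * b2 + w / ?d * b3"
    "c = u / ?d * c1 + v / ?d * c2 + w / ?d * c3"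
    using det by (simp_all add: eq_divide_eq flip: add_divide_distrib)
  then show ?thesis by blast
qed

text \<open>Two-sided bounds by powers of the largest denominator; they keep the exponents w_i
  between - C and C.\<close>

lemma form_bounds_4:
  fixes Q V D D' R \<rho> :: real
  assumes Q: "1 \<le> Q" "Q \<le> V" and D: "0 \<le> D" "D \<le> 1" "0 \<le> D'" "D' \<le> 1" and DQ: "5/6 \<le> D * Q" "D * Q \<le> 5/4" "5/6 \<le> D' * V" "D' * V \<le> 5/4"
    and R: "1 \<le> R" "0 < \<rho>" "\<rho> \<le> 1" and i: "i < (4 :: nat)"
  shows "\<rho> / V\<^sup>2 \<le> [4 * Q * V * R, 4 * D' * Q * \<rho>, 2 * D * V * \<rho>, 2 * D * D' * \<rho>] ! i"
    "[4 * Q * V * R, 4 * D' * Q * \<rho>, 2 * D * V * \<rho>, 2 * D * D' * \<rho>] ! i \<le> 5 * V\<^sup>2 * R"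
proof -
  have V1: "V \<ge> 1" using Q by linarith
  have V2: "V\<^sup>2 \<ge> 1" using V1 by simp
  have VV: "Q * V \<le> V * V" using Q V1 by (intro mult_right_mono) auto
  have QV1: "Q * V \<ge> 1" using Q V1 by (intro mult_ge1_I) auto
  have "D * Q \<le> D * V" using Q D by (intro mult_left_mono) auto
  then have DV: "5/6 \<le> D * V" using DQ by linarith
  have low: "\<rho> / V\<^sup>2 \<le> x * \<rho>" if "1 \<le> x * V\<^sup>2" for x
    using mult_right_mono[OF that, of \<rho>] R V1 by (simp add: field_simps)
  have l1: "1 \<le> 4 * D' * Q * V\<^sup>2"
  proof -
    have "5/6 * 1 \<le> (D' * V) * (Q * V)" using DQ QV1 by (intro mult_mono) auto
    then show ?thesis by (simp add: power2_eq_square mult_ac)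
  qed
  have l2: "1 \<le> 2 * D * V * V\<^sup>2"
  proof -
    have "5/6 * 1 \<le> (D * V) * V\<^sup>2" using DV V2 by (intro mult_mono) auto
    then show ?thesis by (simp add: mult_ac)
  qed
  have l3: "1 \<le> 2 * D * D' * V\<^sup>2"
  proof -
    have "5/6 * (5/6) \<le> (D * V) * (D' * V)" using DQ DV by (intro mult_mono) auto
    then show ?thesis by (simp add: power2_eq_square mult_ac)
  qed
  have l0: "\<rho> / V\<^sup>2 \<le> 4 * Q * V * R"
  proof -
    have "\<rho> / V\<^sup>2 \<le> \<rho> / 1" using V2 R by (intro divide_left_mono) auto
    moreover have "1 * 1 \<le> (Q * V) * R" using QV1 R(1) by (intro mult_mono) auto
    ultimately show ?thesis using R by simp
  qed
  show "\<rho> / V\<^sup>2 \<le> [4 * Q * V * R, 4 * D' * Q * \<rho>, 2 * D * V * \<rho>, 2 * D * D' * \<rho>] ! i"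
    using i l0 low[OF l1] low[OF l2] low[OF l3] unfolding less4 by auto
  have VR: "V\<^sup>2 * R \<ge> 1" using V2 R by (intro mult_ge1_I) auto
  have u0: "4 * Q * V * R \<le> 5 * V\<^sup>2 * R"
  proof -
    have "(Q * V) * R \<le> (V * V) * R" by (rule mult_right_mono[OF VV]) (use R in auto)
    then show ?thesis using VR by (simp add: power2_eq_square mult_ac)
  qed
  have u1: "4 * D' * Q * \<rho> \<le> 5 * V\<^sup>2 * R"
  proof -
    have "D' * Q \<le> D' * V" using Q D by (intro mult_left_mono) auto
    then have "(D' * Q) * \<rho> \<le> 5/4 * 1" using DQ R D Q by (intro mult_mono) auto
    then show ?thesis using VR by (simp add: mult_ac)
  qed
  have u2: "2 * D * V * \<rho> \<le> 5 * V\<^sup>2 * R"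
  proof -
    have "D * V * \<rho> \<le> 1 * V * 1" using D R V1 by (intro mult_mono) auto
    also have "... \<le> V * V * R" using V1 R mult_mono[of 1 V V V] mult_mono[of "V" "V * V" 1 R] by (simp add: mult_ge1_I)
    finally show ?thesis using VR by (simp add: power2_eq_square mult_ac)
  qed
  have u3: "2 * D * D' * \<rho> \<le> 5 * V\<^sup>2 * R"
  proof -
    have "D * D' * \<rho> \<le> 1 * 1 * 1" using D R by (intro mult_mono) auto
    then show ?thesis using VR by (simp add: mult_ac)
  qed
  show "[4 * Q * V * R, 4 * D' * Q * \<rho>, 2 * D * V * \<rho>, 2 * D * D' * \<rho>] ! i \<le> 5 * V\<^sup>2 * R"
    using i u0 u1 u2 u3 unfolding less4 by auto
qed

text \<open>All denominators pair with remainders to D Q and D' V, each at most 5/4, so only R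
  \<rho>^3 survives; 64 (5/4)^4 is below 160.\<close>

lemma form_product_4:
  fixes Q V D D' R \<rho> :: real
  assumes "0 \<le> Q" "0 \<le> V" "0 \<le> D" "0 \<le> D'" "D * Q \<le> 5/4" "D' * V \<le> 5/4" "0 \<le> R" "0 \<le> \<rho>"
  shows "(\<Prod>i<4. [4 * Q * V * R, 4 * D' * Q * \<rho>, 2 * D * V * \<rho>, 2 * D * D' * \<rho>] ! i) \<le> 160 * R * \<rho> ^ 3"
proof -
  have "(\<Prod>i<4. [4 * Q * V * R, 4 * D' * Q * \<rho>, 2 * D * V * \<rho>, 2 * D * D' * \<rho>] ! i) =
    64 * (((D * Q) * (D * Q)) * ((D' * V) * (D' * V))) * (R * \<rho> ^ 3)"
    by (simp add: eval_nat_numeral algebra_simps)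
  also have "... \<le> 64 * ((5/4 * (5/4)) * (5/4 * (5/4))) * (R * \<rho> ^ 3)"
    using assms by (intro mult_right_mono mult_left_mono mult_mono) auto
  also have "... \<le> 160 * R * \<rho> ^ 3" using assms by simp
  finally show ?thesis .
qed

lemma form_bounds_3:
  fixes Q D R \<rho> :: real
  assumes Q: "1 \<le> Q" and D: "0 \<le> D" "D \<le> 1" and DQ: "5/6 \<le> D * Q" "D * Q \<le> 5/4"
    and R: "0 < \<rho>" "\<rho> \<le> R" and i: "i < (3 :: nat)"
  shows "\<rho> / Q\<^sup>2 \<le> [4 * Q\<^sup>2 * R, 2 * D * Q * \<rho>, 2 * D\<^sup>2 * \<rho>] ! i"
    "[4 * Q\<^sup>2 * R, 2 * D * Q * \<rho>, 2 * D\<^sup>2 * \<rho>] ! i \<le> 4 * Q\<^sup>2 * R"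
proof -
  have Q2: "Q\<^sup>2 \<ge> 1" using Q by simp
  have QR: "R \<le> Q\<^sup>2 * R" using mult_right_mono[OF Q2, of R] R by simp
  have low: "\<rho> / Q\<^sup>2 \<le> x * \<rho>" if "1 \<le> x * Q\<^sup>2" for x
    using mult_right_mono[OF that, of \<rho>] R Q by (simp add: field_simps)
  have l1: "1 \<le> 2 * D * Q * Q\<^sup>2"
  proof -
    have "5/6 * 1 \<le> (D * Q) * Q\<^sup>2" using DQ Q2 by (intro mult_mono) auto
    then show ?thesis by simp
  qed
  have l2: "1 \<le> 2 * D\<^sup>2 * Q\<^sup>2"
  proof -
    have "5/6 * (5/6) \<le> (D * Q) * (D * Q)" using DQ by (intro mult_mono) auto
    then show ?thesis by (simp add: power2_eq_square mult_ac)
  qed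
  have l0: "\<rho> / Q\<^sup>2 \<le> 4 * Q\<^sup>2 * R"
  proof -
    have "\<rho> / Q\<^sup>2 \<le> \<rho> / 1" using Q2 R by (intro divide_left_mono) auto
    then have "\<rho> / Q\<^sup>2 \<le> \<rho>" by simp
    then show ?thesis using QR R by linarith
  qed
  show "\<rho> / Q\<^sup>2 \<le> [4 * Q\<^sup>2 * R, 2 * D * Q * \<rho>, 2 * D\<^sup>2 * \<rho>] ! i"
    using i l0 low[OF l1] low[OF l2] unfolding less3 by auto
  have u1: "2 * D * Q * \<rho> \<le> 4 * Q\<^sup>2 * R"
  proof -
    have "(D * Q) * \<rho> \<le> 5/4 * R" using DQ R by (intro mult_mono) auto
    then show ?thesis using QR R by linarith
  qed
  have u2: "2 * D\<^sup>2 * \<rho> \<le> 4 * Q\<^sup>2 * R"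
  proof -
    have "D\<^sup>2 * \<rho> \<le> 1 * R" using D R by (intro mult_mono) (auto simp: power_le_one)
    then show ?thesis using QR R by linarith
  qed
  show "[4 * Q\<^sup>2 * R, 2 * D * Q * \<rho>, 2 * D\<^sup>2 * \<rho>] ! i \<le> 4 * Q\<^sup>2 * R"
    using i u1 u2 unfolding less3 by auto
qed

text \<open>Three pairs D Q absorb all denominators, and 16 (5/4)^3 is below 32.\<close>

lemma form_product_3:
  fixes Q D R \<rho> :: real
  assumes "0 \<le> Q" "0 \<le> D" "D * Q \<le> 5/4" "0 \<le> R" "0 \<le> \<rho>"
  shows "(\<Prod>i<3. [4 * Q\<^sup>2 * R, 2 * D * Q * \<rho>, 2 * D\<^sup>2 * \<rho>] ! i) \<le> 32 * R * \<rho>\<^sup>2"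
proof -
  have "(\<Prod>i<3. [4 * Q\<^sup>2 * R, 2 * D * Q * \<rho>, 2 * D\<^sup>2 * \<rho>] ! i) = 16 * ((D * Q) * (D * Q) * (D * Q)) * (R * \<rho>\<^sup>2)"
    by (simp add: eval_nat_numeral algebra_simps)
  also have "... \<le> 16 * (5/4 * (5/4) * (5/4)) * (R * \<rho>\<^sup>2)"
    using assms by (intro mult_right_mono mult_left_mono mult_mono) auto
  also have "... \<le> 32 * R * \<rho>\<^sup>2" using assms by simp
  finally show ?thesis .
qed

section \<open>Integer points spanning the hyperplanes\<close>

context cfrac begin

text \<open>The entries of \<open>M r * S * transpose (M r')\<close> for the symmetric matrix \<open>S\<close> with entries \<open>a, b, b, c\<close>.\<close>

definition pt4 :: "nat => nat => int => int => int => nat => int" where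
  "pt4 r r' a b c l = (let P = cp A (Suc r); P' = cp A r; Q = cq A (Suc r); Q' = cq A r;
      U = cp A (Suc r'); U' = cp A r'; V = cq A (Suc r'); V' = cq A r' in
    [P * U * a + P * U' * b + P' * U * b + P' * U' * c, P * V * a + P * V' * b + P' * V * b + P' * V' * c,
     Q * U * a + Q * U' * b + Q' * U * b + Q' * U' * c, Q * V * a + Q * V' * b + Q' * V * b + Q' * V' * c] ! l)"

definition pt3 :: "nat => int => int => int => nat => int" where
  "pt3 r a b c l = (let P = cp A (Suc r); P' = cp A r; Q = cq A (Suc r); Q' = cq A r in
    [P * P * a + 2 * P * P' * b + P' * P' * c, P * Q * a + (P * Q' + P' * Q) * b + P' * Q' * c,
     Q * Q * a + 2 * Q * Q' * b + Q' * Q' * c] ! l)"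

text \<open>The forms are tensor products, so each index contributes a denominator or a remainder;
  \<open>dd_Suc\<close> then brings out the small quantities y - Y x and z - Y y.\<close>

lemma pt4_forms:
  fixes a b c :: int
  defines "x \<equiv> ri a" and "y \<equiv> ri b" and "z \<equiv> ri c"
  shows "(\<Sum>l<4. Lf4 (Y 0) 0 l * ri (pt4 r r' a b c l)) = q (Suc r) * q (Suc r') * x + q (Suc r) * q r' * y + q r * q (Suc r') * y + q r * q r' * z"
    "(\<Sum>l<4. Lf4 (Y 0) 1 l * ri (pt4 r r' a b c l)) = dd r' * (q (Suc r) * (y - Y r' * x) + q r * (z - Y r' * y))"
    "(\<Sum>l<4. Lf4 (Y 0) 2 l * ri (pt4 r r' a b c l)) = dd r * (q (Suc r') * (y - Y r * x) + q r' * (z - Y r * y))"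
    "(\<Sum>l<4. Lf4 (Y 0) 3 l * ri (pt4 r r' a b c l)) = dd r * dd r' * ((z - Y r * y) - Y r' * (y - Y r * x))"
proof -
  show "(\<Sum>l<4. Lf4 (Y 0) 0 l * ri (pt4 r r' a b c l)) = q (Suc r) * q (Suc r') * x + q (Suc r) * q r' * y + q r * q (Suc r') * y + q r * q r' * z"
    by (simp add: sum_lessThan_4 Lf4_def pt4_def Let_def x_def y_def z_def)
  have "(\<Sum>l<4. Lf4 (Y 0) 1 l * ri (pt4 r r' a b c l)) =
      q (Suc r) * dd (Suc r') * x + q (Suc r) * dd r' * y + q r * dd (Suc r') * y + q r * dd r' * z"
    by (simp add: sum_lessThan_4 Lf4_def pt4_def Let_def x_def y_def z_def dd_def algebra_simps)
  then show "(\<Sum>l<4. Lf4 (Y 0) 1 l * ri (pt4 r r' a b c l)) = dd r' * (q (Suc r) * (y - Y r' * x) + q r * (z - Y r' * y))"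
    by (simp add: dd_Suc algebra_simps)
  have "(\<Sum>l<4. Lf4 (Y 0) 2 l * ri (pt4 r r' a b c l)) =
      dd (Suc r) * q (Suc r') * x + dd (Suc r) * q r' * y + dd r * q (Suc r') * y + dd r * q r' * z"
    by (simp add: sum_lessThan_4 Lf4_def pt4_def Let_def x_def y_def z_def dd_def algebra_simps)
  then show "(\<Sum>l<4. Lf4 (Y 0) 2 l * ri (pt4 r r' a b c l)) = dd r * (q (Suc r') * (y - Y r * x) + q r' * (z - Y r * y))"
    by (simp add: dd_Suc algebra_simps)
  have "(\<Sum>l<4. Lf4 (Y 0) 3 l * ri (pt4 r r' a b c l)) =
      dd (Suc r) * dd (Suc r') * x + dd (Suc r) * dd r' * y + dd r * dd (Suc r') * y + dd r * dd r' * z"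
    by (simp add: sum_lessThan_4 Lf4_def pt4_def Let_def x_def y_def z_def dd_def power2_eq_square algebra_simps)
  then show "(\<Sum>l<4. Lf4 (Y 0) 3 l * ri (pt4 r r' a b c l)) = dd r * dd r' * ((z - Y r * y) - Y r' * (y - Y r * x))"
    by (simp add: dd_Suc algebra_simps)
qed

lemma pt3_forms:
  fixes a b c :: int
  defines "x \<equiv> ri a" and "y \<equiv> ri b" and "z \<equiv> ri c"
  shows "(\<Sum>l<3. Lf3 (Y 0) 0 l * ri (pt3 r a b c l)) = q (Suc r) * q (Suc r) * x + q (Suc r) * q r * y + q r * q (Suc r) * y + q r * q r * z"
    "(\<Sum>l<3. Lf3 (Y 0) 1 l * ri (pt3 r a b c l)) = dd r * (q (Suc r) * (y - Y r * x) + q r * (z - Y r * y))"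
    "(\<Sum>l<3. Lf3 (Y 0) 2 l * ri (pt3 r a b c l)) = dd r * dd r * ((z - Y r * y) - Y r * (y - Y r * x))"
proof -
  show "(\<Sum>l<3. Lf3 (Y 0) 0 l * ri (pt3 r a b c l)) = q (Suc r) * q (Suc r) * x + q (Suc r) * q r * y + q r * q (Suc r) * y + q r * q r * z"
    by (simp add: sum_lessThan_3 Lf3_def pt3_def Let_def x_def y_def z_def)
  have "(\<Sum>l<3. Lf3 (Y 0) 1 l * ri (pt3 r a b c l)) =
      q (Suc r) * dd (Suc r) * x + (q (Suc r) * dd r + q r * dd (Suc r)) * y + q r * dd r * z"
    by (simp add: sum_lessThan_3 Lf3_def pt3_def Let_def x_def y_def z_def dd_def algebra_simps)
  then show "(\<Sum>l<3. Lf3 (Y 0) 1 l * ri (pt3 r a b c l)) = dd r * (q (Suc r) * (y - Y r * x) + q r * (z - Y r * y))"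
    by (simp add: dd_Suc algebra_simps)
  have "(\<Sum>l<3. Lf3 (Y 0) 2 l * ri (pt3 r a b c l)) =
      dd (Suc r) * dd (Suc r) * x + 2 * dd (Suc r) * dd r * y + dd r * dd r * z"
    by (simp add: sum_lessThan_3 Lf3_def pt3_def Let_def x_def y_def z_def dd_def power2_eq_square algebra_simps)
  then show "(\<Sum>l<3. Lf3 (Y 0) 2 l * ri (pt3 r a b c l)) = dd r * dd r * ((z - Y r * y) - Y r * (y - Y r * x))"
    by (simp add: dd_Suc algebra_simps)
qed

lemma bilinear_bounds:
  fixes x y z Q Q' V V' D D' y0 y1 y2 R \<rho> \<sigma> :: real
  assumes "\<bar>x\<bar> \<le> R" "\<bar>y\<bar> \<le> R" "\<bar>z\<bar> \<le> R" and Q: "\<bar>Q'\<bar> \<le> \<bar>Q\<bar>" "\<bar>V'\<bar> \<le> \<bar>V\<bar>" and "\<bar>y2\<bar> \<le> 1"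
    and e: "\<bar>y0\<bar> \<le> \<sigma>" "\<bar>y1\<bar> \<le> \<sigma>"
  shows "\<bar>Q * V * x + Q * V' * y + Q' * V * y + Q' * V' * z\<bar> \<le> 4 * \<bar>Q\<bar> * \<bar>V\<bar> * R"
    "\<bar>D * (Q * y0 + Q' * y1)\<bar> \<le> 2 * \<bar>D\<bar> * \<bar>Q\<bar> * \<sigma>"
    "\<bar>D * D' * (y1 - y2 * y0)\<bar> \<le> 2 * \<bar>D\<bar> * \<bar>D'\<bar> * \<sigma>"
proof -
  have m: "\<bar>u * v * w\<bar> \<le> \<bar>Q\<bar> * \<bar>V\<bar> * R" if "\<bar>u\<bar> \<le> \<bar>Q\<bar>" "\<bar>v\<bar> \<le> \<bar>V\<bar>" "\<bar>w\<bar> \<le> R" for u v w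
    unfolding abs_mult using that by (intro mult_mono) auto
  show "\<bar>Q * V * x + Q * V' * y + Q' * V * y + Q' * V' * z\<bar> \<le> 4 * \<bar>Q\<bar> * \<bar>V\<bar> * R"
    using m[of Q V x] m[of Q V' y] m[of Q' V y] m[of Q' V' z] assms unfolding abs_le_iff by linarith
  have "\<bar>Q * y0\<bar> \<le> \<bar>Q\<bar> * \<sigma>" "\<bar>Q' * y1\<bar> \<le> \<bar>Q\<bar> * \<sigma>" unfolding abs_mult using e Q by (auto intro!: mult_mono)
  then have "\<bar>Q * y0 + Q' * y1\<bar> \<le> 2 * (\<bar>Q\<bar> * \<sigma>)" by linarith
  then have "\<bar>D\<bar> * \<bar>Q * y0 + Q' * y1\<bar> \<le> \<bar>D\<bar> * (2 * (\<bar>Q\<bar> * \<sigma>))" by (intro mult_left_mono) auto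
  then show "\<bar>D * (Q * y0 + Q' * y1)\<bar> \<le> 2 * \<bar>D\<bar> * \<bar>Q\<bar> * \<sigma>" unfolding abs_mult by (simp add: mult_ac)
  have "\<bar>y2 * y0\<bar> \<le> 1 * \<sigma>" unfolding abs_mult using assms by (intro mult_mono) auto
  then have "\<bar>y1 - y2 * y0\<bar> \<le> 2 * \<sigma>" using e by linarith
  then have "\<bar>D\<bar> * \<bar>D'\<bar> * \<bar>y1 - y2 * y0\<bar> \<le> \<bar>D\<bar> * \<bar>D'\<bar> * (2 * \<sigma>)" by (intro mult_left_mono) auto
  then show "\<bar>D * D' * (y1 - y2 * y0)\<bar> \<le> 2 * \<bar>D\<bar> * \<bar>D'\<bar> * \<sigma>" unfolding abs_mult by (simp add: mult_ac)
qed

lemma det_sq: "(p (Suc r) * q r - p r * q (Suc r)) * (p (Suc r) * q r - p r * q (Suc r)) = 1"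
proof -
  have "p (Suc r) * q r - p r * q (Suc r) = ri (cp A (Suc r) * cq A r - cp A r * cq A (Suc r))" by simp
  then show ?thesis unfolding cf_det by (simp flip: power_mult_distrib)
qed

text \<open>Both convergent matrices have determinant 1 or -1, so every x is their product with a
  unique real matrix in the middle, and orthogonality to \<open>h4\<close> says precisely that this
  matrix is symmetric. \<epsilon> is the product of the two determinants.\<close>

lemma pt4_span:
  fixes x :: "nat => real"
  assumes perp: "(\<Sum>l<4. ri (h4 r r' l) * x l) = 0"
  obtains \<epsilon> a b c :: real where
    "\<And>l a1 b1 c1 a2 b2 c2 a3 b3 c3 u v w. a = u * ri a1 + v * ri a2 + w * ri a3 ==>
      b = u * ri b1 + v * ri b2 + w * ri b3 ==> c = u * ri c1 + v * ri c2 + w * ri c3 ==> l < 4 ==>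
      x l = \<epsilon> * u * ri (pt4 r r' a1 b1 c1 l) + \<epsilon> * v * ri (pt4 r r' a2 b2 c2 l) + \<epsilon> * w * ri (pt4 r r' a3 b3 c3 l)"
proof -
  let ?P = "p (Suc r)" and ?P' = "p r" and ?Q = "q (Suc r)" and ?Q' = "q r"
  let ?U = "p (Suc r')" and ?U' = "p r'" and ?V = "q (Suc r')" and ?V' = "q r'"
  define d where "d = ?P * ?Q' - ?P' * ?Q"
  define d' where "d' = ?U * ?V' - ?U' * ?V"
  define a where "a = ?Q' * ?V' * x 0 - ?Q' * ?U' * x 1 - ?P' * ?V' * x 2 + ?P' * ?U' * x 3"
  define b where "b = - ?Q' * ?V * x 0 + ?Q' * ?U * x 1 + ?P' * ?V * x 2 - ?P' * ?U * x 3"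
  define b' where "b' = - ?Q * ?V' * x 0 + ?Q * ?U' * x 1 + ?P * ?V' * x 2 - ?P * ?U' * x 3"
  define c where "c = ?Q * ?V * x 0 - ?Q * ?U * x 1 - ?P * ?V * x 2 + ?P * ?U * x 3"
  have "b - b' = (\<Sum>l<4. ri (h4 r r' l) * x l)"
    unfolding b_def b'_def by (simp add: sum_lessThan_4 h4_def algebra_simps)
  then have bb: "b' = b" using perp by simp
  have dd2: "d * d' * (d * d') = 1"
  proof -
    have "d * d' * (d * d') = (d * d) * (d' * d')" by simp
    then show ?thesis unfolding d_def d'_def det_sq by simp
  qed
  have x0: "d * d' * x 0 = ?P * ?U * a + ?P * ?U' * b + ?P' * ?U * b + ?P' * ?U' * c"
    and x1: "d * d' * x 1 = ?P * ?V * a + ?P * ?V' * b + ?P' * ?V * b + ?P' * ?V' * c"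
    and x2: "d * d' * x 2 = ?Q * ?U * a + ?Q * ?U' * b + ?Q' * ?U * b + ?Q' * ?U' * c"
    and x3: "d * d' * x 3 = ?Q * ?V * a + ?Q * ?V' * b + ?Q' * ?V * b + ?Q' * ?V' * c"
  proof -
    have "d * d' * x 0 = ?P * ?U * a + ?P * ?U' * b + ?P' * ?U * b' + ?P' * ?U' * c"
      "d * d' * x 1 = ?P * ?V * a + ?P * ?V' * b + ?P' * ?V * b' + ?P' * ?V' * c"
      "d * d' * x 2 = ?Q * ?U * a + ?Q * ?U' * b + ?Q' * ?U * b' + ?Q' * ?U' * c"
      "d * d' * x 3 = ?Q * ?V * a + ?Q * ?V' * b + ?Q' * ?V * b' + ?Q' * ?V' * c"
      unfolding d_def d'_def a_def b_def b'_def c_def by (simp_all only: algebra_simps) (simp_all add: algebra_simps)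
    then show "d * d' * x 0 = ?P * ?U * a + ?P * ?U' * b + ?P' * ?U * b + ?P' * ?U' * c"
      "d * d' * x 1 = ?P * ?V * a + ?P * ?V' * b + ?P' * ?V * b + ?P' * ?V' * c"
      "d * d' * x 2 = ?Q * ?U * a + ?Q * ?U' * b + ?Q' * ?U * b + ?Q' * ?U' * c"
      "d * d' * x 3 = ?Q * ?V * a + ?Q * ?V' * b + ?Q' * ?V * b + ?Q' * ?V' * c" unfolding bb .
  qed
  show thesis
  proof (rule that[of a b c "d * d'"])
    fix l :: nat and a1 b1 c1 a2 b2 c2 a3 b3 c3 :: int and u v w :: real
    assume e: "a = u * ri a1 + v * ri a2 + w * ri a3"
      "b = u * ri b1 + v * ri b2 + w * ri b3" "c = u * ri c1 + v * ri c2 + w * ri c3" and l: "l < 4"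
    have "d * d' * x l = u * ri (pt4 r r' a1 b1 c1 l) + v * ri (pt4 r r' a2 b2 c2 l) + w * ri (pt4 r r' a3 b3 c3 l)"
      using l unfolding less4
      by (elim disjE; simp only: x0 x1 x2 x3; simp add: e pt4_def Let_def algebra_simps)
    then have "d * d' * (d * d' * x l) = d * d' * (u * ri (pt4 r r' a1 b1 c1 l) + v * ri (pt4 r r' a2 b2 c2 l) + w * ri (pt4 r r' a3 b3 c3 l))" by simp
    then have "(d * d' * (d * d')) * x l = d * d' * (u * ri (pt4 r r' a1 b1 c1 l) + v * ri (pt4 r r' a2 b2 c2 l) + w * ri (pt4 r r' a3 b3 c3 l))"
      by (simp only: mult.assoc)
    then show "x l = d * d' * u * ri (pt4 r r' a1 b1 c1 l) + d * d' * v * ri (pt4 r r' a2 b2 c2 l) + d * d' * w * ri (pt4 r r' a3 b3 c3 l)"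
      unfolding dd2 by (simp add: algebra_simps)
  qed
qed

lemma datum4:
  fixes R \<rho> t C \<delta> :: real
  assumes rr: "r < r'" and ts: "three_short (Y r) R \<rho>" and \<rho>: "0 < \<rho>" "\<rho> \<le> 1" "\<rho> \<le> R / 2" and R: "1 \<le> R"
    and close: "\<bar>Y r - Y r'\<bar> * R \<le> \<rho>" and t: "t > 0" "C > 0"
    and up: "5 * (q (Suc r'))\<^sup>2 * R \<le> exp (C * t)" and low: "exp (- (C * t)) \<le> \<rho> / (q (Suc r'))\<^sup>2"
    and pr: "160 * R * \<rho> ^ 3 \<le> exp (- (\<delta> * t))"
    and h: "h4 r r' 0 \<noteq> 0" "\<And>a d g. d > 0 ==> h4 r r' 0 = d * g ==> h4 r r' 1 = - a * g ==> exp (t / C) < ri d"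
  shows "\<exists>w y h a d. approx_datum 4 (Lf4 (Y 0)) C \<delta> t w y h a d"
proof -
  have R0: "R > 0" using R by simp
  from ts obtain a1 b1 c1 a2 b2 c2 a3 b3 c3 :: int where
    det: "(b1 * c2 - c1 * b2) * a3 + (c1 * a2 - a1 * c2) * b3 + (a1 * b2 - b1 * a2) * c3 \<noteq> 0" and
    N: "tn (Y r) R \<rho> (ri a1) (ri b1) (ri c1) \<le> 1"
      "tn (Y r) R \<rho> (ri a2) (ri b2) (ri c2) \<le> 1"
      "tn (Y r) R \<rho> (ri a3) (ri b3) (ri c3) \<le> 1" unfolding three_short_def by blast
  define a where "a k = (if k = 1 then a1 else if k = 2 then a2 else a3)" for k :: nat
  define b where "b k = (if k = 1 then b1 else if k = 2 then b2 else b3)" for k :: nat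
  define c where "c k = (if k = 1 then c1 else if k = 2 then c2 else c3)" for k :: nat
  have Nk: "tn (Y r) R \<rho> (ri (a k)) (ri (b k)) (ri (c k)) \<le> 1" for k using N by (simp add: a_def b_def c_def)
  define y where "y k = pt4 r r' (a k) (b k) (c k)" for k
  define Q where "Q = \<bar>q (Suc r)\<bar>"
  define V where "V = \<bar>q (Suc r')\<bar>"
  define D where "D = \<bar>dd r\<bar>"
  define D' where "D' = \<bar>dd r'\<bar>"
  define bb where "bb i = [4 * Q * V * R, 4 * D' * Q * \<rho>, 2 * D * V * \<rho>, 2 * D * D' * \<rho>] ! i" for i
  have QV: "1 \<le> Q" "Q \<le> V" using q_ge1[of r] q_strict[OF rr] by (auto simp: Q_def V_def)
  have Db: "0 \<le> D" "D \<le> 1" "0 \<le> D'" "D' \<le> 1" using dd_le1 by (auto simp: D_def D'_def)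
  have DQ: "5/6 \<le> D * Q" "D * Q \<le> 5/4" "5/6 \<le> D' * V" "D' * V \<le> 5/4"
    using dd_q[of r] dd_q[of r'] by (auto simp: D_def Q_def D'_def V_def)
  have V2: "(q (Suc r'))\<^sup>2 = V\<^sup>2" by (simp add: V_def)
  have small: "\<bar>\<Sum>l<4. Lf4 (Y 0) i l * ri (y k l)\<bar> \<le> bb i" if i: "i < 4" for k i
  proof -
    let ?x = "ri (a k)" and ?y = "ri (b k)" and ?z = "ri (c k)"
    have e: "\<bar>?x\<bar> \<le> R" "\<bar>?y - Y r * ?x\<bar> \<le> \<rho>" "\<bar>?z - Y r * ?y\<bar> \<le> \<rho>" using Nk[of k] unfolding tn_le_iff[OF R0 \<rho>(1)] by auto
    note yz = triple_bound[OF e Y5 \<rho>(3)]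
    \<comment> \<open>Replacing Y r by Y r' costs at most another \<rho>, by the hypothesis
      \<open>close\<close>.\<close>
    have c1: "\<bar>(Y r - Y r') * w\<bar> \<le> \<rho>" if "\<bar>w\<bar> \<le> R" for w
    proof -
      have "\<bar>(Y r - Y r') * w\<bar> \<le> \<bar>Y r - Y r'\<bar> * R" unfolding abs_mult using that by (intro mult_left_mono) auto
      then show ?thesis using close by linarith
    qed
    have "?y - Y r' * ?x = (?y - Y r * ?x) + (Y r - Y r') * ?x" "?z - Y r' * ?y = (?z - Y r * ?y) + (Y r - Y r') * ?y" by (simp_all add: algebra_simps)
    then have e': "\<bar>?y - Y r' * ?x\<bar> \<le> 2 * \<rho>" "\<bar>?z - Y r' * ?y\<bar> \<le> 2 * \<rho>" using e c1[OF e(1)] c1[OF yz(1)] by linarith+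
    note B = bilinear_bounds[OF e(1) yz q_mono[of r] q_mono[of r'] Y1[of r']]
    note B' = bilinear_bounds[OF e(1) yz q_mono[of r'] q_mono[of r] Y1[of r']]
    have f0: "\<bar>\<Sum>l<4. Lf4 (Y 0) 0 l * ri (y k l)\<bar> \<le> bb 0"
      unfolding y_def pt4_forms bb_def using B(1)[OF e(2,3)] by (simp add: Q_def V_def)
    have f1: "\<bar>\<Sum>l<4. Lf4 (Y 0) 1 l * ri (y k l)\<bar> \<le> bb 1"
      unfolding y_def pt4_forms bb_def using B(2)[OF e', of "dd r'"] by (simp add: Q_def D'_def)
    have f2: "\<bar>\<Sum>l<4. Lf4 (Y 0) 2 l * ri (y k l)\<bar> \<le> bb 2"
      unfolding y_def pt4_forms bb_def using B'(2)[OF e(2,3), of "dd r"] by (simp add: V_def D_def)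
    have f3: "\<bar>\<Sum>l<4. Lf4 (Y 0) 3 l * ri (y k l)\<bar> \<le> bb 3"
      unfolding y_def pt4_forms bb_def using B(3)[OF e(2,3), of "dd r" "dd r'"] by (simp add: D_def D'_def)
    show ?thesis using i f0 f1 f2 f3 unfolding less4 by auto
  qed
  have "\<exists>w a d. approx_datum 4 (Lf4 (Y 0)) C \<delta> t w y (\<lambda>l. ri (h4 r r' l)) a d"
  proof (rule approx_datumI[where b = bb])
    show "(\<Prod>i<4. bb i) \<le> exp (- (\<delta> * t))"
    proof -
      have "(\<Prod>i<4. bb i) \<le> 160 * R * \<rho> ^ 3" unfolding bb_def by (rule form_product_4) (use QV Db DQ R \<rho> in auto)
      then show ?thesis using pr by linarith
    qed
    show "exp (- (C * t)) \<le> bb i" "bb i \<le> exp (C * t)" if "i < 4" for i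
      using form_bounds_4[OF QV Db DQ R \<rho>(1,2) that] up low unfolding bb_def[symmetric] V2 by linarith+
    show "exp (t / C) < ri d" if "d > 0" "h4 r r' 0 = d * g" "h4 r r' 1 = - a * g" for a d g by (rule h(2)[OF that])
    fix x assume "(\<Sum>l<4. ri (h4 r r' l) * x l) = 0"
    from pt4_span[OF this] obtain \<epsilon> sa sb sc where span:
      "\<And>l a1 b1 c1 a2 b2 c2 a3 b3 c3 u v w. sa = u * ri a1 + v * ri a2 + w * ri a3 ==>
      sb = u * ri b1 + v * ri b2 + w * ri b3 ==> sc = u * ri c1 + v * ri c2 + w * ri c3 ==> l < 4 ==>
      x l = \<epsilon> * u * ri (pt4 r r' a1 b1 c1 l) + \<epsilon> * v * ri (pt4 r r' a2 b2 c2 l) + \<epsilon> * w * ri (pt4 r r' a3 b3 c3 l)"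
      by metis
    have "ri ((b1 * c2 - c1 * b2) * a3 + (c1 * a2 - a1 * c2) * b3 + (a1 * b2 - b1 * a2) * c3) \<noteq> 0" using det unfolding of_int_eq_0_iff .
    then have "(ri b1 * ri c2 - ri c1 * ri b2) * ri a3 +
      (ri c1 * ri a2 - ri a1 * ri c2) * ri b3 +
      (ri a1 * ri b2 - ri b1 * ri a2) * ri c3 \<noteq> 0" by simp
    from cramer3[OF this, of sa sb sc] obtain u v w where uvw: "sa = u * ri a1 + v * ri a2 + w * ri a3"
      "sb = u * ri b1 + v * ri b2 + w * ri b3" "sc = u * ri c1 + v * ri c2 + w * ri c3" by blast
    have *: "x l = (\<Sum>k\<in>{1..<4}. (if k = 1 then \<epsilon> * u else if k = 2 then \<epsilon> * v else \<epsilon> * w) * ri (y k l))" if "l < 4" for l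
      unfolding sum_one_4 using span[OF uvw that] by (simp add: y_def a_def b_def c_def)
    show "\<exists>u. \<forall>l<4. x l = (\<Sum>k\<in>{1..<4}. u k * ri (y k l))"
      by (rule exI[of _ "\<lambda>k. if k = 1 then \<epsilon> * u else if k = 2 then \<epsilon> * v else \<epsilon> * w"]) (use * in blast)
  qed (use t h small in auto)
  then show ?thesis by blast
qed

lemma convergent_of_size:
  assumes "Z \<ge> 1"
  obtains j where "Z \<le> \<bar>q (Suc j)\<bar>" "\<bar>q (Suc j)\<bar> \<le> (M + 1) * Z"
proof -
  have "\<exists>j. Z \<le> \<bar>q (Suc j)\<bar>"
  proof -
    obtain j where "Z < (5 :: real) ^ j" using real_arch_pow[of 5 Z] by auto
    then show ?thesis using q_lower[of j] by (intro exI[of _ j]) linarith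
  qed
  then obtain j where j: "Z \<le> \<bar>q (Suc j)\<bar>" "\<And>i. i < j ==> \<not> Z \<le> \<bar>q (Suc i)\<bar>"
    using exists_least_iff[of "\<lambda>j. Z \<le> \<bar>q (Suc j)\<bar>"] by auto
  have "\<bar>q (Suc j)\<bar> \<le> (M + 1) * Z"
  proof (cases j)
    case 0
    have "1 * 1 \<le> (M + 1) * Z" using assms M6 by (intro mult_mono) auto
    then show ?thesis using 0 by simp
  next
    case (Suc i)
    then have "\<bar>q (Suc i)\<bar> \<le> Z" using j(2)[of i] by simp
    then have "(M + 1) * \<bar>q (Suc i)\<bar> \<le> (M + 1) * Z" using M6 by (intro mult_left_mono) auto
    then show ?thesis using q_M[of i] Suc by simp
  qed
  then show thesis using that j(1) by blast
qed

end

text \<open>The equation is solved by a = fa g, b = fa k, c = - (fb k + fc g) with free g and k, and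
  the two unimodular pairs span all choices of (k, g).\<close>

lemma line_combination:
  fixes fa fb fc a b c x1 y1 x2 y2 :: real
  assumes fa: "fa \<noteq> 0" and perp: "fa * c + fb * b + fc * a = 0" and e: "(x2 * y1 - x1 * y2) * (x2 * y1 - x1 * y2) = 1"
  shows "\<exists>u v. a = u * (fa * y1) + v * (fa * y2) \<and> b = u * (fa * x1) + v * (fa * x2) \<and>
    c = u * (- (fb * x1 + fc * y1)) + v * (- (fb * x2 + fc * y2))"
proof -
  define e where "e = x2 * y1 - x1 * y2"
  define g where "g = a / fa"
  define k where "k = b / fa"
  have a: "a = fa * g" and b: "b = fa * k" using fa by (simp_all add: g_def k_def)
  have "fa * (c + fb * k + fc * g) = 0" using perp unfolding a b by (simp add: algebra_simps)
  then have c: "c = - (fb * k + fc * g)" using fa by (simp add: eq_neg_iff_add_eq_0 add.assoc)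
  define u where "u = e * (g * x2 - k * y2)"
  define v where "v = e * (k * y1 - g * x1)"
  have gu: "g = u * y1 + v * y2" and ku: "k = u * x1 + v * x2"
  proof -
    have "u * y1 + v * y2 = (e * e) * g" "u * x1 + v * x2 = (e * e) * k" unfolding u_def v_def e_def by (simp_all add: algebra_simps)
    then show "g = u * y1 + v * y2" "k = u * x1 + v * x2" using assms(3) unfolding e_def by simp_all
  qed
  show ?thesis unfolding a b c gu ku by (intro exI[of _ u] exI[of _ v]) (simp add: algebra_simps)
qed

context cfrac begin

lemma pt3_span:
  fixes x :: "nat => real"
  assumes perp: "(\<Sum>l<3. ri (h3 r fa fb fc l) * x l) = 0"
  obtains a b c :: real where "ri fa * c + ri fb * b + ri fc * a = 0"
    "\<And>l a1 b1 c1 a2 b2 c2 u v. a = u * ri a1 + v * ri a2 ==>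
      b = u * ri b1 + v * ri b2 ==> c = u * ri c1 + v * ri c2 ==> l < 3 ==>
      x l = u * ri (pt3 r a1 b1 c1 l) + v * ri (pt3 r a2 b2 c2 l)"
proof -
  let ?P = "p (Suc r)" and ?P' = "p r" and ?Q = "q (Suc r)" and ?Q' = "q r"
  define d where "d = ?P * ?Q' - ?P' * ?Q"
  define a where "a = ?Q' * ?Q' * x 0 - 2 * ?Q' * ?P' * x 1 + ?P' * ?P' * x 2"
  define b where "b = - ?Q * ?Q' * x 0 + (?Q' * ?P + ?P' * ?Q) * x 1 - ?P * ?P' * x 2"
  define c where "c = ?Q * ?Q * x 0 - 2 * ?Q * ?P * x 1 + ?P * ?P * x 2"
  have dd2: "d * d = 1" unfolding d_def by (rule det_sq)
  have "(d * d) * x 0 = ?P * ?P * a + 2 * ?P * ?P' * b + ?P' * ?P' * c"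
    "(d * d) * x 1 = ?P * ?Q * a + (?P * ?Q' + ?P' * ?Q) * b + ?P' * ?Q' * c"
    "(d * d) * x 2 = ?Q * ?Q * a + 2 * ?Q * ?Q' * b + ?Q' * ?Q' * c"
    unfolding d_def a_def b_def c_def by (simp_all add: algebra_simps)
  then have x: "x 0 = ?P * ?P * a + 2 * ?P * ?P' * b + ?P' * ?P' * c"
    "x 1 = ?P * ?Q * a + (?P * ?Q' + ?P' * ?Q) * b + ?P' * ?Q' * c"
    "x 2 = ?Q * ?Q * a + 2 * ?Q * ?Q' * b + ?Q' * ?Q' * c"
    unfolding dd2 by simp_all
  show thesis
  proof (rule that[of c b a])
    have "ri fa * c + ri fb * b + ri fc * a = (\<Sum>l<3. ri (h3 r fa fb fc l) * x l)"
      unfolding a_def b_def c_def by (simp add: sum_lessThan_3 h3_def algebra_simps)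
    then show "ri fa * c + ri fb * b + ri fc * a = 0" using perp by simp
    fix l :: nat and a1 b1 c1 a2 b2 c2 :: int and u v :: real
    assume e: "a = u * ri a1 + v * ri a2" "b = u * ri b1 + v * ri b2" "c = u * ri c1 + v * ri c2" and l: "l < 3"
    show "x l = u * ri (pt3 r a1 b1 c1 l) + v * ri (pt3 r a2 b2 c2 l)"
      using l unfolding less3
      by (elim disjE; simp only: x; simp add: e pt3_def Let_def algebra_simps)
  qed
qed

text \<open>The plane of all S orthogonal to the form is spanned by a = fa y, b = fa x, c = - (fb x
  + fc y) for two consecutive convergents x / y of Y r, the larger denominator being about Z. The
  entries have size F Z, and b - Y a, c - Y b have size F / Z as long as \<eta> Z is no larger than
  this.\<close>

lemma datum3:
  fixes F \<eta> Z t C \<delta> :: real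
  defines "R \<equiv> F * ((M + 1) * Z)" and "\<rho> \<equiv> 4 * F / Z"
  assumes sf: "small_form (Y r) F \<eta> fa fb fc" and F: "F \<ge> 1" and Z: "Z \<ge> 2"
    and \<eta>: "\<eta> < 1" "\<eta> * ((M + 1) * Z) \<le> F / Z" "5 * (M + 1) * F * \<eta> < 1" and t: "t > 0" "C > 0"
    and up: "4 * (q (Suc r))\<^sup>2 * R \<le> exp (C * t)" and low: "exp (- (C * t)) \<le> \<rho> / (q (Suc r))\<^sup>2"
    and pr: "32 * R * \<rho>\<^sup>2 \<le> exp (- (\<delta> * t))"
    and h: "h3 r fa fb fc 0 \<noteq> 0" "\<And>a d g. d > 0 ==> h3 r fa fb fc 0 = d * g ==> h3 r fa fb fc 1 = - a * g ==> exp (t / C) < ri d"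
  shows "\<exists>w y h a d. approx_datum 3 (Lf3 (Y 0)) C \<delta> t w y h a d"
proof -
  interpret sh: cfrac "\<lambda>k. A (k + r)" "\<lambda>k. Y (k + r)" M by (rule shift_cfrac)
  define fy where "fy = ri fa * (Y r)\<^sup>2 + ri fb * Y r + ri fc"
  have prim: "\<exists>u v w. u * fa + v * fb + w * fc = 1" and fA: "\<bar>ri fa\<bar> \<le> F" "\<bar>ri fa * Y r + ri fb\<bar> \<le> F" and fy: "\<bar>fy\<bar> \<le> \<eta>"
    using sf by (auto simp: small_form_def fy_def)
  have \<rho>0: "\<rho> > 0" using F Z by (simp add: \<rho>_def)
  have R0: "R > 0" using F Z M6 by (simp add: R_def)
  have \<rho>R: "\<rho> \<le> R / 2"
  proof -
    have "\<rho> \<le> 4 * F / 2" unfolding \<rho>_def using F Z by (intro divide_left_mono) auto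
    moreover have "F * (7 * 2) \<le> R" unfolding R_def using F Z M6 by (intro mult_left_mono mult_mono) auto
    ultimately show ?thesis using F by linarith
  qed
  \<comment> \<open>For fa = 0 the form would be linear and too small at Y r; bad approximability
    excludes this by 5 (M + 1) F \<eta> < 1.\<close>
  have fa0: "fa \<noteq> 0"
  proof
    assume z: "fa = 0"
    have fb0: "fb \<noteq> 0"
    proof
      assume "fb = 0"
      then have "\<bar>ri fc\<bar> < 1" using fy \<eta>(1) z by (simp add: fy_def)
      then have "fc = 0" by linarith
      then show False using prim z \<open>fb = 0\<close> by simp
    qed
    have fbF: "\<bar>ri fb\<bar> \<le> F" using fA(2) z by simp
    have "1 / (5 * (M + 1) * \<bar>ri fb\<bar>) \<le> \<bar>fy\<bar>"
      using badly_approximable_shift[OF fb0, of r "- fc"] by (simp add: fy_def z)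
    then have "1 \<le> \<bar>fy\<bar> * (5 * (M + 1) * \<bar>ri fb\<bar>)"
      using fb0 M6 by (subst (asm) pos_divide_le_eq) auto
    also have "... \<le> \<eta> * (5 * (M + 1) * F)" using fy fbF M6 F by (intro mult_mono) auto
    finally show False using \<eta>(3) by (simp add: mult_ac)
  qed
  obtain j where j: "Z \<le> \<bar>sh.q (Suc j)\<bar>" "\<bar>sh.q (Suc j)\<bar> \<le> (M + 1) * Z"
    by (rule sh.convergent_of_size[of Z]) (use Z in auto)
  define xx where "xx k = (if k = 1 then cp (\<lambda>k. A (k + r)) j else cp (\<lambda>k. A (k + r)) (Suc j))" for k :: nat
  define yy where "yy k = (if k = 1 then cq (\<lambda>k. A (k + r)) j else cq (\<lambda>k. A (k + r)) (Suc j))" for k :: nat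
  define dk where "dk k = ri (yy k) * Y r - ri (xx k)" for k
  have dj: "\<bar>sh.dd j\<bar> \<le> 5/4 / Z"
  proof -
    have "\<bar>sh.dd j\<bar> * Z \<le> \<bar>sh.dd j\<bar> * \<bar>sh.q (Suc j)\<bar>" using j(1) by (intro mult_left_mono) auto
    also have "... \<le> 5/4" by (rule sh.dd_q)
    finally show ?thesis using Z by (simp add: pos_le_divide_eq)
  qed
  have dkb: "\<bar>dk k\<bar> \<le> 5/4 / Z" for k
  proof -
    have "dk k = sh.dd j \<or> dk k = sh.dd (Suc j)" by (auto simp: dk_def sh.dd_def xx_def yy_def)
    then show ?thesis using dj sh.dd_Suc_le[of j] by (elim disjE) auto
  qed
  have yb: "\<bar>ri (yy k)\<bar> \<le> (M + 1) * Z" for k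
    using j(2) sh.q_mono[of j] by (auto simp: yy_def)
  define a where "a k = fa * yy k" for k
  define b where "b k = fa * xx k" for k
  define c where "c k = - (fb * xx k + fc * yy k)" for k
  define y where "y k = pt3 r (a k) (b k) (c k)" for k
  define Q where "Q = \<bar>q (Suc r)\<bar>"
  define D where "D = \<bar>dd r\<bar>"
  define bb where "bb i = [4 * Q\<^sup>2 * R, 2 * D * Q * \<rho>, 2 * D\<^sup>2 * \<rho>] ! i" for i
  have Q1: "1 \<le> Q" using q_ge1[of r] by (auto simp: Q_def)
  have Db: "0 \<le> D" "D \<le> 1" using dd_le1 by (auto simp: D_def)
  have DQ: "5/6 \<le> D * Q" "D * Q \<le> 5/4" using dd_q[of r] by (auto simp: D_def Q_def)
  have Q2: "(q (Suc r))\<^sup>2 = Q\<^sup>2" by (simp add: Q_def)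
  have small: "\<bar>\<Sum>l<3. Lf3 (Y 0) i l * ri (y k l)\<bar> \<le> bb i" if i: "i < 3" for k i
  proof -
    let ?x = "ri (a k)" and ?y = "ri (b k)" and ?z = "ri (c k)"
    have e1: "\<bar>?x\<bar> \<le> R" unfolding a_def R_def of_int_mult abs_mult using fA yb F by (intro mult_mono) auto
    have Fd: "F * (5/4 / Z) \<le> \<rho>" unfolding \<rho>_def using F Z by (simp add: field_simps)
    have e2: "\<bar>?y - Y r * ?x\<bar> \<le> \<rho>"
    proof -
      have "?y - Y r * ?x = - (ri fa * dk k)" by (simp add: a_def b_def dk_def algebra_simps)
      then have "\<bar>?y - Y r * ?x\<bar> = \<bar>ri fa\<bar> * \<bar>dk k\<bar>" by (simp add: abs_mult)
      also have "... \<le> F * (5/4 / Z)" using fA dkb F by (intro mult_mono) auto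
      finally show ?thesis using Fd by linarith
    qed
    have e3: "\<bar>?z - Y r * ?y\<bar> \<le> \<rho>"
    proof -
      have eq: "?z - Y r * ?y = (ri fa * Y r + ri fb) * dk k - fy * ri (yy k)"
        by (simp add: b_def c_def dk_def fy_def algebra_simps power2_eq_square)
      have "\<bar>(ri fa * Y r + ri fb) * dk k\<bar> \<le> F * (5/4 / Z)" unfolding abs_mult using fA dkb F by (intro mult_mono) auto
      moreover have "\<bar>fy * ri (yy k)\<bar> \<le> \<eta> * ((M + 1) * Z)" unfolding abs_mult using fy yb by (intro mult_mono) auto
      moreover have "F * (5/4 / Z) + F / Z \<le> \<rho>" unfolding \<rho>_def using F Z by (simp add: field_simps)
      ultimately show ?thesis unfolding eq using \<eta>(2) by linarith
    qed
    note yz = triple_bound[OF e1 e2 e3 Y5 \<rho>R]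
    note B = bilinear_bounds[OF e1 yz q_mono[of r] q_mono[of r] Y1[of r] e2 e3]
    have f0: "\<bar>\<Sum>l<3. Lf3 (Y 0) 0 l * ri (y k l)\<bar> \<le> bb 0"
      unfolding y_def pt3_forms bb_def using B(1) by (simp add: Q_def power2_eq_square mult.assoc)
    have f1: "\<bar>\<Sum>l<3. Lf3 (Y 0) 1 l * ri (y k l)\<bar> \<le> bb 1"
      unfolding y_def pt3_forms bb_def using B(2)[of "dd r"] by (simp add: Q_def D_def)
    have f2: "\<bar>\<Sum>l<3. Lf3 (Y 0) 2 l * ri (y k l)\<bar> \<le> bb 2"
      unfolding y_def pt3_forms bb_def using B(3)[of "dd r" "dd r"] by (simp add: D_def power2_eq_square mult.assoc)
    show ?thesis using i f0 f1 f2 unfolding less3 by auto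
  qed
  have "\<exists>w a d. approx_datum 3 (Lf3 (Y 0)) C \<delta> t w y (\<lambda>l. ri (h3 r fa fb fc l)) a d"
  proof (rule approx_datumI[where b = bb])
    show "(\<Prod>i<3. bb i) \<le> exp (- (\<delta> * t))"
    proof -
      have "(\<Prod>i<3. bb i) \<le> 32 * R * \<rho>\<^sup>2" unfolding bb_def by (rule form_product_3) (use Q1 Db DQ R0 \<rho>0 in auto)
      then show ?thesis using pr by linarith
    qed
    have \<rho>R': "\<rho> \<le> R" using \<rho>R R0 by linarith
    show "exp (- (C * t)) \<le> bb i" "bb i \<le> exp (C * t)" if "i < 3" for i
      using form_bounds_3[OF Q1 Db DQ \<rho>0 \<rho>R' that] up low unfolding bb_def[symmetric] Q2 by linarith+
    show "exp (t / C) < ri d" if "d > 0" "h3 r fa fb fc 0 = d * g" "h3 r fa fb fc 1 = - a * g" for a d g by (rule h(2)[OF that])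
    fix x assume "(\<Sum>l<3. ri (h3 r fa fb fc l) * x l) = 0"
    from pt3_span[OF this] obtain sa sb sc where sp: "ri fa * sc + ri fb * sb + ri fc * sa = 0"
      and span: "\<And>l a1 b1 c1 a2 b2 c2 u v. sa = u * ri a1 + v * ri a2 ==>
      sb = u * ri b1 + v * ri b2 ==> sc = u * ri c1 + v * ri c2 ==> l < 3 ==>
      x l = u * ri (pt3 r a1 b1 c1 l) + v * ri (pt3 r a2 b2 c2 l)"
      by metis
    have fa0': "ri fa \<noteq> 0" using fa0 by simp
    have sq: "(ri (xx 2) * ri (yy 1) - ri (xx 1) * ri (yy 2)) *
        (ri (xx 2) * ri (yy 1) - ri (xx 1) * ri (yy 2)) = 1"
      unfolding xx_def yy_def using sh.det_sq[of j] by simp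
    from line_combination[OF fa0' sp sq] obtain u v where uv: "sa = u * ri (a 1) + v * ri (a 2)"
      "sb = u * ri (b 1) + v * ri (b 2)" "sc = u * ri (c 1) + v * ri (c 2)"
      unfolding a_def b_def c_def of_int_mult of_int_minus of_int_add by blast
    have *: "x l = (\<Sum>k\<in>{1..<3}. (if k = 1 then u else v) * ri (y k l))" if "l < 3" for l
      unfolding sum_one_3 using span[OF uv that] by (simp add: y_def)
    show "\<exists>u. \<forall>l<3. x l = (\<Sum>k\<in>{1..<3}. u k * ri (y k l))"
      by (rule exI[of _ "\<lambda>k. if k = 1 then u else v"]) (use * in blast)
  qed (use t h small in auto)
  then show ?thesis by blast
qed

end

section \<open>Continued fractions with repetitions\<close>

theorem (in cfrac) stammering_transcendental:
  fixes g :: "int poly" and K :: real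
  assumes np: "\<not> (\<exists>l\<ge>1. \<exists>N\<ge>1. \<forall>n\<ge>N. A (n + l) = A n)"
    and rep: "\<And>T. \<exists>t r r'. T \<le> t \<and> t \<le> r \<and> r < r' \<and> real r' \<le> K * real t \<and> (\<forall>k<t. A (r + k + 1) = A (r' + k + 1))"
    and g: "g \<noteq> 0"
  shows "poly (rpoly g) (Y 0) \<noteq> 0"
proof
  assume root: "poly (rpoly g) (Y 0) = 0"
  obtain \<kappa> :: nat and C0 :: real where C0: "C0 \<ge> 1" and L:
    "\<And>a b c :: int. \<And>H. a \<noteq> 0 \<or> b \<noteq> 0 \<or> c \<noteq> 0 ==> \<bar>ri a\<bar> \<le> H ==> \<bar>ri b\<bar> \<le> H ==>
      \<bar>ri c\<bar> \<le> H ==> H \<ge> 1 ==> 1 \<le> C0 * H ^ \<kappa> * \<bar>ri a * (Y 0)\<^sup>2 + ri b * Y 0 + ri c\<bar>"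
    by (rule quadratic_liouville[OF g root np]) blast
  \<comment> \<open>The unit of scale is x = \<epsilon> t. Then 20000 x is at most t, even after
    multiplication by the exponent \<kappa> of the Liouville inequality.\<close>
  define \<epsilon> where "\<epsilon> = 1 / (20000 * (real \<kappa> + 1))"
  define lM where "lM = ln (M + 1)"
  have lM: "lM \<ge> 0" "exp lM = M + 1" using M6 by (simp_all add: lM_def)
  \<comment> \<open>The term 20 (\<kappa> + 1) keeps X^(6 \<kappa>) below exp t for X = exp (t / C);
    the other terms dominate the squared denominators up to r' with room for R and \<rho>.\<close>
  define C where "C = 20 * (real \<kappa> + 1) + 2 * \<bar>K\<bar> * lM + 3"
  define \<delta> where "\<delta> = \<epsilon> / 2"
  define K4 where "K4 = 4 * (10 * (M + 1)) ^ 3"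
  define K3 where "K3 = 250 * (M + 1)"
  define T0 where "T0 = 1000 * (M + 1) / \<epsilon> + C0 * K4 ^ \<kappa> + C0 * K3 ^ \<kappa> + 10"
  have \<epsilon>0: "\<epsilon> > 0" by (simp add: \<epsilon>_def add_pos_nonneg)
  have KlM: "\<bar>K\<bar> * lM \<ge> 0" using lM by simp
  have C1: "C \<ge> 1" "C \<ge> 20 * (real \<kappa> + 1)" "C \<ge> 2 * \<bar>K\<bar> * lM + 3" using KlM by (auto simp: C_def)
  have key: "(\<exists>w y h a b. approx_datum 4 (Lf4 (Y 0)) C \<delta> (real t) w y h a b) \<or> (\<exists>w y h a b. approx_datum 3 (Lf3 (Y 0)) C \<delta> (real t) w y h a b)"
    if tT: "real t \<ge> T0" and tr: "t \<le> r" and rr: "r < r'" and r'K: "real r' \<le> K * real t" and Aeq: "\<forall>k<t. A (r + k + 1) = A (r' + k + 1)" for t r r' :: nat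
  proof -
    define \<tau> where "\<tau> = real t"
    define x where "x = \<epsilon> * \<tau>"
    have K40: "C0 * K4 ^ \<kappa> \<ge> 0" "C0 * K3 ^ \<kappa> \<ge> 0" using C0 M6 by (simp_all add: K4_def K3_def)
    have Me: "1000 * (M + 1) / \<epsilon> \<ge> 0" using M6 \<epsilon>0 by simp
    have \<tau>: "\<tau> \<ge> 10" "\<tau> \<ge> C0 * K4 ^ \<kappa>" "\<tau> \<ge> C0 * K3 ^ \<kappa>" "\<tau> \<ge> 1000 * (M + 1) / \<epsilon>"
      using tT K40 Me by (auto simp: \<tau>_def T0_def)
    have xM: "x \<ge> 1000 * (M + 1)" using \<tau>(4) \<epsilon>0 by (simp add: x_def pos_divide_le_eq mult.commute)
    have x0: "x > 0" using xM M6 by argo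
    have expx: "exp x \<ge> 1000 * (M + 1)" using xM exp_ge_add_one_self[of x] by linarith
    have exp\<tau>: "exp \<tau> > \<tau>" using exp_ge_add_one_self[of \<tau>] by linarith
    have x\<tau>: "20000 * x * (real \<kappa> + 1) = \<tau>" 
    proof -
      have "real \<kappa> + 1 > 0" by linarith
      then have "20000 * (real \<kappa> + 1) \<noteq> 0" by simp
      then show ?thesis by (simp add: x_def \<epsilon>_def mult_ac)
    qed
    have x\<tau>1: "20000 * x \<le> \<tau>"
    proof -
      have "20000 * x * 1 \<le> 20000 * x * (real \<kappa> + 1)" using x0 by (intro mult_left_mono) auto
      then show ?thesis using x\<tau> by simp
    qed
    have x\<tau>2: "20000 * (x * real \<kappa>) \<le> \<tau>" using x\<tau> x0 by (simp add: distrib_left)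
    have p25: "(1/25 :: real) ^ t \<le> exp (- 2 * \<tau>)"
    proof -
      have "exp (2 :: real) = exp 1 * exp 1" by (simp flip: exp_add)
      also have "... \<le> 3 * 3" using exp_le by (intro mult_mono) auto
      finally have e2: "exp (2 :: real) \<le> 25" by simp
      have "exp (2 * \<tau>) = exp 2 ^ t" by (simp add: \<tau>_def mult.commute flip: exp_of_nat_mult)
      also have "... \<le> 25 ^ t" using e2 by (intro power_mono) auto
      finally have "1 / 25 ^ t \<le> 1 / exp (2 * \<tau>)" by (intro divide_left_mono) auto
      then show ?thesis by (simp add: power_divide exp_minus inverse_eq_divide)
    qed
    have tC: "\<tau> / C * (20 * real \<kappa>) \<le> \<tau>"
    proof -
      have "\<tau> * (20 * real \<kappa>) \<le> \<tau> * C" using C1(2) \<tau>(1) by (intro mult_left_mono) auto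
      then show ?thesis using C1(1) by (simp add: pos_divide_le_eq)
    qed
    have t0: "\<tau> > 0" "C > 0" using \<tau> C1 by linarith+
    define X where "X = exp (\<tau> / C)"
    have X1: "X \<ge> 1" unfolding X_def using t0 by simp
    have qb: "(q (Suc j))\<^sup>2 \<le> exp (2 * \<bar>K\<bar> * lM * \<tau>)" if "j \<le> r'" for j
    proof -
      have "\<bar>q (Suc j)\<bar> \<le> (M + 1) ^ j" by (rule q_upper)
      also have "... \<le> (M + 1) ^ r'" using that M6 by (intro power_increasing) auto
      also have "... = exp (real r' * lM)" unfolding lM(2)[symmetric] by (simp add: exp_of_nat_mult)
      also have "... \<le> exp (\<bar>K\<bar> * \<tau> * lM)"
      proof -
        have "K * \<tau> \<le> \<bar>K\<bar> * \<tau>" using t0 by (intro mult_right_mono) auto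
        then have "real r' \<le> \<bar>K\<bar> * \<tau>" using r'K by (simp add: \<tau>_def)
        then have "real r' * lM \<le> \<bar>K\<bar> * \<tau> * lM" using lM by (intro mult_right_mono) auto
        then show ?thesis by simp
      qed
      finally have "\<bar>q (Suc j)\<bar>\<^sup>2 \<le> (exp (\<bar>K\<bar> * \<tau> * lM))\<^sup>2" by (intro power_mono) auto
      also have "... = exp (2 * \<bar>K\<bar> * lM * \<tau>)" by (simp add: power2_eq_square mult_ac flip: exp_add)
      finally show ?thesis by simp
    qed
    have e5: "exp \<tau> \<ge> 5" using exp\<tau> \<tau> by linarith
    have expC: "exp (2 * \<bar>K\<bar> * lM * \<tau>) * exp (3 * \<tau>) \<le> exp (C * \<tau>)"
    proof -
      have "(2 * \<bar>K\<bar> * lM + 3) * \<tau> \<le> C * \<tau>" using C1(3) t0 by (intro mult_right_mono) auto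
      then show ?thesis by (simp add: distrib_right flip: exp_add)
    qed
    have up: "5 * (q (Suc j))\<^sup>2 * S \<le> exp (C * \<tau>)" if "j \<le> r'" "0 \<le> S" "S \<le> exp \<tau>" for j S
    proof -
      have "5 * (q (Suc j))\<^sup>2 * S \<le> exp \<tau> * exp (2 * \<bar>K\<bar> * lM * \<tau>) * exp \<tau>"
        using qb[OF that(1)] e5 that by (intro mult_mono) auto
      also have "... = exp (2 * \<bar>K\<bar> * lM * \<tau>) * exp (2 * \<tau>)" by (simp add: algebra_simps flip: exp_add)
      also have "... \<le> exp (2 * \<bar>K\<bar> * lM * \<tau>) * exp (3 * \<tau>)" using t0 by (intro mult_left_mono) auto
      finally show ?thesis using expC by linarith
    qed
    have low: "exp (- (C * \<tau>)) \<le> S / (q (Suc j))\<^sup>2" if "j \<le> r'" "exp (- \<tau>) \<le> S" for j S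
    proof -
      have q0: "(q (Suc j))\<^sup>2 > 0" using q_ge1[of j] by auto
      have "exp (- (C * \<tau>)) * (q (Suc j))\<^sup>2 \<le> exp (- (C * \<tau>)) * exp (2 * \<bar>K\<bar> * lM * \<tau>)" using qb[OF that(1)] by (intro mult_left_mono) auto
      also have "... = exp (2 * \<bar>K\<bar> * lM * \<tau>) * exp (3 * \<tau>) * exp (- (C * \<tau>) - 3 * \<tau>)" by (simp flip: exp_add)
      also have "... \<le> exp (C * \<tau>) * exp (- (C * \<tau>) - 3 * \<tau>)" using expC by (intro mult_right_mono) auto
      also have "... = exp (- 3 * \<tau>)" by (simp flip: exp_add)
      also have "... \<le> exp (- \<tau>)" using t0 by simp
      finally have "exp (- (C * \<tau>)) * (q (Suc j))\<^sup>2 \<le> S" using that(2) by linarith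
      then show ?thesis using q0 by (simp add: pos_le_divide_eq)
    qed
    \<comment> \<open>The product of the forms is at most a constant times exp (- x). Half of the
      exponent is spent on the constant, which explains \<delta> = \<epsilon> / 2.\<close>
    have half: "c * exp (- x) \<le> exp (- (\<delta> * \<tau>))" if "c \<le> 500 * (M + 1)" for c
    proof -
      have dx: "\<delta> * \<tau> = x / 2" by (simp add: \<delta>_def x_def)
      have "c \<le> exp (x / 2)" using that xM exp_ge_add_one_self[of "x / 2"] by linarith
      then have "c * exp (- x) \<le> exp (x / 2) * exp (- x)" by (intro mult_right_mono) auto
      also have "... = exp (- (x / 2))" by (simp flip: exp_add)
      finally show ?thesis unfolding dx .
    qed
    have close: "\<bar>Y r - Y r'\<bar> \<le> (1/25) ^ t" using Aeq by (intro Y_close) auto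
    have small: "C0 * (k * S) ^ \<kappa> * (1/25) ^ j < 1" if "t \<le> j" "0 \<le> k" "0 \<le> S" "C0 * k ^ \<kappa> \<le> \<tau>" "S ^ \<kappa> \<le> exp \<tau>" for k S j
    proof -
      have "(1/25 :: real) ^ j \<le> (1/25) ^ t" using that(1) by (intro power_decreasing) auto
      then have pj: "(1/25 :: real) ^ j \<le> exp (- 2 * \<tau>)" using p25 by linarith
      have "C0 * (k * S) ^ \<kappa> * (1/25) ^ j = (C0 * k ^ \<kappa>) * S ^ \<kappa> * (1/25) ^ j" by (simp add: power_mult_distrib)
      also have "... \<le> \<tau> * exp \<tau> * exp (- 2 * \<tau>)" using that pj t0 by (intro mult_mono) auto
      also have "... < exp \<tau> * exp \<tau> * exp (- 2 * \<tau>)" using exp\<tau> by (intro mult_strict_right_mono) auto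
      also have "... = 1" by (simp flip: exp_add)
      finally show ?thesis .
    qed
    have eM: "exp x \<ge> 100 * (M + 1)" using expx M6 by argo
    from form_persists[OF x0 eM, of r] show ?thesis
    proof (elim disjE bexE exE conjE)
      fix k :: nat
      assume k: "k \<in> {1000..5000}" and ts: "three_short (Y r) (exp (x * (3 * real k - 1))) (exp (x * (- real k)))"
      define R where "R = exp (x * (3 * real k - 1))"
      define \<rho> where "\<rho> = exp (x * (- real k))"
      have k': "1000 \<le> real k" "real k \<le> 5000" using k by auto
      have xk: "x * real k \<le> x * 5000" "x * 1000 \<le> x * real k" using k' x0 by (auto intro!: mult_left_mono)
      have \<rho>1: "\<rho> \<le> 1" using x0 by (simp add: \<rho>_def)
      have R2: "R \<ge> 2"
      proof -
        have "x \<le> x * (3 * real k - 1)" using xk x0 by (simp add: right_diff_distrib)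
        then have "exp x \<le> R" unfolding R_def by simp
        then show ?thesis using expx M6 by argo
      qed
      have x3k: "x * (3 * real k - 1) = 3 * (x * real k) - x" by (simp add: algebra_simps)
      have RS: "R \<le> exp \<tau>" unfolding R_def x3k exp_le_cancel_iff using xk x\<tau>1 x0 by linarith
      have cl: "\<bar>Y r - Y r'\<bar> * R \<le> \<rho>"
      proof -
        have "\<bar>Y r - Y r'\<bar> * R \<le> exp (- 2 * \<tau>) * R" using close p25 R2 by (intro mult_right_mono) auto
        also have "... = exp (- 2 * \<tau> + x * (3 * real k - 1))" unfolding R_def exp_add ..
        also have "... \<le> \<rho>" unfolding \<rho>_def x3k mult_minus_right exp_le_cancel_iff using xk x\<tau>1 x0 by linarith
        finally show ?thesis .
      qed
      have \<rho>\<tau>: "exp (- \<tau>) \<le> \<rho>" unfolding \<rho>_def mult_minus_right exp_le_cancel_iff using xk x\<tau>1 x0 by linarith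
      have pr: "160 * R * \<rho> ^ 3 \<le> exp (- (\<delta> * \<tau>))"
      proof -
        have "R * \<rho> ^ 3 = exp (- x)" by (simp add: R_def \<rho>_def power3_eq_cube algebra_simps flip: exp_add)
        then show ?thesis using half[of 160] M6 by (simp add: mult.assoc)
      qed
      have X6: "(X ^ 6) ^ \<kappa> \<le> exp \<tau>"
      proof -
        have "(X ^ 6) ^ \<kappa> = exp (\<tau> / C * (6 * real \<kappa>))" unfolding X_def by (simp add: mult_ac flip: exp_of_nat_mult power_mult)
        also have "... \<le> exp \<tau>"
        proof -
          have "\<tau> / C * (6 * real \<kappa>) \<le> \<tau> / C * (20 * real \<kappa>)" using t0 by (intro mult_left_mono) auto
          then show ?thesis using tC by simp
        qed
        finally show ?thesis .
      qed
      have "C0 * (K4 * X ^ 6) ^ \<kappa> * (1/25) ^ t < 1" using \<tau>(2) M6 X1 X6 by (intro small) (auto simp: K4_def)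
      moreover have "K4 * X ^ 6 = 4 * (10 * (M + 1) * X\<^sup>2) ^ 3" by (simp add: K4_def power_mult_distrib flip: power_mult)
      ultimately have sm: "C0 * (4 * (10 * (M + 1) * X\<^sup>2) ^ 3) ^ \<kappa> * (1/25) ^ t < 1" by simp
      have "(1/25 :: real) ^ t \<le> 1" by (simp add: power_le_one)
      note ht = h4_height[OF rr close this L C0 X1 sm]
      have "\<exists>w y h a d. approx_datum 4 (Lf4 (Y 0)) C \<delta> \<tau> w y h a d"
      proof (rule datum4[OF rr, of R \<rho>])
        show "three_short (Y r) R \<rho>" using ts by (simp add: R_def \<rho>_def)
        show "0 < \<rho>" by (simp add: \<rho>_def)
        show "\<rho> \<le> R / 2" using \<rho>1 R2 by linarith
        show "5 * (q (Suc r'))\<^sup>2 * R \<le> exp (C * \<tau>)" using R2 RS by (intro up) auto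
        show "exp (- (C * \<tau>)) \<le> \<rho> / (q (Suc r'))\<^sup>2" using \<rho>\<tau> by (intro low) auto
        show "h4 r r' 0 \<noteq> 0" by (rule ht(1)) auto
        show "exp (\<tau> / C) < ri d" if "d > 0" "h4 r r' 0 = d * g" "h4 r r' 1 = - a * g" for a d g
          unfolding X_def[symmetric] by (rule ht(2)[OF _ _ _ _ _ that]) auto
      qed (use \<rho>1 R2 cl t0 pr in auto)
      then show ?thesis by (simp add: \<tau>_def)
    next
      fix l hi :: real and fa fb fc :: int
      assume l: "1000 \<le> l" "l \<le> 2000" "19/10 * l \<le> hi" and sf: "small_form (Y r) (exp (x * (l + 1))) (exp (x * (2 - 3 * hi))) fa fb fc"
      define F where "F = exp (x * (l + 1))"
      define \<eta> where "\<eta> = exp (x * (2 - 3 * hi))"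
      \<comment> \<open>F^3 / Z has the exponent 3 (l + 1) - (3 l + 10) = -7. With the constants
        absorbed, \<eta> Z \<le> F / Z amounts to 3 hi \<ge> 5 l + 22, which follows from hi \<ge>
        19/10 l and l \<ge> 1000.\<close>
      define Z where "Z = exp (x * (3 * l + 10))"
      have em: "exp (x * u) \<le> exp (x * v)" if "u \<le> v" for u v using that x0 by simp
      have M1: "M + 1 \<le> exp (x * 1)" "5 * (M + 1) \<le> exp (x * 1)" "512 * (M + 1) \<le> exp (x * 1)" using expx M6 by auto
      have ea: "exp (x * u) * exp (x * v) = exp (x * (u + v))" for u v by (simp add: distrib_left exp_add)
      have F1: "F \<ge> 1" unfolding F_def using x0 l by simp
      have Z2: "Z \<ge> 2"
      proof -
        have "exp (x * 1) \<le> Z" unfolding Z_def using l by (intro em) auto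
        then show ?thesis using M1(1) M6 by linarith
      qed
      have \<eta>1: "\<eta> < 1" unfolding \<eta>_def using x0 l by (simp add: mult_less_0_iff)
      have \<eta>2: "\<eta> * ((M + 1) * Z) \<le> F / Z"
      proof -
        have "\<eta> * ((M + 1) * Z) \<le> \<eta> * (exp (x * 1) * Z)" using M1 by (intro mult_left_mono mult_right_mono) (auto simp: \<eta>_def Z_def)
        also have "... = exp (x * (2 - 3 * hi + (1 + (3 * l + 10))))" unfolding \<eta>_def Z_def ea ..
        also have "... \<le> exp (x * (l + 1 - (3 * l + 10)))" using l by (intro em) auto
        also have "... = F / Z" unfolding F_def Z_def exp_diff[symmetric] right_diff_distrib ..
        finally show ?thesis .
      qed
      have \<eta>3: "5 * (M + 1) * F * \<eta> < 1"
      proof -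
        have "5 * (M + 1) * F * \<eta> \<le> exp (x * 1) * F * \<eta>" using M1(2) F1 by (intro mult_right_mono) (auto simp: \<eta>_def)
        also have "... = exp (x * (1 + (l + 1) + (2 - 3 * hi)))" unfolding F_def \<eta>_def ea ..
        also have "... < 1" using x0 l by (simp add: mult_less_0_iff)
        finally show ?thesis .
      qed
      define R where "R = F * ((M + 1) * Z)"
      define \<rho> where "\<rho> = 4 * F / Z"
      have FZ: "F / Z = exp (x * (- 2 * l - 9))"
      proof -
        have "x * (l + 1) - x * (3 * l + 10) = x * (- 2 * l - 9)" by (simp add: algebra_simps)
        then show ?thesis unfolding F_def Z_def exp_diff[symmetric] by (simp only:)
      qed
      have R0: "R \<ge> 0" using F1 M6 Z2 by (simp add: R_def)
      have R\<tau>: "R \<le> exp \<tau>"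
      proof -
        have "R \<le> F * (exp (x * 1) * Z)" unfolding R_def using M1 F1 Z2 by (intro mult_left_mono mult_right_mono) auto
        also have "... = exp (x * (l + 1 + (1 + (3 * l + 10))))" unfolding F_def Z_def ea ..
        also have "... \<le> exp (x * 20000)" using l by (intro em) auto
        also have "... \<le> exp \<tau>" using x\<tau>1 by simp
        finally show ?thesis .
      qed
      have \<rho>\<tau>: "exp (- \<tau>) \<le> \<rho>"
      proof -
        have "exp (- \<tau>) \<le> exp (x * (- 20000))" using x\<tau>1 by simp
        also have "... \<le> F / Z" unfolding FZ using l by (intro em) auto
        also have "... \<le> \<rho>" unfolding \<rho>_def using F1 Z2 by (intro divide_right_mono) auto
        finally show ?thesis .
      qed
      have pr: "32 * R * \<rho>\<^sup>2 \<le> exp (- (\<delta> * \<tau>))"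
      proof -
        have "\<rho> = 4 * (F / Z)" by (simp add: \<rho>_def)
        then have "32 * R * \<rho>\<^sup>2 = 512 * (M + 1) * (F * Z * ((F / Z) * (F / Z)))" by (simp add: R_def power2_eq_square)
        also have "... \<le> exp (x * 1) * (F * Z * ((F / Z) * (F / Z)))" using M1(3) F1 Z2 by (intro mult_right_mono) auto
        also have "... = exp (x * (1 + ((l + 1) + (3 * l + 10) + ((- 2 * l - 9) + (- 2 * l - 9)))))" unfolding FZ unfolding F_def Z_def ea ..
        also have "... \<le> exp (x * (- 1))" by (intro em) auto
        also have "... \<le> exp (- (\<delta> * \<tau>))" using half[of 1] M6 by simp
        finally show ?thesis .
      qed
      have FX: "(F * X\<^sup>2) ^ \<kappa> \<le> exp \<tau>"
      proof -
        have "F ^ \<kappa> = exp (x * real \<kappa> * (l + 1))" unfolding F_def by (simp add: mult_ac flip: exp_of_nat_mult)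
        moreover have "(X\<^sup>2) ^ \<kappa> = exp (\<tau> / C * (2 * real \<kappa>))" unfolding X_def by (simp add: mult_ac flip: exp_of_nat_mult power_mult)
        ultimately have e: "(F * X\<^sup>2) ^ \<kappa> = exp (x * real \<kappa> * (l + 1) + \<tau> / C * (2 * real \<kappa>))" by (simp add: power_mult_distrib exp_add)
        have "x * real \<kappa> * (l + 1) \<le> x * real \<kappa> * 10000" using l x0 by (intro mult_left_mono) auto
        moreover have "x * real \<kappa> * 10000 \<le> \<tau> / 2" using x\<tau>2 by simp
        moreover have "\<tau> / C * (2 * real \<kappa>) = \<tau> / C * (20 * real \<kappa>) / 10" by simp
        ultimately have "x * real \<kappa> * (l + 1) + \<tau> / C * (2 * real \<kappa>) \<le> \<tau>"
          using tC t0 by argo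
        then show ?thesis unfolding e by simp
      qed
      have "C0 * (K3 * (F * X\<^sup>2)) ^ \<kappa> * (1/25) ^ r < 1" using \<tau>(3) M6 X1 F1 FX tr by (intro small) (auto simp: K3_def)
      moreover have "K3 * (F * X\<^sup>2) = 5 * (10 * (M + 1) * (5 * F) * X\<^sup>2)" by (simp add: K3_def)
      ultimately have sm: "C0 * (5 * (10 * (M + 1) * (5 * F) * X\<^sup>2)) ^ \<kappa> * (1/25) ^ r < 1" by (simp only:)
      have sf': "small_form (Y r) F \<eta> fa fb fc" using sf by (simp add: F_def \<eta>_def)
      note ht = h3_height[OF sf' F1 less_imp_le[OF \<eta>1] L C0 X1 sm]
      have "\<exists>w y h a d. approx_datum 3 (Lf3 (Y 0)) C \<delta> \<tau> w y h a d"
      proof (rule datum3[OF sf' F1 Z2 \<eta>1 \<eta>2 \<eta>3 t0])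
        have "4 * (q (Suc r))\<^sup>2 * R \<le> 5 * (q (Suc r))\<^sup>2 * R" using R0 by (intro mult_right_mono) auto
        also have "... \<le> exp (C * \<tau>)" using R0 R\<tau> rr by (intro up) auto
        finally show "4 * (q (Suc r))\<^sup>2 * (F * ((M + 1) * Z)) \<le> exp (C * \<tau>)" by (simp only: R_def)
        show "exp (- (C * \<tau>)) \<le> 4 * F / Z / (q (Suc r))\<^sup>2" using \<rho>\<tau> rr unfolding \<rho>_def by (intro low) auto
        show "32 * (F * ((M + 1) * Z)) * (4 * F / Z)\<^sup>2 \<le> exp (- (\<delta> * \<tau>))" using pr by (simp only: R_def \<rho>_def)
        show "h3 r fa fb fc 0 \<noteq> 0" by (rule ht(1)) auto
        show "exp (\<tau> / C) < ri d" if "d > 0" "h3 r fa fb fc 0 = d * g" "h3 r fa fb fc 1 = - a * g" for a d g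
          unfolding X_def[symmetric] by (rule ht(2)[OF _ _ _ _ _ that]) auto
      qed
      then show ?thesis by (simp add: \<tau>_def)
    qed
  qed
  have "\<exists>t\<ge>T. (\<exists>w y h a b. approx_datum 4 (Lf4 (Y 0)) C \<delta> t w y h a b) \<or> (\<exists>w y h a b. approx_datum 3 (Lf3 (Y 0)) C \<delta> t w y h a b)" for T
  proof -
    obtain t r r' where t: "nat \<lceil>max T T0\<rceil> \<le> t" "t \<le> r" "r < r'" "real r' \<le> K * real t" "\<forall>k<t. A (r + k + 1) = A (r' + k + 1)"
      using rep by blast
    have "real t \<ge> max T T0" using t(1) by linarith
    then have "real t \<ge> T" "real t \<ge> T0" by auto
    then show ?thesis using key[OF _ t(2-5)] by blast
  qed
  then have "(\<forall>T. \<exists>t\<ge>T. \<exists>w y h a b. approx_datum 4 (Lf4 (Y 0)) C \<delta> t w y h a b) \<or> (\<forall>T. \<exists>t\<ge>T. \<exists>w y h a b. approx_datum 3 (Lf3 (Y 0)) C \<delta> t w y h a b)"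
    by (meson order_trans linear)
  then show False 
    using no_approx_data_4[OF g root C1(1), of \<delta>] no_approx_data_3[OF g root C1(1), of \<delta>] \<epsilon>0 unfolding \<delta>_def by simp
qed

section \<open>Hurwitz expansions\<close>

lemma hurwitz_T_in_domain: "hurwitz_T z \<in> hurwitz_domain"
proof (cases "z = 0")
  case False
  define w where "w = inverse z"
  have "- 1/2 \<le> y - of_int \<lfloor>y + 1/2\<rfloor> \<and> y - of_int \<lfloor>y + 1/2\<rfloor> < 1/2" for y :: real by linarith
  then show ?thesis using False by (auto simp: hurwitz_T_def hurwitz_domain_def nearest_gauss_def simp flip: w_def)
qed (simp add: hurwitz_T_def hurwitz_domain_def)

text \<open>The pair of digits \<open>-2, 1 + i b\<close> maps the half plane \<open>Re v > - 1/2\<close> outside the domain, so that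
  the orbit is confined to the line \<open>Re v = - 1/2\<close>.\<close>

lemma hurwitz_pair_step:
  fixes w v :: complex and b :: real
  assumes w: "w \<noteq> 0" and u: "inverse w + 2 \<noteq> 0" and v: "inverse (inverse w + 2) = 1 + \<i> * of_real b + v"
    and Re: "Re w \<ge> - 1/2" "Re v \<ge> - 1/2"
  shows "Re w = - 1/2" "Re v = - 1/2" "(2 * Im w) * (2 * b + 2 * Im v) = 1"
proof -
  define c where "c = 1 + \<i> * of_real b + v"
  define s where "s = 1/2 + Re v"
  define \<beta> where "\<beta> = b + Im v"
  have "(inverse w + 2) * c = 1" using u v by (simp add: c_def flip: v)
  then have "w * ((inverse w + 2) * c) = w" by simp
  then have "c + 2 * w * c = w" using w by (simp add: algebra_simps)
  then have e: "w * (1 - 2 * c) = c" by (simp add: algebra_simps)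
  have c: "Re c = 1/2 + s" "Im c = \<beta>" by (simp_all add: c_def s_def \<beta>_def)
  have 1: "- 2 * s * Re w + 2 * \<beta> * Im w = 1/2 + s" using arg_cong[OF e, of Re] c by (simp add: algebra_simps)
  have 2: "- 2 * \<beta> * Re w - 2 * s * Im w = \<beta>" using arg_cong[OF e, of Im] c by (simp add: algebra_simps)
  \<comment> \<open>Elimination of Im w. As -2 Re w is at most 1, the resulting identity forces s =
    0; then Re w = - 1/2 follows from the imaginary part.\<close>
  have "s * (- 2 * s * Re w + 2 * \<beta> * Im w) + \<beta> * (- 2 * \<beta> * Re w - 2 * s * Im w) = s * (1/2 + s) + \<beta> * \<beta>"
    unfolding 1 2 ..
  then have 3: "- 2 * Re w * (s * s + \<beta> * \<beta>) = s / 2 + (s * s + \<beta> * \<beta>)" by (simp add: algebra_simps)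
  have s0: "s \<ge> 0" using Re by (simp add: s_def)
  have "- 2 * Re w * (s * s + \<beta> * \<beta>) \<le> 1 * (s * s + \<beta> * \<beta>)" using Re by (intro mult_right_mono) auto
  then have "s / 2 + (s * s + \<beta> * \<beta>) \<le> 1 * (s * s + \<beta> * \<beta>)" unfolding 3 .
  then have s: "s = 0" using s0 by simp
  then show "Re v = - 1/2" by (simp add: s_def)
  have b0: "\<beta> \<noteq> 0" using 1 s by auto
  have "\<beta> * (2 * Re w + 1) = 0" using 2 s by (simp add: algebra_simps)
  then show "Re w = - 1/2" using b0 by simp
  show "(2 * Im w) * (2 * b + 2 * Im v) = 1" using 1 s by (simp add: \<beta>_def algebra_simps)
qed

lemma hurwitz_interleaved:
  assumes he: "has_hurwitz_expansion \<zeta> (interleaved_pq B)"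
  defines "z \<equiv> \<lambda>n. (hurwitz_T ^^ n) \<zeta>"
  shows "Re (z (2 * k)) = - 1/2" "\<bar>2 * Im (z (2 * k))\<bar> \<le> 1"
    "(2 * Im (z (2 * k))) * (2 * of_int (B (Suc k)) + 2 * Im (z (2 * Suc k))) = 1"
proof -
  have zd: "z n \<in> hurwitz_domain" for n
    using he hurwitz_T_in_domain by (cases n) (auto simp: z_def has_hurwitz_expansion_def)
  have z0: "z n \<noteq> 0" and pq: "nearest_gauss (inverse (z n)) = interleaved_pq B (Suc n)" for n
    using he unfolding has_hurwitz_expansion_def z_def hurwitz_pq_def by (auto dest: spec[of _ "Suc n"])
  have step: "z (Suc n) = inverse (z n) - interleaved_pq B (Suc n)" for n
    using z0[of n] by (simp add: z_def hurwitz_T_def flip: pq)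
  have u: "z (Suc (2 * k)) = inverse (z (2 * k)) + 2" using step[of "2 * k"] by (simp add: interleaved_pq_def)
  have v: "z (2 * Suc k) = inverse (z (Suc (2 * k))) - (1 + \<i> * of_int (B (Suc k)))"
    using step[of "Suc (2 * k)"] by (simp add: interleaved_pq_def)
  have R: "Re (z n) \<ge> - 1/2" for n using zd[of n] by (simp add: hurwitz_domain_def)
  have "inverse (inverse (z (2 * k)) + 2) = 1 + \<i> * of_real (of_int (B (Suc k))) + z (2 * Suc k)"
    unfolding v u by simp
  from hurwitz_pair_step[OF z0 _ this R R] z0[of "Suc (2 * k)"] u
  show "Re (z (2 * k)) = - 1/2" "(2 * Im (z (2 * k))) * (2 * of_int (B (Suc k)) + 2 * Im (z (2 * Suc k))) = 1" by auto
  show "\<bar>2 * Im (z (2 * k))\<bar> \<le> 1" using zd[of "2 * k"] by (auto simp: hurwitz_domain_def)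
qed

text \<open>Real and imaginary part of (-1 + i X)^j as integral polynomials.\<close>

fun repoly :: "nat => int poly \<times> int poly" where
  "repoly 0 = (1, 0)"
| "repoly (Suc j) = (- fst (repoly j) - pCons 0 (snd (repoly j)), - snd (repoly j) + pCons 0 (fst (repoly j)))"

lemma rpoly_uminus: "rpoly (- P) = - rpoly P"
  by (intro poly_eqI) (simp add: coeff_map_poly)

lemma rpoly_diff: "rpoly (P - Q) = rpoly P - rpoly Q"
  by (intro poly_eqI) (simp add: coeff_map_poly)

lemma rpoly_pCons: "rpoly (pCons a P) = pCons (ri a) (rpoly P)"
  by (simp add: map_poly_pCons)

lemma rpoly_sum: "rpoly (\<Sum>i\<in>S. P i) = (\<Sum>i\<in>S. rpoly (P i))"
  by (induction S rule: infinite_finite_induct) (simp_all add: rpoly_add)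

lemma repoly_eval: "Complex (- 1) x ^ j = Complex (poly (rpoly (fst (repoly j))) x) (poly (rpoly (snd (repoly j))) x)"
proof (induction j)
  case 0
  then show ?case by (simp add: complex_eq_iff)
next
  case (Suc j)
  then show ?case unfolding power_Suc Suc by (simp add: complex_eq_iff rpoly_diff rpoly_uminus rpoly_pCons)
qed

lemma algebraic_on_line:
  assumes alg: "algebraic \<zeta>" and Re: "Re \<zeta> = - 1/2"
  obtains g :: "int poly" where "g \<noteq> 0" "poly (rpoly g) (2 * Im \<zeta>) = 0"
proof -
  from alg obtain P where P: "\<And>i. coeff P i \<in> \<int>" "P \<noteq> 0" "poly P \<zeta> = 0" unfolding algebraic_def by blast
  then have "\<forall>i. \<exists>c. coeff P i = of_int c" by (auto simp: Ints_def)
  from choice[OF this] obtain c where c: "\<And>i. coeff P i = of_int (c i)" by blast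
  define n where "n = degree P"
  define G where "G = (\<Sum>j\<le>n. smult (c j * 2 ^ (n - j)) (fst (repoly j)))"
  define H where "H = (\<Sum>j\<le>n. smult (c j * 2 ^ (n - j)) (snd (repoly j)))"
  have ev: "2 ^ n * poly P (Complex (- 1/2) (x / 2)) = Complex (poly (rpoly G) x) (poly (rpoly H) x)" for x
  proof -
    have half: "Complex (- 1/2) (x / 2) = Complex (- 1) x / 2" by (simp add: complex_eq_iff)
    have "2 ^ n * poly P (Complex (- 1/2) (x / 2)) = (\<Sum>j\<le>n. of_int (c j * 2 ^ (n - j)) * Complex (- 1) x ^ j)"
      unfolding poly_altdef n_def[symmetric] sum_distrib_left half
    proof (intro sum.cong refl)
      fix j assume "j \<in> {..n}"
      then have "(2 :: complex) ^ n = 2 ^ (n - j) * 2 ^ j" by (simp flip: power_add)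
      then show "2 ^ n * (coeff P j * (Complex (- 1) x / 2) ^ j) = of_int (c j * 2 ^ (n - j)) * Complex (- 1) x ^ j"
        by (simp add: c power_divide)
    qed
    also have "... = Complex (poly (rpoly G) x) (poly (rpoly H) x)"
      unfolding repoly_eval G_def H_def rpoly_sum rpoly_smult
      by (simp add: complex_eq_iff poly_sum)
    finally show ?thesis .
  qed
  have "\<zeta> = Complex (- 1/2) (2 * Im \<zeta> / 2)" using Re by (simp add: complex_eq_iff)
  then have "2 ^ n * poly P (Complex (- 1/2) (2 * Im \<zeta> / 2)) = 0" using P(3) by simp
  then have z: "poly (rpoly G) (2 * Im \<zeta>) = 0" "poly (rpoly H) (2 * Im \<zeta>) = 0" unfolding ev by (simp_all add: complex_eq_iff)
  have "G \<noteq> 0 \<or> H \<noteq> 0"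
  proof (rule ccontr)
    assume "\<not> (G \<noteq> 0 \<or> H \<noteq> 0)"
    then have "poly P (Complex (- 1/2) (x / 2)) = 0" for x using ev[of x] by (auto simp: complex_eq_iff)
    then have "range (\<lambda>x. Complex (- 1/2) (x / 2)) \<subseteq> {x. poly P x = 0}" by auto
    then have "finite (range (\<lambda>x. Complex (- 1/2) (x / 2)))" using poly_roots_finite[OF P(2)] by (rule finite_subset)
    moreover have "inj (\<lambda>x. Complex (- 1/2) (x / 2))" by (auto simp: inj_def)
    ultimately have "finite (UNIV :: real set)" by (rule finite_imageD)
    then show False using infinite_UNIV_char_0 by blast
  qed
  then show thesis using that z by blast
qed

section \<open>Repetitions\<close>

text \<open>The pigeonhole principle for words of length n over a finite alphabet provides a
  repetition, so the \<open>LEAST\<close> in \<open>rep_fun\<close> is attained.\<close>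

lemma rep_fun_repetition:
  fixes B :: "nat => int"
  assumes M: "\<forall>n\<ge>1. \<bar>B n\<bar> \<le> M"
  shows "\<exists>i\<in>{1..rep_fun n B - n}. \<forall>k<n. B (i + k) = B (rep_fun n B - n + 1 + k)"
  unfolding rep_fun_def
proof (rule LeastI_ex)
  define F where "F i = map (\<lambda>k. B (Suc i + k)) [0..<n]" for i
  have "range F \<subseteq> {xs. set xs \<subseteq> {-M..M} \<and> length xs = n}"
  proof clarify
    fix i
    have "B (Suc i + k) \<in> {-M..M}" for k using M[rule_format, of "Suc i + k"] by auto
    then show "set (F i) \<subseteq> {-M..M} \<and> length (F i) = n" by (auto simp: F_def simp del: add_Suc)
  qed
  then have "finite (range F)" by (rule finite_subset) (intro finite_lists_length_eq, simp)
  then have "\<not> inj F" using finite_imageD[of F UNIV] by auto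
  then obtain i j where "F i = F j" "i \<noteq> j" by (auto simp: inj_def)
  then obtain i j where ij: "F i = F j" "i < j" by (metis nat_neq_iff)
  have "B (Suc i + k) = B (Suc j + k)" if "k < n" for k
    using arg_cong[OF ij(1), of "\<lambda>xs. xs ! k"] that by (simp add: F_def)
  then show "\<exists>m. \<exists>i\<in>{1..m - n}. \<forall>k<n. B (i + k) = B (m - n + 1 + k)"
    using ij(2) by (intro exI[of _ "j + n"] bexI[of _ "Suc i"]) auto
qed

text \<open>A repetition given by \<open>rep_fun\<close> may begin at the very first place.
  Discarding its first half makes the starting place at least as large as the remaining
  length.\<close>

lemma rep_exponent_repetitions:
  fixes B :: "nat => int"
  assumes M: "\<forall>n\<ge>1. \<bar>B n\<bar> \<le> M" and re: "rep_exponent B < \<infinity>"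
  obtains K :: real where "\<And>T. \<exists>t r r'. T \<le> t \<and> t \<le> r \<and> r < r' \<and> real r' \<le> K * real t \<and> (\<forall>k<t. B (r + k + 1) = B (r' + k + 1))"
proof -
  obtain K0 where K0: "rep_exponent B < ereal K0" using re less_PInf_Ex_of_nat[of "rep_exponent B"] by auto
  have inf: "\<exists>n\<ge>N. real (rep_fun n B) < K0 * real n" for N
  proof (rule ccontr)
    assume "\<not> ?thesis"
    then have "\<forall>n\<ge>max N 1. ereal K0 \<le> ereal (real (rep_fun n B) / real n)" by (auto simp: pos_le_divide_eq not_less)
    then have "ereal K0 \<le> rep_exponent B" unfolding rep_exponent_def
      by (intro Liminf_bounded) (auto simp: eventually_sequentially intro!: exI[of _ "max N 1"])
    then show False using K0 by simp
  qed
  show thesis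
  proof (rule that[of "3 * \<bar>K0\<bar>"])
    fix T :: nat
    obtain n where n: "n \<ge> 2 * T + 4" "real (rep_fun n B) < K0 * real n" using inf by blast
    define m where "m = rep_fun n B"
    obtain i where i: "i \<in> {1..m - n}" "\<forall>k<n. B (i + k) = B (m - n + 1 + k)"
      using rep_fun_repetition[OF M, of n] unfolding m_def by blast
    \<comment> \<open>n - t places are dropped and n - t \<ge> t. The inequality n \<le> 3 t is the
      origin of the factor 3 in the constant.\<close>
    define t where "t = n div 2"
    define r where "r = i - 1 + (n - t)"
    define r' where "r' = m - n + (n - t)"
    have t: "T \<le> t" "t \<le> n - t" "n \<le> 3 * t" using n(1) by (auto simp: t_def)
    have "t \<le> r" using t by (simp add: r_def)
    moreover have "r < r'" using i(1) by (auto simp: r_def r'_def)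
    moreover have "real r' \<le> 3 * \<bar>K0\<bar> * real t"
    proof -
      have "r' \<le> m" using i(1) by (auto simp: r'_def)
      then have "real r' \<le> real m" by simp
      also have "... \<le> K0 * real n" using n(2) by (simp add: m_def)
      also have "... \<le> \<bar>K0\<bar> * real (3 * t)" using t(3) by (intro mult_mono) (auto simp del: of_nat_mult)
      finally show ?thesis by simp
    qed
    moreover have "B (r + k + 1) = B (r' + k + 1)" if "k < t" for k
    proof -
      have "n - t + k < n" using that t(2) by (simp add: t_def)
      then have "B (i + (n - t + k)) = B (m - n + 1 + (n - t + k))" using i(2) by blast
      moreover have "i + (n - t + k) = r + k + 1" using i(1) by (auto simp: r_def)
      moreover have "m - n + 1 + (n - t + k) = r' + k + 1" by (simp add: r'_def)
      ultimately show ?thesis by (simp only:)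
    qed
    ultimately show "\<exists>t r r'. T \<le> t \<and> t \<le> r \<and> r < r' \<and> real r' \<le> 3 * \<bar>K0\<bar> * real t \<and> (\<forall>k<t. B (r + k + 1) = B (r' + k + 1))"
      using t(1) by blast
  qed
qed

theorem theorem1p4:
  fixes B :: "nat \<Rightarrow> int" and \<zeta> :: complex
  assumes "\<exists>M. \<forall>n\<ge>1. \<bar>B n\<bar> \<le> M"
    and "\<not> periodic_seq B"
    and "\<forall>n\<ge>1. \<bar>B n\<bar> \<ge> 3"
    and "rep_exponent B < \<infinity>"
    and "has_hurwitz_expansion \<zeta> (interleaved_pq B)"
  shows "\<not> algebraic \<zeta>"
proof
  assume alg: "algebraic \<zeta>"
  obtain M where M: "\<forall>n\<ge>1. \<bar>B n\<bar> \<le> M" using assms(1) by blast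
  \<comment> \<open>On the line Re = - 1/2 the doubled imaginary parts satisfy a real continued
    fraction with doubled digits, so |B n| \<ge> 3 gives the bound 6 of the locale.\<close>
  define A where "A k = 2 * B k" for k
  define Y where "Y k = 2 * Im ((hurwitz_T ^^ (2 * k)) \<zeta>)" for k
  note hz = hurwitz_interleaved[OF assms(5)]
  interpret cfrac A Y "2 * ri M"
  proof
    fix k
    show "Y k * (ri (A (Suc k)) + Y (Suc k)) = 1" using hz(3)[of k] by (simp add: Y_def A_def)
    show "\<bar>Y k\<bar> \<le> 1" using hz(2)[of k] by (simp add: Y_def)
    have "3 \<le> \<bar>B (Suc k)\<bar>" "\<bar>B (Suc k)\<bar> \<le> M" using assms(3) M by auto
    then have "ri 3 \<le> ri \<bar>B (Suc k)\<bar>" "ri \<bar>B (Suc k)\<bar> \<le> ri M" by (simp_all only: of_int_le_iff)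
    then show "6 \<le> \<bar>ri (A (Suc k))\<bar>" "\<bar>ri (A (Suc k))\<bar> \<le> 2 * ri M" by (simp_all add: A_def abs_mult)
  qed
  have "Re \<zeta> = - 1/2" using hz(1)[of 0] by simp
  then obtain g :: "int poly" where g: "g \<noteq> 0" "poly (rpoly g) (2 * Im \<zeta>) = 0"
    by (rule algebraic_on_line[OF alg]) blast
  have Y0: "Y 0 = 2 * Im \<zeta>" by (simp add: Y_def)
  obtain K where K: "\<And>T. \<exists>t r r'. T \<le> t \<and> t \<le> r \<and> r < r' \<and> real r' \<le> K * real t \<and> (\<forall>k<t. B (r + k + 1) = B (r' + k + 1))"
    by (rule rep_exponent_repetitions[OF M assms(4)]) blast
  have np: "\<not> (\<exists>l\<ge>1. \<exists>N\<ge>1. \<forall>n\<ge>N. A (n + l) = A n)" using assms(2) by (auto simp: periodic_seq_def A_def)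
  have "\<exists>t r r'. T \<le> t \<and> t \<le> r \<and> r < r' \<and> real r' \<le> K * real t \<and> (\<forall>k<t. A (r + k + 1) = A (r' + k + 1))" for T
    using K[of T] by (simp add: A_def)
  from stammering_transcendental[OF np this g(1)] g(2) Y0 show False by simp
qed


end
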